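(* Let $p$ be even and let $\mu$ be a probability measure on $\partial\mathbb{D}$ whose Verblunsky coefficients are periodic with period $p$. Let $\mu^*$ be a measure of the form $w(t)\mu+\mu_0$, where $w$ is positive and continuous everywhere on $\mathrm{supp}(\mu)$ and $\mu_0$ is a finite positive measure on $\partial\mathbb{D}$ with $\mathrm{supp}(\mu_0)\subseteq\mathrm{supp}(\mu_{ac})$. Let $\theta\in\mathbb{R}$ with $\mathrm{dist}(e^{i\theta},\mathrm{supp}(\mu_0))>0$. (i) If $e^{i\theta}$ is an interior point of a band in $\mathrm{supp}(\mu)$, then $$\lim_{n\to\infty}\frac{K_{n}\left(e^{i(\theta+a/n)},e^{i(\theta+b/n)};\mu^*\right)}{K_{n}(e^{i\theta},e^{i\theta};\mu^* )}=e^{i\frac{a-\bar{b}}{2}}\,\mathrm{sinc}(V(\theta)(a-\bar{b})).$$ (ii) If $e^{i\theta}$ is an endpoint of a band in $\mathrm{supp}(\mu)$, $\Delta(e^{i\theta})=2$, and $e^{i\theta}$ is not a resonance, then $$\lim_{n\to\infty}\frac{K_{n}\left(e^{i(\theta-a/n^2)},e^{i(\theta-b/n^2)};\mu^*\right)}{K_{n}(e^{i\theta},e^{i\theta};\mu^* )}=\frac{\mathbb{J}_{1/2}^*\left(\frac{W(\theta)a}{p^2},\frac{W(\theta)\bar{b}}{p^2}\right)}{\mathbb{J}_{1/2}^*(0,0)}.$$ (iii) If $e^{i\theta}$ is an endpoint of a band in $\mathrm{supp}(\mu)$, $\Delta(e^{i\theta})=2$, and $e^{i\theta}$ is a resonance,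 then $$\lim_{n\to\infty}\frac{K_{n}\left(e^{i(\theta-a/n^2)},e^{i(\theta-b/n^2)};\mu^*\right)}{K_{n}(e^{i\theta},e^{i\theta};\mu^* )}=\frac{\mathbb{J}_{-1/2}^*\left(\frac{W(\theta)a}{p^2},\frac{W(\theta)\bar{b}}{p^2}\right)}{\mathbb{J}_{-1/2}^*(0,0)}.$$ In each case the convergence is uniform for $(a,b)$ in compact subsets of $\mathbb{C}^2$.
   Context: $\mathbb{D}=\{z\in\mathbb{C}:|z|<1\}$. A sequence $\{\alpha_n\}_{n\ge0}\subset\mathbb{D}$ is the sequence of Verblunsky coefficients of a unique probability measure $\mu$ on $\partial\mathbb{D}$ with infinite support; its monic orthogonal polynomials satisfy $\Phi_0=1$, $\Phi_{n+1}(z)=z\Phi_n(z)-\bar\alpha_n\Phi_n^*(z)$, where for a polynomial $Q_n$ with index $n$, $Q_n^*(z)=z^n\overline{Q_n(1/\bar z)}$. The second kind polynomials $\Psi_n$ are obtained from the same recursion with $\alpha_n$ replaced by $-\alpha_n$ and $\Psi_0=1$. Put $\varphi_n=\Phi_n/\prod_{j=0}^{n-1}\sqrt{1-|\alpha_j|^2}$ and $\psi_n=\Psi_n/\prod_{j=0}^{n-1}\sqrt{1-|\alpha_j|^2}$. For $\{\alpha_n\}$ of period $p$ ($p$ even), put $\Delta(z)=\dfrac{\varphi_p(z)+\varphi_p^*(z)+\psi_p(z)+\psi_p^*(z)}{2z^{p/2}}$. The bands of $\mathrm{supp}(\mu)$ are the disjoint closed arcs whose union is $\{e^{i\theta}:|\Delta(e^{i\theta})|\le2\}=\mathrm{supp}(\mu_{ac})$,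 where $\mu_{ac}$ is the absolutely continuous part of $\mu$; outside the bands $\mu$ has at most one point mass in each gap between bands. The resonances are the zeros of $\varphi_p(z)-\varphi_p^*(z)$. Put $W(s)=\frac{d}{ds}\Delta(e^{is})$ and $$V(\theta)=\frac{|W(\theta)|}{p\sqrt{4-\Delta(e^{i\theta})^2}},$$ extended by continuity to those interior points of bands where $|\Delta(e^{i\theta})|=2$ (closed gaps). For a finite positive measure $\rho$ on $\partial\mathbb{D}$ with infinite support and orthonormal polynomials $\varphi_j(\cdot;\rho)$, $K_n(z,w;\rho)=\sum_{j=0}^n\varphi_j(z;\rho)\overline{\varphi_j(w;\rho)}$; it is evaluated at complex $a,b$. $\mathrm{sinc}(x)=\sin(x)/x$, with $\mathrm{sinc}(0)=1$. With $J_s$ the Bessel function of the first kind of order $s$, $$\mathbb{J}_s^*(a,b)=\begin{cases}\dfrac{J_s(\sqrt{a})\sqrt{b}J_s'(\sqrt{b})-J_s(\sqrt{b})\sqrt{a}J_s'(\sqrt{a})}{2a^{s/2}b^{s/2}(a-b)}, & a\neq b,\\[2mm] \dfrac{1}{4a^s}\left(J_s(\sqrt{a})^2-J_{s+1}(\sqrt{a})J_{s-1}(\sqrt{a})\right), & a=b,\end{cases}$$ which extends to an entire function on $\mathbb{C}^2$ (values such as $\mathbb{J}_s^*(0,0)$ are taken from this extension). *)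

theory Defs
  imports "HOL-Probability.Probability_Measure"
begin

section \<open>Measures on the unit circle\<close>

text \<open>Measures on the circle are Borel measures on the complex plane carried by
  \<^term>\<open>sphere (0::complex) 1\<close>.\<close>

definition circle_measure :: "complex measure \<Rightarrow> bool" where
  "circle_measure M \<longleftrightarrow>
     finite_measure M \<and> sets M = sets borel \<and> emeasure M (- sphere 0 1) = 0"

definition msupp :: "complex measure \<Rightarrow> complex set" where
  "msupp M = {z. \<forall>U. open U \<and> z \<in> U \<longrightarrow> 0 < emeasure M U}"

definition arc_length :: "complex measure" where
  "arc_length = distr (density lborel (indicator {0..<2 * pi})) borel cis"

text \<open>The absolutely continuous part in the Lebesgue decomposition with respect to arc length;
  the description is unique for finite Borel measures.
  Note that \<^term>\<open>absolutely_continuous M N\<close> reads: N is absolutely continuous with respect to M.\<close>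

definition ac_part :: "complex measure \<Rightarrow> complex measure" where
  "ac_part M = (THE N. sets N = sets borel \<and> absolutely_continuous arc_length N \<and>
     (\<exists>S. sets S = sets borel \<and>
          (\<exists>Z \<in> null_sets arc_length. emeasure S (- Z) = 0) \<and>
          (\<forall>A \<in> sets borel. emeasure M A = emeasure N A + emeasure S A)))"


section \<open>Orthogonal polynomials and the Christoffel-Darboux kernel\<close>

text \<open>The descriptions below are unique for finite measures on the circle with infinite support.\<close>

definition monic_op :: "complex measure \<Rightarrow> nat \<Rightarrow> complex poly" where
  "monic_op M n = (THE P. degree P = n \<and> lead_coeff P = 1 \<and>
     (\<forall>k<n. (LINT z|M. poly P z * cnj (z ^ k)) = 0))"

definition orthonormal_poly :: "complex measure \<Rightarrow> nat \<Rightarrow> complex poly" where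
  "orthonormal_poly M n =
     smult (complex_of_real (1 / sqrt (LINT z|M. (cmod (poly (monic_op M n) z))\<^sup>2))) (monic_op M n)"

definition CD_kernel :: "nat \<Rightarrow> complex \<Rightarrow> complex \<Rightarrow> complex measure \<Rightarrow> complex" where
  "CD_kernel n z w M =
     (\<Sum>j\<le>n. poly (orthonormal_poly M j) z * cnj (poly (orthonormal_poly M j) w))"


section \<open>Szego recursion and Verblunsky coefficients\<close>

definition szego_star :: "nat \<Rightarrow> complex poly \<Rightarrow> complex poly" where
  "szego_star n Q = (\<Sum>k\<le>n. monom (cnj (coeff Q (n - k))) k)"

lemma poly_szego_star:
  assumes "degree Q \<le> n" and "z \<noteq> 0"
  shows "poly (szego_star n Q) z = z ^ n * cnj (poly Q (1 / cnj z))"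
proof -
  have "poly Q (1 / cnj z) = (\<Sum>k\<le>n. coeff Q k * (1 / cnj z) ^ k)"
    unfolding poly_altdef using assms(1)
    by (intro sum.mono_neutral_left) (auto simp: coeff_eq_0)
  then have "z ^ n * cnj (poly Q (1 / cnj z)) = (\<Sum>k\<le>n. cnj (coeff Q k) * (z ^ n * (1 / z) ^ k))"
    by (simp add: sum_distrib_left algebra_simps)
  also have "\<dots> = (\<Sum>k\<le>n. cnj (coeff Q k) * z ^ (n - k))"
    using assms(2) by (intro sum.cong refl) (simp add: power_diff power_one_over)
  also have "\<dots> = (\<Sum>k\<le>n. cnj (coeff Q (n - k)) * z ^ k)"
    by (rule sum.reindex_bij_witness[of _ "\<lambda>k. n - k" "\<lambda>k. n - k"]) auto
  also have "\<dots> = poly (szego_star n Q) z"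
    by (simp add: szego_star_def poly_sum poly_monom)
  finally show ?thesis by simp
qed

primrec szego_poly :: "(nat \<Rightarrow> complex) \<Rightarrow> nat \<Rightarrow> complex poly" where
  "szego_poly \<alpha> 0 = 1"
| "szego_poly \<alpha> (Suc n) =
     pCons 0 (szego_poly \<alpha> n) - smult (cnj (\<alpha> n)) (szego_star n (szego_poly \<alpha> n))"

definition verblunsky_coeffs :: "complex measure \<Rightarrow> (nat \<Rightarrow> complex) \<Rightarrow> bool" where
  "verblunsky_coeffs M \<alpha> \<longleftrightarrow>
     prob_space M \<and> circle_measure M \<and> infinite (msupp M) \<and>
     (\<forall>n. cmod (\<alpha> n) < 1) \<and> (\<forall>n. monic_op M n = szego_poly \<alpha> n)"

definition phi :: "(nat \<Rightarrow> complex) \<Rightarrow> nat \<Rightarrow> complex poly" where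
  "phi \<alpha> n = smult (complex_of_real (1 / (\<Prod>j<n. sqrt (1 - (cmod (\<alpha> j))\<^sup>2)))) (szego_poly \<alpha> n)"

definition psi :: "(nat \<Rightarrow> complex) \<Rightarrow> nat \<Rightarrow> complex poly" where
  "psi \<alpha> n = phi (\<lambda>j. - \<alpha> j) n"


section \<open>Discriminant, bands and resonances for period p\<close>

definition Delta :: "(nat \<Rightarrow> complex) \<Rightarrow> nat \<Rightarrow> complex \<Rightarrow> complex" where
  "Delta \<alpha> p z =
     (poly (phi \<alpha> p) z + poly (szego_star p (phi \<alpha> p)) z
        + poly (psi \<alpha> p) z + poly (szego_star p (psi \<alpha> p)) z) / (2 * z ^ (p div 2))"

lemma degree_szego_star: "degree (szego_star n Q) \<le> n"
  unfolding szego_star_def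
  by (intro degree_sum_le) (auto intro: order_trans[OF degree_monom_le])

lemma degree_szego_poly: "degree (szego_poly \<alpha> n) \<le> n"
proof (induction n)
  case (Suc n)
  have "degree (smult (cnj (\<alpha> n)) (szego_star n (szego_poly \<alpha> n))) \<le> Suc n"
    by (meson degree_smult_le degree_szego_star le_Suc_eq order_trans)
  moreover have "degree (pCons 0 (szego_poly \<alpha> n)) \<le> Suc n"
    using Suc.IH degree_pCons_le[of 0 "szego_poly \<alpha> n"] by linarith
  ultimately show ?case
    by (simp add: degree_diff_le)
qed simp

text \<open>The discriminant is real on the circle, so taking its real part below loses nothing.\<close>

lemma Delta_real:
  assumes "even p"
  shows "Im (Delta \<alpha> p (cis s)) = 0"
proof -
  obtain m where p: "p = 2 * m" using assms by blast
  have cc: "cis s * cnj (cis s) = 1"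
    by (simp add: cis_cnj cis_mult)
  have inv: "1 / cnj (cis s) = cis s"
    using cc by (metis cis_neq_zero divide_eq_eq complex_cnj_zero_iff)
  have key: "(poly Q (cis s) + poly (szego_star p Q) (cis s)) / cis s ^ m
      = of_real (2 * Re (poly Q (cis s) / cis s ^ m))"
    if "degree Q \<le> p" for Q
  proof -
    have "poly (szego_star p Q) (cis s) / cis s ^ m = cis s ^ m * cnj (poly Q (cis s))"
      unfolding poly_szego_star[OF that cis_neq_zero] inv
      by (simp add: p mult_2 power_add)
    also have "\<dots> = cnj (poly Q (cis s) / cis s ^ m)"
      by (simp add: cis_cnj divide_inverse power_inverse flip: cis_inverse)
    finally show ?thesis
      by (simp only: add_divide_distrib complex_add_cnj)
  qed
  have deg: "degree (phi \<beta> p) \<le> p" for \<beta>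
    unfolding phi_def by (meson degree_smult_le degree_szego_poly order_trans)
  have "Delta \<alpha> p (cis s) =
      ((poly (phi \<alpha> p) (cis s) + poly (szego_star p (phi \<alpha> p)) (cis s)) / cis s ^ m
       + (poly (psi \<alpha> p) (cis s) + poly (szego_star p (psi \<alpha> p)) (cis s)) / cis s ^ m) / 2"
    by (simp add: Delta_def p field_simps)
  also have "\<dots> = of_real (Re (poly (phi \<alpha> p) (cis s) / cis s ^ m)
      + Re (poly (psi \<alpha> p) (cis s) / cis s ^ m))"
    using key[OF deg, of \<alpha>] key[of "psi \<alpha> p"] deg[of "\<lambda>j. - \<alpha> j"]
    by (simp add: psi_def)
  finally show ?thesis by simp
qed

text \<open>Two arcs that meet at a closed gap belong to the same component, hence form one band.\<close>

definition bands :: "(nat \<Rightarrow> complex) \<Rightarrow> nat \<Rightarrow> complex set set" where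
  "bands \<alpha> p = components {z \<in> sphere 0 1. cmod (Delta \<alpha> p z) \<le> 2}"

definition band_interior_point :: "(nat \<Rightarrow> complex) \<Rightarrow> nat \<Rightarrow> complex \<Rightarrow> bool" where
  "band_interior_point \<alpha> p z \<longleftrightarrow>
     (\<exists>B \<in> bands \<alpha> p. z \<in> top_of_set (sphere 0 1) interior_of B)"

definition band_endpoint :: "(nat \<Rightarrow> complex) \<Rightarrow> nat \<Rightarrow> complex \<Rightarrow> bool" where
  "band_endpoint \<alpha> p z \<longleftrightarrow>
     (\<exists>B \<in> bands \<alpha> p. z \<in> B - top_of_set (sphere 0 1) interior_of B)"

definition resonance :: "(nat \<Rightarrow> complex) \<Rightarrow> nat \<Rightarrow> complex \<Rightarrow> bool" where
  "resonance \<alpha> p z \<longleftrightarrow> poly (phi \<alpha> p) z - poly (szego_star p (phi \<alpha> p)) z = 0"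

definition W :: "(nat \<Rightarrow> complex) \<Rightarrow> nat \<Rightarrow> real \<Rightarrow> real" where
  "W \<alpha> p s = deriv (\<lambda>t. Re (Delta \<alpha> p (cis t))) s"

definition V_open :: "(nat \<Rightarrow> complex) \<Rightarrow> nat \<Rightarrow> real \<Rightarrow> real" where
  "V_open \<alpha> p s = \<bar>W \<alpha> p s\<bar> / (real p * sqrt (4 - (Re (Delta \<alpha> p (cis s)))\<^sup>2))"

definition V :: "(nat \<Rightarrow> complex) \<Rightarrow> nat \<Rightarrow> real \<Rightarrow> real" where
  "V \<alpha> p \<theta> =
     (if cmod (Delta \<alpha> p (cis \<theta>)) = 2 then Lim (at \<theta>) (V_open \<alpha> p) else V_open \<alpha> p \<theta>)"


section \<open>Limit kernels\<close>

definition csinc :: "complex \<Rightarrow> complex" where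
  "csinc z = (if z = 0 then 1 else sin z / z)"

text \<open>Principal branch, intended for nonzero argument (for order 0 the value at 0 is not the
  usual one, because \<^term>\<open>(0::complex) powr 0\<close> is 0).
  The reciprocal Gamma function \<^term>\<open>rGamma :: complex \<Rightarrow> complex\<close> is entire, so every order is covered.\<close>

definition bessel_J :: "complex \<Rightarrow> complex \<Rightarrow> complex" where
  "bessel_J s z =
     (z / 2) powr s * (\<Sum>m. (- 1) ^ m * rGamma (of_nat m + s + 1) / fact m * (z / 2) ^ (2 * m))"

definition Jstar_formula :: "complex \<Rightarrow> complex \<Rightarrow> complex \<Rightarrow> complex" where
  "Jstar_formula s a b =
     (if a \<noteq> b then
        (bessel_J s (csqrt a) * csqrt b * deriv (bessel_J s) (csqrt b)
           - bessel_J s (csqrt b) * csqrt a * deriv (bessel_J s) (csqrt a))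
        / (2 * a powr (s / 2) * b powr (s / 2) * (a - b))
      else
        ((bessel_J s (csqrt a))\<^sup>2 - bessel_J (s + 1) (csqrt a) * bessel_J (s - 1) (csqrt a))
        / (4 * a powr s))"

text \<open>With principal branches the formula is already the entire function where both arguments are
  nonzero: the branch of \<^term>\<open>bessel_J s (csqrt a)\<close> is cancelled by that of
  \<^term>\<open>a powr (s / 2)\<close>. On the coordinate axes the entire extension is the limit from that set.\<close>

definition Jstar :: "complex \<Rightarrow> complex \<Rightarrow> complex \<Rightarrow> complex" where
  "Jstar s a b =
     (if a \<noteq> 0 \<and> b \<noteq> 0 then Jstar_formula s a b
      else Lim (at (a, b) within {(x, y). x \<noteq> 0 \<and> y \<noteq> 0}) (\<lambda>(x, y). Jstar_formula s x y))"

end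

theory Submission
  imports Defs "HOL-Complex_Analysis.Complex_Analysis" "HOL-Real_Asymp.Real_Asymp"
begin

text \<open>For the periodic measure itself, the kernel can be computed. After \<open>q\<close> periods the solutions of the recursion
  are combinations of Chebyshev polynomials of half the discriminant. At a band edge, where the discriminant is
  2 up to a term of the order of the inverse square of q, the kernel at q p is a Riemann sum of products of \<open>cos\<close> and \<open>sin\<close> profiles; its limit is
  an integral which evaluates to the Bessel kernel of order 1/2, or -1/2 at a resonance. In the interior of a band the
  Christoffel-Darboux formula gives the sine kernel off the diagonal, and the maximum modulus principle extends
  the convergence to the diagonal.

  The limit passes to the perturbed measure by localization. Multiplying a polynomial by a power of
  \<open>(1 + z exp (- \<i> \<theta>)) / 2\<close> of degree about the square root of n costs nothing in the limit, but makes it negligible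
  away from \<open>exp (\<i> \<theta>)\<close>. Near that point the new measure is almost \<open>w (exp (\<i> \<theta>))\<close> times the old one, and the
  added mass is harmless because the old kernel grows polynomially on the bands. The extremal property of the kernel
  on the diagonal, with the reproducing property off the diagonal, compares the two kernels up to this
  constant factor, which cancels in the quotient.\<close>

section \<open>Limits along sequences\<close>

text \<open>Limits are proved for moving points and for arbitrary index sequences tending to
  infinity; compactness upgrades them to uniform convergence. Moving points also absorb a rescaling
  by factors tending to 1, and so the index can be moved: the periodic kernel is computed only at
  degrees q p - 1, and N is enclosed between two such degrees, leaving room for the degree of the
  localizing factor.

  Three obstacles shape the rest. At an edge the Chebyshev angle is not analytic in the point, only
  its square is; hence the cosine and sinc of a square root. At a closed gap the angle branches only
  apparently: the monodromy matrix must be shown to be a multiple of the identity there, with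
  nondegenerate derivative of its traceless part, before the angle can be continued analytically.
  Finally, polynomial growth is needed on the support of the added mass, so the support of the
  absolutely continuous part has to be located in the bands. This comes from Fatou's lemma:
  normalized polynomials grow off the bands, except at the finitely many resonances.\<close>

lemma uniform_limit_continuous_convergence:
  fixes f :: "nat \<Rightarrow> 'a::metric_space \<Rightarrow> 'b::metric_space"
  assumes C: "compact C" and l: "continuous_on C l"
    and conv: "\<And>N x y. filterlim N at_top sequentially \<Longrightarrow> (\<And>n. x n \<in> C) \<Longrightarrow> x \<longlonglongrightarrow> y \<Longrightarrow> y \<in> C
                 \<Longrightarrow> (\<lambda>n. f (N n) (x n)) \<longlonglongrightarrow> l y"
  shows "uniform_limit C f l sequentially"
proof (rule ccontr)
  assume "\<not> ?thesis"
  then obtain e where e: "e > 0" "\<not> (\<forall>\<^sub>F n in sequentially. \<forall>x\<in>C. dist (f n x) (l x) < e)"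
    unfolding uniform_limit_iff by auto
  define S where "S = {n. \<exists>x\<in>C. dist (f n x) (l x) \<ge> e}"
  have "infinite S"
  proof
    assume "finite S"
    then obtain m where m: "\<And>n. n \<in> S \<Longrightarrow> n \<le> m"
      by (auto simp: finite_nat_set_iff_bounded_le)
    have "\<forall>\<^sub>F n in sequentially. \<forall>x\<in>C. dist (f n x) (l x) < e"
      using eventually_gt_at_top[of m]
    proof eventually_elim
      case (elim n)
      then have "n \<notin> S" using m by (meson not_le)
      then show ?case by (auto simp: S_def not_le)
    qed
    then show False using e by blast
  qed
  \<comment> \<open>Witnesses exist only at the bad indices, which is why \<open>conv\<close> has to
    be available along an arbitrary index sequence: here the bad indices, thinned once more so that
    the witnesses converge.\<close>
  define r where "r = enumerate S"
  have r: "strict_mono r" "\<And>n. r n \<in> S"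
    unfolding r_def using \<open>infinite S\<close> by (auto intro: strict_mono_enumerate enumerate_in_set)
  from r(2) have "\<forall>n. \<exists>x. x\<in>C \<and> dist (f (r n) x) (l x) \<ge> e" by (auto simp: S_def)
  then obtain x where x: "\<And>n. x n \<in> C" "\<And>n. dist (f (r n) (x n)) (l (x n)) \<ge> e" by metis
  have "seq_compact C" using C compact_eq_seq_compact_metric by blast
  moreover have "\<forall>n. x n \<in> C" using x(1) by simp
  ultimately obtain y r' where y: "y \<in> C" and r': "strict_mono r'" "(x \<circ> r') \<longlonglongrightarrow> y"
    by (rule seq_compactE)
  have fl: "filterlim (\<lambda>n. r (r' n)) at_top sequentially"
    using filterlim_subseq[OF strict_mono_compose[OF r(1) r'(1)]] .
  have 1: "(\<lambda>n. f (r (r' n)) (x (r' n))) \<longlonglongrightarrow> l y"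
    using conv[OF fl, of "x \<circ> r'" y] r' y x by (auto simp: o_def)
  have 2: "(\<lambda>n. l (x (r' n))) \<longlonglongrightarrow> l y"
    using continuous_on_tendsto_compose[OF l r'(2) y] x(1) by (auto simp: o_def)
  have "(\<lambda>n. dist (f (r (r' n)) (x (r' n))) (l (x (r' n)))) \<longlonglongrightarrow> dist (l y) (l y)"
    by (intro tendsto_dist 1 2)
  then have "(\<lambda>n. dist (f (r (r' n)) (x (r' n))) (l (x (r' n)))) \<longlonglongrightarrow> 0" by simp
  from order_tendstoD(2)[OF this e(1)] obtain n where "dist (f (r (r' n)) (x (r' n))) (l (x (r' n))) < e"
    by (auto simp: eventually_sequentially)
  with x(2)[of "r' n"] show False by simp
qed

text \<open>By the maximum modulus principle, division by \<^term>\<open>a - c\<close> costs nothing: convergence off the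
  diagonal controls the limit on it.\<close>

lemma continuous_convergence_diagonal:
  fixes G :: "nat \<Rightarrow> complex \<Rightarrow> complex \<Rightarrow> complex" and H :: "complex \<Rightarrow> complex \<Rightarrow> complex"
  assumes holG: "\<And>n c. (\<lambda>a. G n a c) holomorphic_on UNIV"
    and holH: "\<And>c. (\<lambda>a. H a c) holomorphic_on UNIV"
    and contH: "continuous_on UNIV (\<lambda>(a, c). H a c)"
    and conv: "\<And>Q a c a' c'. filterlim Q at_top sequentially \<Longrightarrow> a \<longlonglongrightarrow> a' \<Longrightarrow> c \<longlonglongrightarrow> c' \<Longrightarrow> a' \<noteq> c'
                 \<Longrightarrow> (\<lambda>n. G (Q n) (a n) (c n)) \<longlonglongrightarrow> H a' c'"
    and Q: "filterlim Q at_top sequentially" and a: "a \<longlonglongrightarrow> a'" and c: "c \<longlonglongrightarrow> c'"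
  shows "(\<lambda>n. G (Q n) (a n) (c n)) \<longlonglongrightarrow> H a' c'"
proof (cases "a' = c'")
  case False
  then show ?thesis using conv Q a c by blast
next
  case True
  define f where "f n z = G (Q n) z (c n) - H z (c n)" for n z
  have contf: "continuous_on UNIV (f n)" for n
    unfolding f_def by (intro continuous_intros holomorphic_on_imp_continuous_on holG holH)
  have holf: "f n holomorphic_on UNIV" for n
    unfolding f_def by (intro holomorphic_intros holG holH)
  \<comment> \<open>The largest value on the unit circle around \<open>c n\<close> bounds
    \<open>f n\<close> on the whole disc. Every subsequential limit of its location has distance 1
    from \<open>c'\<close>, so it lies off the diagonal, where \<open>conv\<close> applies.\<close>
  have "\<exists>z. z \<in> sphere (c n) 1 \<and> (\<forall>y\<in>sphere (c n) 1. cmod (f n y) \<le> cmod (f n z))" for n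
  proof -
    have "c n + 1 \<in> sphere (c n) 1" by (simp add: dist_norm)
    then have "sphere (c n) 1 \<noteq> {}" by blast
    moreover have "continuous_on (sphere (c n) 1) (\<lambda>z. cmod (f n z))"
      by (intro continuous_on_norm continuous_on_subset[OF contf]) auto
    ultimately show ?thesis
      using continuous_attains_sup[of "sphere (c n) 1" "\<lambda>z. cmod (f n z)"] by auto
  qed
  then obtain z where z: "\<And>n. z n \<in> sphere (c n) 1" "\<And>n y. y \<in> sphere (c n) 1 \<Longrightarrow> cmod (f n y) \<le> cmod (f n (z n))"
    by metis
  have mm: "cmod (f n y) \<le> cmod (f n (z n))" if "y \<in> cball (c n) 1" for n y
    by (rule maximum_modulus_frontier[of "f n" "cball (c n) 1"])
      (use that z in \<open>auto intro: holomorphic_on_subset[OF holf] continuous_on_subset[OF contf]\<close>)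
  have lim0: "(\<lambda>n. f n (z n)) \<longlonglongrightarrow> 0"
  proof (rule ccontr)
    assume "\<not> ?thesis"
    then obtain e where e: "e > 0" and "\<not> (\<forall>\<^sub>F n in sequentially. cmod (f n (z n)) < e)"
      by (auto simp: tendsto_iff)
    then have fr: "\<forall>m. \<exists>n\<ge>m. cmod (f n (z n)) \<ge> e"
      by (auto simp: eventually_sequentially not_less)
    define S where "S = {n. cmod (f n (z n)) \<ge> e}"
    have "infinite S"
      unfolding S_def infinite_nat_iff_unbounded_le using fr by auto
    define r where "r = enumerate S"
    have r: "strict_mono r" "\<And>n. r n \<in> S"
      unfolding r_def using \<open>infinite S\<close> by (auto intro: strict_mono_enumerate enumerate_in_set)
    have "bounded (range c)" using c convergent_imp_bounded by blast
    then obtain B where B: "\<And>n. cmod (c n) \<le> B" by (auto simp: bounded_iff)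
    have zb: "cmod (z n) \<le> B + 1" for n
    proof -
      have "cmod (z n) \<le> cmod (c n) + cmod (z n - c n)" by (metis add.commute diff_add_cancel norm_triangle_ineq)
      moreover have "cmod (z n - c n) = 1" using z(1)[of n] by (simp add: dist_norm norm_minus_commute)
      ultimately show ?thesis using B[of n] by linarith
    qed
    have "seq_compact (cball (0::complex) (B+1))"
      using compact_cball compact_eq_seq_compact_metric by blast
    moreover have "\<forall>n. z (r n) \<in> cball 0 (B+1)" using zb by simp
    ultimately obtain y r' where r': "strict_mono r'" "((\<lambda>n. z (r n)) \<circ> r') \<longlonglongrightarrow> y"
      by (rule seq_compactE)
    define s where "s n = r (r' n)" for n
    have s: "filterlim s at_top sequentially"
      unfolding s_def using filterlim_subseq[OF strict_mono_compose[OF r(1) r'(1)]] .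
    have zs: "(\<lambda>n. z (s n)) \<longlonglongrightarrow> y" using r'(2) by (simp add: o_def s_def)
    have cs: "(\<lambda>n. c (s n)) \<longlonglongrightarrow> c'" using filterlim_compose[OF c s] .
    have "(\<lambda>n. dist (c (s n)) (z (s n))) \<longlonglongrightarrow> dist c' y" by (intro tendsto_dist zs cs)
    moreover have "dist (c (s n)) (z (s n)) = 1" for n using z(1)[of "s n"] by simp
    ultimately have "(\<lambda>n::nat. 1) \<longlonglongrightarrow> dist c' y" by simp
    then have "dist c' y = 1" by (simp add: LIMSEQ_const_iff)
    then have "y \<noteq> c'" by auto
    then have g: "(\<lambda>n. G (Q (s n)) (z (s n)) (c (s n))) \<longlonglongrightarrow> H y c'"
      using conv[OF filterlim_compose[OF Q s] zs cs] by simp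
    have h: "(\<lambda>n. H (z (s n)) (c (s n))) \<longlonglongrightarrow> H y c'"
      using continuous_on_tendsto_compose[OF contH tendsto_Pair[OF zs cs]] by simp
    have "(\<lambda>n. f (s n) (z (s n))) \<longlonglongrightarrow> 0"
      unfolding f_def using tendsto_diff[OF g h] by simp
    then have "\<forall>\<^sub>F n in sequentially. cmod (f (s n) (z (s n))) < e"
      using e by (auto simp: tendsto_iff)
    then obtain n where "cmod (f (s n) (z (s n))) < e" by (auto simp: eventually_sequentially)
    moreover have "s n \<in> S" using r by (simp add: s_def)
    ultimately show False by (simp add: S_def)
  qed
  have "(\<lambda>n. dist (c n) (a n)) \<longlonglongrightarrow> dist c' a'" by (intro tendsto_dist a c)
  then have "(\<lambda>n. dist (c n) (a n)) \<longlonglongrightarrow> 0" using True by simp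
  then have "\<forall>\<^sub>F n in sequentially. dist (c n) (a n) < 1" by (rule order_tendstoD) simp
  then have ev: "\<forall>\<^sub>F n in sequentially. cmod (f n (a n)) \<le> cmod (f n (z n))"
    by eventually_elim (use mm in auto)
  have "(\<lambda>n. cmod (f n (z n))) \<longlonglongrightarrow> 0" using lim0 by (simp add: tendsto_norm_zero)
  then have "(\<lambda>n. f n (a n)) \<longlonglongrightarrow> 0"
    by (rule Lim_null_comparison[OF ev])
  moreover have "(\<lambda>n. H (a n) (c n)) \<longlonglongrightarrow> H a' c'"
    using continuous_on_tendsto_compose[OF contH tendsto_Pair[OF a c]] by simp
  ultimately have "(\<lambda>n. f n (a n) + H (a n) (c n)) \<longlonglongrightarrow> 0 + H a' c'" by (rule tendsto_add)
  then show ?thesis by (simp add: f_def)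
qed

text \<open>The parameter moves with n, so convergence of Riemann sums for a fixed integrand is not
  enough. Uniform continuity on the product of [0,1] and a ball around \<open>p'\<close> controls
  the variation over a cell and the shift of the parameter together; each may use up d/2.\<close>

lemma Riemann_sum_tendsto:
  fixes f :: "real \<Rightarrow> 'a::euclidean_space \<Rightarrow> complex"
  assumes cont: "continuous_on UNIV (\<lambda>(u, p). f u p)"
    and Q: "filterlim Q at_top sequentially" and p: "p \<longlonglongrightarrow> p'"
  shows "(\<lambda>n. (\<Sum>q<Q n. f (real q / real (Q n)) (p n)) / of_nat (Q n)) \<longlonglongrightarrow> integral {0..1} (\<lambda>u. f u p')"
proof (rule tendstoI)
  fix e :: real assume e: "e > 0"
  define K where "K = {0..1::real} \<times> cball p' 1"
  have "compact K" unfolding K_def by (intro compact_Times) auto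
  then have "uniformly_continuous_on K (\<lambda>(u, p). f u p)"
    using compact_uniformly_continuous continuous_on_subset[OF cont] by blast
  then obtain d where d: "d > 0" "\<And>x y. x \<in> K \<Longrightarrow> y \<in> K \<Longrightarrow> dist y x < d \<Longrightarrow> dist ((\<lambda>(u, p). f u p) y) ((\<lambda>(u, p). f u p) x) < e/2"
    using e unfolding uniformly_continuous_on_def by (metis half_gt_zero)
  have contp: "continuous_on T (\<lambda>u. f u p')" for T
    using continuous_on_compose2[OF cont, of T "\<lambda>u. (u, p')"] by (simp add: continuous_on_Pair)
  have "\<forall>\<^sub>F n in sequentially. dist (p n) p' < min 1 (d/2)"
    using p d(1) by (intro tendstoD) auto
  moreover have "\<forall>\<^sub>F n in sequentially. real (Q n) > 2 / d"
    using Q filterlim_compose[OF filterlim_real_sequentially Q] by (auto simp: filterlim_at_top_dense)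
  moreover have "\<forall>\<^sub>F n in sequentially. Q n \<ge> 1"
    using Q by (simp add: filterlim_at_top)
  ultimately show "\<forall>\<^sub>F n in sequentially. dist ((\<Sum>q<Q n. f (real q / real (Q n)) (p n)) / of_nat (Q n)) (integral {0..1} (\<lambda>u. f u p')) < e"
  proof eventually_elim
    case (elim n)
    define M where "M = Q n"
    have M: "M > 0" "real M > 2/d" using elim by (auto simp: M_def)
    have split: "integral {0..real m / real M} (\<lambda>u. f u p') = (\<Sum>q<m. integral {real q / M..real (Suc q) / M} (\<lambda>u. f u p'))" for m
    proof (induction m)
      case (Suc m)
      have "integral {0..real (Suc m) / real M} (\<lambda>u. f u p') =
         integral {0..real m / real M} (\<lambda>u. f u p') + integral {real m / M..real (Suc m) / M} (\<lambda>u. f u p')"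
        using M by (intro Henstock_Kurzweil_Integration.integral_combine[symmetric] integrable_continuous_interval contp)
          (auto simp: divide_right_mono)
      then show ?case using Suc by simp
    qed simp
    have cell: "cmod (f (real q / M) (p n) / of_nat M - integral {real q / M..real (Suc q) / M} (\<lambda>u. f u p')) \<le> e/2 * (1/M)"
      if "q < M" for q
    proof -
      let ?I = "{real q / M..real (Suc q) / M}"
      have len: "real (Suc q) / M - real q / M = 1 / M" by (simp flip: diff_divide_distrib)
      have le: "real q / M \<le> real (Suc q) / M" by (simp add: divide_right_mono)
      have "integral ?I (\<lambda>u. f (real q / M) (p n)) = (1 / M) *\<^sub>R f (real q / M) (p n)"
        using le len by simp
      also have "\<dots> = f (real q / M) (p n) / of_nat M" by (simp add: scaleR_conv_of_real)
      finally have 1: "f (real q / M) (p n) / of_nat M = integral ?I (\<lambda>u. f (real q / M) (p n))" ..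
      have "f (real q / M) (p n) / of_nat M - integral ?I (\<lambda>u. f u p') = integral ?I (\<lambda>u. f (real q / M) (p n) - f u p')"
        unfolding 1 by (intro integral_diff[symmetric] integrable_continuous_interval contp) auto
      also have "cmod \<dots> \<le> e/2 * (real (Suc q) / M - real q / M)"
      proof (rule integral_bound[OF le])
        show "continuous_on ?I (\<lambda>u. f (real q / real M) (p n) - f u p')" by (intro continuous_intros contp)
        fix u assume u: "u \<in> ?I"
        have "real (Suc q) / M \<le> 1" using that M by simp
        then have "u \<in> {0..1}" using u by (auto intro: order_trans[rotated])
        moreover have "real q / M \<in> {0..1}" using that by auto
        ultimately have K: "(u, p') \<in> K" "(real q / M, p n) \<in> K" using elim by (auto simp: K_def dist_commute)
        have "dist (real q / M, p n) (u, p') \<le> dist (real q / M) u + dist (p n) p'"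
          unfolding dist_prod_def by (simp add: sqrt_sum_squares_le_sum)
        also have "dist (real q / M) u \<le> 1 / M" using u len by (auto simp: dist_real_def)
        also have "1 / M < d / 2" using M d(1) by (simp add: field_simps)
        finally have "dist (real q / M, p n) (u, p') < d" using elim by simp
        from d(2)[OF K this] show "cmod (f (real q / real M) (p n) - f u p') \<le> e/2" by (simp add: dist_norm)
      qed
      finally show ?thesis using len by simp
    qed
    have "(\<Sum>q<M. f (real q / real M) (p n)) / of_nat M - integral {0..1} (\<lambda>u. f u p')
      = (\<Sum>q<M. f (real q / M) (p n) / of_nat M - integral {real q / M..real (Suc q) / M} (\<lambda>u. f u p'))"
      using split[of M] M by (simp add: sum_subtractf sum_divide_distrib)
    also have "cmod \<dots> \<le> (\<Sum>q<M. e/2 * (1/M))"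
      by (intro sum_norm_le cell) auto
    also have "\<dots> = e/2" using M by simp
    also have "\<dots> < e" using e by simp
    finally show ?case by (simp add: dist_norm M_def)
  qed
qed

text \<open>Caratheodory's form of the derivative, f z - f x = g z (z - x), avoids a division by
  \<open>h n\<close>, which may vanish.\<close>

lemma field_derivative_sequentially:
  assumes f: "(f has_field_derivative d) (at x)" and h: "h \<longlonglongrightarrow> 0" and k: "(\<lambda>n. k n * h n) \<longlonglongrightarrow> c"
  shows "(\<lambda>n. k n * (f (x + h n) - f x)) \<longlonglongrightarrow> (c * d :: complex)"
proof -
  obtain g where g: "\<And>z. f z - f x = g z * (z - x)" "isCont g x" "g x = d"
    using f by (auto simp: CARAT_DERIV)
  have "(\<lambda>n. x + h n) \<longlonglongrightarrow> x" using tendsto_add[OF tendsto_const h, of x] by simp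
  from isCont_tendsto_compose[OF g(2) this] have "(\<lambda>n. g (x + h n)) \<longlonglongrightarrow> d" using g(3) by simp
  from tendsto_mult[OF k this] show ?thesis
    by (simp add: g(1) mult_ac)
qed

section \<open>The Bessel kernels of order one half and minus one half\<close>

text \<open>Cosine and sinc of a square root. Both are even in the root, so the branch cut of
  \<open>csqrt\<close> disappears and they are entire.\<close>

definition cosq :: "complex \<Rightarrow> complex" where "cosq z = cos (csqrt z)"

definition sincq :: "complex \<Rightarrow> complex" where "sincq z = (if z = 0 then 1 else sin (csqrt z) / csqrt z)"

lemma cosq_power2 [simp]: "cosq (w\<^sup>2) = cos w"
proof -
  have "csqrt (w\<^sup>2) = w \<or> csqrt (w\<^sup>2) = - w" by (metis power2_csqrt power2_eq_iff)
  then show ?thesis by (auto simp: cosq_def)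
qed

lemma sincq_power2: "w * sincq (w\<^sup>2) = sin w"
proof -
  have "csqrt (w\<^sup>2) = w \<or> csqrt (w\<^sup>2) = - w" by (metis power2_csqrt power2_eq_iff)
  then show ?thesis by (auto simp: sincq_def)
qed

lemma cosq_0 [simp]: "cosq 0 = 1" and sincq_0 [simp]: "sincq 0 = 1"
  by (simp_all add: cosq_def sincq_def)

text \<open>The cosine series has even powers only, hence is a power series in z. It gives
  continuity across the cut of \<open>csqrt\<close> and, later, the comparison with the Bessel
  series.\<close>

lemma cosq_sums: "(\<lambda>n. (-1)^n / fact (2*n) * z^n) sums cosq z"
proof -
  define w where "w = csqrt z"
  have w: "w\<^sup>2 = z" by (simp add: w_def)
  have "(\<lambda>n. cos_coeff n *\<^sub>R w ^ n) sums cos w" by (rule cos_converges)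
  moreover have "strict_mono (\<lambda>n::nat. 2*n)" by (simp add: strict_mono_def)
  moreover have "cos_coeff n *\<^sub>R w ^ n = 0" if "n \<notin> range (\<lambda>n::nat. 2*n)" for n
    using that by (auto simp: cos_coeff_def elim!: evenE)
  ultimately have "(\<lambda>n. cos_coeff (2*n) *\<^sub>R w ^ (2*n)) sums cos w"
    using sums_mono_reindex[of "\<lambda>n. 2*n" "\<lambda>n. cos_coeff n *\<^sub>R w ^ n" "cos w"] by blast
  then show ?thesis
    by (simp add: cos_coeff_def scaleR_conv_of_real power_mult w cosq_def w_def)
qed

lemma sincq_sums: "(\<lambda>n. (-1)^n / fact (2*n+1) * z^n) sums sincq z"
proof (cases "z = 0")
  case True
  have "(\<lambda>n. (-1)^n / fact (2*n+1) * (0::complex)^n) sums ((-1)^0 / fact (2*0+1))"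
    by (rule powser_sums_zero)
  then show ?thesis using True by simp
next
  case False
  define w where "w = csqrt z"
  have w: "w\<^sup>2 = z" "w \<noteq> 0" using False by (simp_all add: w_def)
  have "(\<lambda>n. sin_coeff n *\<^sub>R w ^ n) sums sin w" by (rule sin_converges)
  moreover have "strict_mono (\<lambda>n::nat. 2*n+1)" by (simp add: strict_mono_def)
  moreover have "sin_coeff n *\<^sub>R w ^ n = 0" if "n \<notin> range (\<lambda>n::nat. 2*n+1)" for n
    using that by (auto simp: sin_coeff_def elim!: oddE)
  ultimately have "(\<lambda>n. sin_coeff (2*n+1) *\<^sub>R w ^ (2*n+1)) sums sin w"
    using sums_mono_reindex[of "\<lambda>n. 2*n+1" "\<lambda>n. sin_coeff n *\<^sub>R w ^ n" "sin w"] by blast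
  then have "(\<lambda>n. sin_coeff (2*n+1) *\<^sub>R w ^ (2*n+1) / w) sums (sin w / w)" by (rule sums_divide)
  moreover have "sin_coeff (2*n+1) *\<^sub>R w ^ (2*n+1) / w = (-1)^n / fact (2*n+1) * z^n" for n
    using w(2) by (simp add: sin_coeff_def scaleR_conv_of_real power_mult w(1) del: fact_Suc)
  ultimately show ?thesis using False by (simp add: sincq_def w_def)
qed

lemma continuous_on_cosq [continuous_intros]:
  assumes "continuous_on A f" shows "continuous_on A (\<lambda>x. cosq (f x))"
proof -
  have "isCont cosq z" for z
  proof -
    have eq: "cosq = (\<lambda>z. \<Sum>n. (-1)^n / fact (2*n) * z^n)"
      using cosq_sums by (auto simp: sums_iff)
    show ?thesis unfolding eq
      by (rule isCont_powser[of _ "of_real (cmod z + 1)"])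
        (use cosq_sums in \<open>auto simp: sums_iff simp del: of_real_add\<close>)
  qed
  then have "continuous_on UNIV cosq" by (simp add: continuous_on_eq_continuous_at)
  from continuous_on_compose2[OF this assms] show ?thesis by simp
qed

lemma continuous_on_sincq [continuous_intros]:
  assumes "continuous_on A f" shows "continuous_on A (\<lambda>x. sincq (f x))"
proof -
  have "isCont sincq z" for z
  proof -
    have eq: "sincq = (\<lambda>z. \<Sum>n. (-1)^n / fact (2*n+1) * z^n)"
      using sincq_sums by (auto simp: sums_iff)
    show ?thesis unfolding eq
      by (rule isCont_powser[of _ "of_real (cmod z + 1)"])
        (use sincq_sums in \<open>auto simp: sums_iff simp del: of_real_add fact_Suc\<close>)
  qed
  then have "continuous_on UNIV sincq" by (simp add: continuous_on_eq_continuous_at)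
  from continuous_on_compose2[OF this assms] show ?thesis by simp
qed

lemma tendsto_cosq [tendsto_intros]: "(f \<longlongrightarrow> a) F \<Longrightarrow> ((\<lambda>x. cosq (f x)) \<longlongrightarrow> cosq a) F"
  using continuous_on_tendsto_compose[of UNIV cosq f a F] continuous_on_cosq[of UNIV "\<lambda>x. x"]
  by simp

lemma tendsto_sincq [tendsto_intros]: "(f \<longlongrightarrow> a) F \<Longrightarrow> ((\<lambda>x. sincq (f x)) \<longlongrightarrow> sincq a) F"
  using continuous_on_tendsto_compose[of UNIV sincq f a F] continuous_on_sincq[of UNIV "\<lambda>x. x"]
  by simp

text \<open>\<open>cos_kernel\<close> and \<open>sin_kernel\<close> are pi times the Bessel kernels
  of order -1/2 and 1/2, in the form in which they arise as limits of Riemann sums. As integrals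
  they are visibly continuous in both arguments, also on the coordinate axes.\<close>

definition cos_kernel :: "complex \<Rightarrow> complex \<Rightarrow> complex" where
  "cos_kernel a b = integral {0..1::real} (\<lambda>u. cosq (of_real (u\<^sup>2) * a) * cosq (of_real (u\<^sup>2) * b))"

definition sin_kernel :: "complex \<Rightarrow> complex \<Rightarrow> complex" where
  "sin_kernel a b = integral {0..1::real} (\<lambda>u. of_real (u\<^sup>2) * sincq (of_real (u\<^sup>2) * a) * sincq (of_real (u\<^sup>2) * b))"

lemma continuous_on_cos_kernel: "continuous_on UNIV (\<lambda>(a, b). cos_kernel a b)"
  unfolding cos_kernel_def case_prod_beta
  by (rule integral_continuous_on_param[of UNIV 0 "1::real", simplified cbox_interval])
    (auto intro!: continuous_intros simp: case_prod_beta)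

lemma continuous_on_sin_kernel: "continuous_on UNIV (\<lambda>(a, b). sin_kernel a b)"
  unfolding sin_kernel_def case_prod_beta
  by (rule integral_continuous_on_param[of UNIV 0 "1::real", simplified cbox_interval])
    (auto intro!: continuous_intros simp: case_prod_beta)

lemma cosq_scaled: "cosq (of_real (u\<^sup>2) * x\<^sup>2) = cos (of_real u * x)"
  using cosq_power2[of "of_real u * x"] by (simp add: power_mult_distrib)

lemma sincq_scaled: "of_real u * x * sincq (of_real (u\<^sup>2) * x\<^sup>2) = sin (of_real u * x)"
  using sincq_power2[of "of_real u * x"] by (simp add: power_mult_distrib)

text \<open>With squares as arguments \<open>cosq\<close> becomes a genuine cosine. The
  antiderivative is the Wronskian of the two cosines divided by the difference of the squared
  frequencies.\<close>

lemma cos_kernel_offdiag: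
  assumes "x\<^sup>2 \<noteq> y\<^sup>2"
  shows "cos_kernel (x\<^sup>2) (y\<^sup>2) = (x * sin x * cos y - y * cos x * sin y) / (x\<^sup>2 - y\<^sup>2)"
proof -
  let ?F = "\<lambda>u::real. (x * sin (of_real u * x) * cos (of_real u * y) - y * cos (of_real u * x) * sin (of_real u * y)) / (x\<^sup>2 - y\<^sup>2)"
  have "((\<lambda>u::real. cos (of_real u * x) * cos (of_real u * y)) has_integral (?F 1 - ?F 0)) {0..1}"
  proof (rule fundamental_theorem_of_calculus)
    fix u :: real
    have "((\<lambda>z. x * sin (z * x) * cos (z * y) - y * cos (z * x) * sin (z * y)) has_field_derivative
       ((x\<^sup>2 - y\<^sup>2) * (cos (of_real u * x) * cos (of_real u * y)))) (at (of_real u))"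
      by (auto intro!: derivative_eq_intros simp: algebra_simps power2_eq_square)
    from has_vector_derivative_real_field[OF DERIV_cdivide[OF this, of "x\<^sup>2 - y\<^sup>2"]] assms(1)
    show "(?F has_vector_derivative cos (of_real u * x) * cos (of_real u * y)) (at u within {0..1})" by simp
  qed simp
  then show ?thesis unfolding cos_kernel_def cosq_scaled by (simp add: integral_unique)
qed

text \<open>For equal frequencies the Wronskian formula degenerates to 0/0; the double-angle
  antiderivative takes its place.\<close>

lemma cos_kernel_diag:
  assumes "x \<noteq> 0"
  shows "cos_kernel (x\<^sup>2) (x\<^sup>2) = (1 + sin x * cos x / x) / 2"
proof -
  let ?F = "\<lambda>u::real. (of_real u + sin (of_real u * x) * cos (of_real u * x) / x) / 2"
  have "((\<lambda>u::real. cos (of_real u * x) * cos (of_real u * x)) has_integral (?F 1 - ?F 0)) {0..1}"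
  proof (rule fundamental_theorem_of_calculus)
    fix u :: real
    define C S where "C = cos (of_real u * x)" and "S = sin (of_real u * x)"
    have CS: "C * C + S * S = 1" using sin_cos_squared_add3[of "of_real u * x"] by (simp add: C_def S_def)
    have d: "((\<lambda>z. sin (z * x) * cos (z * x)) has_field_derivative (x * C * C - x * S * S)) (at (of_real u))"
      by (auto intro!: derivative_eq_intros simp: C_def S_def algebra_simps)
    have "((\<lambda>z. (z + sin (z * x) * cos (z * x) / x) / 2) has_field_derivative
       (1 + (x * C * C - x * S * S) / x) / 2) (at (of_real u))"
      by (rule DERIV_cdivide[OF DERIV_add[OF DERIV_ident DERIV_cdivide[OF d]]])
    moreover have "(1 + (x * C * C - x * S * S) / x) / 2 = C * C"
    proof -
      have "(x * C * C - x * S * S) / x = C * C - S * S" using assms by (simp add: field_simps)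
      moreover have "S * S = 1 - C * C" using CS by (simp add: algebra_simps)
      ultimately show ?thesis by simp
    qed
    ultimately have "((\<lambda>z. (z + sin (z * x) * cos (z * x) / x) / 2) has_field_derivative
       (cos (of_real u * x) * cos (of_real u * x))) (at (of_real u))" by (simp add: C_def S_def)
    from has_vector_derivative_real_field[OF this]
    show "(?F has_vector_derivative cos (of_real u * x) * cos (of_real u * x)) (at u within {0..1})" .
  qed simp
  then show ?thesis unfolding cos_kernel_def cosq_scaled by (simp add: integral_unique)
qed

text \<open>The weight u^2 in \<open>sin_kernel\<close> supplies one factor u for each sinc, which
  turns both into sines.\<close>

lemma sin_kernel_eq:
  assumes "x \<noteq> 0" "y \<noteq> 0"
  shows "sin_kernel (x\<^sup>2) (y\<^sup>2) = integral {0..1::real} (\<lambda>u. sin (of_real u * x) * sin (of_real u * y)) / (x * y)"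
proof -
  have "of_real (u\<^sup>2) * sincq (of_real (u\<^sup>2) * x\<^sup>2) * sincq (of_real (u\<^sup>2) * y\<^sup>2) =
     sin (of_real u * x) * sin (of_real u * y) / (x * y)" for u
    using assms by (simp add: sincq_scaled[of u x, symmetric] sincq_scaled[of u y, symmetric] power2_eq_square)
  then show ?thesis unfolding sin_kernel_def by simp
qed

lemma sin_kernel_offdiag:
  assumes "x\<^sup>2 \<noteq> y\<^sup>2" "x \<noteq> 0" "y \<noteq> 0"
  shows "sin_kernel (x\<^sup>2) (y\<^sup>2) = (y * sin x * cos y - x * cos x * sin y) / (x * y * (x\<^sup>2 - y\<^sup>2))"
proof -
  let ?F = "\<lambda>u::real. (y * sin (of_real u * x) * cos (of_real u * y) - x * cos (of_real u * x) * sin (of_real u * y)) / (x\<^sup>2 - y\<^sup>2)"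
  have "((\<lambda>u::real. sin (of_real u * x) * sin (of_real u * y)) has_integral (?F 1 - ?F 0)) {0..1}"
  proof (rule fundamental_theorem_of_calculus)
    fix u :: real
    have "((\<lambda>z. y * sin (z * x) * cos (z * y) - x * cos (z * x) * sin (z * y)) has_field_derivative
       ((x\<^sup>2 - y\<^sup>2) * (sin (of_real u * x) * sin (of_real u * y)))) (at (of_real u))"
      by (auto intro!: derivative_eq_intros simp: algebra_simps power2_eq_square)
    from has_vector_derivative_real_field[OF DERIV_cdivide[OF this, of "x\<^sup>2 - y\<^sup>2"]] assms(1)
    show "(?F has_vector_derivative sin (of_real u * x) * sin (of_real u * y)) (at u within {0..1})" by simp
  qed simp
  then show ?thesis unfolding sin_kernel_eq[OF assms(2,3)] using assms by (simp add: integral_unique)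
qed

lemma sin_kernel_diag:
  assumes "x \<noteq> 0"
  shows "sin_kernel (x\<^sup>2) (x\<^sup>2) = (1 - sin x * cos x / x) / (2 * x\<^sup>2)"
proof -
  let ?F = "\<lambda>u::real. (of_real u - sin (of_real u * x) * cos (of_real u * x) / x) / 2"
  have "((\<lambda>u::real. sin (of_real u * x) * sin (of_real u * x)) has_integral (?F 1 - ?F 0)) {0..1}"
  proof (rule fundamental_theorem_of_calculus)
    fix u :: real
    define C S where "C = cos (of_real u * x)" and "S = sin (of_real u * x)"
    have CS: "C * C + S * S = 1" using sin_cos_squared_add3[of "of_real u * x"] by (simp add: C_def S_def)
    have d: "((\<lambda>z. sin (z * x) * cos (z * x)) has_field_derivative (x * C * C - x * S * S)) (at (of_real u))"
      by (auto intro!: derivative_eq_intros simp: C_def S_def algebra_simps)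
    have "((\<lambda>z. (z - sin (z * x) * cos (z * x) / x) / 2) has_field_derivative
       (1 - (x * C * C - x * S * S) / x) / 2) (at (of_real u))"
      by (rule DERIV_cdivide[OF DERIV_diff[OF DERIV_ident DERIV_cdivide[OF d]]])
    moreover have "(1 - (x * C * C - x * S * S) / x) / 2 = S * S"
    proof -
      have "(x * C * C - x * S * S) / x = C * C - S * S" using assms by (simp add: field_simps)
      moreover have "C * C = 1 - S * S" using CS by (simp add: algebra_simps)
      ultimately show ?thesis by simp
    qed
    ultimately have "((\<lambda>z. (z - sin (z * x) * cos (z * x) / x) / 2) has_field_derivative
       (sin (of_real u * x) * sin (of_real u * x))) (at (of_real u))" by (simp add: C_def S_def)
    from has_vector_derivative_real_field[OF this]
    show "(?F has_vector_derivative sin (of_real u * x) * sin (of_real u * x)) (at u within {0..1})" .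
  qed simp
  then show ?thesis unfolding sin_kernel_eq[OF assms assms] using assms by (simp add: integral_unique power2_eq_square)
qed

lemma cos_kernel_0: "cos_kernel 0 0 = 1"
  by (simp add: cos_kernel_def)

lemma sin_kernel_0: "sin_kernel 0 0 = 1/3"
proof -
  have "((\<lambda>u::real. (of_real (u\<^sup>2))::complex) has_integral (of_real 1 ^ 3 / 3 - of_real 0 ^ 3 / 3)) {0..1}"
  proof (rule fundamental_theorem_of_calculus)
    fix u :: real
    have "((\<lambda>z::complex. z ^ 3 / 3) has_field_derivative (of_real (u\<^sup>2))) (at (of_real u))"
      by (auto intro!: derivative_eq_intros simp: power2_eq_square)
    from has_vector_derivative_real_field[OF this]
    show "((\<lambda>u::real. of_real u ^ 3 / 3 :: complex) has_vector_derivative of_real (u\<^sup>2)) (at u within {0..1})" .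
  qed simp
  then show ?thesis by (simp add: sin_kernel_def integral_unique)
qed

section \<open>Bessel series of half-integer order\<close>

definition bterm :: "complex \<Rightarrow> complex \<Rightarrow> nat \<Rightarrow> complex" where
  "bterm s t m = (-1)^m * rGamma (of_nat m + s + 1) / fact m * t^m"

lemma bessel_J_sums:
  assumes "bterm s ((z/2)\<^sup>2) sums B" shows "bessel_J s z = (z/2) powr s * B"
  using assms by (simp add: bessel_J_def bterm_def[abs_def] sums_iff power_mult)

text \<open>Here t stands for (z/2)^2, and the prefactor (z/2)^s is left out. The functional
  equation of the reciprocal Gamma function splits each coefficient in two; summed over m this is
  the contiguous relation J_{s-1} = (2s/z) J_s - J_{s+1}.\<close>

lemma bterm_recurrence: "bterm (s-1) t m = s * bterm s t m + (if m = 0 then 0 else - t * bterm (s+1) t (m-1))"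
proof (cases m)
  case 0
  have "rGamma s = s * rGamma (s + 1)" by (simp add: rGamma_plus1)
  then show ?thesis using 0 by (simp add: bterm_def)
next
  case (Suc k)
  have "rGamma (of_nat m + s) = (of_nat m + s) * rGamma (of_nat m + s + 1)" by (simp add: rGamma_plus1)
  moreover have "(-1)^m * (of_nat m * rGamma (of_nat m + s + 1)) / fact m * t^m = - t * bterm (s+1) t k"
  proof -
    have "(of_nat m :: complex) \<noteq> 0" "fact m = of_nat m * (fact k :: complex)" using Suc by (simp_all del: of_nat_Suc)
    then have "(-1)^m * (of_nat m * rGamma (of_nat m + s + 1)) / fact m * t^m = (-1)^m * rGamma (of_nat m + s + 1) / fact k * t^m"
      by (simp add: field_simps)
    also have "of_nat m + s + 1 = of_nat k + (s + 1) + 1" using Suc by simp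
    finally show ?thesis using Suc by (simp add: bterm_def)
  qed
  moreover have "bterm (s-1) t m = (-1)^m * rGamma (of_nat m + s) / fact m * t^m" by (simp add: bterm_def)
  moreover have "(-1)^m * ((n + s) * g) / fact m * t^m = s * ((-1)^m * g / fact m * t^m) + (-1)^m * (n * g) / fact m * t^m"
    for n g by (simp add: add_divide_distrib distrib_left distrib_right)
  ultimately show ?thesis using Suc by (simp only: bterm_def) simp
qed

lemma bterm_sums_down:
  assumes "bterm s t sums X" "bterm (s+1) t sums Y"
  shows "bterm (s-1) t sums (s * X - t * Y)"
proof -
  have "(\<lambda>m. (if m = 0 then 0 else - t * bterm (s+1) t (m-1))) sums (- t * Y)"
    using sums_mult[OF assms(2), of "-t"] sums_Suc_iff[of "\<lambda>m. (if m = 0 then 0 else - t * bterm (s+1) t (m-1))" "-t*Y"]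
    by simp
  from sums_add[OF sums_mult[OF assms(1), of s] this] show ?thesis
    by (simp add: bterm_recurrence[symmetric])
qed

lemma bterm_sums_up:
  assumes "bterm s t sums X" "bterm (s-1) t sums Y" "t \<noteq> 0"
  shows "bterm (s+1) t sums ((s * X - Y) / t)"
proof -
  have "(\<lambda>m. s * bterm s t m - bterm (s-1) t m) sums (s * X - Y)"
    by (intro sums_diff sums_mult assms)
  then have "(\<lambda>m. if m = 0 then 0 else t * bterm (s+1) t (m-1)) sums (s * X - Y)"
    by (rule sums_cong[THEN iffD1, rotated]) (simp add: bterm_recurrence)
  then have "(\<lambda>m. t * bterm (s+1) t m) sums (s * X - Y)"
    using sums_Suc_iff[of "\<lambda>m. (if m = 0 then 0 else t * bterm (s+1) t (m-1))" "s * X - Y"] by simp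
  from sums_divide[OF this, of t] show ?thesis using assms(3) by simp
qed

lemma rGamma_half: "rGamma (1/2 :: complex) = 1 / of_real (sqrt pi)"
  by (simp add: rGamma_inverse_Gamma Gamma_one_half_complex inverse_eq_divide)

text \<open>Half-integer Gamma values are rational multiples of the square root of pi. This closed
  form turns the Bessel coefficients of order -1/2 and 1/2 into those of cosine and sine.\<close>

lemma rGamma_half_nat: "rGamma (of_nat m + 1/2 :: complex) = 4^m * fact m / (of_real (sqrt pi) * fact (2*m))"
proof (induction m)
  case 0
  then show ?case using rGamma_half by simp
next
  case (Suc m)
  have nz: "(of_nat m + 1/2 :: complex) \<noteq> 0"
  proof
    assume "(of_nat m + 1/2 :: complex) = 0"
    then have "Re (of_nat m + 1/2) = 0" by simp
    then show False by simp
  qed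
  have "(of_nat m + 1/2) * rGamma (of_nat m + 1/2 + 1 :: complex) = rGamma (of_nat m + 1/2)"
    by (rule rGamma_plus1)
  then have "rGamma (of_nat (Suc m) + 1/2 :: complex) = rGamma (of_nat m + 1/2) / (of_nat m + 1/2)"
    using nz by (simp add: field_simps add_ac)
  also have "\<dots> = 4^Suc m * fact (Suc m) / (of_real (sqrt pi) * fact (2*Suc m))"
  proof -
    have a: "(fact (2 * Suc m) :: complex) = 2 * (of_nat m + 1) * (2 * of_nat m + 1) * fact (2*m)"
      by (simp add: algebra_simps)
    have b: "(of_nat m + 1 :: complex) \<noteq> 0" using of_nat_neq_0[of m, where 'a=complex] by (simp add: add.commute)
    have c: "(2 * of_nat m + 1 :: complex) \<noteq> 0" using nz by (simp add: field_simps)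
    have d: "of_nat m + 1/2 = (2 * of_nat m + 1 :: complex) / 2" by (simp add: field_simps)
    have e: "fact (Suc m) = (of_nat m + 1) * (fact m :: complex)" by simp
    define x y z r :: complex where "x = of_nat m + 1" and "y = 2 * of_nat m + 1" and "z = fact (2*m)" and "r = of_real (sqrt pi)"
    have "x \<noteq> 0" "y \<noteq> 0" "z \<noteq> 0" "r \<noteq> 0" using b c by (simp_all add: x_def y_def z_def r_def)
    then show ?thesis unfolding Suc.IH unfolding a d e x_def[symmetric] y_def[symmetric] z_def[symmetric] r_def[symmetric] power_Suc
      by (simp add: field_simps)
  qed
  finally show ?case .
qed

lemma bterm_minus_half: "bterm (-1/2) t m = (-1)^m / fact (2*m) * (4*t)^m / of_real (sqrt pi)"
proof -
  have "of_nat m + (-1/2) + 1 = (of_nat m + 1/2 :: complex)" by simp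
  then have "bterm (-1/2) t m = (- 1) ^ m * (4^m * fact m / (of_real (sqrt pi) * fact (2*m))) / fact m * t ^ m"
    unfolding bterm_def by (simp only: rGamma_half_nat)
  then show ?thesis by (simp add: power_mult_distrib mult_ac)
qed

lemma bterm_half: "bterm (1/2) t m = 2 * ((-1)^m / fact (2*m+1) * (4*t)^m) / of_real (sqrt pi)"
proof -
  have "of_nat m + 1/2 + 1 = (of_nat (Suc m) + 1/2 :: complex)" by simp
  then have "bterm (1/2) t m = (- 1) ^ m * (4^Suc m * fact (Suc m) / (of_real (sqrt pi) * fact (2*Suc m))) / fact m * t ^ m"
    unfolding bterm_def by (simp only: rGamma_half_nat)
  also have "(fact (2*Suc m) :: complex) = 2 * fact (Suc m) / fact m * fact (2*m+1)"
  proof -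
    have "(fact (2*Suc m) :: complex) = of_nat (2 * Suc m) * fact (2*m+1)" by (simp del: of_nat_Suc of_nat_mult)
    then show ?thesis by simp
  qed
  finally show ?thesis by (simp add: power_mult_distrib field_simps del: fact_Suc)
qed

text \<open>Division by a positive number leaves the argument unchanged, so the principal logarithm
  is additive here.\<close>

lemma powr_divide_2: "x \<noteq> 0 \<Longrightarrow> (x/2) powr s = x powr s / 2 powr (s::complex)"
proof -
  assume "x \<noteq> 0"
  then have "Ln (x / of_real 2) = Ln x - of_real (ln 2)" by (intro Ln_divide_of_real) auto
  then have "Ln (x / 2) = Ln x - Ln 2" using Ln_of_real[of 2] by simp
  then show ?thesis using \<open>x \<noteq> 0\<close> by (simp add: powr_def right_diff_distrib exp_diff)
qed

text \<open>Halving the argument keeps it inside the principal range, so the two principal powers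
  agree without a correction factor.\<close>

lemma csqrt_powr:
  assumes "a \<noteq> 0" shows "csqrt a powr s = a powr (s/2)"
proof -
  have eq: "Ln (csqrt a) = Ln a / 2"
    using assms mpi_less_Im_Ln[OF assms] Im_Ln_le_pi[OF assms] by (simp add: csqrt_exp_Ln Ln_exp)
  show ?thesis using assms by (simp add: powr_def eq)
qed

lemma csqrt_eq_powr: "a \<noteq> 0 \<Longrightarrow> csqrt a = a powr (1/2)"
  by (simp add: powr_def csqrt_exp_Ln)

lemma two_powr_half: "(2::complex) powr (1/2) = of_real (sqrt 2)"
  using csqrt_eq_powr[of 2] by (simp add: csqrt_of_real_nonneg[of 2, simplified])

lemma bessel_J_half:
  assumes "z \<noteq> 0" shows "bessel_J (1/2) z = of_real (sqrt (2/pi)) * z powr (-1/2) * sin z"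
proof -
  have "bterm (1/2) ((z/2)\<^sup>2) sums (2 / of_real (sqrt pi) * sincq (4 * (z/2)\<^sup>2))"
    using sums_mult[OF sincq_sums, of "2 / of_real (sqrt pi)" "4 * (z/2)\<^sup>2"]
    by (simp add: bterm_half[abs_def] power_divide mult_ac)
  moreover have "4 * (z/2)\<^sup>2 = z\<^sup>2" by (simp add: power_divide)
  ultimately have "bessel_J (1/2) z = (z/2) powr (1/2) * (2 / of_real (sqrt pi) * sincq (z\<^sup>2))"
    by (simp only: bessel_J_sums)
  also have "sincq (z\<^sup>2) = sin z / z" using sincq_power2[of z] assms by (simp add: field_simps)
  also have "(z/2) powr (1/2) = z powr (1/2) / of_real (sqrt 2)"
    using assms by (simp add: powr_divide_2 two_powr_half)
  also have "z powr (1/2) = z powr (-1/2) * z"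
    using powr_add[of z "-1/2" 1] assms by simp
  finally have *: "bessel_J (1/2) z = z powr (-1/2) * z / of_real (sqrt 2) * (2 / of_real (sqrt pi) * (sin z / z))" .
  have "(2::complex) / of_real (sqrt 2) = of_real (2 / sqrt 2)" by (simp only: of_real_divide of_real_numeral)
  also have "2 / sqrt 2 = sqrt 2" by (simp add: real_div_sqrt)
  finally have "of_real (sqrt (2/pi)) = (2::complex) / of_real (sqrt 2) / of_real (sqrt pi)"
    by (simp only: real_sqrt_divide of_real_divide)
  then show ?thesis unfolding * using assms by simp
qed

lemma bessel_J_minus_half:
  assumes "z \<noteq> 0" shows "bessel_J (-1/2) z = of_real (sqrt (2/pi)) * z powr (-1/2) * cos z"
proof -
  have "bterm (-1/2) ((z/2)\<^sup>2) sums (1 / of_real (sqrt pi) * cosq (4 * (z/2)\<^sup>2))"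
    using sums_mult[OF cosq_sums, of "1 / of_real (sqrt pi)" "4 * (z/2)\<^sup>2"]
    by (simp add: bterm_minus_half[abs_def, simplified] power_divide mult_ac)
  moreover have "4 * (z/2)\<^sup>2 = z\<^sup>2" by (simp add: power_divide)
  ultimately have "bessel_J (-1/2) z = (z/2) powr (-1/2) * (1 / of_real (sqrt pi) * cosq (z\<^sup>2))"
    by (simp only: bessel_J_sums)
  also have "(z/2) powr (-1/2) = z powr (-1/2) * of_real (sqrt 2)"
  proof -
    have h: "(2::complex) powr (-1/2) = inverse (of_real (sqrt 2))"
      using powr_minus[of 2 "1/2::complex"] unfolding two_powr_half by simp
    show ?thesis unfolding powr_divide_2[OF assms] h by (simp only: divide_inverse inverse_inverse_eq)
  qed
  finally have *: "bessel_J (-1/2) z = z powr (-1/2) * of_real (sqrt 2) * (1 / of_real (sqrt pi) * cosq (z\<^sup>2))" .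
  have "of_real (sqrt (2/pi)) = (of_real (sqrt 2) / of_real (sqrt pi) :: complex)"
    by (simp only: real_sqrt_divide of_real_divide)
  then show ?thesis unfolding * cosq_power2 by (simp only: times_divide_eq_left times_divide_eq_right mult_1 mult_ac)
qed

text \<open>On the diagonal \<open>Jstar_formula\<close> involves the neighbouring orders s + 1 and
  s - 1. For s = 1/2 and s = -1/2 these include 3/2 and -3/2, which the contiguous relation reduces
  to the elementary orders.\<close>

lemma bessel_J_three_halves:
  assumes "z \<noteq> 0"
  shows "bessel_J (3/2) z = bessel_J (1/2) z / z - bessel_J (-1/2) z"
    and "bessel_J (-3/2) z = - bessel_J (-1/2) z / z - bessel_J (1/2) z"
proof -
  define t where "t = (z/2)\<^sup>2"
  have t: "t \<noteq> 0" using assms by (simp add: t_def)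
  obtain X where X: "bterm (1/2) t sums X"
    using sums_mult[OF sincq_sums, of "2 / of_real (sqrt pi)" "4 * t"]
    by (auto simp: bterm_half[abs_def] mult_ac)
  obtain Y where Y: "bterm (-1/2) t sums Y"
    using sums_mult[OF cosq_sums, of "1 / of_real (sqrt pi)" "4 * t"]
    by (auto simp: bterm_minus_half[abs_def, simplified] mult_ac)
  have J: "bessel_J (1/2) z = (z/2) powr (1/2) * X" "bessel_J (-1/2) z = (z/2) powr (-1/2) * Y"
    using bessel_J_sums X Y unfolding t_def by blast+
  have "bterm (3/2) t sums ((1/2 * X - Y) / t)"
    using bterm_sums_up[of "1/2" t X Y] X Y t by simp
  then have J3: "bessel_J (3/2) z = (z/2) powr (3/2) * ((1/2 * X - Y) / t)"
    using bessel_J_sums unfolding t_def by blast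
  have "bterm (-3/2) t sums (- (1/2) * Y - t * X)"
    using bterm_sums_down[of "-1/2" t Y X] X Y by simp
  then have J4: "bessel_J (-3/2) z = (z/2) powr (-3/2) * (- (1/2) * Y - t * X)"
    using bessel_J_sums unfolding t_def by blast
  \<comment> \<open>The lowest exponent that occurs; the other powers are this one times an integral
    power of z/2.\<close>
  define P where "P = (z/2) powr (-3/2)"
  have P1: "(z/2) powr (-1/2) = P * (z/2)" using powr_add[of "z/2" "-3/2" 1] assms by (simp add: P_def)
  have P2: "(z/2) powr (1/2) = P * (z/2)\<^sup>2"
  proof -
    have "(z/2) powr (1/2) = (z/2) powr (-1/2) * (z/2)" using powr_add[of "z/2" "-1/2" 1] assms by simp
    then show ?thesis unfolding P1 by (simp add: power2_eq_square)
  qed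
  have P3: "(z/2) powr (3/2) = P * (z/2)^3"
  proof -
    have "(z/2) powr (3/2) = (z/2) powr (1/2) * (z/2)" using powr_add[of "z/2" "1/2" 1] assms by simp
    then show ?thesis unfolding P2 by (simp add: power2_eq_square power3_eq_cube)
  qed
  note P = P1 P2 P3
  show "bessel_J (3/2) z = bessel_J (1/2) z / z - bessel_J (-1/2) z"
    unfolding J J3 P t_def using assms by (simp add: field_simps power2_eq_square power3_eq_cube)
  show "bessel_J (-3/2) z = - bessel_J (-1/2) z / z - bessel_J (1/2) z"
    unfolding J J4 P t_def using assms by (simp add: P_def[symmetric, simplified] field_simps power2_eq_square power3_eq_cube)
qed

lemma powr_minus_half_square:
  assumes "x \<noteq> 0" shows "x powr (-1/2) * x powr (-1/2) = 1 / (x::complex)"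
proof -
  have "x powr (-1/2) * x powr (-1/2) = x powr (-1/2 + -1/2)" by (simp only: powr_add)
  also have "\<dots> = x powr (-1)" by simp
  also have "\<dots> = 1 / x" using assms by (subst powr_minus) (simp add: inverse_eq_divide)
  finally show ?thesis .
qed

text \<open>Off the branch cut the elementary formulas may be differentiated. Values of
  \<open>csqrt\<close> at nonzero points avoid the cut (\<open>csqrt_notin_nonpos_Reals\<close>), so
  the derivatives in \<open>Jstar_formula\<close> are covered.\<close>

lemma deriv_bessel_J_half:
  assumes "y \<notin> \<real>\<^sub>\<le>\<^sub>0"
  shows "y * deriv (bessel_J (1/2)) y = of_real (sqrt (2/pi)) * y powr (-1/2) * (y * cos y - sin y / 2)"
    and "y * deriv (bessel_J (-1/2)) y = of_real (sqrt (2/pi)) * y powr (-1/2) * (- y * sin y - cos y / 2)"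
proof -
  have y: "y \<noteq> 0" using assms by auto
  have p: "y powr (-(1/2)) = y * y powr (-(3/2))" using powr_add[of y "-3/2" 1] y by simp
  have ev: "\<forall>\<^sub>F z in nhds y. z \<noteq> 0" using y by (intro t1_space_nhds)
  have "((\<lambda>z. of_real (sqrt (2/pi)) * z powr (-1/2) * sin z) has_field_derivative
     of_real (sqrt (2/pi)) * (- 1 / 2 * y powr (-3/2) * sin y + y powr (-1/2) * cos y)) (at y)"
    using assms by (auto intro!: derivative_eq_intros simp: algebra_simps)
  then have "(bessel_J (1/2) has_field_derivative
     of_real (sqrt (2/pi)) * (- 1 / 2 * y powr (-3/2) * sin y + y powr (-1/2) * cos y)) (at y)"
    by (subst DERIV_cong_ev[OF refl _ refl]) (use ev in \<open>auto elim!: eventually_mono simp: bessel_J_half\<close>)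
  then show "y * deriv (bessel_J (1/2)) y = of_real (sqrt (2/pi)) * y powr (-1/2) * (y * cos y - sin y / 2)"
    by (subst DERIV_imp_deriv, assumption) (simp add: p algebra_simps)
  have "((\<lambda>z. of_real (sqrt (2/pi)) * z powr (-1/2) * cos z) has_field_derivative
     of_real (sqrt (2/pi)) * (- 1 / 2 * y powr (-3/2) * cos y - y powr (-1/2) * sin y)) (at y)"
    using assms by (auto intro!: derivative_eq_intros simp: algebra_simps)
  then have "(bessel_J (-1/2) has_field_derivative
     of_real (sqrt (2/pi)) * (- 1 / 2 * y powr (-3/2) * cos y - y powr (-1/2) * sin y)) (at y)"
    by (subst DERIV_cong_ev[OF refl _ refl]) (use ev in \<open>auto elim!: eventually_mono simp: bessel_J_minus_half[simplified]\<close>)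
  then show "y * deriv (bessel_J (-1/2)) y = of_real (sqrt (2/pi)) * y powr (-1/2) * (- y * sin y - cos y / 2)"
    by (subst DERIV_imp_deriv, assumption) (simp add: p algebra_simps)
qed

lemma csqrt_notin_nonpos_Reals: "a \<noteq> 0 \<Longrightarrow> csqrt a \<notin> \<real>\<^sub>\<le>\<^sub>0"
  using csqrt_principal[of a] csqrt_eq_0[of a]
  by (auto simp: complex_nonpos_Reals_iff complex_eq_iff[of "csqrt a"] simp del: csqrt.sel csqrt_eq_0)

lemma of_real_sqrt_two_pi: "(of_real (sqrt (2/pi)))\<^sup>2 = (2 / of_real pi :: complex)"
  by (simp flip: of_real_power)

text \<open>The powers x^(-1/2) and y^(-1/2), written u and v, cancel against those in a^(1/4) = u x
  and b^(1/4) = v y, and the terms -sin/2 of the derivatives cancel by antisymmetry. What remains is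
  the closed form of \<open>sin_kernel\<close>, with the constant k^2/2 = 1/pi.\<close>

lemma Jstar_formula_half:
  assumes "a \<noteq> 0" "b \<noteq> 0"
  shows "Jstar_formula (1/2) a b = sin_kernel a b / of_real pi"
proof -
  define x y where "x = csqrt a" and "y = csqrt b"
  have xy: "x\<^sup>2 = a" "y\<^sup>2 = b" "x \<noteq> 0" "y \<noteq> 0" "x \<notin> \<real>\<^sub>\<le>\<^sub>0" "y \<notin> \<real>\<^sub>\<le>\<^sub>0"
    using assms csqrt_notin_nonpos_Reals by (simp_all add: x_def y_def)
  define k where "k = (of_real (sqrt (2/pi)) :: complex)"
  have k: "k * k = 2 / of_real pi" using of_real_sqrt_two_pi by (simp add: k_def power2_eq_square)
  define u v where "u = x powr (-1/2)" and "v = y powr (-1/2)"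
  have inv: "u * u = 1 / x" "v * v = 1 / y"
    unfolding u_def v_def by (intro powr_minus_half_square xy)+
  have uv: "a powr (1/4) = u * x" "b powr (1/4) = v * y" "u * u * x = 1" "v * v * y = 1"
    subgoal using csqrt_powr[of a "1/2"] powr_add[of x "-1/2" 1] assms xy by (simp add: x_def u_def)
    subgoal using csqrt_powr[of b "1/2"] powr_add[of y "-1/2" 1] assms xy by (simp add: y_def v_def)
    using inv xy by simp_all
  have nz: "u \<noteq> 0" "v \<noteq> 0" using uv by auto
  have J: "bessel_J (1/2) x = k * u * sin x" "bessel_J (1/2) y = k * v * sin y" "bessel_J (-1/2) x = k * u * cos x"
    using bessel_J_half bessel_J_minus_half xy by (simp_all add: k_def u_def v_def)
  have D: "x * deriv (bessel_J (1/2)) x = k * u * (x * cos x - sin x / 2)"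
    "y * deriv (bessel_J (1/2)) y = k * v * (y * cos y - sin y / 2)"
    using deriv_bessel_J_half xy by (simp_all add: k_def u_def v_def)
  show ?thesis
  proof (cases "a = b")
    case False
    then have ne: "x\<^sup>2 \<noteq> y\<^sup>2" using xy by simp
    have "Jstar_formula (1/2) a b =
       (k * u * sin x * (y * deriv (bessel_J (1/2)) y) - k * v * sin y * (x * deriv (bessel_J (1/2)) x)) / (2 * (u * x) * (v * y) * (a - b))"
      unfolding Jstar_formula_def using False by (simp add: x_def[symmetric] y_def[symmetric] J uv mult.assoc)
    also have "\<dots> = (k * k) * ((u * v) * (y * sin x * cos y - x * cos x * sin y)) / ((u * v) * (2 * (x * y) * (a - b)))"
      unfolding D by (rule arg_cong2[where f="(/)"]) (simp_all add: field_simps)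
    also have "\<dots> = (k * k) / 2 * ((y * sin x * cos y - x * cos x * sin y) / (x * y * (a - b)))"
      using nz by (simp add: mult.assoc)
    also have "\<dots> = sin_kernel a b / of_real pi"
      using sin_kernel_offdiag[OF ne] xy by (simp add: k)
    finally show ?thesis .
  next
    case True
    have "bessel_J (3/2) x = k * u * (sin x / x - cos x)"
      using bessel_J_three_halves(1)[OF xy(3)] J by (simp add: field_simps)
    moreover have "a powr (1/2) = x" using csqrt_eq_powr[OF assms(1)] by (simp add: x_def)
    ultimately have "Jstar_formula (1/2) a b = ((k * u * sin x)\<^sup>2 - k * u * (sin x / x - cos x) * (k * u * cos x)) / (4 * x)"
      unfolding Jstar_formula_def using J by (simp add: x_def[symmetric] True[symmetric])
    also have "\<dots> = (k * k) * ((u * u * x) * ((sin x)\<^sup>2 + (cos x)\<^sup>2 - sin x * cos x / x)) / (4 * x * x)"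
    proof -
      have "((k * u * s)\<^sup>2 - k * u * (s / x - c) * (k * u * c)) / (4 * x) = (k * k) * ((u * u * x) * (s\<^sup>2 + c\<^sup>2 - s * c / x)) / (4 * x * x)" for s c
        using xy(3) by (simp add: field_simps power2_eq_square)
      then show ?thesis .
    qed
    also have "\<dots> = 1 / of_real pi * ((1 - sin x * cos x / x) / (2 * x\<^sup>2))"
    proof -
      have "2 / p * (1 * (1 - r)) / (4 * x * x) = 1 / p * ((1 - r) / (2 * x\<^sup>2))" if "p \<noteq> 0" for p r
        using xy(3) that by (simp add: field_simps power2_eq_square)
      then show ?thesis unfolding k uv(3) sin_cos_squared_add by (metis of_real_eq_0_iff pi_neq_zero)
    qed
    also have "\<dots> = sin_kernel a b / of_real pi"
      by (simp add: True[symmetric] sin_kernel_diag[OF xy(3), unfolded xy(1)] xy(1))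
    finally show ?thesis .
  qed
qed

lemma Jstar_formula_minus_half:
  assumes "a \<noteq> 0" "b \<noteq> 0"
  shows "Jstar_formula (-1/2) a b = cos_kernel a b / of_real pi"
proof -
  define x y where "x = csqrt a" and "y = csqrt b"
  have xy: "x\<^sup>2 = a" "y\<^sup>2 = b" "x \<noteq> 0" "y \<noteq> 0" "x \<notin> \<real>\<^sub>\<le>\<^sub>0" "y \<notin> \<real>\<^sub>\<le>\<^sub>0"
    using assms csqrt_notin_nonpos_Reals by (simp_all add: x_def y_def)
  define k where "k = (of_real (sqrt (2/pi)) :: complex)"
  have k: "k * k = 2 / of_real pi" using of_real_sqrt_two_pi by (simp add: k_def power2_eq_square)
  define u v where "u = x powr (-1/2)" and "v = y powr (-1/2)"
  have inv: "u * u = 1 / x" "v * v = 1 / y"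
    unfolding u_def v_def by (intro powr_minus_half_square xy)+
  have uv: "a powr (-1/4) = u" "b powr (-1/4) = v" "u * u * x = 1" "v * v * y = 1"
    subgoal using csqrt_powr[of a "-1/2"] assms by (simp add: x_def u_def)
    subgoal using csqrt_powr[of b "-1/2"] assms by (simp add: y_def v_def)
    using inv xy by simp_all
  have nz: "u \<noteq> 0" "v \<noteq> 0" using uv by auto
  have J: "bessel_J (1/2) x = k * u * sin x" "bessel_J (-1/2) y = k * v * cos y" "bessel_J (-1/2) x = k * u * cos x"
    using bessel_J_half bessel_J_minus_half xy by (simp_all add: k_def u_def v_def)
  have D: "x * deriv (bessel_J (-1/2)) x = k * u * (- x * sin x - cos x / 2)"
    "y * deriv (bessel_J (-1/2)) y = k * v * (- y * sin y - cos y / 2)"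
    using deriv_bessel_J_half xy by (simp_all add: k_def u_def v_def)
  show ?thesis
  proof (cases "a = b")
    case False
    then have ne: "x\<^sup>2 \<noteq> y\<^sup>2" using xy by simp
    have "Jstar_formula (-1/2) a b =
       (k * u * cos x * (y * deriv (bessel_J (-1/2)) y) - k * v * cos y * (x * deriv (bessel_J (-1/2)) x)) / (2 * u * v * (a - b))"
      unfolding Jstar_formula_def using False uv J by (simp add: x_def[symmetric] y_def[symmetric] mult.assoc)
    also have "\<dots> = (k * k) * ((u * v) * (x * sin x * cos y - y * cos x * sin y)) / ((u * v) * (2 * (a - b)))"
      unfolding D by (rule arg_cong2[where f="(/)"]) (simp_all add: field_simps)
    also have "\<dots> = (k * k) / 2 * ((x * sin x * cos y - y * cos x * sin y) / (a - b))"
      using nz by simp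
    also have "\<dots> = cos_kernel a b / of_real pi"
      using cos_kernel_offdiag[OF ne] xy by (simp add: k)
    finally show ?thesis .
  next
    case True
    have J3: "bessel_J (-3/2) x = k * u * (- cos x / x - sin x)"
      using bessel_J_three_halves(2)[OF xy(3)] J by (simp add: field_simps)
    have "a powr (-1/2) = u * u" using csqrt_powr[of a "-1"] assms powr_add[of x "-1/2" "-1/2"]
      by (simp add: x_def u_def)
    then have "Jstar_formula (-1/2) a b = ((k * u * cos x)\<^sup>2 - k * u * sin x * (k * u * (- cos x / x - sin x))) / (4 * (u * u))"
      unfolding Jstar_formula_def using J J3 by (simp add: x_def[symmetric] True[symmetric])
    also have "\<dots> = (k * k) / 4 * ((sin x)\<^sup>2 + (cos x)\<^sup>2 + sin x * cos x / x)"
    proof -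
      have "((k * u * c)\<^sup>2 - k * u * s * (k * u * (- c / x - s))) / (4 * (u * u)) = (k * k) / 4 * (s\<^sup>2 + c\<^sup>2 + s * c / x)" for s c
        using xy nz by (simp add: field_simps power2_eq_square)
      then show ?thesis .
    qed
    also have "\<dots> = 1 / of_real pi * ((1 + sin x * cos x / x) / 2)"
      unfolding k by simp
    also have "\<dots> = cos_kernel a b / of_real pi"
      by (simp add: True[symmetric] cos_kernel_diag[OF xy(3), unfolded xy(1)])
    finally show ?thesis .
  qed
qed

text \<open>The limit in the definition of \<open>Jstar\<close> is determined only if its filter is
  nontrivial. Shifting both coordinates by a small positive r, which avoids the at most two values
  that would put a coordinate at 0, leaves the axes.\<close>

lemma off_axes_islimpt: "(a, b) islimpt {(x, y). x \<noteq> (0::complex) \<and> y \<noteq> (0::complex)}"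
  unfolding islimpt_approachable
proof (intro allI impI)
  fix e :: real assume "e > 0"
  then have "infinite {0<..<e/2}" by simp
  then have "infinite ({0<..<e/2} - {Re (-a), Re (-b)})" by (simp add: Diff_infinite_finite)
  then have "{0<..<e/2} - {Re (-a), Re (-b)} \<noteq> {}" by (rule infinite_imp_nonempty)
  then obtain r where "r \<in> {0<..<e/2} - {Re (-a), Re (-b)}" by blast
  then have r: "0 < r" "r < e/2" "r \<noteq> - Re a" "r \<noteq> - Re b" by auto
  then have "a + of_real r \<noteq> 0" "b + of_real r \<noteq> 0" by (auto simp: complex_eq_iff)
  moreover have "dist (a + of_real r, b + of_real r) (a, b) \<le> dist (a + of_real r) a + dist (b + of_real r) b"
    unfolding dist_prod_def by (simp add: sqrt_sum_squares_le_sum)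
  then have "dist (a + of_real r, b + of_real r) (a, b) < e" using r by (simp add: dist_norm)
  ultimately show "\<exists>x'\<in>{(x, y). x \<noteq> 0 \<and> y \<noteq> (0::complex)}. x' \<noteq> (a, b) \<and> dist x' (a, b) < e"
    using r by (intro bexI[of _ "(a + of_real r, b + of_real r)"]) auto
qed

lemma Jstar_eqI:
  assumes cont: "continuous_on UNIV (\<lambda>(a, b). F a b)"
    and F: "\<And>a b. a \<noteq> 0 \<Longrightarrow> b \<noteq> 0 \<Longrightarrow> Jstar_formula s a b = F a b"
  shows "Jstar s a b = F a b"
proof (cases "a \<noteq> 0 \<and> b \<noteq> 0")
  case True then show ?thesis using F by (simp add: Jstar_def)
next
  case False
  let ?S = "{(x, y). x \<noteq> 0 \<and> y \<noteq> (0::complex)}"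
  have "((\<lambda>(x, y). F x y) \<longlongrightarrow> F a b) (at (a, b) within ?S)"
    using continuous_on_subset[OF cont, of "UNIV"] cont
    by (metis (mono_tags, lifting) UNIV_I case_prod_conv continuous_on_def tendsto_within_subset top_greatest)
  then have "((\<lambda>(x, y). Jstar_formula s x y) \<longlongrightarrow> F a b) (at (a, b) within ?S)"
    by (rule Lim_transform_eventually)
      (unfold eventually_at_filter, rule always_eventually, auto simp: F)
  moreover have "at (a, b) within ?S \<noteq> bot"
    using off_axes_islimpt trivial_limit_within by blast
  ultimately show ?thesis using False by (auto simp: Jstar_def intro!: tendsto_Lim)
qed

lemma Jstar_half: "Jstar (1/2) a b = sin_kernel a b / of_real pi"
  by (rule Jstar_eqI) (auto intro!: continuous_intros continuous_on_sin_kernel[unfolded case_prod_beta] simp: Jstar_formula_half case_prod_beta)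

lemma Jstar_minus_half: "Jstar (- (1/2)) a b = cos_kernel a b / of_real pi"
  by (rule Jstar_eqI) (auto intro!: continuous_intros continuous_on_cos_kernel[unfolded case_prod_beta] simp: Jstar_formula_minus_half[simplified] case_prod_beta)

section \<open>Orthogonal polynomials on the unit circle\<close>

lemma AE_circle_norm:
  assumes "circle_measure M" shows "AE z in M. cmod z = 1"
proof (rule AE_I')
  show "{z \<in> space M. \<not> cmod z = 1} \<subseteq> - sphere 0 1" by auto
  show "- sphere 0 1 \<in> null_sets M" using assms by (auto simp: circle_measure_def null_sets_def)
qed

lemma borel_measurable_cong_borel: "sets M = sets borel \<Longrightarrow> borel_measurable M = borel_measurable borel"
  by (rule measurable_cong_sets) auto

lemma circle_measurable: "circle_measure M \<Longrightarrow> borel_measurable M = borel_measurable borel"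
  by (rule borel_measurable_cong_borel) (simp add: circle_measure_def)

lemma circle_space: "circle_measure M \<Longrightarrow> space M = UNIV"
  using sets_eq_imp_space_eq[of M borel] by (auto simp: circle_measure_def)

lemma circle_integrable:
  fixes f :: "complex \<Rightarrow> 'b::{banach, second_countable_topology}"
  assumes M: "circle_measure M" and f: "continuous_on UNIV f"
  shows "integrable M f"
proof -
  have "compact (f ` sphere 0 1)" using f by (intro compact_continuous_image continuous_on_subset[OF f]) auto
  then obtain B where B: "\<And>z. z \<in> sphere 0 1 \<Longrightarrow> norm (f z) \<le> B"
    using compact_imp_bounded bounded_iff by (metis imageI)
  have fin: "finite_measure M" using M by (simp add: circle_measure_def)
  show ?thesis
  proof (rule finite_measure.integrable_const_bound[OF fin])
    show "AE z in M. norm (f z) \<le> B" using AE_circle_norm[OF M] by eventually_elim (auto intro: B)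
    show "f \<in> borel_measurable M"
      using borel_measurable_continuous_onI[OF f] by (simp add: circle_measurable[OF M])
  qed
qed

definition inner_M :: "complex measure \<Rightarrow> complex poly \<Rightarrow> complex poly \<Rightarrow> complex" where
  "inner_M M P Q = (LINT z|M. poly P z * cnj (poly Q z))"

definition sqnorm_M :: "complex measure \<Rightarrow> complex poly \<Rightarrow> real" where
  "sqnorm_M M P = (LINT z|M. (cmod (poly P z))\<^sup>2)"

definition nontrivial_measure :: "complex measure \<Rightarrow> bool" where
  "nontrivial_measure M \<longleftrightarrow> circle_measure M \<and> infinite (msupp M)"

lemma inner_M_add: "circle_measure M \<Longrightarrow> inner_M M (P + Q) R = inner_M M P R + inner_M M Q R"
  unfolding inner_M_def
  by (subst Bochner_Integration.integral_add[symmetric]) (auto intro!: circle_integrable continuous_intros simp: algebra_simps)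

lemma inner_M_smult: "inner_M M (smult c P) R = c * inner_M M P R"
  unfolding inner_M_def by (simp add: mult.assoc)

lemma inner_M_cnj: "inner_M M Q P = cnj (inner_M M P Q)"
  unfolding inner_M_def by (subst Bochner_Integration.integral_cnj[symmetric]) (simp add: mult.commute)

lemma inner_M_zero [simp]: "inner_M M 0 R = 0" "inner_M M R 0 = 0"
  by (simp_all add: inner_M_def)

lemma inner_M_diff: "circle_measure M \<Longrightarrow> inner_M M (P - Q) R = inner_M M P R - inner_M M Q R"
  using inner_M_add[of M P "smult (-1) Q" R] inner_M_smult[of M "-1" Q R] by simp

lemma inner_M_sum: "circle_measure M \<Longrightarrow> inner_M M (\<Sum>i\<in>A. f i) R = (\<Sum>i\<in>A. inner_M M (f i) R)"
  by (induction A rule: infinite_finite_induct) (auto simp: inner_M_add)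

lemma inner_M_smult_right: "inner_M M P (smult c R) = cnj c * inner_M M P R"
  using inner_M_cnj[of M P "smult c R"] inner_M_cnj[of M P R] by (simp add: inner_M_smult)

lemma inner_M_add_right: "circle_measure M \<Longrightarrow> inner_M M R (P + Q) = inner_M M R P + inner_M M R Q"
  using inner_M_cnj[of M R "P + Q"] inner_M_cnj[of M R P] inner_M_cnj[of M R Q] by (simp add: inner_M_add)

lemma inner_M_sum_right: "circle_measure M \<Longrightarrow> inner_M M R (\<Sum>i\<in>A. f i) = (\<Sum>i\<in>A. inner_M M R (f i))"
  by (induction A rule: infinite_finite_induct) (auto simp: inner_M_add_right)

lemma inner_M_self: "inner_M M P P = of_real (sqnorm_M M P)"
  unfolding inner_M_def sqnorm_M_def by (simp add: complex_norm_square[symmetric] flip: integral_complex_of_real)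

lemma sqnorm_M_nonneg: "sqnorm_M M P \<ge> 0"
  unfolding sqnorm_M_def by simp

text \<open>If a polynomial vanishes almost everywhere, the complement of its root set is an open
  null set, so the support lies inside the roots. For a nonzero polynomial this contradicts infinite
  support.\<close>

lemma sqnorm_M_eq_0:
  assumes M: "nontrivial_measure M" and "sqnorm_M M P = 0"
  shows "P = 0"
proof (rule ccontr)
  assume P: "P \<noteq> 0"
  have C: "circle_measure M" using M by (simp add: nontrivial_measure_def)
  have "integrable M (\<lambda>z. (cmod (poly P z))\<^sup>2)" by (intro circle_integrable[OF C] continuous_intros)
  then have "AE z in M. (cmod (poly P z))\<^sup>2 = 0"
    using assms(2) integral_nonneg_eq_0_iff_AE[of M "\<lambda>z. (cmod (poly P z))\<^sup>2"] by (simp add: sqnorm_M_def)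
  then have AE: "AE z in M. poly P z = 0" by simp
  have op: "open (- {z. poly P z = 0})"
    using P by (intro open_Compl finite_imp_closed poly_roots_finite)
  have "emeasure M (- {z. poly P z = 0}) = 0"
  proof (rule emeasure_eq_0_AE[of "\<lambda>z. poly P z \<noteq> 0" M, simplified, THEN trans[rotated]])
    show "AE z in M. poly P z = 0" by (rule AE)
    show "emeasure M (- {z. poly P z = 0}) = emeasure M {x \<in> space M. poly P x \<noteq> 0}"
      by (simp add: circle_space[OF C] Compl_eq)
  qed
  then have "msupp M \<subseteq> {z. poly P z = 0}"
    using op unfolding msupp_def by fastforce
  then have "finite (msupp M)" using P poly_roots_finite finite_subset by blast
  then show False using M by (simp add: nontrivial_measure_def)
qed

lemma sqnorm_M_pos: "nontrivial_measure M \<Longrightarrow> P \<noteq> 0 \<Longrightarrow> sqnorm_M M P > 0"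
  using sqnorm_M_eq_0 sqnorm_M_nonneg by (metis less_eq_real_def)

lemma degree_lt_combination:
  fixes e :: "nat \<Rightarrow> complex poly"
  assumes e: "\<And>j. j \<le> n \<Longrightarrow> degree (e j) = j \<and> e j \<noteq> 0" and P: "degree P \<le> n"
  shows "\<exists>c. P = (\<Sum>j\<le>n. smult (c j) (e j))"
  using e P
proof (induction n arbitrary: P)
  case 0
  then obtain a b where "e 0 = [:a:]" "P = [:b:]" "a \<noteq> 0" by (metis degree_eq_zeroE le_0_eq pCons_0_0)
  then show ?case by (intro exI[of _ "\<lambda>_. b / a"]) simp
next
  case (Suc n)
  define c where "c = coeff P (Suc n) / lead_coeff (e (Suc n))"
  define R where "R = P - smult c (e (Suc n))"
  have e1: "degree (e (Suc n)) = Suc n" "e (Suc n) \<noteq> 0" using Suc.prems(1)[of "Suc n"] by auto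
  have "coeff R k = 0" if "k > n" for k
  proof (cases "k = Suc n")
    case True
    have "lead_coeff (e (Suc n)) \<noteq> 0" using e1(2) leading_coeff_0_iff by blast
    then show ?thesis using True e1 by (simp add: R_def c_def)
  next
    case False
    then show ?thesis using that e1 Suc.prems(2) by (simp add: R_def coeff_eq_0)
  qed
  then have "degree R \<le> n" by (simp add: degree_le)
  then obtain d where "R = (\<Sum>j\<le>n. smult (d j) (e j))" using Suc by (metis le_Suc_eq)
  then have "P = (\<Sum>j\<le>n. smult (d j) (e j)) + smult c (e (Suc n))" by (simp add: R_def algebra_simps)
  also have "\<dots> = (\<Sum>j\<le>Suc n. smult ((d(Suc n := c)) j) (e j))" by simp
  finally show ?case by blast
qed

lemma inner_monomials_zero:
  assumes C: "circle_measure M" and z: "\<forall>k<n. inner_M M P (monom 1 k) = 0" and Q: "degree Q < n \<or> Q = 0"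
  shows "inner_M M P Q = 0"
proof (cases "Q = 0")
  case False
  then have dQ: "degree Q < n" using Q by simp
  have "Q = (\<Sum>k\<le>degree Q. smult (coeff Q k) (monom 1 k))"
    by (simp add: smult_monom poly_as_sum_of_monoms)
  then have "inner_M M P Q = inner_M M P (\<Sum>k\<le>degree Q. smult (coeff Q k) (monom 1 k))" by simp
  also have "\<dots> = 0"
    unfolding inner_M_sum_right[OF C] inner_M_smult_right using z dQ by (intro sum.neutral) auto
  finally show ?thesis .
qed simp

definition is_monic_op :: "complex measure \<Rightarrow> nat \<Rightarrow> complex poly \<Rightarrow> bool" where
  "is_monic_op M n P \<longleftrightarrow> degree P = n \<and> lead_coeff P = 1 \<and> (\<forall>k<n. inner_M M P (monom 1 k) = 0)"

text \<open>The leading terms cancel, so P - Q has degree below n and is orthogonal to both P and Q,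
  hence to itself.\<close>

lemma is_monic_op_unique:
  assumes M: "nontrivial_measure M" and "is_monic_op M n P" "is_monic_op M n Q"
  shows "P = Q"
proof -
  have C: "circle_measure M" using M by (simp add: nontrivial_measure_def)
  have "degree (P - Q) < n \<or> P - Q = 0"
  proof -
    have "degree (P - Q) \<le> n" using assms by (intro degree_diff_le) (auto simp: is_monic_op_def)
    moreover have "coeff (P - Q) n = 0" using assms by (auto simp: is_monic_op_def)
    moreover have "coeff (P - Q) (degree (P - Q)) = 0 \<Longrightarrow> P - Q = 0" by (simp only: leading_coeff_0_iff)
    ultimately show ?thesis using le_neq_implies_less by blast
  qed
  then have "inner_M M P (P - Q) = 0" "inner_M M Q (P - Q) = 0"
    using assms(2,3) inner_monomials_zero[OF C, of n] unfolding is_monic_op_def by blast+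
  then have "inner_M M (P - Q) (P - Q) = 0" by (simp add: inner_M_diff[OF C])
  then have "sqnorm_M M (P - Q) = 0" by (simp add: inner_M_self)
  then have "P - Q = 0" by (rule sqnorm_M_eq_0[OF M])
  then show ?thesis by simp
qed

text \<open>Gram-Schmidt applied to z^n. Together with uniqueness it gives the definite description
  \<open>monic_op\<close> its meaning.\<close>

lemma is_monic_op_exists:
  assumes M: "nontrivial_measure M"
  shows "\<exists>P. is_monic_op M n P"
proof (induction n rule: less_induct)
  case (less n)
  have C: "circle_measure M" using M by (simp add: nontrivial_measure_def)
  obtain e where e: "\<And>j. j < n \<Longrightarrow> is_monic_op M j (e j)" using less by metis
  have e0: "degree (e j) = j" "e j \<noteq> 0" if "j < n" for j using e[OF that] by (auto simp: is_monic_op_def)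
  have orth: "inner_M M (e i) (e j) = 0" if "j < i" "i < n" for i j
    using e[OF that(2)] e0[of j] that by (intro inner_monomials_zero[OF C]) (auto simp: is_monic_op_def)
  have orth': "inner_M M (e i) (e j) = 0" if "i \<noteq> j" "i < n" "j < n" for i j
    using orth[of j i] orth[of i j] that inner_M_cnj[of M "e i" "e j"] by (cases "i < j") auto
  define P where "P = monom 1 n - (\<Sum>j<n. smult (inner_M M (monom 1 n) (e j) / inner_M M (e j) (e j)) (e j))"
  have small: "degree (\<Sum>j<n. smult (a j) (e j)) < n \<or> (\<Sum>j<n. smult (a j) (e j)) = 0" for a
  proof (cases "n = 0")
    case False
    then have "degree (\<Sum>j<n. smult (a j) (e j)) \<le> n - 1"
      by (intro degree_sum_le) (use e0 in \<open>auto intro!: order_trans[OF degree_smult_le]\<close>)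
    then have "degree (\<Sum>j<n. smult (a j) (e j)) < n" using False by linarith
    then show ?thesis ..
  qed simp
  have cS: "coeff (\<Sum>j<n. smult (a j) (e j)) n = 0" for a using small[of a] by (auto simp: coeff_eq_0)
  have cP: "coeff P n = 1" unfolding P_def coeff_diff cS by simp
  have dS: "degree (\<Sum>j<n. smult (a j) (e j)) \<le> n" for a using small[of a] by auto
  have "degree P \<le> n" unfolding P_def
    by (intro degree_diff_le dS) (simp add: degree_monom_eq)
  moreover have "degree P \<ge> n" using cP by (simp add: le_degree)
  ultimately have dP: "degree P = n" by simp
  have Pe: "inner_M M P (e i) = 0" if "i < n" for i
  proof -
    have "inner_M M (e i) (e i) \<noteq> 0"
      using sqnorm_M_pos[OF M e0(2)[OF that]] by (simp add: inner_M_self)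
    moreover have "(\<Sum>j<n. inner_M M (monom 1 n) (e j) / inner_M M (e j) (e j) * inner_M M (e j) (e i)) =
       (\<Sum>j<n. if j = i then inner_M M (monom 1 n) (e i) / inner_M M (e i) (e i) * inner_M M (e i) (e i) else 0)"
      using orth' that by (intro sum.cong) auto
    ultimately show ?thesis using that
      unfolding P_def inner_M_diff[OF C] inner_M_sum[OF C] inner_M_smult by simp
  qed
  have "inner_M M P (monom 1 k) = 0" if "k < n" for k
  proof -
    have "\<exists>c. monom 1 k = (\<Sum>j\<le>k. smult (c j) (e j))"
      by (rule degree_lt_combination) (use e0 that in \<open>auto simp: degree_monom_eq\<close>)
    then obtain c where "monom 1 k = (\<Sum>j\<le>k. smult (c j) (e j))" by blast
    then show ?thesis using Pe that by (simp add: inner_M_sum_right[OF C] inner_M_smult_right)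
  qed
  then show ?case using cP dP by (auto simp: is_monic_op_def)
qed

lemma monic_op_is_monic_op:
  assumes M: "nontrivial_measure M" shows "is_monic_op M n (monic_op M n)"
proof -
  have eq: "monic_op M n = (THE P. is_monic_op M n P)"
    by (simp add: monic_op_def is_monic_op_def inner_M_def poly_monom)
  show ?thesis unfolding eq
    using is_monic_op_exists[OF M] is_monic_op_unique[OF M] by (metis theI)
qed

lemma orthonormal_poly_props:
  assumes M: "nontrivial_measure M"
  shows degree_orthonormal_poly: "degree (orthonormal_poly M n) = n"
    and orthonormal_poly_nonzero: "orthonormal_poly M n \<noteq> 0"
    and inner_orthonormal_poly: "inner_M M (orthonormal_poly M m) (orthonormal_poly M n) = (if m = n then 1 else 0)"
proof -
  have C: "circle_measure M" using M by (simp add: nontrivial_measure_def)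
  define e where "e = monic_op M"
  have e: "is_monic_op M n (e n)" for n unfolding e_def by (rule monic_op_is_monic_op[OF M])
  have e0: "degree (e j) = j" "e j \<noteq> 0" for j using e[of j] by (auto simp: is_monic_op_def)
  have pos: "sqnorm_M M (e n) > 0" for n by (rule sqnorm_M_pos[OF M e0(2)])
  have def: "orthonormal_poly M n = smult (of_real (1 / sqrt (sqnorm_M M (e n)))) (e n)" for n
    by (simp add: orthonormal_poly_def sqnorm_M_def e_def)
  have nz: "(of_real (1 / sqrt (sqnorm_M M (e n))) :: complex) \<noteq> 0" for n using pos[of n] by simp
  show "degree (orthonormal_poly M n) = n" "orthonormal_poly M n \<noteq> 0"
    unfolding def using nz[of n] e0[of n] by simp_all
  have orth: "inner_M M (e i) (e j) = 0" if "j < i" for i j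
    using e[of i] e0[of j] that by (intro inner_monomials_zero[OF C]) (auto simp: is_monic_op_def)
  have orth': "inner_M M (e i) (e j) = 0" if "i \<noteq> j" for i j
    using orth[of j i] orth[of i j] that inner_M_cnj[of M "e i" "e j"] by (cases "i < j") auto
  show "inner_M M (orthonormal_poly M m) (orthonormal_poly M n) = (if m = n then 1 else 0)"
  proof (cases "m = n")
    case True
    have "1 / sqrt (sqnorm_M M (e n)) * (1 / sqrt (sqnorm_M M (e n)) * sqnorm_M M (e n)) = 1"
      using pos[of n] by (simp add: field_simps)
    then have "complex_of_real (1 / sqrt (sqnorm_M M (e n)) * (1 / sqrt (sqnorm_M M (e n)) * sqnorm_M M (e n))) = 1"
      by (simp only: of_real_1)
    then show ?thesis using True unfolding def
      by (simp only: inner_M_smult inner_M_smult_right inner_M_self[of M "e n"] complex_cnj_complex_of_real of_real_mult if_True refl)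
  next
    case False
    then show ?thesis unfolding def by (simp add: inner_M_smult inner_M_smult_right orth')
  qed
qed

lemma orthonormal_expansion:
  assumes M: "nontrivial_measure M" and P: "degree P \<le> n"
  shows "P = (\<Sum>j\<le>n. smult (inner_M M P (orthonormal_poly M j)) (orthonormal_poly M j))"
proof -
  have C: "circle_measure M" using M by (simp add: nontrivial_measure_def)
  have "\<exists>c. P = (\<Sum>j\<le>n. smult (c j) (orthonormal_poly M j))"
    by (rule degree_lt_combination) (use orthonormal_poly_props[OF M] P in auto)
  then obtain c where c: "P = (\<Sum>j\<le>n. smult (c j) (orthonormal_poly M j))" by blast
  have "inner_M M P (orthonormal_poly M i) = c i" if "i \<le> n" for i
  proof -
    have "inner_M M P (orthonormal_poly M i) = (\<Sum>j\<le>n. c j * (if j = i then 1 else 0))"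
      by (subst c) (simp only: inner_M_sum[OF C] inner_M_smult inner_orthonormal_poly[OF M])
    also have "\<dots> = (\<Sum>j\<le>n. if j = i then c j else 0)" by (intro sum.cong) auto
    finally show ?thesis using that by simp
  qed
  then show ?thesis by (subst c) (intro sum.cong, auto)
qed

lemma sqnorm_expansion:
  assumes M: "nontrivial_measure M" and P: "degree P \<le> n"
  shows "sqnorm_M M P = (\<Sum>j\<le>n. (cmod (inner_M M P (orthonormal_poly M j)))\<^sup>2)"
proof -
  have C: "circle_measure M" using M by (simp add: nontrivial_measure_def)
  let ?c = "\<lambda>j. inner_M M P (orthonormal_poly M j)"
  have "of_real (sqnorm_M M P) = inner_M M P P" by (simp add: inner_M_self)
  also have "\<dots> = inner_M M P (\<Sum>j\<le>n. smult (?c j) (orthonormal_poly M j))"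
    using orthonormal_expansion[OF assms] by simp
  also have "\<dots> = (\<Sum>j\<le>n. cnj (?c j) * ?c j)"
    by (simp only: inner_M_sum_right[OF C] inner_M_smult_right)
  also have "\<dots> = of_real (\<Sum>j\<le>n. (cmod (?c j))\<^sup>2)"
    by (simp add: mult.commute flip: complex_norm_square)
  finally show ?thesis by (simp only: of_real_eq_iff)
qed

section \<open>The reproducing kernel and its extremal property\<close>

lemma CD_kernel_diag: "CD_kernel n z z M = of_real (\<Sum>j\<le>n. (cmod (poly (orthonormal_poly M j) z))\<^sup>2)"
  by (simp add: CD_kernel_def flip: complex_norm_square)

lemma CD_kernel_diag_nonneg: "Re (CD_kernel n z z M) \<ge> 0"
  unfolding CD_kernel_diag by (simp add: sum_nonneg)

text \<open>The second factor is the squared norm of K_n(.,x) - G/c, expanded by the reproducing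
  property; h holds its orthonormal coordinates, up to sign. Evaluation at y is then Cauchy-Schwarz.
  A candidate G whose value at x and whose norm are right to leading order thus approximates the
  kernel at every y, so diagonal information controls the kernel off the diagonal.\<close>

lemma CD_kernel_perturbation:
  assumes M: "nontrivial_measure M" and G: "degree G \<le> n" and c: "c \<noteq> (0::real)"
  shows "(cmod (CD_kernel n y x M - poly G y / of_real c))\<^sup>2
    \<le> Re (CD_kernel n y y M) * (Re (CD_kernel n x x M) - 2 / c * Re (poly G x) + sqnorm_M M G / c\<^sup>2)"
proof -
  let ?\<phi> = "orthonormal_poly M"
  let ?g = "\<lambda>j. inner_M M G (?\<phi> j)"
  define h where "h j = cnj (poly (?\<phi> j) x) - ?g j / of_real c" for j
  have Gp: "poly G z = (\<Sum>j\<le>n. ?g j * poly (?\<phi> j) z)" for z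
    by (subst orthonormal_expansion[OF M G]) (simp add: poly_sum)
  have "CD_kernel n y x M - poly G y / of_real c = (\<Sum>j\<le>n. h j * poly (?\<phi> j) y)"
    unfolding Gp CD_kernel_def h_def by (simp add: sum_subtractf[symmetric] sum_divide_distrib algebra_simps)
  then have "(cmod (CD_kernel n y x M - poly G y / of_real c))\<^sup>2 \<le> (\<Sum>j\<le>n. cmod (h j) * cmod (poly (?\<phi> j) y))\<^sup>2"
    by (simp add: norm_mult[symmetric] norm_sum power_mono)
  also have "\<dots> \<le> (\<Sum>j\<le>n. (cmod (h j))\<^sup>2) * (\<Sum>j\<le>n. (cmod (poly (?\<phi> j) y))\<^sup>2)"
    by (rule Cauchy_Schwarz_ineq_sum)
  also have "(\<Sum>j\<le>n. (cmod (h j))\<^sup>2) = Re (CD_kernel n x x M) - 2 / c * Re (poly G x) + sqnorm_M M G / c\<^sup>2"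
  proof -
    have "(cmod (h j))\<^sup>2 = (cmod (poly (?\<phi> j) x))\<^sup>2 - 2 / c * Re (?g j * poly (?\<phi> j) x) + (cmod (?g j))\<^sup>2 / c\<^sup>2" for j
      using c unfolding h_def cmod_power2 by (simp add: field_simps power2_eq_square)
    then show ?thesis
      unfolding Gp CD_kernel_diag sqnorm_expansion[OF M G]
      by (simp add: sum.distrib sum_subtractf sum_distrib_left sum_divide_distrib del: times_complex.sel)
  qed
  also have "(\<Sum>j\<le>n. (cmod (poly (?\<phi> j) y))\<^sup>2) = Re (CD_kernel n y y M)" by (simp add: CD_kernel_diag)
  finally show ?thesis by (simp add: mult.commute)
qed

text \<open>The extremal property of the diagonal: Cauchy-Schwarz in orthonormal coordinates. It is
  the source of every upper bound on a kernel by another one.\<close>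

lemma poly_le_CD_kernel:
  assumes M: "nontrivial_measure M" and P: "degree P \<le> n"
  shows "(cmod (poly P x))\<^sup>2 \<le> Re (CD_kernel n x x M) * sqnorm_M M P"
proof -
  let ?\<phi> = "orthonormal_poly M"
  let ?g = "\<lambda>j. inner_M M P (?\<phi> j)"
  have "poly P x = (\<Sum>j\<le>n. ?g j * poly (?\<phi> j) x)"
    by (subst orthonormal_expansion[OF M P]) (simp add: poly_sum)
  then have "(cmod (poly P x))\<^sup>2 \<le> (\<Sum>j\<le>n. cmod (?g j) * cmod (poly (?\<phi> j) x))\<^sup>2"
    by (simp add: norm_mult[symmetric] norm_sum power_mono)
  also have "\<dots> \<le> (\<Sum>j\<le>n. (cmod (?g j))\<^sup>2) * (\<Sum>j\<le>n. (cmod (poly (?\<phi> j) x))\<^sup>2)"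
    by (rule Cauchy_Schwarz_ineq_sum)
  finally show ?thesis by (simp add: CD_kernel_diag sqnorm_expansion[OF M P] mult.commute)
qed

definition CD_poly :: "nat \<Rightarrow> complex \<Rightarrow> complex measure \<Rightarrow> complex poly" where
  "CD_poly n x M = (\<Sum>j\<le>n. smult (cnj (poly (orthonormal_poly M j) x)) (orthonormal_poly M j))"

lemma poly_CD_poly: "poly (CD_poly n x M) z = CD_kernel n z x M"
  by (simp add: CD_poly_def CD_kernel_def poly_sum mult.commute)

lemma degree_CD_poly: "nontrivial_measure M \<Longrightarrow> degree (CD_poly n x M) \<le> n"
  unfolding CD_poly_def
  by (intro degree_sum_le) (auto intro!: order_trans[OF degree_smult_le] simp: degree_orthonormal_poly)

lemma sqnorm_CD_poly:
  assumes M: "nontrivial_measure M" shows "sqnorm_M M (CD_poly n x M) = Re (CD_kernel n x x M)"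
proof -
  have C: "circle_measure M" using M by (simp add: nontrivial_measure_def)
  have "inner_M M (CD_poly n x M) (orthonormal_poly M i) = cnj (poly (orthonormal_poly M i) x)" if "i \<le> n" for i
  proof -
    have "inner_M M (CD_poly n x M) (orthonormal_poly M i) = (\<Sum>j\<le>n. cnj (poly (orthonormal_poly M j) x) * (if j = i then 1 else 0))"
      unfolding CD_poly_def by (simp only: inner_M_sum[OF C] inner_M_smult inner_orthonormal_poly[OF M])
    also have "\<dots> = (\<Sum>j\<le>n. if j = i then cnj (poly (orthonormal_poly M j) x) else 0)" by (intro sum.cong) auto
    finally show ?thesis using that by simp
  qed
  then show ?thesis
    by (simp add: sqnorm_expansion[OF M degree_CD_poly[OF M]] CD_kernel_diag)
qed

section \<open>Localization\<close>

definition loc_poly :: "real \<Rightarrow> nat \<Rightarrow> complex poly" where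
  "loc_poly \<theta> k = [:1/2, cis (-\<theta>) / 2:] ^ k"

text \<open>The exponent \<gamma> is the scale: 1 in the interior of a band, 2 at an edge.\<close>

definition pt :: "real \<Rightarrow> nat \<Rightarrow> nat \<Rightarrow> complex \<Rightarrow> complex" where
  "pt \<theta> \<gamma> N a = exp (\<i> * (of_real \<theta> + a / of_nat N ^ \<gamma>))"

lemma poly_loc_poly: "poly (loc_poly \<theta> k) z = ((1 + z * cis (-\<theta>)) / 2) ^ k"
  by (simp add: loc_poly_def poly_power add_divide_distrib)

lemma degree_loc_poly: "degree (loc_poly \<theta> k) \<le> k"
proof -
  have "degree (loc_poly \<theta> k) \<le> degree [:1/2, cis (-\<theta>) / 2:] * k"
    unfolding loc_poly_def by (rule degree_power_le)
  also have "degree [:1/2, cis (-\<theta>) / 2:] \<le> 1" by simp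
  finally show ?thesis by simp
qed

text \<open>The parallelogram law for 1 and u = z exp(-i \<theta>): on the circle the base (1 + u)/2
  loses exactly a quarter of the squared distance to \<open>cis \<theta>\<close>.\<close>

lemma norm_loc_poly:
  assumes "cmod z = 1"
  shows "(cmod (poly (loc_poly \<theta> k) z))\<^sup>2 = (1 - (cmod (z - cis \<theta>))\<^sup>2 / 4) ^ k"
proof -
  define u where "u = z * cis (-\<theta>)"
  have u: "cmod u = 1" using assms by (simp add: u_def norm_mult)
  have "z - cis \<theta> = cis \<theta> * (u - 1)"
    by (simp add: u_def algebra_simps cis_mult)
  then have d: "cmod (z - cis \<theta>) = cmod (u - 1)" by (simp add: norm_mult)
  have "(cmod (1 + u))\<^sup>2 + (cmod (u - 1))\<^sup>2 = 2 + 2 * (cmod u)\<^sup>2"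
    unfolding cmod_power2 by (simp add: power2_eq_square algebra_simps)
  then have "(cmod ((1 + u) / 2))\<^sup>2 = 1 - (cmod (z - cis \<theta>))\<^sup>2 / 4"
    unfolding d using u by (simp add: norm_divide power_divide field_simps)
  moreover have "(cmod (w ^ k))\<^sup>2 = ((cmod w)\<^sup>2) ^ k" for w
    by (simp only: norm_power power_mult[symmetric] mult.commute[of k 2])
  ultimately show ?thesis
    by (simp only: poly_loc_poly u_def[symmetric])
qed

lemma norm_power_minus_one_le: "cmod (w ^ k - 1) \<le> exp (real k * cmod (w - 1)) - 1"
proof (induction k)
  case (Suc k)
  define h where "h = cmod (w - 1)"
  have h: "h \<ge> 0" by (simp add: h_def)
  have w: "cmod w \<le> 1 + h" using norm_triangle_ineq[of "w - 1" 1] by (simp add: h_def)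
  have "w ^ Suc k - 1 = w * (w ^ k - 1) + (w - 1)" by (simp add: algebra_simps)
  then have "cmod (w ^ Suc k - 1) \<le> cmod (w * (w^k - 1)) + h" using norm_triangle_ineq h_def by metis
  also have "cmod (w * (w^k - 1)) \<le> (1 + h) * (exp (real k * h) - 1)"
    unfolding norm_mult using w h Suc h_def by (intro mult_mono) auto
  also have "(1 + h) * (exp (real k * h) - 1) + h = (1 + h) * exp (real k * h) - 1" by (simp add: algebra_simps)
  also have "\<dots> \<le> exp h * exp (real k * h) - 1" using exp_ge_add_one_self[of h] by (simp add: add.commute)
  also have "\<dots> = exp (real (Suc k) * h) - 1" by (simp add: exp_add[symmetric] algebra_simps)
  finally show ?case by (simp add: h_def)
qed simp

lemma exp_minus_one_tendsto_mult:
  assumes "u \<longlonglongrightarrow> 0" "(\<lambda>n. k n * u n) \<longlonglongrightarrow> c"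
  shows "(\<lambda>n. k n * (exp (u n) - 1)) \<longlonglongrightarrow> (c::complex)"
  using field_derivative_sequentially[OF _ assms, of exp 1 0] DERIV_exp[of "0::complex"] by simp

text \<open>The points approach \<open>cis \<theta>\<close> at rate 1/N or faster, while the
  exponent k is of smaller order than N. So k times the distance of the base from 1 tends to 0, and
  the localizing factor is asymptotically invisible at these points, complex ones included.\<close>

lemma loc_poly_tendsto_one:
  assumes N: "filterlim N at_top sequentially" and a: "a \<longlonglongrightarrow> a'" and \<gamma>: "\<gamma> \<ge> 1"
    and k: "(\<lambda>n. real (k n) / real (N n)) \<longlonglongrightarrow> 0"
  shows "(\<lambda>n. poly (loc_poly \<theta> (k n)) (pt \<theta> \<gamma> (N n) (a n))) \<longlonglongrightarrow> 1"
proof -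
  define u where "u n = \<i> * (a n / of_nat (N n) ^ \<gamma>)" for n
  have iN: "(\<lambda>n. inverse (complex_of_nat (N n))) \<longlonglongrightarrow> 0" by (rule filterlim_compose[OF lim_inverse_n N])
  obtain \<gamma>' where \<gamma>': "\<gamma> = Suc \<gamma>'" using \<gamma> by (cases \<gamma>) auto
  have 1: "\<exists>L. (\<lambda>n. a n * inverse (complex_of_nat (N n)) ^ \<gamma>') \<longlonglongrightarrow> L"
    using tendsto_mult[OF a tendsto_power[OF iN]] by blast
  then obtain L where L: "(\<lambda>n. a n * inverse (complex_of_nat (N n)) ^ \<gamma>') \<longlonglongrightarrow> L" by blast
  have u_eq: "u n = \<i> * (a n * inverse (complex_of_nat (N n)) ^ \<gamma>') * inverse (complex_of_nat (N n))" for n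
    by (simp add: u_def \<gamma>' divide_inverse power_inverse mult_ac)
  have u0: "u \<longlonglongrightarrow> 0"
    unfolding u_eq[abs_def] using tendsto_mult[OF tendsto_mult[OF tendsto_const L] iN] by simp
  have kc: "(\<lambda>n. complex_of_nat (k n) * inverse (of_nat (N n))) \<longlonglongrightarrow> 0"
    using tendsto_of_real[OF k, where 'a=complex] by (simp add: divide_inverse)
  have "(\<lambda>n. \<i> * (a n * inverse (complex_of_nat (N n)) ^ \<gamma>') * (complex_of_nat (k n) * inverse (of_nat (N n)))) \<longlonglongrightarrow> \<i> * L * 0"
    by (intro tendsto_intros L kc)
  then have "(\<lambda>n. complex_of_nat (k n) * u n) \<longlonglongrightarrow> 0"
    by (simp add: u_eq mult_ac)
  then have "(\<lambda>n. complex_of_nat (k n) * (exp (u n) - 1)) \<longlonglongrightarrow> 0"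
    by (rule exp_minus_one_tendsto_mult[OF u0])
  then have "(\<lambda>n. cmod (complex_of_nat (k n) * (exp (u n) - 1)) / 2) \<longlonglongrightarrow> 0"
    using tendsto_divide[OF tendsto_norm_zero tendsto_const, of _ _ 2] by fastforce
  then have lim: "(\<lambda>n. exp (cmod (complex_of_nat (k n) * (exp (u n) - 1)) / 2) - 1) \<longlonglongrightarrow> exp 0 - 1"
    by (intro tendsto_intros)
  have le: "cmod (poly (loc_poly \<theta> (k n)) (pt \<theta> \<gamma> (N n) (a n)) - 1)
    \<le> exp (cmod (complex_of_nat (k n) * (exp (u n) - 1)) / 2) - 1" for n
  proof -
    have "pt \<theta> \<gamma> (N n) (a n) * cis (-\<theta>) = exp (u n)"
      by (simp add: pt_def u_def cis_conv_exp exp_add[symmetric] algebra_simps)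
    then have p: "poly (loc_poly \<theta> (k n)) (pt \<theta> \<gamma> (N n) (a n)) = ((1 + exp (u n)) / 2) ^ k n"
      by (simp add: poly_loc_poly)
    have e: "(1 + exp (u n)) / 2 - 1 = (exp (u n) - 1) / 2" by (simp add: field_simps)
    have h: "real (k n) * cmod ((1 + exp (u n)) / 2 - 1) = cmod (complex_of_nat (k n) * (exp (u n) - 1)) / 2"
      unfolding e by (simp add: norm_mult norm_divide)
    show ?thesis using norm_power_minus_one_le[of "(1 + exp (u n)) / 2" "k n"] unfolding h p .
  qed
  from lim have "(\<lambda>n. exp (cmod (complex_of_nat (k n) * (exp (u n) - 1)) / 2) - 1) \<longlonglongrightarrow> 0" by simp
  then have "(\<lambda>n. poly (loc_poly \<theta> (k n)) (pt \<theta> \<gamma> (N n) (a n)) - 1) \<longlonglongrightarrow> 0"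
    by (rule Lim_null_comparison[OF always_eventually, rotated]) (use le in blast)
  then show ?thesis by (simp add: LIM_zero_iff)
qed

text \<open>The radius N^(-1/8) tends to 0, yet its square times the exponent k of order at least
  sqrt N is of order N^(1/4) and tends to infinity; so the factor is negligible already outside a
  shrinking neighbourhood. At a fixed distance the decay is exponential in sqrt N and beats the
  cubic growth allowed for the kernel.\<close>

lemma far_decay_tendsto:
  assumes N: "filterlim N at_top sequentially"
    and k: "\<And>n. real (k n) \<ge> sqrt (real (N n)) - 1"
  shows "(\<lambda>n. (1 - (real (N n) powr (-1/8))\<^sup>2 / 4) ^ k n) \<longlonglongrightarrow> 0"
    and "0 < d \<Longrightarrow> d \<le> 2 \<Longrightarrow> (\<lambda>n. (real (N n) + 1) ^ 3 * (1 - d\<^sup>2 / 4) ^ k n) \<longlonglongrightarrow> 0"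
proof -
  have rN: "filterlim (\<lambda>n. real (N n)) at_top sequentially"
    using filterlim_compose[OF filterlim_real_sequentially N] .
  have N1: "\<forall>\<^sub>F n in sequentially. N n \<ge> 1" using N by (simp add: filterlim_at_top)
  have base: "(1 - x) ^ m \<le> exp (- (s - 1) * x)" if "0 \<le> x" "x \<le> 1" "real m \<ge> s - 1" for x s m
  proof -
    have "(1 - x) ^ m \<le> exp (- x) ^ m" using that exp_ge_add_one_self[of "-x"] by (intro power_mono) auto
    also have "\<dots> = exp (- (real m * x))" by (simp add: exp_of_nat_mult[symmetric])
    also have "\<dots> \<le> exp (- (s - 1) * x)" using that mult_right_mono[of "s-1" "real m" x] by (simp add: algebra_simps)
    finally show ?thesis .
  qed
  have "((\<lambda>x::real. exp (- (sqrt x - 1) * ((x powr (-1/8))\<^sup>2 / 4))) \<longlongrightarrow> 0) at_top" by real_asymp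
  from filterlim_compose[OF this rN]
  have lim: "(\<lambda>n. exp (- (sqrt (real (N n)) - 1) * ((real (N n) powr (-1/8))\<^sup>2 / 4))) \<longlonglongrightarrow> 0" .
  have small: "0 \<le> (real (N n) powr (-1/8))\<^sup>2 / 4" "(real (N n) powr (-1/8))\<^sup>2 / 4 \<le> 1" if "N n \<ge> 1" for n
  proof -
    have "real (N n) powr (-1/8) \<le> 1"
      using that ge_one_powr_ge_zero[of "real (N n)" "1/8"] powr_minus_divide[of "real (N n)" "1/8"] by simp
    then have "(real (N n) powr (-1/8))\<^sup>2 \<le> 1" by (simp add: power_le_one)
    then show "(real (N n) powr (-1/8))\<^sup>2 / 4 \<le> 1" by simp
  qed simp
  show "(\<lambda>n. (1 - (real (N n) powr (-1/8))\<^sup>2 / 4) ^ k n) \<longlonglongrightarrow> 0"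
  proof (rule tendsto_sandwich[OF _ _ tendsto_const lim])
    show "\<forall>\<^sub>F n in sequentially. 0 \<le> (1 - (real (N n) powr (-1/8))\<^sup>2 / 4) ^ k n"
      using N1 by eventually_elim (use small in auto)
    show "\<forall>\<^sub>F n in sequentially. (1 - (real (N n) powr (-1/8))\<^sup>2 / 4) ^ k n \<le> exp (- (sqrt (real (N n)) - 1) * ((real (N n) powr (-1/8))\<^sup>2 / 4))"
      using N1 by eventually_elim (intro base small k)
  qed
  assume d: "0 < d" "d \<le> 2"
  define e where "e = d\<^sup>2 / 4"
  have "d\<^sup>2 \<le> 2\<^sup>2" using d by (intro power_mono) auto
  then have e: "0 < e" "e \<le> 1" using d by (auto simp: e_def)
  have "((\<lambda>x::real. (x + 1)^3 * exp (- (sqrt x - 1) * e)) \<longlongrightarrow> 0) at_top" using e(1) by real_asymp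
  from filterlim_compose[OF this rN]
  have lim: "(\<lambda>n. (real (N n) + 1)^3 * exp (- (sqrt (real (N n)) - 1) * e)) \<longlonglongrightarrow> 0" .
  show "(\<lambda>n. (real (N n) + 1) ^ 3 * (1 - d\<^sup>2 / 4) ^ k n) \<longlonglongrightarrow> 0"
    unfolding e_def[symmetric]
  proof (rule tendsto_sandwich[OF _ _ tendsto_const lim])
    show "\<forall>\<^sub>F n in sequentially. 0 \<le> (real (N n) + 1) ^ 3 * (1 - e) ^ k n" using e by simp
    show "\<forall>\<^sub>F n in sequentially. (real (N n) + 1) ^ 3 * (1 - e) ^ k n \<le> (real (N n) + 1)^3 * exp (- (sqrt (real (N n)) - 1) * e)"
      using e by (intro always_eventually allI mult_left_mono base k) auto
  qed
qed

text \<open>Multiples of p on both sides of N, with room for the degree k of the localizing factor: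
  N + k is at most \<open>Qp n * p - 1\<close>, and \<open>Qm n * p - 1\<close> plus k is at most N.
  As k is the integer part of sqrt N, both multiples are N(1 + o(1)).\<close>

lemma block_approximation:
  assumes N: "filterlim N at_top sequentially" and p: "0 < (p::nat)"
  obtains k Qp Qm :: "nat \<Rightarrow> nat" where "\<And>n. sqrt (real (N n)) - 1 \<le> real (k n)" "(\<lambda>n. real (k n) / real (N n)) \<longlonglongrightarrow> 0"
    "\<And>n. N n + k n < Qp n * p" "filterlim Qp at_top sequentially" "(\<lambda>n. real (Qp n * p) / real (N n)) \<longlonglongrightarrow> 1"
    "\<And>n. Qm n * p + k n \<le> N n + 1" "filterlim Qm at_top sequentially" "(\<lambda>n. real (Qm n * p) / real (N n)) \<longlonglongrightarrow> 1"
proof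
  define k where "k n = nat \<lfloor>sqrt (real (N n))\<rfloor>" for n
  define Qp where "Qp n = (N n + k n) div p + 1" for n
  define Qm where "Qm n = (N n + 1 - k n) div p" for n
  have rN: "filterlim (\<lambda>n. real (N n)) at_top sequentially"
    using filterlim_compose[OF filterlim_real_sequentially N] .
  have N1: "\<forall>\<^sub>F n in sequentially. N n \<ge> 1" using N by (simp add: filterlim_at_top)
  have k1: "sqrt (real (N n)) - 1 \<le> real (k n)" and k2: "real (k n) \<le> sqrt (real (N n))" for n
    unfolding k_def using of_nat_floor[of "sqrt (real (N n))"] real_sqrt_ge_zero[of "real (N n)"] by linarith+
  then show "sqrt (real (N n)) - 1 \<le> real (k n)" for n by blast
  show kN: "(\<lambda>n. real (k n) / real (N n)) \<longlonglongrightarrow> 0"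
  proof (rule tendsto_sandwich[OF _ _ tendsto_const])
    have "((\<lambda>x::real. sqrt x / x) \<longlongrightarrow> 0) at_top" by real_asymp
    from filterlim_compose[OF this rN] show "(\<lambda>n. sqrt (real (N n)) / real (N n)) \<longlonglongrightarrow> 0" .
  qed (auto intro!: always_eventually divide_right_mono k2)
  have k_le: "k n \<le> N n" for n
  proof (cases "N n = 0")
    case False
    then have "sqrt (real (N n)) \<le> sqrt ((real (N n))\<^sup>2)"
      by (intro real_sqrt_le_mono) (simp add: power2_eq_square)
    then show ?thesis using k2[of n] by simp
  qed (use k2[of n] in simp)
  have div: "p * (m div p) \<le> m" "m < p * (m div p) + p" for m
    using p dividend_less_div_times[of p m] by (simp_all add: algebra_simps)
  show Qp: "N n + k n < Qp n * p" for n using div(2)[of "N n + k n"] by (simp add: Qp_def algebra_simps)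
  show Qm: "Qm n * p + k n \<le> N n + 1" for n
    unfolding Qm_def mult.commute[of _ p] using div(1)[of "N n + 1 - k n"] k_le[of n] by linarith
  \<comment> \<open>Both multiples differ from N by at most k + p + 1, which is of smaller order
    than N; this single bound yields divergence and the ratio.\<close>
  have lim: "filterlim Q at_top sequentially \<and> (\<lambda>n. real (Q n * p) / real (N n)) \<longlonglongrightarrow> 1"
    if Q: "\<And>n. \<bar>real (Q n * p) - real (N n)\<bar> \<le> real (k n) + real (p + 1)" for Q
  proof
    have "(\<lambda>n. real (k n) / real (N n) + real (p + 1) / real (N n)) \<longlonglongrightarrow> 0 + 0"
      by (intro tendsto_add kN real_tendsto_divide_at_top[OF tendsto_const rN])
    then have l: "(\<lambda>n. real (k n) / real (N n) + real (p + 1) / real (N n)) \<longlonglongrightarrow> 0" by simp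
    have "\<forall>\<^sub>F n in sequentially. norm (real (Q n * p) / real (N n) - 1) \<le> real (k n) / real (N n) + real (p + 1) / real (N n)"
      using N1
    proof eventually_elim
      case (elim n)
      then have "real (Q n * p) / real (N n) - 1 = (real (Q n * p) - real (N n)) / real (N n)"
        by (simp add: diff_divide_distrib)
      then have "norm (real (Q n * p) / real (N n) - 1) = \<bar>real (Q n * p) - real (N n)\<bar> / real (N n)"
        by (simp only: real_norm_def abs_divide abs_of_nat)
      also have "\<dots> \<le> (real (k n) + real (p + 1)) / real (N n)" by (rule divide_right_mono[OF Q]) simp
      finally show ?case by (simp only: add_divide_distrib)
    qed
    from Lim_null_comparison[OF this l] show ratio: "(\<lambda>n. real (Q n * p) / real (N n)) \<longlonglongrightarrow> 1" by (simp only: LIM_zero_iff)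
    have "filterlim (\<lambda>n. real (Q n * p) / real (N n) * real (N n)) at_top sequentially"
      by (rule filterlim_tendsto_pos_mult_at_top[OF ratio _ rN]) simp
    moreover have "\<forall>\<^sub>F n in sequentially. real (Q n * p) / real (N n) * real (N n) = real (Q n * p)"
      using N1 by eventually_elim simp
    ultimately have *: "filterlim (\<lambda>n. real (Q n * p)) at_top sequentially"
      by (rule filterlim_cong[OF refl refl, THEN iffD1, rotated])
    show "filterlim Q at_top sequentially" unfolding filterlim_at_top
    proof
      fix Z
      have "\<forall>\<^sub>F n in sequentially. real (Z * p) \<le> real (Q n * p)"
        using * unfolding filterlim_at_top by blast
      then show "\<forall>\<^sub>F n in sequentially. Z \<le> Q n"
        by eventually_elim (use p in \<open>simp only: of_nat_le_iff mult_le_cancel2\<close>)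
    qed
  qed
  have "\<bar>real (Qp n * p) - real (N n)\<bar> \<le> real (k n) + real (p + 1)" for n
  proof -
    have "Qp n * p \<le> N n + k n + p" using div(1)[of "N n + k n"] by (simp add: Qp_def mult.commute)
    then show ?thesis using Qp[of n] by linarith
  qed
  from lim[OF this] show "filterlim Qp at_top sequentially" "(\<lambda>n. real (Qp n * p) / real (N n)) \<longlonglongrightarrow> 1" by auto
  have "\<bar>real (Qm n * p) - real (N n)\<bar> \<le> real (k n) + real (p + 1)" for n
  proof -
    have "N n + 1 - k n < Qm n * p + p" using div(2)[of "N n + 1 - k n"] by (simp add: Qm_def mult.commute)
    then have "N n + 1 < Qm n * p + p + k n" by linarith
    then show ?thesis using Qm[of n] by linarith
  qed
  from lim[OF this] show "filterlim Qm at_top sequentially" "(\<lambda>n. real (Qm n * p) / real (N n)) \<longlonglongrightarrow> 1" by auto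
qed

text \<open>One setting for all three cases: \<gamma> is the scale of the points, \<beta> the order
  of growth of the kernel and L its limit, given only along multiples of p. The constant c is the
  local density of \<open>Ms\<close> with respect to M, and \<open>\<omega> \<delta>\<close> bounds
  the deviation from it within distance \<delta>. The added mass \<open>M0\<close> keeps distance
  \<delta>0 from \<open>cis \<theta>\<close> and lives where the kernel of M grows at most
  cubically.\<close>

locale localization =
  fixes M Ms M0 :: "complex measure" and v :: "complex \<Rightarrow> real" and \<omega> :: "real \<Rightarrow> real"
    and \<theta> c m0 Mx \<delta>0 B :: real and p \<gamma> \<beta> :: nat and L :: "complex \<Rightarrow> complex \<Rightarrow> complex"
  assumes M: "nontrivial_measure M" and Ms: "nontrivial_measure Ms" and M0: "circle_measure M0"
    and v: "v \<in> borel_measurable borel"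
    and v_bounds: "AE z in M. m0 \<le> v z \<and> v z \<le> Mx" and m0: "0 < m0" and Mx: "0 \<le> Mx"
    and v_near: "\<And>\<delta>. \<delta> > 0 \<Longrightarrow> AE z in M. cmod (z - cis \<theta>) \<le> \<delta> \<longrightarrow> \<bar>v z - c\<bar> \<le> \<omega> \<delta>"
    and \<omega>: "(\<omega> \<longlongrightarrow> 0) (at_right 0)" and m0_le: "m0 \<le> c"
    and sqnorm_Ms: "\<And>P. sqnorm_M Ms P = (LINT z|M. v z * (cmod (poly P z))\<^sup>2) + sqnorm_M M0 P"
    and far: "AE z in M0. \<delta>0 \<le> cmod (z - cis \<theta>) \<and> (\<forall>n. Re (CD_kernel n z z M) \<le> B * (real n + 1) ^ 3)"
    and \<delta>0: "0 < \<delta>0" "\<delta>0 \<le> 2" and B: "0 \<le> B"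
    and p: "0 < p" and \<gamma>: "1 \<le> \<gamma>"
    and H: "\<And>Q a b a' b'. filterlim Q at_top sequentially \<Longrightarrow> a \<longlonglongrightarrow> a' \<Longrightarrow> b \<longlonglongrightarrow> b' \<Longrightarrow>
      (\<lambda>n. CD_kernel (Q n * p - 1) (pt \<theta> \<gamma> (Q n * p) (a n)) (pt \<theta> \<gamma> (Q n * p) (b n)) M / of_nat (Q n * p) ^ \<beta>)
        \<longlonglongrightarrow> L a' b'"
begin

lemma c: "0 < c" using m0 m0_le by simp

lemma C: "circle_measure M" "circle_measure Ms" using M Ms by (auto simp: nontrivial_measure_def)

lemma integrable_v: "integrable M (\<lambda>z. v z * (cmod (poly P z))\<^sup>2)"
proof (rule Bochner_Integration.integrable_bound)
  show "integrable M (\<lambda>z. Mx * (cmod (poly P z))\<^sup>2)"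
    by (intro circle_integrable[OF C(1)] continuous_intros)
  have "v \<in> borel_measurable M" using v by (simp add: circle_measurable[OF C(1)])
  moreover have "(\<lambda>z. (cmod (poly P z))\<^sup>2) \<in> borel_measurable M"
    by (rule borel_measurable_integrable) (intro circle_integrable[OF C(1)] continuous_intros)
  ultimately show "(\<lambda>z. v z * (cmod (poly P z))\<^sup>2) \<in> borel_measurable M" by simp
  show "AE z in M. norm (v z * (cmod (poly P z))\<^sup>2) \<le> norm (Mx * (cmod (poly P z))\<^sup>2)"
    using v_bounds by eventually_elim (use m0 in \<open>auto simp: abs_mult intro!: mult_right_mono\<close>)
qed

text \<open>Within distance \<delta> the density is at least c - \<omega> \<delta>; farther away the
  density is at least \<open>m0\<close> while the localizing factor is at most (1 - \<delta>^2/4)^k.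
  The maximum with \<open>m0\<close> keeps the denominator positive when \<omega> \<delta> is not
  small.\<close>

lemma sqnorm_loc_le:
  assumes \<delta>: "0 < \<delta>" "\<delta> \<le> 2"
  shows "sqnorm_M M (P * loc_poly \<theta> k) \<le> (1 / max m0 (c - \<omega> \<delta>) + (1 - \<delta>\<^sup>2 / 4) ^ k / m0) * sqnorm_M Ms P"
proof -
  let ?A = "1 / max m0 (c - \<omega> \<delta>) + (1 - \<delta>\<^sup>2 / 4) ^ k / m0"
  have "\<delta>\<^sup>2 \<le> 2\<^sup>2" using \<delta> by (intro power_mono) auto
  then have r: "0 \<le> 1 - \<delta>\<^sup>2 / 4" by simp
  have A: "0 \<le> ?A" using r m0 by (intro add_nonneg_nonneg divide_nonneg_pos) auto
  have "sqnorm_M M (P * loc_poly \<theta> k) \<le> (LINT z|M. ?A * (v z * (cmod (poly P z))\<^sup>2))"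
    unfolding sqnorm_M_def
  proof (rule integral_mono_AE)
    show "integrable M (\<lambda>z. (cmod (poly (P * loc_poly \<theta> k) z))\<^sup>2)"
      by (intro circle_integrable[OF C(1)] continuous_intros)
    show "integrable M (\<lambda>z. ?A * (v z * (cmod (poly P z))\<^sup>2))" by (intro integrable_mult_right integrable_v)
    show "AE z in M. (cmod (poly (P * loc_poly \<theta> k) z))\<^sup>2 \<le> ?A * (v z * (cmod (poly P z))\<^sup>2)"
      using AE_circle_norm[OF C(1)] v_bounds v_near[OF \<delta>(1)]
    proof eventually_elim
      case (elim z)
      let ?s = "(cmod (poly (loc_poly \<theta> k) z))\<^sup>2"
      have s: "?s = (1 - (cmod (z - cis \<theta>))\<^sup>2 / 4) ^ k" using elim by (simp add: norm_loc_poly)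
      have "cmod (z - cis \<theta>) \<le> 2" using norm_triangle_ineq4[of z "cis \<theta>"] elim by simp
      then have "(cmod (z - cis \<theta>))\<^sup>2 \<le> 2\<^sup>2" by (intro power_mono) auto
      then have z: "0 \<le> 1 - (cmod (z - cis \<theta>))\<^sup>2 / 4" by simp
      have "?s \<le> ?A * v z"
      proof (cases "cmod (z - cis \<theta>) \<le> \<delta>")
        case True
        then have "max m0 (c - \<omega> \<delta>) \<le> v z" using elim by auto
        then have "1 \<le> 1 / max m0 (c - \<omega> \<delta>) * v z" using m0 by (simp add: field_simps)
        moreover have "?s \<le> 1" unfolding s using z by (intro power_le_one) auto
        moreover have "0 \<le> (1 - \<delta>\<^sup>2 / 4) ^ k / m0 * v z" using r m0 elim by (intro mult_nonneg_nonneg) auto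
        ultimately show ?thesis unfolding distrib_right by linarith
      next
        case False
        then have "\<delta>\<^sup>2 \<le> (cmod (z - cis \<theta>))\<^sup>2" using \<delta> by (intro power_mono) auto
        then have "?s \<le> (1 - \<delta>\<^sup>2 / 4) ^ k" unfolding s using z by (intro power_mono) auto
        also have "\<dots> \<le> (1 - \<delta>\<^sup>2 / 4) ^ k * (v z / m0)" using m0 elim r mult_left_mono[of 1 "v z / m0" "(1 - \<delta>\<^sup>2 / 4) ^ k"] by simp
        finally have "?s \<le> (1 - \<delta>\<^sup>2 / 4) ^ k / m0 * v z" by simp
        moreover have "0 \<le> 1 / max m0 (c - \<omega> \<delta>) * v z" using m0 elim by (intro mult_nonneg_nonneg) auto
        ultimately show ?thesis unfolding distrib_right by linarith
      qed
      from mult_right_mono[OF this, of "(cmod (poly P z))\<^sup>2"] show ?case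
        by (simp add: norm_mult power_mult_distrib mult_ac)
    qed
  qed
  also have "\<dots> = ?A * (LINT z|M. v z * (cmod (poly P z))\<^sup>2)" by simp
  also have "\<dots> \<le> ?A * sqnorm_M Ms P"
    unfolding sqnorm_Ms using A sqnorm_M_nonneg[of M0 P] by (intro mult_left_mono) auto
  finally show ?thesis .
qed

text \<open>The opposite comparison also has to pay for \<open>M0\<close>, which need not be
  dominated by M. There the kernel is bounded pointwise by |K(z,x)|^2 \<le> K(z,z) K(x,x), with
  K(z,z) at most cubic, and the localizing factor at distance \<delta>0 makes the contribution
  small.\<close>

lemma sqnorm_Ms_loc_CD_le:
  assumes \<delta>: "0 < \<delta>" "\<delta> \<le> 2"
  shows "sqnorm_M Ms (CD_poly m x M * loc_poly \<theta> k) \<le> Re (CD_kernel m x x M) *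
    (c + \<bar>\<omega> \<delta>\<bar> + Mx * (1 - \<delta>\<^sup>2 / 4) ^ k + B * (real m + 1) ^ 3 * (1 - \<delta>0\<^sup>2 / 4) ^ k * measure M0 (space M0))"
proof -
  define P where "P = CD_poly m x M"
  let ?K = "Re (CD_kernel m x x M)"
  let ?A = "c + \<bar>\<omega> \<delta>\<bar> + Mx * (1 - \<delta>\<^sup>2 / 4) ^ k"
  let ?D = "?K * (B * (real m + 1) ^ 3 * (1 - \<delta>0\<^sup>2 / 4) ^ k)"
  have "\<delta>\<^sup>2 \<le> 2\<^sup>2" "\<delta>0\<^sup>2 \<le> 2\<^sup>2" using power_mono[of \<delta> 2 2] power_mono[of \<delta>0 2 2] \<delta> \<delta>0 by auto
  then have r: "0 \<le> 1 - \<delta>\<^sup>2 / 4" "0 \<le> 1 - \<delta>0\<^sup>2 / 4" by auto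
  have "(LINT z|M. v z * (cmod (poly (P * loc_poly \<theta> k) z))\<^sup>2) \<le> (LINT z|M. ?A * (cmod (poly P z))\<^sup>2)"
  proof (rule integral_mono_AE)
    show "integrable M (\<lambda>z. ?A * (cmod (poly P z))\<^sup>2)"
      by (intro circle_integrable[OF C(1)] continuous_intros)
    show "integrable M (\<lambda>z. v z * (cmod (poly (P * loc_poly \<theta> k) z))\<^sup>2)" by (rule integrable_v)
    show "AE z in M. v z * (cmod (poly (P * loc_poly \<theta> k) z))\<^sup>2 \<le> ?A * (cmod (poly P z))\<^sup>2"
      using AE_circle_norm[OF C(1)] v_bounds v_near[OF \<delta>(1)]
    proof eventually_elim
      case (elim z)
      let ?s = "(cmod (poly (loc_poly \<theta> k) z))\<^sup>2"
      have s: "?s = (1 - (cmod (z - cis \<theta>))\<^sup>2 / 4) ^ k" using elim by (simp add: norm_loc_poly)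
      have "cmod (z - cis \<theta>) \<le> 2" using norm_triangle_ineq4[of z "cis \<theta>"] elim by simp
      then have "(cmod (z - cis \<theta>))\<^sup>2 \<le> 2\<^sup>2" by (intro power_mono) auto
      then have z: "0 \<le> 1 - (cmod (z - cis \<theta>))\<^sup>2 / 4" by simp
      have v0: "0 \<le> v z" using elim m0 by simp
      have "v z * ?s \<le> ?A"
      proof (cases "cmod (z - cis \<theta>) \<le> \<delta>")
        case True
        have "?s \<le> 1" unfolding s using z by (intro power_le_one) auto
        then have "v z * ?s \<le> v z" using v0 by (simp add: mult_left_le)
        also have "v z \<le> c + \<bar>\<omega> \<delta>\<bar>" using True elim by auto
        also have "\<dots> \<le> ?A" using Mx r by simp
        finally show ?thesis .
      next
        case False
        then have "\<delta>\<^sup>2 \<le> (cmod (z - cis \<theta>))\<^sup>2" using \<delta> by (intro power_mono) auto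
        then have "?s \<le> (1 - \<delta>\<^sup>2 / 4) ^ k" unfolding s using z by (intro power_mono) auto
        then have "v z * ?s \<le> Mx * (1 - \<delta>\<^sup>2 / 4) ^ k" using elim v0 Mx by (intro mult_mono) auto
        then show ?thesis using c by linarith
      qed
      from mult_right_mono[OF this, of "(cmod (poly P z))\<^sup>2"] show ?case
        by (simp add: norm_mult power_mult_distrib mult_ac)
    qed
  qed
  also have "\<dots> = ?A * ?K" using sqnorm_CD_poly[OF M, of m x] by (simp add: P_def sqnorm_M_def)
  finally have 1: "(LINT z|M. v z * (cmod (poly (P * loc_poly \<theta> k) z))\<^sup>2) \<le> ?A * ?K" .
  have "sqnorm_M M0 (P * loc_poly \<theta> k) \<le> (LINT z|M0. ?D)"
    unfolding sqnorm_M_def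
  proof (rule integral_mono_AE)
    show "integrable M0 (\<lambda>z. (cmod (poly (P * loc_poly \<theta> k) z))\<^sup>2)"
      by (intro circle_integrable[OF M0] continuous_intros)
    show "integrable M0 (\<lambda>z. ?D)" by (intro circle_integrable[OF M0] continuous_intros)
    show "AE z in M0. (cmod (poly (P * loc_poly \<theta> k) z))\<^sup>2 \<le> ?D"
      using AE_circle_norm[OF M0] far
    proof eventually_elim
      case (elim z)
      let ?s = "(cmod (poly (loc_poly \<theta> k) z))\<^sup>2"
      have s: "?s = (1 - (cmod (z - cis \<theta>))\<^sup>2 / 4) ^ k" using elim by (simp add: norm_loc_poly)
      have "cmod (z - cis \<theta>) \<le> 2" using norm_triangle_ineq4[of z "cis \<theta>"] elim by simp
      then have "(cmod (z - cis \<theta>))\<^sup>2 \<le> 2\<^sup>2" by (intro power_mono) auto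
      then have z: "0 \<le> 1 - (cmod (z - cis \<theta>))\<^sup>2 / 4" by simp
      have "\<delta>0\<^sup>2 \<le> (cmod (z - cis \<theta>))\<^sup>2" using \<delta>0 elim by (intro power_mono) auto
      then have 1: "?s \<le> (1 - \<delta>0\<^sup>2 / 4) ^ k" unfolding s using z by (intro power_mono) auto
      have "(cmod (poly P z))\<^sup>2 \<le> Re (CD_kernel m z z M) * ?K"
        using poly_le_CD_kernel[OF M degree_CD_poly[OF M], of m x z] sqnorm_CD_poly[OF M] by (simp add: P_def)
      also have "\<dots> \<le> B * (real m + 1) ^ 3 * ?K"
        using elim CD_kernel_diag_nonneg by (intro mult_right_mono) auto
      finally have "(cmod (poly P z))\<^sup>2 * ?s \<le> B * (real m + 1) ^ 3 * ?K * (1 - \<delta>0\<^sup>2 / 4) ^ k"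
        using 1 B CD_kernel_diag_nonneg by (intro mult_mono) auto
      then show ?case by (simp add: norm_mult power_mult_distrib mult_ac)
    qed
  qed
  also have "\<dots> = ?D * measure M0 (space M0)" by simp
  finally have 2: "sqnorm_M M0 (P * loc_poly \<theta> k) \<le> ?D * measure M0 (space M0)" .
  show ?thesis unfolding P_def[symmetric] sqnorm_Ms using 1 2 by (simp add: algebra_simps)
qed

text \<open>Points scaled by N are points scaled by Q p whose argument is multiplied by (Q p /
  N)^\<gamma>, a factor tending to 1. Convergence for moving arguments in H absorbs it.\<close>

lemma H_scaled:
  assumes N: "filterlim N at_top sequentially" and Q: "filterlim Q at_top sequentially"
    and ratio: "(\<lambda>n. real (Q n * p) / real (N n)) \<longlonglongrightarrow> 1"
    and a: "a \<longlonglongrightarrow> a'" and b: "b \<longlonglongrightarrow> b'"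
  shows "(\<lambda>n. CD_kernel (Q n * p - 1) (pt \<theta> \<gamma> (N n) (a n)) (pt \<theta> \<gamma> (N n) (b n)) M / of_nat (N n) ^ \<beta>) \<longlonglongrightarrow> L a' b'"
proof -
  define \<rho> where "\<rho> n = complex_of_real (real (Q n * p) / real (N n))" for n
  have \<rho>: "\<rho> \<longlonglongrightarrow> 1" unfolding \<rho>_def using tendsto_of_real[OF ratio, where 'a=complex] by simp
  have a2: "(\<lambda>n. a n * \<rho> n ^ \<gamma>) \<longlonglongrightarrow> a'" "(\<lambda>n. b n * \<rho> n ^ \<gamma>) \<longlonglongrightarrow> b'"
    using tendsto_mult[OF a tendsto_power[OF \<rho>]] tendsto_mult[OF b tendsto_power[OF \<rho>]] by simp_all
  have "(\<lambda>n. CD_kernel (Q n * p - 1) (pt \<theta> \<gamma> (Q n * p) (a n * \<rho> n ^ \<gamma>)) (pt \<theta> \<gamma> (Q n * p) (b n * \<rho> n ^ \<gamma>)) M / of_nat (Q n * p) ^ \<beta> * \<rho> n ^ \<beta>)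
     \<longlonglongrightarrow> L a' b' * 1 ^ \<beta>"
    by (intro tendsto_mult H Q a2 tendsto_power \<rho>)
  moreover have "\<forall>\<^sub>F n in sequentially.
     CD_kernel (Q n * p - 1) (pt \<theta> \<gamma> (Q n * p) (a n * \<rho> n ^ \<gamma>)) (pt \<theta> \<gamma> (Q n * p) (b n * \<rho> n ^ \<gamma>)) M / of_nat (Q n * p) ^ \<beta> * \<rho> n ^ \<beta>
     = CD_kernel (Q n * p - 1) (pt \<theta> \<gamma> (N n) (a n)) (pt \<theta> \<gamma> (N n) (b n)) M / of_nat (N n) ^ \<beta>"
  proof -
    have "\<forall>\<^sub>F n in sequentially. N n \<ge> 1" "\<forall>\<^sub>F n in sequentially. Q n \<ge> 1"
      using N Q by (simp_all add: filterlim_at_top)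
    then show ?thesis
    proof eventually_elim
      case (elim n)
      define x y where "x = complex_of_nat (Q n * p)" and "y = complex_of_nat (N n)"
      have nz: "x \<noteq> 0" "y \<noteq> 0" using elim p by (auto simp: x_def y_def)
      have \<rho>n: "\<rho> n = x / y" by (simp add: \<rho>_def x_def y_def)
      have "pt \<theta> \<gamma> (Q n * p) (t * \<rho> n ^ \<gamma>) = pt \<theta> \<gamma> (N n) t" for t
        unfolding pt_def x_def[symmetric] y_def[symmetric] \<rho>n using nz by (simp add: power_divide)
      then show ?case
        unfolding x_def[symmetric] y_def[symmetric] \<rho>n using nz by (simp add: power_divide)
    qed
  qed
  ultimately show ?thesis by (simp add: tendsto_cong)
qed

text \<open>\<open>lo\<close> and \<open>hi\<close> bound the cost of passing from \<open>Ms\<close>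
  to M and back. For \<delta> = N^(-1/8) they tend to 1/c and c, so the comparison is asymptotically
  sharp.\<close>

definition "lo \<delta> k = 1 / max m0 (c - \<omega> \<delta>) + (1 - \<delta>\<^sup>2 / 4) ^ k / m0"

definition "hi \<delta> k n = c + \<bar>\<omega> \<delta>\<bar> + Mx * (1 - \<delta>\<^sup>2 / 4) ^ k
  + B * ((real n + 1) ^ 3 * (1 - \<delta>0\<^sup>2 / 4) ^ k) * measure M0 (space M0)"

lemma lo_hi_tendsto:
  assumes N: "filterlim N at_top sequentially" and k: "\<And>n. sqrt (real (N n)) - 1 \<le> real (k n)"
  shows "(\<lambda>n. lo (real (N n) powr (-1/8)) (k n)) \<longlonglongrightarrow> 1 / c" "(\<lambda>n. hi (real (N n) powr (-1/8)) (k n) (N n)) \<longlonglongrightarrow> c"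
    "\<forall>\<^sub>F n in sequentially. 0 < real (N n) powr (-1/8) \<and> real (N n) powr (-1/8) \<le> 2"
proof -
  define \<delta> where "\<delta> n = real (N n) powr (-1/8)" for n
  have rN: "filterlim (\<lambda>n. real (N n)) at_top sequentially"
    using filterlim_compose[OF filterlim_real_sequentially N] .
  have far0: "(\<lambda>n. (1 - (\<delta> n)\<^sup>2 / 4) ^ k n) \<longlonglongrightarrow> 0" "(\<lambda>n. (real (N n) + 1) ^ 3 * (1 - \<delta>0\<^sup>2 / 4) ^ k n) \<longlonglongrightarrow> 0"
    using far_decay_tendsto[OF N k] \<delta>0 unfolding \<delta>_def by auto
  have "((\<lambda>x::real. x powr (-1/8)) \<longlongrightarrow> 0) at_top" by real_asymp
  from filterlim_compose[OF this rN] have d0: "\<delta> \<longlonglongrightarrow> 0" by (simp add: \<delta>_def[abs_def])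
  have "\<forall>\<^sub>F n in sequentially. N n \<ge> 1" using N by (simp add: filterlim_at_top)
  then have dpos: "\<forall>\<^sub>F n in sequentially. 0 < \<delta> n" by eventually_elim (auto simp: \<delta>_def)
  then show "\<forall>\<^sub>F n in sequentially. 0 < real (N n) powr (-1/8) \<and> real (N n) powr (-1/8) \<le> 2"
    using order_tendstoD(2)[OF d0, of 2] unfolding \<delta>_def by (auto elim: eventually_elim2)
  have "filterlim \<delta> (at_right 0) sequentially"
    unfolding filterlim_at using d0 dpos by (auto elim: eventually_mono)
  from filterlim_compose[OF \<omega> this] have \<omega>0: "(\<lambda>n. \<omega> (\<delta> n)) \<longlonglongrightarrow> 0" .
  have "(\<lambda>n. 1 / max m0 (c - \<omega> (\<delta> n)) + (1 - (\<delta> n)\<^sup>2 / 4) ^ k n / m0) \<longlonglongrightarrow> 1 / max m0 (c - 0) + 0 / m0"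
    using m0 by (intro tendsto_intros \<omega>0 far0) auto
  then show "(\<lambda>n. lo (real (N n) powr (-1/8)) (k n)) \<longlonglongrightarrow> 1 / c"
    using m0_le by (simp add: lo_def \<delta>_def max_absorb2)
  have "(\<lambda>n. c + \<bar>\<omega> (\<delta> n)\<bar> + Mx * (1 - (\<delta> n)\<^sup>2 / 4) ^ k n + B * ((real (N n) + 1) ^ 3 * (1 - \<delta>0\<^sup>2 / 4) ^ k n) * measure M0 (space M0))
    \<longlonglongrightarrow> c + \<bar>0\<bar> + Mx * 0 + B * 0 * measure M0 (space M0)"
    by (intro tendsto_intros \<omega>0 far0)
  then show "(\<lambda>n. hi (real (N n) powr (-1/8)) (k n) (N n)) \<longlonglongrightarrow> c" by (simp add: hi_def \<delta>_def)
qed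

lemma degree_CD_poly_loc:
  "nontrivial_measure K \<Longrightarrow> degree (CD_poly n z K * loc_poly \<theta> k) \<le> n + k"
  using degree_mult_le[of "CD_poly n z K" "loc_poly \<theta> k"] degree_CD_poly[of K n z] degree_loc_poly[of \<theta> k]
  by (meson add_mono order_trans)

text \<open>The kernel polynomial of \<open>Ms\<close>, multiplied by the localizing factor, is
  inserted into the extremal property of M.\<close>

lemma CD_kernel_Ms_diag_le:
  assumes deg: "n + k \<le> m" and \<delta>: "0 < \<delta>" "\<delta> \<le> 2"
  shows "Re (CD_kernel n z z Ms) * (cmod (poly (loc_poly \<theta> k) z))\<^sup>2 \<le> Re (CD_kernel m z z M) * lo \<delta> k"
proof -
  define P r where "P = CD_poly n z Ms" and "r = Re (CD_kernel n z z Ms)"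
  have Kr: "CD_kernel n z z Ms = of_real r" unfolding r_def by (simp add: CD_kernel_diag)
  have r: "r \<ge> 0" unfolding r_def by (rule CD_kernel_diag_nonneg)
  have "(r * cmod (poly (loc_poly \<theta> k) z))\<^sup>2 = (cmod (poly (P * loc_poly \<theta> k) z))\<^sup>2"
    using r Kr by (simp add: P_def poly_CD_poly norm_mult)
  also have "\<dots> \<le> Re (CD_kernel m z z M) * sqnorm_M M (P * loc_poly \<theta> k)"
    unfolding P_def by (rule poly_le_CD_kernel[OF M order_trans[OF degree_CD_poly_loc[OF Ms] deg]])
  also have "\<dots> \<le> Re (CD_kernel m z z M) * (lo \<delta> k * sqnorm_M Ms P)"
    using sqnorm_loc_le[OF \<delta>] CD_kernel_diag_nonneg unfolding lo_def by (intro mult_left_mono) auto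
  also have "sqnorm_M Ms P = r" unfolding P_def r_def by (rule sqnorm_CD_poly[OF Ms])
  finally have main: "r * (r * (cmod (poly (loc_poly \<theta> k) z))\<^sup>2) \<le> r * (Re (CD_kernel m z z M) * lo \<delta> k)"
    by (simp add: power2_eq_square mult_ac)
  have "0 \<le> lo \<delta> k"
    using power_mono[of \<delta> 2 2] \<delta> m0 unfolding lo_def by (intro add_nonneg_nonneg divide_nonneg_pos) auto
  \<comment> \<open>Both sides of \<open>main\<close> carry a factor r that can be cancelled only if
    it is positive; for r = 0 the claim reduces to nonnegativity of the right-hand side.\<close>
  then have "r = 0 \<Longrightarrow> r * (cmod (poly (loc_poly \<theta> k) z))\<^sup>2 \<le> Re (CD_kernel m z z M) * lo \<delta> k"
    using CD_kernel_diag_nonneg by simp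
  moreover have "r > 0 \<Longrightarrow> r * (cmod (poly (loc_poly \<theta> k) z))\<^sup>2 \<le> Re (CD_kernel m z z M) * lo \<delta> k"
    using main by (rule mult_left_le_imp_le)
  ultimately show ?thesis using r unfolding r_def by fastforce
qed

text \<open>Here the localized kernel of M at the smaller degree m serves as the candidate G in
  \<open>CD_kernel_perturbation\<close> for \<open>Ms\<close>.\<close>

lemma CD_kernel_Ms_near:
  assumes deg: "m + k \<le> n" and \<delta>: "0 < \<delta>" "\<delta> \<le> 2"
  shows "(cmod (CD_kernel n z u Ms - CD_kernel m z u M * poly (loc_poly \<theta> k) z / of_real c))\<^sup>2 \<le>
    Re (CD_kernel n z z Ms) * (Re (CD_kernel n u u Ms) - 2 / c * Re (CD_kernel m u u M * poly (loc_poly \<theta> k) u)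
      + Re (CD_kernel m u u M) * hi \<delta> k n / c\<^sup>2)"
proof -
  define G where "G = CD_poly m u M * loc_poly \<theta> k"
  have "sqnorm_M Ms G \<le> Re (CD_kernel m u u M) * (c + \<bar>\<omega> \<delta>\<bar> + Mx * (1 - \<delta>\<^sup>2 / 4) ^ k +
     B * (real m + 1) ^ 3 * (1 - \<delta>0\<^sup>2 / 4) ^ k * measure M0 (space M0))"
    unfolding G_def by (rule sqnorm_Ms_loc_CD_le[OF \<delta>])
  also have "\<dots> \<le> Re (CD_kernel m u u M) * hi \<delta> k n"
  proof (rule mult_left_mono)
    have "(real m + 1) ^ 3 \<le> (real n + 1) ^ 3" using deg by (intro power_mono) auto
    moreover have "0 \<le> (1 - \<delta>0\<^sup>2 / 4) ^ k" using power_mono[of \<delta>0 2 2] \<delta>0 by simp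
    ultimately have "B * ((real m + 1) ^ 3 * (1 - \<delta>0\<^sup>2 / 4) ^ k) * measure M0 (space M0)
       \<le> B * ((real n + 1) ^ 3 * (1 - \<delta>0\<^sup>2 / 4) ^ k) * measure M0 (space M0)"
      using B by (intro mult_right_mono mult_left_mono) auto
    then show "c + \<bar>\<omega> \<delta>\<bar> + Mx * (1 - \<delta>\<^sup>2 / 4) ^ k +
     B * (real m + 1) ^ 3 * (1 - \<delta>0\<^sup>2 / 4) ^ k * measure M0 (space M0) \<le> hi \<delta> k n"
      by (simp add: hi_def mult.assoc)
  qed (rule CD_kernel_diag_nonneg)
  finally have "sqnorm_M Ms G / c\<^sup>2 \<le> Re (CD_kernel m u u M) * hi \<delta> k n / c\<^sup>2" by (rule divide_right_mono) simp
  moreover have "(cmod (CD_kernel n z u Ms - CD_kernel m z u M * poly (loc_poly \<theta> k) z / of_real c))\<^sup>2 \<le>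
    Re (CD_kernel n z z Ms) * (Re (CD_kernel n u u Ms) - 2 / c * Re (CD_kernel m u u M * poly (loc_poly \<theta> k) u) + sqnorm_M Ms G / c\<^sup>2)"
    using CD_kernel_perturbation[OF Ms, of G n c z u] order_trans[OF degree_CD_poly_loc[OF M] deg] c
    by (simp add: G_def poly_CD_poly)
  ultimately show ?thesis
    using mult_left_mono[OF _ CD_kernel_diag_nonneg[of n z Ms]] by (smt (verit))
qed

text \<open>U bounds the diagonal for \<open>Ms\<close> through the kernel of M at a degree above N.
  At a degree below N the localized kernel of M, divided by c, approximates the kernel of
  \<open>Ms\<close> with squared error at most |U| |d|, and d tends to 0 because U is asymptotically
  sharp.\<close>

lemma CD_kernel_Ms_tendsto:
  assumes N: "filterlim N at_top sequentially" and a: "a \<longlonglongrightarrow> a'" and b: "b \<longlonglongrightarrow> b'"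
  shows "(\<lambda>n. CD_kernel (N n) (pt \<theta> \<gamma> (N n) (a n)) (pt \<theta> \<gamma> (N n) (b n)) Ms / of_nat (N n) ^ \<beta>) \<longlonglongrightarrow> L a' b' / of_real c"
proof -
  obtain k Qp Qm where k: "\<And>n. sqrt (real (N n)) - 1 \<le> real (k n)" "(\<lambda>n. real (k n) / real (N n)) \<longlonglongrightarrow> 0"
    and Qp: "\<And>n. N n + k n < Qp n * p" "filterlim Qp at_top sequentially" "(\<lambda>n. real (Qp n * p) / real (N n)) \<longlonglongrightarrow> 1"
    and Qm: "\<And>n. Qm n * p + k n \<le> N n + 1" "filterlim Qm at_top sequentially" "(\<lambda>n. real (Qm n * p) / real (N n)) \<longlonglongrightarrow> 1"
    by (rule block_approximation[OF N p]; rule that)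
  define \<delta> \<kappa> where "\<delta> n = real (N n) powr (-1/8)" and "\<kappa> n = real (N n) ^ \<beta>" for n
  define K where "K n x y = CD_kernel (N n) (pt \<theta> \<gamma> (N n) x) (pt \<theta> \<gamma> (N n) y) Ms" for n x y
  define S where "S n x = poly (loc_poly \<theta> (k n)) (pt \<theta> \<gamma> (N n) x)" for n x
  define Kp where "Kp n x y = CD_kernel (Qp n * p - 1) (pt \<theta> \<gamma> (N n) x) (pt \<theta> \<gamma> (N n) y) M" for n x y
  define Km where "Km n x y = CD_kernel (Qm n * p - 1) (pt \<theta> \<gamma> (N n) x) (pt \<theta> \<gamma> (N n) y) M" for n x y
  have "\<forall>\<^sub>F n in sequentially. N n \<ge> 1" using N by (simp add: filterlim_at_top)
  then have \<kappa>: "\<forall>\<^sub>F n in sequentially. \<kappa> n > 0" by eventually_elim (simp add: \<kappa>_def)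
  have lo: "(\<lambda>n. lo (\<delta> n) (k n)) \<longlonglongrightarrow> 1 / c" and hi: "(\<lambda>n. hi (\<delta> n) (k n) (N n)) \<longlonglongrightarrow> c"
    and \<delta>: "\<forall>\<^sub>F n in sequentially. 0 < \<delta> n \<and> \<delta> n \<le> 2"
    using lo_hi_tendsto[OF N k(1)] by (simp_all add: \<delta>_def)
  have Kp_lim: "(\<lambda>n. Kp n (x n) (y n) / of_real (\<kappa> n)) \<longlonglongrightarrow> L x' y'" if "x \<longlonglongrightarrow> x'" "y \<longlonglongrightarrow> y'" for x y x' y'
    using H_scaled[OF N Qp(2,3) that] by (simp add: Kp_def \<kappa>_def)
  have Km_lim: "(\<lambda>n. Km n (x n) (y n) / of_real (\<kappa> n)) \<longlonglongrightarrow> L x' y'" if "x \<longlonglongrightarrow> x'" "y \<longlonglongrightarrow> y'" for x y x' y'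
    using H_scaled[OF N Qm(2,3) that] by (simp add: Km_def \<kappa>_def)
  have S_lim: "(\<lambda>n. S n (x n)) \<longlonglongrightarrow> 1" if "x \<longlonglongrightarrow> x'" for x x'
    using loc_poly_tendsto_one[OF N that \<gamma> k(2)] by (simp add: S_def)
  define U where "U x n = Re (Kp n (x n) (x n) / of_real (\<kappa> n)) * lo (\<delta> n) (k n) / (cmod (S n (x n)))\<^sup>2" for x n
  have U_lim: "U x \<longlonglongrightarrow> Re (L x' x') * (1 / c) / (cmod 1)\<^sup>2" if x: "x \<longlonglongrightarrow> x'" for x x'
    unfolding U_def[abs_def] by (intro tendsto_intros Kp_lim[OF x x] lo S_lim[OF x]) auto
  have K_le_U: "\<forall>\<^sub>F n in sequentially. Re (K n (x n) (x n)) / \<kappa> n \<le> U x n" if x: "x \<longlonglongrightarrow> x'" for x x'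
  proof -
    have "\<forall>\<^sub>F n in sequentially. cmod (S n (x n)) > 0"
      using order_tendstoD(1)[OF tendsto_norm[OF S_lim[OF x]], of 0] by simp
    then show ?thesis using \<delta> \<kappa>
    proof eventually_elim
      case (elim n)
      have "N n + k n \<le> Qp n * p - 1" using Qp(1)[of n] by linarith
      then have "Re (K n (x n) (x n)) * (cmod (S n (x n)))\<^sup>2 \<le> Re (Kp n (x n) (x n)) * lo (\<delta> n) (k n)"
        unfolding K_def S_def Kp_def using elim by (intro CD_kernel_Ms_diag_le) auto
      then show ?case using elim by (simp add: U_def field_simps)
    qed
  qed
  define d where "d n = U b n - 2 / c * Re (Km n (b n) (b n) / of_real (\<kappa> n) * S n (b n)) + Re (Km n (b n) (b n) / of_real (\<kappa> n)) * hi (\<delta> n) (k n) (N n) / c\<^sup>2" for n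
  have "d \<longlonglongrightarrow> Re (L b' b') * (1 / c) / (cmod 1)\<^sup>2 - 2 / c * Re (L b' b' * 1) + Re (L b' b') * c / c\<^sup>2"
    unfolding d_def[abs_def] using c by (intro tendsto_intros U_lim[OF b] Km_lim[OF b b] S_lim[OF b] hi) auto
  \<comment> \<open>The three terms tend to L/c, -2L/c and L/c: after normalization, candidate and
    kernel coincide in the limit.\<close>
  moreover have "Re (L b' b') * (1 / c) / (cmod 1)\<^sup>2 - 2 / c * Re (L b' b' * 1) + Re (L b' b') * c / c\<^sup>2 = 0"
    using c by (simp add: power2_eq_square field_simps)
  ultimately have d_lim: "d \<longlonglongrightarrow> 0" by (simp only:)
  define err where "err n = (K n (a n) (b n) - Km n (a n) (b n) * S n (a n) / of_real c) / of_real (\<kappa> n)" for n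
  have "\<forall>\<^sub>F n in sequentially. Qm n \<ge> 1" using Qm(2) by (simp add: filterlim_at_top)
  then have ev: "\<forall>\<^sub>F n in sequentially. (cmod (err n))\<^sup>2 \<le> \<bar>U a n\<bar> * \<bar>d n\<bar>"
    using K_le_U[OF a] K_le_U[OF b] \<delta> \<kappa>
  proof eventually_elim
    case (elim n)
    have "Qm n * p \<ge> 1" using elim p by (simp add: Suc_le_eq)
    then have deg: "Qm n * p - 1 + k n \<le> N n" using Qm(1)[of n] by linarith
    let ?D = "Re (K n (b n) (b n)) - 2 / c * Re (Km n (b n) (b n) * S n (b n)) + Re (Km n (b n) (b n)) * hi (\<delta> n) (k n) (N n) / c\<^sup>2"
    have "?D / \<kappa> n = Re (K n (b n) (b n)) / \<kappa> n - 2 / c * Re (Km n (b n) (b n) / of_real (\<kappa> n) * S n (b n)) + Re (Km n (b n) (b n) / of_real (\<kappa> n)) * hi (\<delta> n) (k n) (N n) / c\<^sup>2"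
      by (simp add: add_divide_distrib diff_divide_distrib mult_ac)
    then have Dd: "?D / \<kappa> n \<le> \<bar>d n\<bar>" using elim unfolding d_def by linarith
    have Ka: "0 \<le> Re (K n (a n) (a n)) / \<kappa> n" "Re (K n (a n) (a n)) / \<kappa> n \<le> \<bar>U a n\<bar>"
      using CD_kernel_diag_nonneg elim by (auto simp: K_def)
    have "(cmod (err n))\<^sup>2 = (cmod (K n (a n) (b n) - Km n (a n) (b n) * S n (a n) / of_real c))\<^sup>2 / (\<kappa> n * \<kappa> n)"
      using elim by (simp add: err_def norm_divide power_divide power2_eq_square)
    also have "\<dots> \<le> Re (K n (a n) (a n)) * ?D / (\<kappa> n * \<kappa> n)"
      unfolding K_def Km_def S_def using elim by (intro divide_right_mono CD_kernel_Ms_near[OF deg]) auto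
    also have "\<dots> = Re (K n (a n) (a n)) / \<kappa> n * (?D / \<kappa> n)" by simp
    also have "\<dots> \<le> Re (K n (a n) (a n)) / \<kappa> n * \<bar>d n\<bar>" using Ka(1) Dd by (rule mult_left_mono[rotated])
    also have "\<dots> \<le> \<bar>U a n\<bar> * \<bar>d n\<bar>" using Ka(2) by (rule mult_right_mono) simp
    finally show ?case .
  qed
  have lim: "(\<lambda>n. \<bar>U a n\<bar> * \<bar>d n\<bar>) \<longlonglongrightarrow> \<bar>Re (L a' a') * (1 / c) / (cmod 1)\<^sup>2\<bar> * \<bar>0\<bar>"
    by (intro tendsto_intros U_lim[OF a] d_lim)
  have "(\<lambda>n. (cmod (err n))\<^sup>2) \<longlonglongrightarrow> 0"
    by (rule tendsto_sandwich[OF _ ev tendsto_const lim[unfolded abs_zero mult_zero_right]]) simp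
  from tendsto_real_sqrt[OF this] have err: "err \<longlonglongrightarrow> 0" by (simp add: tendsto_norm_zero_iff)
  have "(\<lambda>n. err n + Km n (a n) (b n) / of_real (\<kappa> n) * S n (a n) / of_real c) \<longlonglongrightarrow> 0 + L a' b' * 1 / of_real c"
    using c by (intro tendsto_intros err Km_lim[OF a b] S_lim[OF a]) auto
  moreover have "err n + Km n (a n) (b n) / of_real (\<kappa> n) * S n (a n) / of_real c = K n (a n) (b n) / of_real (\<kappa> n)" for n
    by (simp add: err_def diff_divide_distrib)
  ultimately show ?thesis by (simp add: K_def \<kappa>_def)
qed

end

section \<open>Transfer matrices\<close>

definition rho :: "(nat \<Rightarrow> complex) \<Rightarrow> nat \<Rightarrow> complex" where
  "rho \<alpha> n = of_real (sqrt (1 - (cmod (\<alpha> n))\<^sup>2))"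

text \<open>At \<^term>\<open>z = exp (\<i> * s)\<close> and for the initial value \<^term>\<open>(1, 1)\<close> this is the pair of the orthonormal polynomial
  and its reverse, divided by the n-th power of \<^term>\<open>exp (\<i> * s / 2)\<close>. In this normalisation the transfer matrices have
  determinant 1 and complex conjugation swaps the two components.\<close>

primrec sol :: "(nat \<Rightarrow> complex) \<Rightarrow> complex \<Rightarrow> complex \<times> complex \<Rightarrow> nat \<Rightarrow> complex \<times> complex" where
  "sol \<alpha> s u 0 = u"
| "sol \<alpha> s u (Suc n) =
    ((exp (\<i> * s / 2) * fst (sol \<alpha> s u n) - cnj (\<alpha> n) * exp (- \<i> * s / 2) * snd (sol \<alpha> s u n)) / rho \<alpha> n,
     (exp (- \<i> * s / 2) * snd (sol \<alpha> s u n) - \<alpha> n * exp (\<i> * s / 2) * fst (sol \<alpha> s u n)) / rho \<alpha> n)"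

lemma rho_square: "cmod (\<alpha> n) < 1 \<Longrightarrow> rho \<alpha> n * rho \<alpha> n = 1 - \<alpha> n * cnj (\<alpha> n)"
proof -
  assume a: "cmod (\<alpha> n) < 1"
  then have "(cmod (\<alpha> n))\<^sup>2 \<le> 1" by (simp add: power_le_one)
  then have "rho \<alpha> n * rho \<alpha> n = of_real (1 - (cmod (\<alpha> n))\<^sup>2)"
    unfolding rho_def of_real_mult[symmetric] by simp
  then show ?thesis by (simp flip: complex_norm_square)
qed

lemma rho_nonzero: "cmod (\<alpha> n) < 1 \<Longrightarrow> rho \<alpha> n \<noteq> 0"
proof -
  assume a: "cmod (\<alpha> n) < 1"
  then have "(cmod (\<alpha> n))\<^sup>2 < 1" by (simp add: abs_square_less_1)
  then show ?thesis by (simp add: rho_def)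
qed

lemma sol_linear:
  "fst (sol \<alpha> s u n) = fst u * fst (sol \<alpha> s (1,0) n) + snd u * fst (sol \<alpha> s (0,1) n)"
  "snd (sol \<alpha> s u n) = fst u * snd (sol \<alpha> s (1,0) n) + snd u * snd (sol \<alpha> s (0,1) n)"
proof (induction n)
  case (Suc n)
  case 1 show ?case by (simp add: Suc[of] add_divide_distrib diff_divide_distrib algebra_simps)
  case 2 show ?case by (simp add: Suc[of] add_divide_distrib diff_divide_distrib algebra_simps)
qed auto

lemma sol_cnj:
  "fst (sol \<alpha> (cnj s) (cnj (snd u), cnj (fst u)) n) = cnj (snd (sol \<alpha> s u n))"
  "snd (sol \<alpha> (cnj s) (cnj (snd u), cnj (fst u)) n) = cnj (fst (sol \<alpha> s u n))"
proof (induction n)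
  case (Suc n)
  have e: "cnj (exp (\<i> * s / 2)) = exp (- \<i> * cnj s / 2)" "cnj (exp (- \<i> * s / 2)) = exp (\<i> * cnj s / 2)"
    by (simp_all add: exp_cnj)
  have r: "cnj (rho \<alpha> n) = rho \<alpha> n" by (simp add: rho_def)
  case 1 show ?case using Suc by (simp add: e[simplified] r)
  case 2 show ?case using Suc by (simp add: e[simplified] r)
qed auto

lemma sol_add_period:
  assumes "\<And>n. \<alpha> (n + p) = \<alpha> n"
  shows "sol \<alpha> s u (m * p + r) = sol \<alpha> s (sol \<alpha> s u (m * p)) r"
proof (induction r)
  case (Suc r)
  have per: "\<alpha> (m * p + r) = \<alpha> r"
  proof (induction m)
    case (Suc m)
    have "\<alpha> (Suc m * p + r) = \<alpha> ((m * p + r) + p)" by (simp add: add_ac)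
    then show ?case using assms Suc by simp
  qed simp
  then show ?case using Suc by (simp add: rho_def)
qed simp

lemma sol_holomorphic: "(\<lambda>s. fst (sol \<alpha> s u n)) holomorphic_on A" "(\<lambda>s. snd (sol \<alpha> s u n)) holomorphic_on A"
proof (induction n)
  case (Suc n)
  have d: "(\<lambda>s. f s / rho \<alpha> n) holomorphic_on A" if "f holomorphic_on A" for f
    using holomorphic_on_mult[OF that holomorphic_on_const[of "inverse (rho \<alpha> n)"]] by (simp add: divide_inverse)
  case 1 show ?case using Suc by (auto intro!: d holomorphic_intros)
  case 2 show ?case using Suc by (auto intro!: d holomorphic_intros)
qed auto

text \<open>One transfer step multiplies the bilinear pairing of the two solutions in a way that
  telescopes, the factor 1 - |\<alpha>_n|^2 cancelling against the squared \<open>rho\<close>. Since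
  s, t and both initial values are free, this one identity yields the determinant of the monodromy
  matrix at s = t, the kernel formula, and a derivative formula at s = t.\<close>

lemma sol_Christoffel_Darboux:
  assumes \<alpha>: "\<And>n. cmod (\<alpha> n) < 1"
  shows "exp (\<i> * (s - t) / 2) ^ n * (fst (sol \<alpha> s u n) * snd (sol \<alpha> t v n) - snd (sol \<alpha> s u n) * fst (sol \<alpha> t v n))
    = (fst u * snd v - snd u * fst v)
      + (exp (\<i> * (s - t)) - 1) * (\<Sum>j<n. exp (\<i> * (s - t) / 2) ^ j * fst (sol \<alpha> s u j) * snd (sol \<alpha> t v j))"
proof (induction n)
  case (Suc n)
  define a b where "a = exp (\<i> * s / 2)" and "b = exp (\<i> * t / 2)"
  have ab: "exp (- \<i> * s / 2) = 1 / a" "exp (- \<i> * t / 2) = 1 / b" "a \<noteq> 0" "b \<noteq> 0"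
    by (simp_all add: a_def b_def exp_minus inverse_eq_divide)
  have l: "exp (\<i> * (s - t) / 2) = a / b" by (simp add: a_def b_def exp_diff[symmetric] algebra_simps diff_divide_distrib)
  have "\<i> * (s - t) = \<i> * (s - t) / 2 + \<i> * (s - t) / 2" by simp
  then have l2: "exp (\<i> * (s - t)) = (a / b)\<^sup>2" unfolding l[symmetric] power2_eq_square exp_add[symmetric] by simp
  define x y x' y' where "x = fst (sol \<alpha> s u n)" and "y = snd (sol \<alpha> s u n)" and "x' = fst (sol \<alpha> t v n)" and "y' = snd (sol \<alpha> t v n)"
  define r A A' where "r = rho \<alpha> n" and "A = \<alpha> n" and "A' = cnj (\<alpha> n)"
  have r: "r \<noteq> 0" "r * r = 1 - A * A'" using rho_nonzero[of \<alpha> n] rho_square[of \<alpha> n] \<alpha> by (simp_all add: r_def A_def A'_def)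
  have "(a / b) * (((a * x - A' * (1 / a) * y) / r) * ((1 / b * y' - A * b * x') / r) - ((1 / a * y - A * a * x) / r) * ((b * x' - A' * (1 / b) * y') / r))
    = (a / b) * ((1 - A * A') * (a / b * x * y' - b / a * y * x')) / (r * r)"
    using ab r(1) by (simp add: field_simps)
  also have "\<dots> = (a / b)\<^sup>2 * x * y' - y * x'"
  proof -
    have "1 - A * A' \<noteq> 0" using r by auto
    then show ?thesis unfolding r(2) using ab by (simp add: field_simps power2_eq_square)
  qed
  finally have step: "(a / b) * (((a * x - A' * (1 / a) * y) / r) * ((1 / b * y' - A * b * x') / r) - ((1 / a * y - A * a * x) / r) * ((b * x' - A' * (1 / b) * y') / r))
     = (x * y' - y * x') + ((a / b)\<^sup>2 - 1) * (x * y')" by (simp add: algebra_simps)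
  have "exp (\<i> * (s - t) / 2) ^ Suc n * (fst (sol \<alpha> s u (Suc n)) * snd (sol \<alpha> t v (Suc n)) - snd (sol \<alpha> s u (Suc n)) * fst (sol \<alpha> t v (Suc n)))
    = (a/b)^n * ((a / b) * (((a * x - A' * (1 / a) * y) / r) * ((1 / b * y' - A * b * x') / r) - ((1 / a * y - A * a * x) / r) * ((b * x' - A' * (1 / b) * y') / r)))"
    unfolding l sol.simps fst_conv snd_conv ab(1,2) A'_def[symmetric]
    unfolding x_def[symmetric] y_def[symmetric] x'_def[symmetric] y'_def[symmetric]
      a_def[symmetric] b_def[symmetric] r_def[symmetric] A_def[symmetric]
    by (simp only: power_Suc mult_ac)
  also have "\<dots> = (a/b)^n * (x * y' - y * x') + ((a / b)\<^sup>2 - 1) * ((a/b)^n * x * y')"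
    unfolding step by (simp add: algebra_simps)
  finally have fin: "exp (\<i> * (s - t) / 2) ^ Suc n * (fst (sol \<alpha> s u (Suc n)) * snd (sol \<alpha> t v (Suc n)) - snd (sol \<alpha> s u (Suc n)) * fst (sol \<alpha> t v (Suc n)))
    = (a/b)^n * (x * y' - y * x') + ((a / b)\<^sup>2 - 1) * ((a/b)^n * x * y')" .
  have IH: "(a/b)^n * (x * y' - y * x') = (fst u * snd v - snd u * fst v)
      + ((a / b)\<^sup>2 - 1) * (\<Sum>j<n. (a/b) ^ j * fst (sol \<alpha> s u j) * snd (sol \<alpha> t v j))"
    using Suc.IH unfolding l l2 x_def[symmetric] y_def[symmetric] x'_def[symmetric] y'_def[symmetric] .
  show ?case unfolding fin
    unfolding IH sum.lessThan_Suc l l2 x_def[symmetric] y'_def[symmetric]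
    by (simp only: distrib_left add.assoc)
qed simp

lemma poly_szego_star_Suc:
  assumes "z \<noteq> 0"
  shows "poly (szego_star (Suc n) (szego_poly \<alpha> (Suc n))) z
    = poly (szego_star n (szego_poly \<alpha> n)) z - \<alpha> n * z * poly (szego_poly \<alpha> n) z"
proof -
  have z: "1 / cnj z \<noteq> 0" using assms by simp
  have "poly (szego_star (Suc n) (szego_poly \<alpha> (Suc n))) z = z ^ Suc n * cnj (poly (szego_poly \<alpha> (Suc n)) (1 / cnj z))"
    by (rule poly_szego_star[OF degree_szego_poly assms])
  also have "poly (szego_poly \<alpha> (Suc n)) (1 / cnj z) = 1 / cnj z * poly (szego_poly \<alpha> n) (1 / cnj z)
     - cnj (\<alpha> n) * ((1 / cnj z) ^ n * cnj (poly (szego_poly \<alpha> n) z))"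
    by (simp add: poly_szego_star[OF degree_szego_poly z, simplified])
  also have "z ^ Suc n * cnj \<dots> = z ^ n * cnj (poly (szego_poly \<alpha> n) (1 / cnj z)) - \<alpha> n * z * poly (szego_poly \<alpha> n) z"
    using assms by (simp add: power_one_over field_simps)
  finally show ?thesis by (simp add: poly_szego_star[OF degree_szego_poly assms])
qed

lemma szego_star_smult: "szego_star n (smult (of_real c) P) = smult (of_real c) (szego_star n P)"
proof -
  have "smult a (sum f A) = (\<Sum>i\<in>A. smult a (f i))" for a :: complex and f and A :: "nat set"
    by (induction A rule: infinite_finite_induct) (simp_all add: smult_add_right)
  then show ?thesis unfolding szego_star_def by (simp add: smult_monom)
qed

lemma exp_half_power: "exp (\<i> * s / 2) * exp (\<i> * s / 2) = exp (\<i> * s)"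
  by (simp add: exp_add[symmetric])

lemma phi_eq_sol:
  assumes \<alpha>: "\<And>n. cmod (\<alpha> n) < 1"
  shows "poly (phi \<alpha> n) (exp (\<i> * s)) = exp (\<i> * s / 2) ^ n * fst (sol \<alpha> s (1, 1) n)"
    and "poly (szego_star n (phi \<alpha> n)) (exp (\<i> * s)) = exp (\<i> * s / 2) ^ n * snd (sol \<alpha> s (1, 1) n)"
proof -
  define R where "R n = (\<Prod>j<n. rho \<alpha> j)" for n
  have R: "complex_of_real (1 / (\<Prod>j<n. sqrt (1 - (cmod (\<alpha> j))\<^sup>2))) = 1 / R n" for n
    by (simp add: R_def rho_def)
  have phi: "phi \<alpha> n = smult (1 / R n) (szego_poly \<alpha> n)"
    unfolding phi_def by (simp only: R)
  have star: "szego_star n (phi \<alpha> n) = smult (1 / R n) (szego_star n (szego_poly \<alpha> n))"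
    unfolding phi_def szego_star_smult by (simp only: R)
  have Rn: "R n \<noteq> 0" for n using rho_nonzero \<alpha> by (auto simp: R_def)
  have RS: "R (Suc n) = R n * rho \<alpha> n" for n by (simp add: R_def)
  define z where "z = exp (\<i> * s / 2)"
  have z: "z \<noteq> 0" "exp (\<i> * s) = z * z" "exp (- \<i> * s / 2) = 1 / z"
    by (simp_all add: z_def exp_half_power exp_minus inverse_eq_divide)
  have "poly (szego_poly \<alpha> n) (z * z) = z ^ n * R n * fst (sol \<alpha> s (1, 1) n) \<and>
     poly (szego_star n (szego_poly \<alpha> n)) (z * z) = z ^ n * R n * snd (sol \<alpha> s (1, 1) n)"
  proof (induction n)
    case 0 show ?case by (simp add: R_def szego_star_def)
  next
    case (Suc n)
    have r: "rho \<alpha> n \<noteq> 0" using rho_nonzero \<alpha> by blast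
    have "poly (szego_poly \<alpha> (Suc n)) (z * z) = z ^ Suc n * R (Suc n) * fst (sol \<alpha> s (1, 1) (Suc n))"
      using Suc z(1) r by (simp add: RS z(3)[simplified] z_def[symmetric] field_simps)
    moreover have "poly (szego_star (Suc n) (szego_poly \<alpha> (Suc n))) (z * z) = z ^ Suc n * R (Suc n) * snd (sol \<alpha> s (1, 1) (Suc n))"
      using Suc z(1) r by (subst poly_szego_star_Suc) (simp_all add: RS z(3)[simplified] z_def[symmetric] field_simps)
    ultimately show ?case ..
  qed
  then show "poly (phi \<alpha> n) (exp (\<i> * s)) = exp (\<i> * s / 2) ^ n * fst (sol \<alpha> s (1, 1) n)"
    "poly (szego_star n (phi \<alpha> n)) (exp (\<i> * s)) = exp (\<i> * s / 2) ^ n * snd (sol \<alpha> s (1, 1) n)"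
    unfolding z(2) z_def[symmetric] star unfolding phi using Rn[of n] by simp_all
qed

text \<open>Changing the sign of all coefficients is conjugation by diag(1,-1). The second kind
  polynomials are therefore the same recursion started at (1,-1).\<close>

lemma sol_minus:
  "fst (sol (\<lambda>j. - \<alpha> j) s (1, 1) n) = fst (sol \<alpha> s (1, -1) n)"
  "snd (sol (\<lambda>j. - \<alpha> j) s (1, 1) n) = - snd (sol \<alpha> s (1, -1) n)"
proof (induction n)
  case (Suc n)
  have r: "rho (\<lambda>j. - \<alpha> j) n = rho \<alpha> n" by (simp add: rho_def)
  case 1 show ?case by (simp add: Suc r)
  case 2 show ?case by (simp add: Suc r field_simps) (simp add: add_divide_distrib diff_divide_distrib)
qed auto

text \<open>The Chebyshev polynomials T of index q (first kind) and U of index q - 1 (second kind).\<close>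

primrec cheb :: "complex \<Rightarrow> nat \<Rightarrow> complex \<times> complex" where
  "cheb x 0 = (1, 0)"
| "cheb x (Suc q) = (x * fst (cheb x q) - (1 - x\<^sup>2) * snd (cheb x q), x * snd (cheb x q) + fst (cheb x q))"

lemma cheb_cos: "fst (cheb (cos \<eta>) q) = cos (of_nat q * \<eta>)" "sin \<eta> * snd (cheb (cos \<eta>) q) = sin (of_nat q * \<eta>)"
proof (induction q)
  case (Suc q)
  have s: "1 - (cos \<eta>)\<^sup>2 = sin \<eta> * sin \<eta>" using sin_squared_eq[of \<eta>] by (simp add: power2_eq_square)
  have m: "of_nat (Suc q) * \<eta> = of_nat q * \<eta> + \<eta>" by (simp add: algebra_simps)
  case 1 show ?case unfolding m cos_add Suc[symmetric] cheb.simps fst_conv s by (simp add: algebra_simps)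
  case 2 show ?case unfolding m sin_add Suc[symmetric] cheb.simps snd_conv by (simp add: algebra_simps)
qed auto

section \<open>The monodromy matrix over one period\<close>

locale periodic_verblunsky =
  fixes \<alpha> :: "nat \<Rightarrow> complex" and p :: nat
  assumes \<alpha>_lt: "\<And>n. cmod (\<alpha> n) < 1" and periodic: "\<And>n. \<alpha> (n + p) = \<alpha> n"
    and even_p: "even p" and p_pos: "0 < p"
begin

abbreviation X :: "complex \<Rightarrow> nat \<Rightarrow> complex" where "X s n \<equiv> fst (sol \<alpha> s (1, 1) n)"
abbreviation Y :: "complex \<Rightarrow> nat \<Rightarrow> complex" where "Y s n \<equiv> snd (sol \<alpha> s (1, 1) n)"

text \<open>The monodromy matrix m has trace \<open>D\<close>. Its traceless part has entries r11, m12, m21 and - r11, and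
  (\<open>\<rho>1\<close>, \<open>\<rho>2\<close>) is the image of (1, 1) under it.\<close>

definition "m11 s = fst (sol \<alpha> s (1, 0) p)"
definition "m12 s = fst (sol \<alpha> s (0, 1) p)"
definition "m21 s = snd (sol \<alpha> s (1, 0) p)"
definition "m22 s = snd (sol \<alpha> s (0, 1) p)"
definition "D s = m11 s + m22 s"
definition "r11 s = (m11 s - m22 s) / 2"
definition "\<rho>1 s = r11 s + m12 s"
definition "\<rho>2 s = m21 s - r11 s"
definition "\<kappa> s = \<rho>1 s - \<rho>2 s"

lemma holomorphic_m:
  "m11 holomorphic_on A" "m12 holomorphic_on A" "m21 holomorphic_on A" "m22 holomorphic_on A"
  unfolding m11_def[abs_def] m12_def[abs_def] m21_def[abs_def] m22_def[abs_def] by (rule sol_holomorphic)+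

lemma holomorphic_D: "D holomorphic_on A"
  unfolding D_def[abs_def] by (intro holomorphic_intros holomorphic_m)
lemma holomorphic_r11: "r11 holomorphic_on A"
  unfolding r11_def[abs_def] by (intro holomorphic_intros holomorphic_m) auto
lemma holomorphic_\<rho>: "\<rho>1 holomorphic_on A" "\<rho>2 holomorphic_on A"
  unfolding \<rho>1_def[abs_def] \<rho>2_def[abs_def] by (intro holomorphic_intros holomorphic_m holomorphic_r11)+
lemma cnj_m: "cnj (m11 s) = m22 (cnj s)" "cnj (m12 s) = m21 (cnj s)" "cnj (m21 s) = m12 (cnj s)" "cnj (m22 s) = m11 (cnj s)"
  using sol_cnj[of \<alpha> s "(1,0)" p] sol_cnj[of \<alpha> s "(0,1)" p]
  by (simp_all add: m11_def m12_def m21_def m22_def)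

lemma cnj_D: "cnj (D s) = D (cnj s)" by (simp add: D_def cnj_m add.commute)
lemma cnj_r11: "cnj (r11 s) = - r11 (cnj s)" by (simp add: r11_def cnj_m field_simps)
lemma cnj_\<rho>: "cnj (\<rho>1 s) = \<rho>2 (cnj s)" "cnj (\<rho>2 s) = \<rho>1 (cnj s)" by (simp_all add: \<rho>1_def \<rho>2_def cnj_m cnj_r11)
lemma cnj_XY: "cnj (X s n) = Y (cnj s) n" "cnj (Y s n) = X (cnj s) n"
  using sol_cnj[of \<alpha> s "(1,1)" n] by simp_all

lemma det_m: "m11 s * m22 s - m12 s * m21 s = 1"
  using sol_Christoffel_Darboux[where \<alpha>=\<alpha> and s=s and t=s and n=p and u="(1,0)" and v="(0,1)", OF \<alpha>_lt]
  by (simp add: m11_def m12_def m21_def m22_def mult.commute)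

text \<open>Cayley-Hamilton for determinant 1: the traceless part of the monodromy matrix squares to
  (D/2)^2 - 1 times the identity, and the left-hand side is the scalar in question.\<close>

lemma r_square: "(r11 s)\<^sup>2 + m12 s * m21 s = (D s / 2)\<^sup>2 - 1"
proof -
  have "(D s / 2)\<^sup>2 - (r11 s)\<^sup>2 = m11 s * m22 s"
    by (simp add: D_def r11_def power2_eq_square field_simps)
  then show ?thesis using det_m[of s] by (simp add: algebra_simps)
qed

lemma R_\<rho>: "r11 s * \<rho>1 s + m12 s * \<rho>2 s = (D s / 2)\<^sup>2 - 1" "m21 s * \<rho>1 s - r11 s * \<rho>2 s = (D s / 2)\<^sup>2 - 1"
  unfolding r_square[symmetric] by (simp_all add: \<rho>1_def \<rho>2_def power2_eq_square algebra_simps)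

lemma m_eq: "m11 s = D s / 2 + r11 s" "m22 s = D s / 2 - r11 s"
  by (simp_all add: D_def r11_def field_simps)

text \<open>The q-th power of a 2x2 matrix of determinant 1 is T_q(D/2) times the identity plus
  U_{q-1}(D/2) times its traceless part; here it acts on (1,1).\<close>

lemma sol_period:
  "sol \<alpha> s (1, 1) (q * p) =
    (fst (cheb (D s / 2) q) + snd (cheb (D s / 2) q) * \<rho>1 s, fst (cheb (D s / 2) q) + snd (cheb (D s / 2) q) * \<rho>2 s)"
proof (induction q)
  case (Suc q)
  define x C S where "x = D s / 2" and "C = fst (cheb x q)" and "S = snd (cheb x q)"
  have "sol \<alpha> s (1, 1) (Suc q * p) = sol \<alpha> s (1, 1) (q * p + p)" by (simp add: add.commute)
  also have "\<dots> = sol \<alpha> s (sol \<alpha> s (1, 1) (q * p)) p" by (rule sol_add_period[where \<alpha>=\<alpha> and p=p, OF periodic])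
  also have "sol \<alpha> s (1, 1) (q * p) = (C + S * \<rho>1 s, C + S * \<rho>2 s)" using Suc by (simp add: x_def C_def S_def)
  also have "sol \<alpha> s \<dots> p = ((C + S * \<rho>1 s) * m11 s + (C + S * \<rho>2 s) * m12 s, (C + S * \<rho>1 s) * m21 s + (C + S * \<rho>2 s) * m22 s)"
    by (rule prod_eqI) (subst sol_linear, simp add: m11_def m12_def m21_def m22_def)+
  also have "\<dots> = (x * (C + S * \<rho>1 s) + (C * \<rho>1 s + S * (r11 s * \<rho>1 s + m12 s * \<rho>2 s)),
      x * (C + S * \<rho>2 s) + (C * \<rho>2 s + S * (m21 s * \<rho>1 s - r11 s * \<rho>2 s)))"
    unfolding m_eq x_def[symmetric] by (simp add: \<rho>1_def \<rho>2_def algebra_simps)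
  also have "\<dots> = (fst (cheb x (Suc q)) + snd (cheb x (Suc q)) * \<rho>1 s, fst (cheb x (Suc q)) + snd (cheb x (Suc q)) * \<rho>2 s)"
    unfolding R_\<rho> x_def[symmetric] by (simp add: C_def[symmetric] S_def[symmetric] algebra_simps)
  finally show ?case by (simp only: x_def)
qed simp

text \<open>First and second kind polynomials probe the monodromy matrix on (1,1) and (1,-1), so in
  their sum the off-diagonal entries cancel and the trace is left. Evenness of p makes z^(p/2) equal
  to exp(i s/2)^p for complex s as well.\<close>

lemma Delta_eq_D: "Delta \<alpha> p (exp (\<i> * s)) = D s"
proof -
  have am: "cmod (- \<alpha> n) < 1" for n using \<alpha>_lt by simp
  obtain m where m: "p = 2 * m" using even_p by blast
  have e: "exp (\<i> * s) ^ (p div 2) = exp (\<i> * s / 2) ^ p"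
    using exp_half_power[of s] by (simp add: m power_mult power2_eq_square)
  have nz: "exp (\<i> * s / 2) ^ p \<noteq> 0" by simp
  have lin: "fst (sol \<alpha> s (1, 1) p) = m11 s + m12 s" "snd (sol \<alpha> s (1, 1) p) = m21 s + m22 s"
    "fst (sol \<alpha> s (1, -1) p) = m11 s - m12 s" "snd (sol \<alpha> s (1, -1) p) = m21 s - m22 s"
    by (subst sol_linear, simp add: m11_def m12_def m21_def m22_def)+
  show ?thesis
    unfolding Delta_def psi_def phi_eq_sol[of \<alpha>, OF \<alpha>_lt] phi_eq_sol[of "\<lambda>j. - \<alpha> j", OF am] sol_minus lin e
    using nz by (simp add: D_def field_simps)
qed

lemma resonance_iff: "resonance \<alpha> p (exp (\<i> * s)) \<longleftrightarrow> \<kappa> s = 0"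
proof -
  have lin: "X s p = m11 s + m12 s" "Y s p = m21 s + m22 s"
    by (subst sol_linear, simp add: m11_def m12_def m21_def m22_def)+
  have "X s p - Y s p = \<kappa> s" unfolding lin by (simp add: \<kappa>_def \<rho>1_def \<rho>2_def r11_def field_simps)
  moreover have "poly (phi \<alpha> p) (exp (\<i> * s)) - poly (szego_star p (phi \<alpha> p)) (exp (\<i> * s)) = exp (\<i> * s / 2) ^ p * (X s p - Y s p)"
    unfolding phi_eq_sol[OF \<alpha>_lt] by (simp add: right_diff_distrib)
  ultimately show ?thesis by (simp add: resonance_def)
qed

text \<open>The conjugated argument is replaced by a free variable t, so that the kernel is
  holomorphic in both; \<open>ker_phi\<close> recovers the sesquilinear kernel at
  \<open>cnj t\<close>.\<close>

definition ker :: "nat \<Rightarrow> complex \<Rightarrow> complex \<Rightarrow> complex" where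
  "ker n s t = (\<Sum>j<n. exp (\<i> * (s - t) / 2) ^ j * X s j * Y t j)"

lemma ker_phi: "(\<Sum>j<n. poly (phi \<alpha> j) (exp (\<i> * s)) * cnj (poly (phi \<alpha> j) (exp (\<i> * t)))) = ker n s (cnj t)"
proof -
  have "poly (phi \<alpha> j) (exp (\<i> * s)) * cnj (poly (phi \<alpha> j) (exp (\<i> * t)))
    = exp (\<i> * (s - cnj t) / 2) ^ j * X s j * Y (cnj t) j" for j
  proof -
    have "cnj (exp (\<i> * t / 2)) = exp (- \<i> * cnj t / 2)" by (simp add: exp_cnj)
    then have "exp (\<i> * s / 2) ^ j * cnj (exp (\<i> * t / 2)) ^ j = exp (\<i> * (s - cnj t) / 2) ^ j"
      by (simp add: power_mult_distrib[symmetric] exp_add[symmetric] field_simps)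
    then show ?thesis unfolding phi_eq_sol[OF \<alpha>_lt] by (simp add: cnj_XY mult_ac)
  qed
  then show ?thesis by (simp add: ker_def)
qed

lemma ker_CD:
  "(exp (\<i> * (s - t)) - 1) * ker (q * p) s t = exp (\<i> * (s - t) / 2) ^ (q * p) *
    (snd (cheb (D s / 2) q) * fst (cheb (D t / 2) q) * \<kappa> s - fst (cheb (D s / 2) q) * snd (cheb (D t / 2) q) * \<kappa> t
      + snd (cheb (D s / 2) q) * snd (cheb (D t / 2) q) * (\<rho>1 s * \<rho>2 t - \<rho>2 s * \<rho>1 t))"
  using sol_Christoffel_Darboux[where \<alpha>=\<alpha> and s=s and t=t and n="q * p" and u="(1,1)" and v="(1,1)", OF \<alpha>_lt]
  unfolding ker_def sol_period by (simp add: \<kappa>_def algebra_simps)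

lemma ker_holomorphic: "(\<lambda>s. ker n s t) holomorphic_on A"
  unfolding ker_def by (intro holomorphic_intros sol_holomorphic) auto

lemma ker_real_diag: "ker n (of_real s) (of_real s) = of_real (\<Sum>j<n. (cmod (X (of_real s) j))\<^sup>2)"
proof -
  have "X (of_real s) j * Y (of_real s) j = of_real ((cmod (X (of_real s) j))\<^sup>2)" for j
    using cnj_XY(1)[of "of_real s" j] complex_norm_square[of "X (of_real s) j"] by simp
  then show ?thesis by (simp add: ker_def mult.assoc)
qed

end

section \<open>Band edges\<close>

lemma holomorphic_has_derivative: "f holomorphic_on UNIV \<Longrightarrow> (f has_field_derivative deriv f x) (at x)"
  using holomorphic_derivI[of f UNIV x] by auto

lemma holomorphic_isCont: "f holomorphic_on UNIV \<Longrightarrow> isCont f x"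
  using holomorphic_on_imp_continuous_on continuous_on_eq_continuous_at by blast

lemma cheb_one: "cheb 1 q = (1, of_nat q)"
  by (induction q) auto

text \<open>Writing U_{q-1} as a quotient of sincs instead of sines includes \<omega> = 0 and
  displays the factor q.\<close>

lemma cheb_cosq:
  assumes "sincq (\<omega>\<^sup>2) \<noteq> 0"
  shows "fst (cheb (cos \<omega>) q) = cosq ((of_nat q * \<omega>)\<^sup>2)"
    and "snd (cheb (cos \<omega>) q) = of_nat q * sincq ((of_nat q * \<omega>)\<^sup>2) / sincq (\<omega>\<^sup>2)"
proof -
  show "fst (cheb (cos \<omega>) q) = cosq ((of_nat q * \<omega>)\<^sup>2)" by (simp add: cheb_cos)
  show "snd (cheb (cos \<omega>) q) = of_nat q * sincq ((of_nat q * \<omega>)\<^sup>2) / sincq (\<omega>\<^sup>2)"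
  proof (cases "\<omega> = 0")
    case False
    have "\<omega> * sincq (\<omega>\<^sup>2) * snd (cheb (cos \<omega>) q) = of_nat q * \<omega> * sincq ((of_nat q * \<omega>)\<^sup>2)"
      unfolding sincq_power2 by (rule cheb_cos)
    then show ?thesis using False assms by (simp add: field_simps)
  qed (simp add: cheb_one)
qed

text \<open>Arccos has a branch point at 1. The half-angle formula 1 - cos \<omega> = 2
  sin(\<omega>/2)^2 with Arcsin, which is continuous at 0, gives an angle that tends to 0. Its sign
  is arbitrary, so only the square of Q \<omega> has a limit.\<close>

lemma cheb_angle_sequence:
  fixes x :: "nat \<Rightarrow> complex"
  assumes Q: "filterlim Q at_top sequentially" and x: "(\<lambda>n. (of_nat (Q n))\<^sup>2 * (2 - 2 * x n)) \<longlonglongrightarrow> A"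
  obtains \<omega> where "\<And>n. x n = cos (\<omega> n)" "\<omega> \<longlonglongrightarrow> 0" "(\<lambda>n. (of_nat (Q n) * \<omega> n)\<^sup>2) \<longlonglongrightarrow> A"
proof
  define y where "y n = Arcsin (csqrt ((1 - x n) / 2))" for n
  have iQ: "(\<lambda>n. inverse (complex_of_nat (Q n))) \<longlonglongrightarrow> 0" by (rule filterlim_compose[OF lim_inverse_n Q])
  have Q1: "\<forall>\<^sub>F n in sequentially. Q n \<ge> 1" using Q by (simp add: filterlim_at_top)
  have siny: "(sin (y n))\<^sup>2 = (1 - x n) / 2" for n by (simp add: y_def)
  show "x n = cos (2 * y n)" for n
    unfolding cos_double_sin siny by (simp add: field_simps)
  have l: "(\<lambda>n. (of_nat (Q n))\<^sup>2 * (2 - 2 * x n) * (inverse (of_nat (Q n)))\<^sup>2 / 4) \<longlonglongrightarrow> A * 0\<^sup>2 / 4"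
    by (intro tendsto_intros x iQ) auto
  have ev: "\<forall>\<^sub>F n in sequentially. (of_nat (Q n))\<^sup>2 * (2 - 2 * x n) * (inverse (of_nat (Q n)))\<^sup>2 / 4 = (1 - x n) / 2"
    using Q1 by eventually_elim (simp add: field_simps)
  have "A * 0\<^sup>2 / 4 = 0" by simp
  then have x0: "(\<lambda>n. (1 - x n) / 2) \<longlonglongrightarrow> 0" using Lim_transform_eventually[OF l ev] by (simp only:)
  have "(\<lambda>n. sqrt (cmod ((1 - x n) / 2))) \<longlonglongrightarrow> sqrt (cmod 0)" by (intro tendsto_intros x0)
  then have "(\<lambda>n. norm (csqrt ((1 - x n) / 2))) \<longlonglongrightarrow> 0" by simp
  then have s0: "(\<lambda>n. csqrt ((1 - x n) / 2)) \<longlonglongrightarrow> 0" by (rule tendsto_norm_zero_cancel)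
  have "isCont Arcsin 0" by (rule isCont_Arcsin) simp
  from isCont_tendsto_compose[OF this s0] have y0: "y \<longlonglongrightarrow> 0" by (simp add: y_def[abs_def])
  then show "(\<lambda>n. 2 * y n) \<longlonglongrightarrow> 0" using tendsto_mult[OF tendsto_const y0, of 2] by simp
  have "(\<lambda>n. sincq ((y n)\<^sup>2)) \<longlonglongrightarrow> sincq (0\<^sup>2)" by (intro tendsto_intros y0)
  then have sy: "(\<lambda>n. sincq ((y n)\<^sup>2)) \<longlonglongrightarrow> 1" by simp
  have "(\<lambda>n. (of_nat (Q n))\<^sup>2 * (2 - 2 * x n) / (sincq ((y n)\<^sup>2))\<^sup>2) \<longlonglongrightarrow> A / 1\<^sup>2"
    by (intro tendsto_intros x sy) auto
  moreover have "\<forall>\<^sub>F n in sequentially. sincq ((y n)\<^sup>2) \<noteq> 0"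
    using tendsto_imp_eventually_ne[OF sy, of 0] by simp
  then have "\<forall>\<^sub>F n in sequentially. (of_nat (Q n))\<^sup>2 * (2 - 2 * x n) / (sincq ((y n)\<^sup>2))\<^sup>2 = (of_nat (Q n) * (2 * y n))\<^sup>2"
  proof eventually_elim
    case (elim n)
    have "2 - 2 * x n = 4 * (y n * sincq ((y n)\<^sup>2))\<^sup>2" unfolding sincq_power2 siny by (simp add: field_simps)
    then show ?case using elim by (simp add: power_mult_distrib)
  qed
  ultimately show "(\<lambda>n. (of_nat (Q n) * (2 * y n))\<^sup>2) \<longlonglongrightarrow> A" by (simp add: tendsto_cong)
qed

text \<open>The shape of a solution after the fraction u of all periods: P is the coefficient of its
  Chebyshev T part, R that of its U part.\<close>

definition edge_profile :: "real \<Rightarrow> complex \<Rightarrow> complex \<Rightarrow> complex \<Rightarrow> complex" where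
  "edge_profile u A P R = P * cosq (of_real (u\<^sup>2) * A) + R * (of_real u * sincq (of_real (u\<^sup>2) * A))"

lemma edge_Riemann_sum:
  assumes Q: "filterlim Q at_top sequentially"
    and lims: "\<delta> \<longlonglongrightarrow> 0" "A \<longlonglongrightarrow> A'" "B \<longlonglongrightarrow> B'" "P1 \<longlonglongrightarrow> P1'" "R1 \<longlonglongrightarrow> R1'" "P2 \<longlonglongrightarrow> P2'" "R2 \<longlonglongrightarrow> R2'"
  shows "(\<lambda>n. (\<Sum>q<Q n. let u = real q / real (Q n) in exp (of_real u * \<delta> n) *
      edge_profile u (A n) (P1 n) (R1 n) * edge_profile u (B n) (P2 n) (R2 n)) / of_nat (Q n))
    \<longlonglongrightarrow> integral {0..1} (\<lambda>u. edge_profile u A' P1' R1' * edge_profile u B' P2' R2')"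
proof -
  let ?f = "\<lambda>u (d, A, B, P1, R1, P2, R2). exp (of_real u * d) * edge_profile u A P1 R1 * edge_profile u B P2 R2"
  have cont: "continuous_on UNIV (\<lambda>(u, p). ?f u p)"
    unfolding case_prod_beta edge_profile_def by (intro continuous_intros)
  have "(\<lambda>n. (\<delta> n, A n, B n, P1 n, R1 n, P2 n, R2 n)) \<longlonglongrightarrow> (0, A', B', P1', R1', P2', R2')"
    by (intro tendsto_Pair lims)
  from Riemann_sum_tendsto[OF cont Q this] show ?thesis by (simp add: Let_def)
qed

lemma sum_nat_blocks:
  fixes p q :: nat
  shows "(\<Sum>j<q * p. f j) = (\<Sum>r<p. \<Sum>i<q. (f (i * p + r) :: 'a :: comm_monoid_add))"
proof -
  have add: "(\<Sum>j<m + p. f j) = (\<Sum>j<m. f j) + (\<Sum>r<p. f (m + r))" for m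
    by (induction p) (simp_all add: add_ac)
  have "(\<Sum>j<q * p. f j) = (\<Sum>i<q. \<Sum>r<p. f (i * p + r))"
  proof (induction q)
    case (Suc q)
    have "Suc q * p = q * p + p" by simp
    then show ?case using Suc by (simp only: add sum.lessThan_Suc)
  qed simp
  then show ?thesis by (simp only: sum.swap[of _ "{..<p}"])
qed

context periodic_verblunsky
begin

definition "Rx r s = fst (sol \<alpha> s (\<rho>1 s, \<rho>2 s) r)"
definition "Ry r s = snd (sol \<alpha> s (\<rho>1 s, \<rho>2 s) r)"

lemma XY_block:
  "X s (q * p + r) = fst (cheb (D s / 2) q) * X s r + snd (cheb (D s / 2) q) * Rx r s"
  "Y s (q * p + r) = fst (cheb (D s / 2) q) * Y s r + snd (cheb (D s / 2) q) * Ry r s"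
proof -
  have eq: "sol \<alpha> s (1, 1) (q * p + r) = sol \<alpha> s (sol \<alpha> s (1, 1) (q * p)) r"
    by (rule sol_add_period[where \<alpha>=\<alpha> and p=p, OF periodic])
  define f g f' g' where "f = fst (sol \<alpha> s (1,0) r)" and "g = fst (sol \<alpha> s (0,1) r)"
    and "f' = snd (sol \<alpha> s (1,0) r)" and "g' = snd (sol \<alpha> s (0,1) r)"
  have F: "fst (sol \<alpha> s (u1, u2) r) = u1 * f + u2 * g" "snd (sol \<alpha> s (u1, u2) r) = u1 * f' + u2 * g'" for u1 u2
    by (subst sol_linear, simp add: f_def g_def f'_def g'_def)+
  show "X s (q * p + r) = fst (cheb (D s / 2) q) * X s r + snd (cheb (D s / 2) q) * Rx r s"
    "Y s (q * p + r) = fst (cheb (D s / 2) q) * Y s r + snd (cheb (D s / 2) q) * Ry r s"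
    unfolding eq sol_period Rx_def Ry_def F by (simp_all add: algebra_simps)
qed

lemma holomorphic_R: "Rx r holomorphic_on A" "Ry r holomorphic_on A"
proof -
  have 1: "Rx r = (\<lambda>s. \<rho>1 s * fst (sol \<alpha> s (1,0) r) + \<rho>2 s * fst (sol \<alpha> s (0,1) r))"
    unfolding Rx_def by (rule ext) (subst sol_linear, simp)
  have 2: "Ry r = (\<lambda>s. \<rho>1 s * snd (sol \<alpha> s (1,0) r) + \<rho>2 s * snd (sol \<alpha> s (0,1) r))"
    unfolding Ry_def by (rule ext) (subst sol_linear, simp)
  show "Rx r holomorphic_on A" unfolding 1 by (intro holomorphic_intros holomorphic_\<rho> sol_holomorphic)
  show "Ry r holomorphic_on A" unfolding 2 by (intro holomorphic_intros holomorphic_\<rho> sol_holomorphic)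
qed

lemma cnj_R: "cnj (Rx r s) = Ry r (cnj s)"
  using sol_cnj(2)[of \<alpha> s "(\<rho>1 s, \<rho>2 s)" r] by (simp add: Rx_def Ry_def cnj_\<rho>)

end

locale periodic_point = periodic_verblunsky +
  fixes \<theta> :: real
begin

abbreviation t0 :: complex where "t0 \<equiv> of_real \<theta>"

definition spt :: "nat \<Rightarrow> nat \<Rightarrow> complex \<Rightarrow> complex" where
  "spt \<gamma> Q a = t0 + a / of_nat (Q * p) ^ \<gamma>"

context
  fixes Q :: "nat \<Rightarrow> nat" and a :: "nat \<Rightarrow> complex" and a' :: complex
  assumes Q: "filterlim Q at_top sequentially" and a: "a \<longlonglongrightarrow> a'"
begin

lemma scaled_tendsto: "(\<lambda>n. of_nat (Q n) ^ \<gamma> * (a n / of_nat (Q n * p) ^ \<gamma>)) \<longlonglongrightarrow> a' / of_nat p ^ \<gamma>"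
proof -
  have "(\<lambda>n. a n / of_nat p ^ \<gamma>) \<longlonglongrightarrow> a' / of_nat p ^ \<gamma>" using p_pos by (intro tendsto_intros a) auto
  moreover have "\<forall>\<^sub>F n in sequentially. Q n \<ge> 1" using Q by (simp add: filterlim_at_top)
  then have "\<forall>\<^sub>F n in sequentially. a n / of_nat p ^ \<gamma> = of_nat (Q n) ^ \<gamma> * (a n / of_nat (Q n * p) ^ \<gamma>)"
    by eventually_elim (simp add: power_mult_distrib)
  ultimately show ?thesis by (rule Lim_transform_eventually)
qed

lemma scaled_tendsto_0:
  assumes "j < \<gamma>"
  shows "(\<lambda>n. of_nat (Q n) ^ j * (a n / of_nat (Q n * p) ^ \<gamma>)) \<longlonglongrightarrow> 0"
proof -
  obtain m where m: "\<gamma> = j + Suc m" using less_imp_Suc_add[OF assms] by auto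
  have "(\<lambda>n. of_nat (Q n) ^ \<gamma> * (a n / of_nat (Q n * p) ^ \<gamma>) * inverse (of_nat (Q n)) ^ Suc m)
    \<longlonglongrightarrow> a' / of_nat p ^ \<gamma> * 0 ^ Suc m"
    by (intro tendsto_mult tendsto_power scaled_tendsto filterlim_compose[OF lim_inverse_n Q])
  moreover have "\<forall>\<^sub>F n in sequentially. Q n \<ge> 1" using Q by (simp add: filterlim_at_top)
  then have "\<forall>\<^sub>F n in sequentially. of_nat (Q n) ^ \<gamma> * (a n / of_nat (Q n * p) ^ \<gamma>) * inverse (of_nat (Q n)) ^ Suc m
    = of_nat (Q n) ^ j * (a n / of_nat (Q n * p) ^ \<gamma>)"
    by eventually_elim (simp add: m power_add power_inverse field_simps)
  ultimately show ?thesis using Lim_transform_eventually by fastforce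
qed

lemma spt_tendsto: "1 \<le> \<gamma> \<Longrightarrow> (\<lambda>n. spt \<gamma> (Q n) (a n)) \<longlonglongrightarrow> t0"
  unfolding spt_def using tendsto_add[OF tendsto_const scaled_tendsto_0[of 0 \<gamma>], of t0] by simp

lemma spt_isCont: "1 \<le> \<gamma> \<Longrightarrow> isCont f t0 \<Longrightarrow> (\<lambda>n. f (spt \<gamma> (Q n) (a n))) \<longlonglongrightarrow> f t0"
  by (rule isCont_tendsto_compose[OF _ spt_tendsto])

lemma spt_deriv:
  assumes "1 \<le> \<gamma>" "(f has_field_derivative d) (at t0)"
  shows "(\<lambda>n. of_nat (Q n) ^ \<gamma> * (f (spt \<gamma> (Q n) (a n)) - f t0)) \<longlonglongrightarrow> a' / of_nat p ^ \<gamma> * d"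
    and "j < \<gamma> \<Longrightarrow> (\<lambda>n. of_nat (Q n) ^ j * (f (spt \<gamma> (Q n) (a n)) - f t0)) \<longlonglongrightarrow> 0"
  using field_derivative_sequentially[OF assms(2) _ scaled_tendsto[of \<gamma>]]
    field_derivative_sequentially[OF assms(2) _ scaled_tendsto_0[of j \<gamma>]] scaled_tendsto_0[of 0 \<gamma>] assms(1)
  by (auto simp: spt_def)

end

end

section \<open>Kernel asymptotics at a band edge\<close>

locale periodic_edge = periodic_point +
  assumes D\<theta>: "D t0 = 2"
begin

text \<open>In the nonresonant case the \<^term>\<open>Rx\<close>, \<^term>\<open>Ry\<close> part of the solution dominates and \<^term>\<open>e = 1\<close>,
  in the resonant case it is negligible and \<^term>\<open>e = 0\<close>.\<close>

lemma ker_edge_tendsto: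
  fixes e :: nat
  assumes Q: "filterlim Q at_top sequentially" and a: "a \<longlonglongrightarrow> a'" and c: "c \<longlonglongrightarrow> c'"
    and Xl: "\<And>r. (\<lambda>n. X (spt 2 (Q n) (a n)) r / of_nat (Q n) ^ e) \<longlonglongrightarrow> x r"
    and Yl: "\<And>r. (\<lambda>n. Y (spt 2 (Q n) (c n)) r / of_nat (Q n) ^ e) \<longlonglongrightarrow> y r"
    and Rxl: "\<And>r. (\<lambda>n. of_nat (Q n) * Rx r (spt 2 (Q n) (a n)) / of_nat (Q n) ^ e) \<longlonglongrightarrow> rx r"
    and Ryl: "\<And>r. (\<lambda>n. of_nat (Q n) * Ry r (spt 2 (Q n) (c n)) / of_nat (Q n) ^ e) \<longlonglongrightarrow> ry r"
  shows "(\<lambda>n. ker (Q n * p) (spt 2 (Q n) (a n)) (spt 2 (Q n) (c n)) / of_nat (Q n) ^ (2 * e + 1)) \<longlonglongrightarrow>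
    (\<Sum>r<p. integral {0..1} (\<lambda>u. edge_profile u (- deriv D t0 * a' / (of_nat p)\<^sup>2) (x r) (rx r) *
      edge_profile u (- deriv D t0 * c' / (of_nat p)\<^sup>2) (y r) (ry r)))"
proof -
  define s t z where "s n = spt 2 (Q n) (a n)" and "t n = spt 2 (Q n) (c n)" and "z n = complex_of_nat (Q n)" for n
  \<comment> \<open>The Chebyshev angle satisfies \<omega>^2 ~ 2 - 2 cos \<omega> = 2 - D, and 2 - D
    is linear in the displacement of order 1/(Q p)^2. This is the origin of the argument -D' a /
    p^2.\<close>
  have Dlim: "(\<lambda>n. (of_nat (Q n))\<^sup>2 * (2 - 2 * (D (spt 2 (Q n) (b n)) / 2))) \<longlonglongrightarrow> - deriv D t0 * b' / (of_nat p)\<^sup>2"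
    if b: "b \<longlonglongrightarrow> b'" for b b'
    using tendsto_minus[OF spt_deriv(1)[OF Q b _ holomorphic_has_derivative[OF holomorphic_D], of 2]]
    by (simp add: D\<theta> algebra_simps)
  obtain \<omega> where w: "\<And>n. D (s n) / 2 = cos (\<omega> n)" "\<omega> \<longlonglongrightarrow> 0" "(\<lambda>n. (z n * \<omega> n)\<^sup>2) \<longlonglongrightarrow> - deriv D t0 * a' / (of_nat p)\<^sup>2"
    using cheb_angle_sequence[OF Q Dlim[OF a]] unfolding s_def z_def by blast
  obtain \<eta> where h: "\<And>n. D (t n) / 2 = cos (\<eta> n)" "\<eta> \<longlonglongrightarrow> 0" "(\<lambda>n. (z n * \<eta> n)\<^sup>2) \<longlonglongrightarrow> - deriv D t0 * c' / (of_nat p)\<^sup>2"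
    using cheb_angle_sequence[OF Q Dlim[OF c]] unfolding t_def z_def by blast
  have "(\<lambda>n. sincq ((\<omega> n)\<^sup>2)) \<longlonglongrightarrow> sincq (0\<^sup>2)" "(\<lambda>n. sincq ((\<eta> n)\<^sup>2)) \<longlonglongrightarrow> sincq (0\<^sup>2)" by (intro tendsto_intros w h)+
  then have sw: "(\<lambda>n. sincq ((\<omega> n)\<^sup>2)) \<longlonglongrightarrow> 1" and sh: "(\<lambda>n. sincq ((\<eta> n)\<^sup>2)) \<longlonglongrightarrow> 1" by simp_all
  have nz: "\<forall>\<^sub>F n in sequentially. sincq ((\<omega> n)\<^sup>2) \<noteq> 0" "\<forall>\<^sub>F n in sequentially. sincq ((\<eta> n)\<^sup>2) \<noteq> 0"
    using tendsto_imp_eventually_ne[OF sw, of 0] tendsto_imp_eventually_ne[OF sh, of 0] by simp_all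
  \<comment> \<open>The phase accumulated over all Q periods. As s - t is of order 1/Q^2, it is of
    order 1/Q and drops out of the limit.\<close>
  define \<delta> where "\<delta> n = of_nat (Q n * p) * (\<i> * (s n - t n) / 2)" for n
  have "(\<lambda>n. of_nat p * (\<i> * (of_nat (Q n) ^ 1 * (a n / of_nat (Q n * p) ^ 2) - of_nat (Q n) ^ 1 * (c n / of_nat (Q n * p) ^ 2)) / 2))
      \<longlonglongrightarrow> of_nat p * (\<i> * (0 - 0) / 2)"
    by (intro tendsto_intros scaled_tendsto_0[OF Q a] scaled_tendsto_0[OF Q c]) auto
  then have \<delta>0: "\<delta> \<longlonglongrightarrow> 0" unfolding \<delta>_def[abs_def] s_def t_def spt_def by (simp add: algebra_simps)
  have st0: "(\<lambda>n. exp (\<i> * (s n - t n) / 2) ^ r) \<longlonglongrightarrow> exp (\<i> * (t0 - t0) / 2) ^ r" for r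
    unfolding s_def t_def by (intro tendsto_intros spt_tendsto[OF Q a] spt_tendsto[OF Q c]) auto
  \<comment> \<open>For a fixed residue r modulo p the summands are samples at u = q/Q of a product
    of two profiles, that is, a Riemann sum.\<close>
  have main: "(\<lambda>n. (\<Sum>q<Q n. exp (\<i> * (s n - t n) / 2) ^ (q * p + r) * X (s n) (q * p + r) * Y (t n) (q * p + r)) / z n ^ (2 * e + 1)) \<longlonglongrightarrow>
     exp (\<i> * (t0 - t0) / 2) ^ r * integral {0..1} (\<lambda>u. edge_profile u (- deriv D t0 * a' / (of_nat p)\<^sup>2) (x r) (rx r / 1) *
      edge_profile u (- deriv D t0 * c' / (of_nat p)\<^sup>2) (y r) (ry r / 1))" for r
  proof (rule Lim_transform_eventually[OF tendsto_mult[OF st0 edge_Riemann_sum[OF Q \<delta>0 w(3) h(3) Xl tendsto_divide[OF Rxl sw] Yl tendsto_divide[OF Ryl sh]]]])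
    have "\<forall>\<^sub>F n in sequentially. Q n \<ge> 1" using Q by (simp add: filterlim_at_top)
    then show "\<forall>\<^sub>F n in sequentially. exp (\<i> * (s n - t n) / 2) ^ r * ((\<Sum>q<Q n. let u = real q / real (Q n) in exp (of_real u * \<delta> n) *
        edge_profile u ((z n * \<omega> n)\<^sup>2) (X (spt 2 (Q n) (a n)) r / of_nat (Q n) ^ e) (of_nat (Q n) * Rx r (spt 2 (Q n) (a n)) / of_nat (Q n) ^ e / sincq ((\<omega> n)\<^sup>2)) *
        edge_profile u ((z n * \<eta> n)\<^sup>2) (Y (spt 2 (Q n) (c n)) r / of_nat (Q n) ^ e) (of_nat (Q n) * Ry r (spt 2 (Q n) (c n)) / of_nat (Q n) ^ e / sincq ((\<eta> n)\<^sup>2))) / of_nat (Q n)) =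
      (\<Sum>q<Q n. exp (\<i> * (s n - t n) / 2) ^ (q * p + r) * X (s n) (q * p + r) * Y (t n) (q * p + r)) / z n ^ (2 * e + 1)"
      using nz unfolding s_def[symmetric] t_def[symmetric] z_def[symmetric]
    proof eventually_elim
      case (elim n)
      have z: "z n \<noteq> 0" using elim by (simp add: z_def)
      have u: "complex_of_real (real q / real (Q n)) = of_nat q / z n" for q by (simp add: z_def)
      have profile: "edge_profile (real q / real (Q n)) ((z n * v)\<^sup>2) (F / z n ^ e) (z n * G / z n ^ e / k)
        = (cosq ((of_nat q * v)\<^sup>2) * F + of_nat q * sincq ((of_nat q * v)\<^sup>2) / k * G) / z n ^ e" for q v F G k
      proof -
        have "of_real ((real q / real (Q n))\<^sup>2) * (z n * v)\<^sup>2 = (of_nat q * v)\<^sup>2"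
          unfolding of_real_power u using z by (simp add: power_divide power_mult_distrib)
        then show ?thesis unfolding edge_profile_def u using z by (simp add: add_divide_distrib mult_ac)
      qed
      have e: "exp (of_real (real q / real (Q n)) * \<delta> n) = exp (\<i> * (s n - t n) / 2) ^ (q * p)" for q
        unfolding u \<delta>_def using z by (simp add: z_def exp_of_nat_mult[symmetric] mult_ac)
      have "X (s n) (q * p + r) = cosq ((of_nat q * \<omega> n)\<^sup>2) * X (s n) r + of_nat q * sincq ((of_nat q * \<omega> n)\<^sup>2) / sincq ((\<omega> n)\<^sup>2) * Rx r (s n)"
        "Y (t n) (q * p + r) = cosq ((of_nat q * \<eta> n)\<^sup>2) * Y (t n) r + of_nat q * sincq ((of_nat q * \<eta> n)\<^sup>2) / sincq ((\<eta> n)\<^sup>2) * Ry r (t n)" for q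
        unfolding XY_block w(1) h(1) using elim by (simp_all only: cheb_cosq not_False_eq_True)
      note summand = e profile this[symmetric]
      \<comment> \<open>One power Q^e for each of the two solutions and one factor Q for the
        mesh.\<close>
      have z2: "z n ^ (2 * e + 1) = z n ^ e * z n ^ e * z n" by (simp add: power_add mult_2)
      show ?case unfolding Let_def summand unfolding sum_divide_distrib sum_distrib_left z2
        using z by (intro sum.cong refl) (simp add: power_add field_simps)
    qed
  qed auto
  have "(\<lambda>n. \<Sum>r<p. (\<Sum>q<Q n. exp (\<i> * (s n - t n) / 2) ^ (q * p + r) * X (s n) (q * p + r) * Y (t n) (q * p + r)) / z n ^ (2 * e + 1)) \<longlonglongrightarrow>
     (\<Sum>r<p. exp (\<i> * (t0 - t0) / 2) ^ r * integral {0..1} (\<lambda>u. edge_profile u (- deriv D t0 * a' / (of_nat p)\<^sup>2) (x r) (rx r / 1) *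
      edge_profile u (- deriv D t0 * c' / (of_nat p)\<^sup>2) (y r) (ry r / 1)))"
    by (intro tendsto_sum main)
  then show ?thesis
    unfolding ker_def sum_nat_blocks s_def[symmetric] t_def[symmetric] z_def[symmetric] sum_divide_distrib[symmetric] by simp
qed

text \<open>At D = 2 the U part grows like q and its coefficient does not vanish, so the solutions
  grow linearly and the kernel cubically. Divided by Q the T part disappears, and only sinc profiles
  survive.\<close>

lemma ker_edge_nonresonant:
  assumes \<kappa>: "\<kappa> t0 \<noteq> 0"
  obtains c0 :: real where "c0 > 0"
    "\<And>Q a c a' c'. filterlim Q at_top sequentially \<Longrightarrow> a \<longlonglongrightarrow> a' \<Longrightarrow> c \<longlonglongrightarrow> c' \<Longrightarrow>
      (\<lambda>n. ker (Q n * p) (spt 2 (Q n) (a n)) (spt 2 (Q n) (c n)) / of_nat (Q n * p) ^ 3) \<longlonglongrightarrow>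
        of_real c0 * sin_kernel (- deriv D t0 * a' / (of_nat p)\<^sup>2) (- deriv D t0 * c' / (of_nat p)\<^sup>2)"
proof
  define c0 where "c0 = (\<Sum>r<p. (cmod (Rx r t0))\<^sup>2) / real p ^ 3"
  \<comment> \<open>At a real point \<rho>1 and \<rho>2 are conjugate, so they vanish together and
    \<kappa> with them.\<close>
  have "\<rho>1 t0 \<noteq> 0" using \<kappa> cnj_\<rho>(1)[of t0] by (auto simp: \<kappa>_def)
  then have "Rx 0 t0 \<noteq> 0" by (simp add: Rx_def)
  then have "0 < (\<Sum>r<p. (cmod (Rx r t0))\<^sup>2)"
    using p_pos by (intro sum_pos2[of _ 0]) auto
  then show "c0 > 0" using p_pos by (simp add: c0_def)
  fix Q :: "nat \<Rightarrow> nat" and a c :: "nat \<Rightarrow> complex" and a' c'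
  assume Q: "filterlim Q at_top sequentially" and a: "a \<longlonglongrightarrow> a'" and c: "c \<longlonglongrightarrow> c'"
  have Q1: "\<forall>\<^sub>F n in sequentially. Q n \<ge> 1" using Q by (simp add: filterlim_at_top)
  have lim: "(\<lambda>n. f (spt 2 (Q n) (b n)) / of_nat (Q n) ^ 1) \<longlonglongrightarrow> 0"
    "(\<lambda>n. of_nat (Q n) * f (spt 2 (Q n) (b n)) / of_nat (Q n) ^ 1) \<longlonglongrightarrow> f t0" if "f holomorphic_on UNIV" "b \<longlonglongrightarrow> b'" for f b b'
  proof -
    have l: "(\<lambda>n. f (spt 2 (Q n) (b n))) \<longlonglongrightarrow> f t0"
      by (rule spt_isCont[OF Q that(2) _ holomorphic_isCont[OF that(1)]]) simp
    show "(\<lambda>n. f (spt 2 (Q n) (b n)) / of_nat (Q n) ^ 1) \<longlonglongrightarrow> 0"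
      using tendsto_mult[OF l filterlim_compose[OF lim_inverse_n Q]] by (simp add: divide_inverse)
    show "(\<lambda>n. of_nat (Q n) * f (spt 2 (Q n) (b n)) / of_nat (Q n) ^ 1) \<longlonglongrightarrow> f t0"
      by (rule Lim_transform_eventually[OF l]) (use Q1 in \<open>auto elim: eventually_mono\<close>)
  qed
  have "edge_profile u A 0 (Rx r t0) * edge_profile u B 0 (Ry r t0)
    = of_real ((cmod (Rx r t0))\<^sup>2) * (of_real (u\<^sup>2) * sincq (of_real (u\<^sup>2) * A) * sincq (of_real (u\<^sup>2) * B))" for u r A B
    using complex_norm_square[of "Rx r t0"] cnj_R[of r t0] by (simp add: edge_profile_def power2_eq_square)
  then have I: "integral {0..1} (\<lambda>u. edge_profile u A 0 (Rx r t0) * edge_profile u B 0 (Ry r t0))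
    = of_real ((cmod (Rx r t0))\<^sup>2) * sin_kernel A B" for r A B
    unfolding sin_kernel_def by simp
  have ker_lim: "(\<lambda>n. ker (Q n * p) (spt 2 (Q n) (a n)) (spt 2 (Q n) (c n)) / of_nat (Q n) ^ (2 * 1 + 1)) \<longlonglongrightarrow>
    (\<Sum>r<p. integral {0..1} (\<lambda>u. edge_profile u (- deriv D t0 * a' / (of_nat p)\<^sup>2) 0 (Rx r t0) *
      edge_profile u (- deriv D t0 * c' / (of_nat p)\<^sup>2) 0 (Ry r t0)))"
    by (rule ker_edge_tendsto[OF Q a c]) (intro lim[OF _ a] lim[OF _ c] sol_holomorphic holomorphic_R)+
  have e: "2 * 1 + 1 = (3::nat)" by simp
  from ker_lim have "(\<lambda>n. ker (Q n * p) (spt 2 (Q n) (a n)) (spt 2 (Q n) (c n)) / of_nat (Q n) ^ (2 * 1 + 1) / of_nat p ^ 3) \<longlonglongrightarrow>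
     (\<Sum>r<p. of_real ((cmod (Rx r t0))\<^sup>2) * sin_kernel (- deriv D t0 * a' / (of_nat p)\<^sup>2) (- deriv D t0 * c' / (of_nat p)\<^sup>2)) / of_nat p ^ 3"
    unfolding I using p_pos by (intro tendsto_divide tendsto_const) auto
  then show "(\<lambda>n. ker (Q n * p) (spt 2 (Q n) (a n)) (spt 2 (Q n) (c n)) / of_nat (Q n * p) ^ 3) \<longlonglongrightarrow>
        of_real c0 * sin_kernel (- deriv D t0 * a' / (of_nat p)\<^sup>2) (- deriv D t0 * c' / (of_nat p)\<^sup>2)"
    unfolding c0_def e by (simp add: power_mult_distrib sum_distrib_right)
qed

text \<open>At a resonance (1,1) is fixed by the monodromy matrix, so the coefficient of the U part
  vanishes at the edge. At distance of order 1/Q^2 it is of order 1/Q^2, which a factor q of at most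
  Q cannot compensate: the solutions stay bounded and the kernel grows linearly.\<close>

lemma ker_edge_resonant:
  assumes \<kappa>: "\<kappa> t0 = 0"
  obtains c0 :: real where "c0 > 0"
    "\<And>Q a c a' c'. filterlim Q at_top sequentially \<Longrightarrow> a \<longlonglongrightarrow> a' \<Longrightarrow> c \<longlonglongrightarrow> c' \<Longrightarrow>
      (\<lambda>n. ker (Q n * p) (spt 2 (Q n) (a n)) (spt 2 (Q n) (c n)) / of_nat (Q n * p) ^ 1) \<longlonglongrightarrow>
        of_real c0 * cos_kernel (- deriv D t0 * a' / (of_nat p)\<^sup>2) (- deriv D t0 * c' / (of_nat p)\<^sup>2)"
proof
  define c0 where "c0 = (\<Sum>r<p. (cmod (X t0 r))\<^sup>2) / real p"
  have "0 < (\<Sum>r<p. (cmod (X t0 r))\<^sup>2)"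
    using p_pos by (intro sum_pos2[of _ 0]) auto
  then show "c0 > 0" using p_pos by (simp add: c0_def)
  have \<rho>12: "\<rho>1 t0 = \<rho>2 t0" using \<kappa> by (simp add: \<kappa>_def)
  \<comment> \<open>With D = 2 the traceless part squares to zero. If it maps (1,1) to a multiple of
    (1,1), that multiple squares to zero as well.\<close>
  have "r11 t0 * \<rho>1 t0 + m12 t0 * \<rho>1 t0 = 0"
    using R_\<rho>(1)[of t0] D\<theta> \<rho>12 by simp
  then have "\<rho>1 t0 * \<rho>1 t0 = 0"
    by (simp only: \<rho>1_def[of t0] algebra_simps)
  then have \<rho>0: "\<rho>1 t0 = 0" "\<rho>2 t0 = 0" using \<rho>12 by auto
  have R0: "Rx r t0 = 0" "Ry r t0 = 0" for r
    unfolding Rx_def Ry_def by (subst sol_linear, simp add: \<rho>0)+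
  fix Q :: "nat \<Rightarrow> nat" and a c :: "nat \<Rightarrow> complex" and a' c'
  assume Q: "filterlim Q at_top sequentially" and a: "a \<longlonglongrightarrow> a'" and c: "c \<longlonglongrightarrow> c'"
  have l0: "(\<lambda>n. of_nat (Q n) * f (spt 2 (Q n) (b n)) / of_nat (Q n) ^ 0) \<longlonglongrightarrow> 0"
    if "f holomorphic_on UNIV" "f t0 = 0" "b \<longlonglongrightarrow> b'" for f b b'
    using spt_deriv(2)[OF Q that(3) _ holomorphic_has_derivative[OF that(1)], of 2 1] that(2) by simp
  have l1: "(\<lambda>n. f (spt 2 (Q n) (b n)) / of_nat (Q n) ^ 0) \<longlonglongrightarrow> f t0" if "f holomorphic_on UNIV" "b \<longlonglongrightarrow> b'" for f b b'
    using spt_isCont[OF Q that(2) _ holomorphic_isCont[OF that(1)], of 2] by simp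
  have "edge_profile u A (X t0 r) 0 * edge_profile u B (Y t0 r) 0
    = of_real ((cmod (X t0 r))\<^sup>2) * (cosq (of_real (u\<^sup>2) * A) * cosq (of_real (u\<^sup>2) * B))" for u r A B
    using complex_norm_square[of "X t0 r"] cnj_XY(1)[of t0 r] by (simp add: edge_profile_def)
  then have I: "integral {0..1} (\<lambda>u. edge_profile u A (X t0 r) 0 * edge_profile u B (Y t0 r) 0)
    = of_real ((cmod (X t0 r))\<^sup>2) * cos_kernel A B" for r A B
    unfolding cos_kernel_def by simp
  have "(\<lambda>n. ker (Q n * p) (spt 2 (Q n) (a n)) (spt 2 (Q n) (c n)) / of_nat (Q n) ^ (2 * 0 + 1)) \<longlonglongrightarrow>
    (\<Sum>r<p. integral {0..1} (\<lambda>u. edge_profile u (- deriv D t0 * a' / (of_nat p)\<^sup>2) (X t0 r) 0 *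
      edge_profile u (- deriv D t0 * c' / (of_nat p)\<^sup>2) (Y t0 r) 0))"
    by (rule ker_edge_tendsto[OF Q a c]) (intro l0[OF _ _ a] l0[OF _ _ c] l1[OF _ a] l1[OF _ c] sol_holomorphic holomorphic_R R0)+
  then have "(\<lambda>n. ker (Q n * p) (spt 2 (Q n) (a n)) (spt 2 (Q n) (c n)) / of_nat (Q n) ^ (2 * 0 + 1) / of_nat p) \<longlonglongrightarrow>
     (\<Sum>r<p. of_real ((cmod (X t0 r))\<^sup>2) * cos_kernel (- deriv D t0 * a' / (of_nat p)\<^sup>2) (- deriv D t0 * c' / (of_nat p)\<^sup>2)) / of_nat p"
    unfolding I using p_pos by (intro tendsto_divide tendsto_const) auto
  then show "(\<lambda>n. ker (Q n * p) (spt 2 (Q n) (a n)) (spt 2 (Q n) (c n)) / of_nat (Q n * p) ^ 1) \<longlonglongrightarrow>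
        of_real c0 * cos_kernel (- deriv D t0 * a' / (of_nat p)\<^sup>2) (- deriv D t0 * c' / (of_nat p)\<^sup>2)"
    unfolding c0_def by (simp add: sum_distrib_right)
qed

end

section \<open>Band interiors\<close>

lemma csinc_sincq: "csinc z = sincq (z\<^sup>2)"
  using sincq_power2[of z] by (auto simp: csinc_def field_simps)

lemma holomorphic_csinc: "csinc holomorphic_on UNIV"
proof -
  have "deriv sin (0::complex) = 1" by (rule DERIV_imp_deriv) (auto intro!: derivative_eq_intros)
  then show ?thesis
    by (intro pole_theorem_open_0[of sin UNIV 0 csinc]) (auto intro!: holomorphic_intros simp: csinc_def)
qed

text \<open>The phases \<open>x n\<close> may run to infinity along the real axis; the addition
  theorems leave only the convergent complex part to be bounded.\<close>

lemma sin_cos_bounded_strip: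
  fixes e :: "nat \<Rightarrow> complex" and x :: "nat \<Rightarrow> real"
  assumes "e \<longlonglongrightarrow> l"
  obtains B where "\<And>n. cmod (sin (of_real (x n) + e n)) \<le> B" "\<And>n. cmod (cos (of_real (x n) + e n)) \<le> B"
proof -
  have "(\<lambda>n. cmod (cos (e n)) + cmod (sin (e n))) \<longlonglongrightarrow> cmod (cos l) + cmod (sin l)"
    by (intro tendsto_intros assms)
  then have "Bseq (\<lambda>n. cmod (cos (e n)) + cmod (sin (e n)))"
    using convergent_imp_Bseq convergent_def by blast
  then obtain B where "\<And>n. norm (cmod (cos (e n)) + cmod (sin (e n))) \<le> B" by (auto simp: Bseq_def)
  then have B: "cmod (cos (e n)) + cmod (sin (e n)) \<le> B" for n by (metis abs_ge_self order_trans real_norm_def)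
  have u: "cmod (sin (of_real (x n)) * w) \<le> cmod w" "cmod (cos (of_real (x n)) * w) \<le> cmod w" for n w
    by (simp_all add: norm_mult sin_of_real cos_of_real mult_left_le_one_le)
  show thesis
  proof (rule that)
    fix n
    have "cmod (sin (of_real (x n) + e n)) \<le> cmod (cos (e n)) + cmod (sin (e n))"
      unfolding sin_add by (rule norm_triangle_le) (intro add_mono u)
    then show "cmod (sin (of_real (x n) + e n)) \<le> B" using B[of n] by linarith
    have "cmod (cos (of_real (x n) + e n)) \<le> cmod (cos (e n)) + cmod (sin (e n))"
      unfolding cos_add by (rule norm_triangle_le_diff) (intro add_mono u)
    then show "cmod (cos (of_real (x n) + e n)) \<le> B" using B[of n] by linarith
  qed
qed

context periodic_verblunsky
begin

lemma D_real: "D (of_real s) = of_real (Re (D (of_real s)))"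
  using cnj_D[of "of_real s"] by (simp add: complex_eq_iff)

lemma cnj_deriv:
  assumes f: "f holomorphic_on UNIV" and g: "\<And>s. cnj (f s) = g (cnj s)"
  shows "cnj (deriv f (of_real s)) = deriv g (of_real s)"
proof -
  have "(f has_field_derivative deriv f (of_real s)) (at (cnj (of_real s)))"
    using holomorphic_has_derivative[OF f] by simp
  from has_field_derivative_cnj_cnj[OF this]
  have "((cnj \<circ> f \<circ> cnj) has_field_derivative cnj (deriv f (of_real s))) (at (of_real s))" .
  moreover have "cnj \<circ> f \<circ> cnj = g" by (auto simp: fun_eq_iff g)
  ultimately show ?thesis using DERIV_imp_deriv by metis
qed

lemma deriv_D_real: "deriv D (of_real s) = of_real (Re (deriv D (of_real s)))"
  using cnj_deriv[OF holomorphic_D cnj_D, of s] by (simp add: complex_eq_iff)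

lemma Re_D_deriv: "((\<lambda>t. Re (D (of_real t))) has_real_derivative Re (deriv D (of_real s))) (at s)"
  by (intro has_field_derivative_Re has_vector_derivative_real_field holomorphic_has_derivative holomorphic_D)

lemma Delta_cis: "Delta \<alpha> p (cis s) = D (of_real s)"
  using Delta_eq_D[of "of_real s"] by (simp add: cis_conv_exp)

lemma W_eq: "W \<alpha> p s = Re (deriv D (of_real s))"
  unfolding W_def Delta_cis by (rule DERIV_imp_deriv[OF Re_D_deriv])

text \<open>Differentiating D = 2 cos \<eta> gives |W| = 2 |sin \<eta>| |\<eta>'|, while sqrt(4 -
  D^2) = 2 |sin \<eta>|. So V is the derivative of the quasi-momentum per step of the recursion, in
  modulus.\<close>

lemma V_open_phase:
  assumes \<eta>: "(\<eta> has_field_derivative d) (at (of_real s))" and cos: "\<forall>\<^sub>F z in nhds (of_real s). cos (\<eta> z) = D z / 2"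
    and nz: "sin (\<eta> (of_real s)) \<noteq> 0" and le: "\<bar>Re (D (of_real s))\<bar> \<le> 2"
  shows "V_open \<alpha> p s = cmod d / p"
proof -
  have "((\<lambda>z. 2 * cos (\<eta> z)) has_field_derivative 2 * (- sin (\<eta> (of_real s)) * d)) (at (of_real s))"
    by (rule derivative_eq_intros \<eta> refl | simp)+
  moreover have "\<forall>\<^sub>F z in nhds (of_real s). 2 * cos (\<eta> z) = D z" using cos by eventually_elim (simp add: mult.commute)
  ultimately have "(D has_field_derivative 2 * (- sin (\<eta> (of_real s)) * d)) (at (of_real s))"
    by (simp add: DERIV_cong_ev)
  then have "deriv D (of_real s) = 2 * (- sin (\<eta> (of_real s)) * d)" by (rule DERIV_imp_deriv)
  then have W: "\<bar>W \<alpha> p s\<bar> = 2 * cmod (sin (\<eta> (of_real s))) * cmod d"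
    unfolding W_eq norm_of_real[symmetric, where 'a=complex] deriv_D_real[symmetric] by (simp add: norm_mult)
  have e: "2 * cos (\<eta> (of_real s)) = of_real (Re (D (of_real s)))"
    using eventually_nhds_x_imp_x[OF cos] by (subst D_real[symmetric]) (simp add: mult.commute)
  have "of_real (4 - (Re (D (of_real s)))\<^sup>2) = (2 * sin (\<eta> (of_real s)))\<^sup>2"
    by (simp only: of_real_diff of_real_power e[symmetric]) (simp add: power_mult_distrib sin_squared_eq)
  from arg_cong[OF this, of cmod] have "\<bar>4 - (Re (D (of_real s)))\<^sup>2\<bar> = (2 * cmod (sin (\<eta> (of_real s))))\<^sup>2"
    by (simp only: norm_of_real norm_power norm_mult norm_numeral)
  moreover have "0 \<le> 4 - (Re (D (of_real s)))\<^sup>2" using power_mono[OF le abs_ge_zero, of 2] by simp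
  ultimately have "4 - (Re (D (of_real s)))\<^sup>2 = (2 * cmod (sin (\<eta> (of_real s))))\<^sup>2" by linarith
  then have "sqrt (4 - (Re (D (of_real s)))\<^sup>2) = 2 * cmod (sin (\<eta> (of_real s)))"
    by (simp only: real_sqrt_abs) simp
  then show ?thesis using nz by (simp add: V_open_def Delta_cis W)
qed

end

text \<open>Near an interior point of a band the solutions oscillate with the quasi-momentum \<open>\<eta>\<close>, and this remains true
  at a closed gap, where \<^term>\<open>sin \<circ> \<eta>\<close> and both residual amplitudes have a simple zero.\<close>

locale band_phase = periodic_point +
  fixes \<eta> g1 g2 :: "complex \<Rightarrow> complex" and r v :: real
  assumes \<eta>_deriv: "(\<eta> has_field_derivative of_real (real p * v)) (at t0)" and \<eta>_t0: "\<eta> t0 = of_real r"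
    and near: "\<forall>\<^sub>F s in nhds t0. cos (\<eta> s) = D s / 2 \<and> \<rho>1 s = sin (\<eta> s) * g1 s \<and> \<rho>2 s = sin (\<eta> s) * g2 s"
    and g_cont: "isCont g1 t0" "isCont g2 t0" and g_ne: "g1 t0 \<noteq> g2 t0"
begin

definition wronskian :: "nat \<Rightarrow> complex \<Rightarrow> complex \<Rightarrow> complex" where
  "wronskian q s t = (let x = of_nat q * \<eta> s; y = of_nat q * \<eta> t in
     sin x * cos y * (g1 s - g2 s) - cos x * sin y * (g1 t - g2 t) + sin x * sin y * (g1 s * g2 t - g2 s * g1 t))"

text \<open>The factor sin \<eta> in \<rho>1 and \<rho>2 cancels the denominator of U = sin(q
  \<eta>) / sin \<eta>. The resulting identities stay valid where sin \<eta> = 0, that is, at a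
  closed gap.\<close>

lemma cheb_phase:
  assumes "cos (\<eta> s) = D s / 2" "\<rho>1 s = sin (\<eta> s) * g1 s" "\<rho>2 s = sin (\<eta> s) * g2 s"
  shows "fst (cheb (D s / 2) q) = cos (of_nat q * \<eta> s)"
    "snd (cheb (D s / 2) q) * \<rho>1 s = sin (of_nat q * \<eta> s) * g1 s"
    "snd (cheb (D s / 2) q) * \<rho>2 s = sin (of_nat q * \<eta> s) * g2 s"
  using cheb_cos[of "\<eta> s" q] assms by (simp_all add: mult_ac)

lemma ker_wronskian:
  assumes s: "cos (\<eta> s) = D s / 2" "\<rho>1 s = sin (\<eta> s) * g1 s" "\<rho>2 s = sin (\<eta> s) * g2 s"
    and t: "cos (\<eta> t) = D t / 2" "\<rho>1 t = sin (\<eta> t) * g1 t" "\<rho>2 t = sin (\<eta> t) * g2 t"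
  shows "(exp (\<i> * (s - t)) - 1) * ker (q * p) s t = exp (\<i> * (s - t) / 2) ^ (q * p) * wronskian q s t"
proof -
  define S S' where "S = snd (cheb (D s / 2) q)" and "S' = snd (cheb (D t / 2) q)"
  define C C' where "C = fst (cheb (D s / 2) q)" and "C' = fst (cheb (D t / 2) q)"
  have C: "C = cos (of_nat q * \<eta> s)" "C' = cos (of_nat q * \<eta> t)"
    unfolding C_def C'_def by (rule cheb_phase[OF s] cheb_phase[OF t])+
  have S: "S * \<rho>1 s = sin (of_nat q * \<eta> s) * g1 s" "S * \<rho>2 s = sin (of_nat q * \<eta> s) * g2 s"
    "S' * \<rho>1 t = sin (of_nat q * \<eta> t) * g1 t" "S' * \<rho>2 t = sin (of_nat q * \<eta> t) * g2 t"
    unfolding S_def S'_def by (rule cheb_phase[OF s] cheb_phase[OF t])+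
  have "S * C' * \<kappa> s - C * S' * \<kappa> t + S * S' * (\<rho>1 s * \<rho>2 t - \<rho>2 s * \<rho>1 t)
    = (S * \<rho>1 s - S * \<rho>2 s) * C' - C * (S' * \<rho>1 t - S' * \<rho>2 t) + (S * \<rho>1 s * (S' * \<rho>2 t) - S * \<rho>2 s * (S' * \<rho>1 t))"
    by (simp add: \<kappa>_def algebra_simps)
  also have "\<dots> = wronskian q s t"
    unfolding S C wronskian_def Let_def by (simp add: algebra_simps)
  finally show ?thesis
    unfolding ker_CD S_def[symmetric] S'_def[symmetric] C_def[symmetric] C'_def[symmetric] by (simp only:)
qed

text \<open>With g1 and g2 frozen at the base point the expression collapses to (g1 - g2) sin(x -
  y), and x - y converges although x and y do not. All corrections are bounded oscillating factors
  times null sequences.\<close>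

lemma wronskian_tendsto:
  assumes Q: "filterlim Q at_top sequentially" and a: "a \<longlonglongrightarrow> a'" and c: "c \<longlonglongrightarrow> c'"
  shows "(\<lambda>n. wronskian (Q n) (spt 1 (Q n) (a n)) (spt 1 (Q n) (c n))) \<longlonglongrightarrow> (g1 t0 - g2 t0) * sin (of_real v * (a' - c'))"
proof -
  define s t where "s n = spt 1 (Q n) (a n)" and "t n = spt 1 (Q n) (c n)" for n
  \<comment> \<open>The common phase Q r, which need not converge, is split off; only the deviations
    E and F have limits.\<close>
  define E F where "E n = of_nat (Q n) * (\<eta> (s n) - of_real r)" and "F n = of_nat (Q n) * (\<eta> (t n) - of_real r)" for n
  define x y where "x n = of_nat (Q n) * \<eta> (s n)" and "y n = of_nat (Q n) * \<eta> (t n)" for n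
  define k where "k = g1 t0 - g2 t0"
  have EF: "E \<longlonglongrightarrow> of_real v * a'" "F \<longlonglongrightarrow> of_real v * c'"
    using spt_deriv(1)[OF Q a order_refl \<eta>_deriv] spt_deriv(1)[OF Q c order_refl \<eta>_deriv] p_pos
    by (simp_all add: E_def[abs_def] F_def[abs_def] s_def t_def \<eta>_t0 mult.commute)
  have xy: "x n = of_real (real (Q n) * r) + E n" "y n = of_real (real (Q n) * r) + F n" for n
    by (simp_all add: x_def y_def E_def F_def algebra_simps)
  obtain B1 where B1: "\<And>n. cmod (sin (x n)) \<le> B1" "\<And>n. cmod (cos (x n)) \<le> B1"
    unfolding xy using sin_cos_bounded_strip[OF EF(1), where x="\<lambda>n. real (Q n) * r"] by blast
  obtain B2 where B2: "\<And>n. cmod (sin (y n)) \<le> B2" "\<And>n. cmod (cos (y n)) \<le> B2"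
    unfolding xy using sin_cos_bounded_strip[OF EF(2), where x="\<lambda>n. real (Q n) * r"] by blast
  have B0: "0 \<le> B1" "0 \<le> B2" using B1(1)[of 0] B2(1)[of 0] norm_ge_zero order_trans by blast+
  have vanish: "(\<lambda>n. f n * h n * e n) \<longlonglongrightarrow> 0"
    if "\<And>n. cmod (f n) \<le> B1" "\<And>n. cmod (h n) \<le> B2" "e \<longlonglongrightarrow> 0" for f h e
    by (rule lim_null_mult_left_bounded[where B="B1 * B2", OF always_eventually that(3)])
      (use that B0 in \<open>auto simp: norm_mult intro!: mult_mono\<close>)
  have gl: "(\<lambda>n. g1 (s n)) \<longlonglongrightarrow> g1 t0" "(\<lambda>n. g2 (s n)) \<longlonglongrightarrow> g2 t0" "(\<lambda>n. g1 (t n)) \<longlonglongrightarrow> g1 t0" "(\<lambda>n. g2 (t n)) \<longlonglongrightarrow> g2 t0"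
    unfolding s_def t_def by (intro spt_isCont[OF Q a] spt_isCont[OF Q c] g_cont order_refl)+
  have d: "(\<lambda>n. g1 (s n) - g2 (s n) - k) \<longlonglongrightarrow> 0" "(\<lambda>n. g1 (t n) - g2 (t n) - k) \<longlonglongrightarrow> 0"
    "(\<lambda>n. g1 (s n) * g2 (t n) - g2 (s n) * g1 (t n)) \<longlonglongrightarrow> 0"
    using tendsto_diff[OF tendsto_diff[OF gl(1,2)] tendsto_const, of k] tendsto_diff[OF tendsto_diff[OF gl(3,4)] tendsto_const, of k]
      tendsto_diff[OF tendsto_mult[OF gl(1,4)] tendsto_mult[OF gl(2,3)]] by (simp_all add: k_def mult.commute)
  have "(\<lambda>n. k * sin (E n - F n) + sin (x n) * cos (y n) * (g1 (s n) - g2 (s n) - k)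
      - cos (x n) * sin (y n) * (g1 (t n) - g2 (t n) - k) + sin (x n) * sin (y n) * (g1 (s n) * g2 (t n) - g2 (s n) * g1 (t n)))
    \<longlonglongrightarrow> k * sin (of_real v * a' - of_real v * c') + 0 - 0 + 0"
    by (intro tendsto_add tendsto_diff tendsto_mult tendsto_const tendsto_sin EF vanish d B1 B2)
  moreover have "k * sin (E n - F n) + sin (x n) * cos (y n) * (g1 (s n) - g2 (s n) - k)
      - cos (x n) * sin (y n) * (g1 (t n) - g2 (t n) - k) + sin (x n) * sin (y n) * (g1 (s n) * g2 (t n) - g2 (s n) * g1 (t n))
    = wronskian (Q n) (s n) (t n)" for n
  proof -
    have e: "sin (E n - F n) = sin (x n) * cos (y n) - cos (x n) * sin (y n)"
      using sin_diff[of "x n" "y n"] by (simp add: xy)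
    show ?thesis unfolding e wronskian_def Let_def x_def[symmetric] y_def[symmetric] by (simp add: algebra_simps)
  qed
  ultimately show ?thesis by (simp add: s_def t_def k_def right_diff_distrib)
qed

text \<open>The limit of the diagonal kernel divided by its degree. The divisor i comes from exp(i
  (s - t)) - 1 in the Christoffel-Darboux formula.\<close>

definition "amplitude = (g1 t0 - g2 t0) * of_real v / \<i>"

lemma ker_band_tendsto:
  assumes Q: "filterlim Q at_top sequentially" and a: "a \<longlonglongrightarrow> a'" and c: "c \<longlonglongrightarrow> c'"
  shows "(\<lambda>n. ker (Q n * p) (spt 1 (Q n) (a n)) (spt 1 (Q n) (c n)) / of_nat (Q n * p)) \<longlonglongrightarrow>
    amplitude * (exp (\<i> * (a' - c') / 2) * csinc (of_real v * (a' - c')))"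
proof (rule continuous_convergence_diagonal[where G="\<lambda>Q a c. ker (Q * p) (spt 1 Q a) (spt 1 Q c) / of_nat (Q * p)"
      and H="\<lambda>a c. amplitude * (exp (\<i> * (a - c) / 2) * csinc (of_real v * (a - c)))", OF _ _ _ _ Q a c])
  fix n c
  have "(\<lambda>s. ker (n * p) s (spt 1 n c)) \<circ> spt 1 n holomorphic_on UNIV"
    by (rule holomorphic_on_compose) (auto intro!: ker_holomorphic holomorphic_intros simp: spt_def[abs_def] divide_inverse)
  then show "(\<lambda>a. ker (n * p) (spt 1 n a) (spt 1 n c) / of_nat (n * p)) holomorphic_on UNIV"
    by (auto intro!: holomorphic_intros simp: o_def divide_inverse simp del: of_nat_mult)
next
  fix c
  have "csinc \<circ> (\<lambda>a. of_real v * (a - c)) holomorphic_on UNIV"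
    by (rule holomorphic_on_compose) (auto intro!: holomorphic_intros holomorphic_on_subset[OF holomorphic_csinc])
  then show "(\<lambda>a. amplitude * (exp (\<i> * (a - c) / 2) * csinc (of_real v * (a - c)))) holomorphic_on UNIV"
    by (auto intro!: holomorphic_intros simp: o_def)
next
  show "continuous_on UNIV (\<lambda>(a, c). amplitude * (exp (\<i> * (a - c) / 2) * csinc (of_real v * (a - c))))"
    unfolding csinc_sincq case_prod_beta by (intro continuous_intros) auto
next
  fix Q :: "nat \<Rightarrow> nat" and a c :: "nat \<Rightarrow> complex" and a' c'
  assume Q: "filterlim Q at_top sequentially" and a: "a \<longlonglongrightarrow> a'" and c: "c \<longlonglongrightarrow> c'" and ne: "a' \<noteq> c'"
  define s t where "s n = spt 1 (Q n) (a n)" and "t n = spt 1 (Q n) (c n)" for n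
  define N u where "N n = complex_of_nat (Q n * p)" and "u n = \<i> * (s n - t n)" for n
  have Q1: "\<forall>\<^sub>F n in sequentially. Q n \<ge> 1" using Q by (simp add: filterlim_at_top)
  have "(\<lambda>n. \<i> * (s n - t n)) \<longlonglongrightarrow> \<i> * (t0 - t0)"
    unfolding s_def t_def by (intro tendsto_intros spt_tendsto[OF Q a] spt_tendsto[OF Q c]) auto
  then have u0: "u \<longlonglongrightarrow> 0" by (simp add: u_def[abs_def])
  have Nu: "N n * u n = \<i> * (a n - c n)" if "Q n \<ge> 1" for n
    using that p_pos by (simp add: N_def u_def s_def t_def spt_def diff_divide_distrib[symmetric] del: of_nat_mult)
  have "(\<lambda>n. \<i> * (a n - c n)) \<longlonglongrightarrow> \<i> * (a' - c')" by (intro tendsto_intros a c)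
  then have "(\<lambda>n. N n * u n) \<longlonglongrightarrow> \<i> * (a' - c')"
    by (rule Lim_transform_eventually) (use Q1 Nu in \<open>auto elim!: eventually_mono\<close>)
  from exp_minus_one_tendsto_mult[OF u0 this]
  have E: "(\<lambda>n. N n * (exp (u n) - 1)) \<longlonglongrightarrow> \<i> * (a' - c')" .
  have "(\<lambda>n. exp (\<i> * (a n - c n) / 2) * wronskian (Q n) (s n) (t n) / (N n * (exp (u n) - 1)))
    \<longlonglongrightarrow> exp (\<i> * (a' - c') / 2) * ((g1 t0 - g2 t0) * sin (of_real v * (a' - c'))) / (\<i> * (a' - c'))"
    using ne unfolding s_def t_def by (intro tendsto_intros a c wronskian_tendsto[OF Q a c] E) auto
  moreover have "exp (\<i> * (a' - c') / 2) * ((g1 t0 - g2 t0) * sin (of_real v * (a' - c'))) / (\<i> * (a' - c'))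
    = amplitude * (exp (\<i> * (a' - c') / 2) * csinc (of_real v * (a' - c')))"
  proof -
    define d where "d = a' - c'"
    have "d \<noteq> 0" using ne by (simp add: d_def)
    then show ?thesis unfolding d_def[symmetric] by (simp add: csinc_def amplitude_def field_simps)
  qed
  moreover have "\<forall>\<^sub>F n in sequentially. N n * (exp (u n) - 1) \<noteq> 0"
    using tendsto_imp_eventually_ne[OF E, of 0] ne by simp
  with Q1 eventually_compose_filterlim[OF near spt_tendsto[OF Q a order_refl]] eventually_compose_filterlim[OF near spt_tendsto[OF Q c order_refl]]
  have "\<forall>\<^sub>F n in sequentially. exp (\<i> * (a n - c n) / 2) * wronskian (Q n) (s n) (t n) / (N n * (exp (u n) - 1))
    = ker (Q n * p) (s n) (t n) / N n"
    unfolding s_def[symmetric] t_def[symmetric]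
  proof eventually_elim
    case (elim n)
    have "exp (u n / 2) ^ (Q n * p) = exp (N n * u n / 2)" by (simp add: N_def exp_of_nat_mult[symmetric])
    also have "\<dots> = exp (\<i> * (a n - c n) / 2)" using Nu elim by simp
    finally have "(exp (u n) - 1) * ker (Q n * p) (s n) (t n) = exp (\<i> * (a n - c n) / 2) * wronskian (Q n) (s n) (t n)"
      using ker_wronskian[of "s n" "t n" "Q n"] elim by (simp add: u_def)
    then show ?case using elim by (simp add: field_simps)
  qed
  ultimately show "(\<lambda>n. ker (Q n * p) (spt 1 (Q n) (a n)) (spt 1 (Q n) (c n)) / of_nat (Q n * p))
    \<longlonglongrightarrow> amplitude * (exp (\<i> * (a' - c') / 2) * csinc (of_real v * (a' - c')))"
    by (simp add: tendsto_cong N_def s_def t_def)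
qed

text \<open>At a real point X and Y have equal modulus, and both C (g1 - g2) and S (g1 - g2) are
  linear combinations of X and Y. Since C^2 + S^2 = 1, X cannot be small.\<close>

lemma X_period_lower_bound:
  "(cmod (g1 t0 - g2 t0))\<^sup>2 \<le> ((cmod (g1 t0) + cmod (g2 t0))\<^sup>2 + 4) * (cmod (X t0 (q * p)))\<^sup>2"
proof -
  define C S where "C = cos (of_nat q * of_real r :: complex)" and "S = sin (of_nat q * of_real r :: complex)"
  have CS: "C = of_real (cos (real q * r))" "S = of_real (sin (real q * r))"
    by (simp_all add: C_def S_def flip: cos_of_real sin_of_real)
  have t0: "cos (\<eta> t0) = D t0 / 2" "\<rho>1 t0 = sin (\<eta> t0) * g1 t0" "\<rho>2 t0 = sin (\<eta> t0) * g2 t0"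
    using eventually_nhds_x_imp_x[OF near] by auto
  have XY: "X t0 (q * p) = C + S * g1 t0" "Y t0 (q * p) = C + S * g2 t0"
    by (simp_all add: sol_period cheb_phase[OF t0] \<eta>_t0 C_def S_def)
  have nY: "cmod (Y t0 (q * p)) = cmod (X t0 (q * p))"
    using cnj_XY(1)[of t0 "q * p"] by (metis complex_cnj_complex_of_real complex_mod_cnj)
  have "C * (g1 t0 - g2 t0) = g1 t0 * Y t0 (q * p) - g2 t0 * X t0 (q * p)" unfolding XY by (simp add: algebra_simps)
  also have "cmod \<dots> \<le> (cmod (g1 t0) + cmod (g2 t0)) * cmod (X t0 (q * p))"
    by (rule order_trans[OF norm_triangle_ineq4]) (simp add: norm_mult nY distrib_right)
  finally have 1: "(cmod (C * (g1 t0 - g2 t0)))\<^sup>2 \<le> ((cmod (g1 t0) + cmod (g2 t0)) * cmod (X t0 (q * p)))\<^sup>2"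
    by (intro power_mono) auto
  have "S * (g1 t0 - g2 t0) = X t0 (q * p) - Y t0 (q * p)" unfolding XY by (simp add: algebra_simps)
  also have "cmod \<dots> \<le> 2 * cmod (X t0 (q * p))"
    by (rule order_trans[OF norm_triangle_ineq4]) (simp add: nY)
  finally have 2: "(cmod (S * (g1 t0 - g2 t0)))\<^sup>2 \<le> (2 * cmod (X t0 (q * p)))\<^sup>2"
    by (intro power_mono) auto
  have "(cmod (g1 t0 - g2 t0))\<^sup>2 = ((cos (real q * r))\<^sup>2 + (sin (real q * r))\<^sup>2) * (cmod (g1 t0 - g2 t0))\<^sup>2"
    by (simp only: sin_cos_squared_add2 mult_1)
  also have "\<dots> = (cmod (C * (g1 t0 - g2 t0)))\<^sup>2 + (cmod (S * (g1 t0 - g2 t0)))\<^sup>2"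
    unfolding CS by (simp only: norm_mult power_mult_distrib distrib_right norm_of_real power2_abs)
  also have "\<dots> \<le> ((cmod (g1 t0) + cmod (g2 t0)) * cmod (X t0 (q * p)))\<^sup>2 + (2 * cmod (X t0 (q * p)))\<^sup>2"
    by (rule add_mono[OF 1 2])
  finally show ?thesis unfolding power_mult_distrib by (simp add: distrib_right[of "_\<^sup>2"])
qed

text \<open>In particular \<open>v\<close> does not vanish: the diagonal of the kernel grows at least linearly.\<close>

lemma amplitude_nonzero: "amplitude \<noteq> 0"
proof
  assume z: "amplitude = 0"
  define m where "m = (cmod (g1 t0 - g2 t0))\<^sup>2 / ((cmod (g1 t0) + cmod (g2 t0))\<^sup>2 + 4)"
  have pos: "0 < (cmod (g1 t0) + cmod (g2 t0))\<^sup>2 + 4" by (rule add_nonneg_pos) auto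
  then have m: "0 < m" using g_ne by (simp add: m_def)
  have mX: "m \<le> (cmod (X t0 (q * p)))\<^sup>2" for q
    using X_period_lower_bound[of q] pos by (simp add: m_def pos_divide_le_eq mult.commute)
  have id: "filterlim (\<lambda>n::nat. n) at_top sequentially" by (simp add: filterlim_ident)
  have "(\<lambda>n. ker (n * p) t0 t0 / of_nat (n * p)) \<longlonglongrightarrow> 0"
    using ker_band_tendsto[OF id tendsto_const[of 0] tendsto_const[of 0]] by (simp add: z spt_def)
  from tendsto_Re[OF this] have l: "(\<lambda>n. Re (ker (n * p) t0 t0 / of_nat (n * p))) \<longlonglongrightarrow> 0" by simp
  have "\<forall>\<^sub>F n in sequentially. m / real p \<le> Re (ker (n * p) t0 t0 / of_nat (n * p))"
    using eventually_gt_at_top[of 0]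
  proof eventually_elim
    case (elim n)
    have "real n * m = (\<Sum>i<n. m)" by simp
    also have "\<dots> \<le> (\<Sum>i<n. (cmod (X t0 (i * p + 0)))\<^sup>2)" using mX by (intro sum_mono) simp
    also have "\<dots> \<le> (\<Sum>r<p. \<Sum>i<n. (cmod (X t0 (i * p + r)))\<^sup>2)"
      using p_pos by (intro member_le_sum[of 0 "{..<p}" "\<lambda>r. \<Sum>i<n. (cmod (X t0 (i * p + r)))\<^sup>2"]) (auto intro: sum_nonneg)
    also have "\<dots> = Re (ker (n * p) t0 t0)"
      unfolding ker_real_diag sum_nat_blocks by simp
    finally have "real n * m / real (n * p) \<le> Re (ker (n * p) t0 t0) / real (n * p)" by (rule divide_right_mono) simp
    also have "\<dots> = Re (ker (n * p) t0 t0 / of_nat (n * p))" by (metis Re_divide_of_real of_real_of_nat_eq)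
    finally show ?case using elim by simp
  qed
  from tendsto_lowerbound[OF l this] have "m / real p \<le> 0" by simp
  then show False using m p_pos by (simp add: divide_le_0_iff)
qed

end

context periodic_point
begin

lemma isCont_eventually_nhds_ne:
  fixes f :: "complex \<Rightarrow> complex"
  shows "isCont f t0 \<Longrightarrow> f t0 \<noteq> c \<Longrightarrow> \<forall>\<^sub>F s in nhds t0. f s \<noteq> c"
  unfolding isCont_def tendsto_at_iff_tendsto_nhds by (rule tendsto_imp_eventually_ne)

text \<open>Where |D| < 2, Arccos is analytic at D/2 and sin \<eta> is nonzero, so \<eta> and the
  quotients of \<rho>1 and \<rho>2 by sin \<eta> can be written down directly.\<close>

lemma open_band_phase:
  assumes lt: "\<bar>Re (D t0)\<bar> < 2"
  shows "\<exists>\<eta> g1 g2 r v. band_phase \<alpha> p \<theta> \<eta> g1 g2 r v \<and> \<bar>v\<bar> = V_open \<alpha> p \<theta>"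
proof -
  define x where "x = Re (D t0) / 2"
  define y where "y = sqrt (1 - x\<^sup>2)"
  have Dx: "D t0 / 2 = of_real x" using D_real[of \<theta>] by (simp add: x_def)
  have x: "\<bar>x\<bar> < 1" using lt by (simp add: x_def)
  then have "x\<^sup>2 < 1" by (simp add: abs_square_less_1)
  then have y: "y > 0" by (simp add: y_def)
  define \<eta> where "\<eta> s = Arccos (D s / 2)" for s
  have \<eta>_t0: "\<eta> t0 = of_real (arccos x)" using of_real_arccos[of x] x by (simp add: \<eta>_def Dx)
  have sin_t0: "sin (\<eta> t0) = of_real y"
    unfolding \<eta>_t0 using sin_arccos[of x] x by (simp add: y_def sin_of_real)
  define v where "v = - Re (deriv D t0) / (2 * y * real p)"
  have "(Arccos has_field_derivative - inverse (sin (Arccos (D t0 / 2)))) (at (D t0 / 2))"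
    by (rule has_field_derivative_Arccos) (use x Dx in auto)
  then have "(Arccos has_field_derivative - inverse (of_real y)) (at (D t0 / 2))"
    using sin_t0 by (simp add: \<eta>_def)
  from DERIV_chain'[OF DERIV_cdivide[OF holomorphic_has_derivative[OF holomorphic_D], of 2] this]
  have "(\<eta> has_field_derivative - inverse (of_real y) * (deriv D t0 / 2)) (at t0)" unfolding \<eta>_def by simp
  moreover have "- inverse (of_real y) * (deriv D t0 / 2) = of_real (real p * v)"
    using p_pos by (subst deriv_D_real) (simp add: v_def field_simps)
  ultimately have \<eta>_deriv: "(\<eta> has_field_derivative of_real (real p * v)) (at t0)" by simp
  have sin_cont: "isCont (\<lambda>s. sin (\<eta> s)) t0" by (intro isCont_o2[OF DERIV_isCont[OF \<eta>_deriv]] isCont_sin)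
  have sin_ne: "sin (\<eta> t0) \<noteq> 0" using y by (simp add: sin_t0)
  \<comment> \<open>\<rho>1 and \<rho>2 are conjugate at a real point. If they agreed, the squared
    modulus of \<rho>1 would equal (D/2)^2 - 1, which is negative here.\<close>
  have \<rho>_ne: "\<rho>1 t0 \<noteq> \<rho>2 t0"
  proof
    assume eq: "\<rho>1 t0 = \<rho>2 t0"
    have "of_real ((cmod (\<rho>1 t0))\<^sup>2) = \<rho>1 t0 * \<rho>1 t0"
      using cnj_\<rho>(1)[of t0] eq by (simp only: complex_norm_square complex_cnj_complex_of_real)
    also have "\<dots> = (D t0 / 2)\<^sup>2 - 1"
      using R_\<rho>(1)[of t0] by (simp only: eq[symmetric]) (simp add: \<rho>1_def algebra_simps)
    also have "\<dots> = complex_of_real (x\<^sup>2 - 1)" by (simp add: Dx)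
    finally have "(cmod (\<rho>1 t0))\<^sup>2 = x\<^sup>2 - 1" by (simp only: of_real_eq_iff)
    then show False using \<open>x\<^sup>2 < 1\<close> zero_le_power2[of "cmod (\<rho>1 t0)"] by simp
  qed
  have "band_phase \<alpha> p \<theta> \<eta> (\<lambda>s. \<rho>1 s / sin (\<eta> s)) (\<lambda>s. \<rho>2 s / sin (\<eta> s)) (arccos x) v"
  proof unfold_locales
    show "\<forall>\<^sub>F s in nhds t0. cos (\<eta> s) = D s / 2 \<and> \<rho>1 s = sin (\<eta> s) * (\<rho>1 s / sin (\<eta> s)) \<and> \<rho>2 s = sin (\<eta> s) * (\<rho>2 s / sin (\<eta> s))"
      using isCont_eventually_nhds_ne[OF sin_cont sin_ne] by eventually_elim (simp add: \<eta>_def)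
    show "isCont (\<lambda>s. \<rho>1 s / sin (\<eta> s)) t0" "isCont (\<lambda>s. \<rho>2 s / sin (\<eta> s)) t0"
      by (intro isCont_divide holomorphic_isCont holomorphic_\<rho> sin_cont sin_ne)+
    show "\<rho>1 t0 / sin (\<eta> t0) \<noteq> \<rho>2 t0 / sin (\<eta> t0)" using \<rho>_ne sin_ne by simp
  qed (fact \<eta>_deriv \<eta>_t0)+
  moreover have "V_open \<alpha> p \<theta> = cmod (of_real (real p * v)) / p"
    by (rule V_open_phase[OF \<eta>_deriv _ sin_ne]) (use lt in \<open>simp_all add: \<eta>_def\<close>)
  then have "\<bar>v\<bar> = V_open \<alpha> p \<theta>" using p_pos by (simp add: norm_mult)
  ultimately show ?thesis by blast
qed

text \<open>The Christoffel-Darboux identity is differentiated at s = t. On the right exp(i (s - t))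
  - 1 vanishes, so only its derivative times the sum at t remains, and the conjugate initial values
  make this sum a sum of squares. The resulting positivity drives the analysis of closed
  gaps.\<close>

lemma CD_derivative:
  assumes eig: "sol \<alpha> t0 (v1, v2) p = (\<sigma> * v1, \<sigma> * v2)" and v: "v1 = cnj u2" "v2 = cnj u1"
    and G: "((\<lambda>s. fst (sol \<alpha> s (u1, u2) p) * v2 - snd (sol \<alpha> s (u1, u2) p) * v1) has_field_derivative G) (at t0)"
  shows "\<sigma> * (\<i> * of_nat p / 2 * (fst (sol \<alpha> t0 (u1, u2) p) * v2 - snd (sol \<alpha> t0 (u1, u2) p) * v1) + G)
    = \<i> * of_real (\<Sum>j<p. (cmod (fst (sol \<alpha> t0 (u1, u2) j)))\<^sup>2)"
proof -
  define g where "g s = fst (sol \<alpha> s (u1, u2) p) * v2 - snd (sol \<alpha> s (u1, u2) p) * v1" for s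
  define S where "S s = (\<Sum>j<p. exp (\<i> * (s - t0) / 2) ^ j * fst (sol \<alpha> s (u1, u2) j) * snd (sol \<alpha> t0 (v1, v2) j))" for s
  have gG: "(g has_field_derivative G) (at t0)" using G by (simp add: g_def[abs_def])
  have S_hol: "S holomorphic_on UNIV"
    unfolding S_def[abs_def] by (intro holomorphic_intros sol_holomorphic) auto
  have eq: "(\<lambda>s. exp (\<i> * (s - t0) / 2) ^ p * (\<sigma> * g s)) = (\<lambda>s. (u1 * v2 - u2 * v1) + (exp (\<i> * (s - t0)) - 1) * S s)"
    using sol_Christoffel_Darboux[where \<alpha>=\<alpha> and t=t0 and n=p and u="(u1, u2)" and v="(v1, v2)", OF \<alpha>_lt] eig
    by (simp add: fun_eq_iff S_def g_def algebra_simps)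
  have "((\<lambda>s. exp (\<i> * (s - t0) / 2) ^ p * (\<sigma> * g s)) has_field_derivative \<sigma> * (\<i> * of_nat p / 2 * g t0 + G)) (at t0)"
    by (rule derivative_eq_intros gG refl | simp)+ (simp add: algebra_simps)
  moreover have "((\<lambda>s. (u1 * v2 - u2 * v1) + (exp (\<i> * (s - t0)) - 1) * S s) has_field_derivative \<i> * S t0) (at t0)"
    by (rule derivative_eq_intros holomorphic_has_derivative[OF S_hol] refl | simp)+
  ultimately have "\<sigma> * (\<i> * of_nat p / 2 * g t0 + G) = \<i> * S t0"
    unfolding eq by (rule DERIV_unique)
  moreover have "S t0 = of_real (\<Sum>j<p. (cmod (fst (sol \<alpha> t0 (u1, u2) j)))\<^sup>2)"
    using sol_cnj(2)[of \<alpha> t0 "(u1, u2)"] by (simp add: S_def v flip: complex_norm_square)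
  ultimately show ?thesis by (simp add: g_def)
qed

end

section \<open>Closed gaps\<close>

locale closed_gap = periodic_point +
  fixes \<sigma> :: real
  assumes \<sigma>: "\<sigma> = 1 \<or> \<sigma> = - 1" and D_t0: "D t0 = 2 * of_real \<sigma>" and D'_t0: "deriv D t0 = 0"
begin

definition "X11 = deriv r11 t0"
definition "X12 = deriv m12 t0"
definition "X21 = deriv m21 t0"

lemma \<sigma>_square: "complex_of_real \<sigma> * of_real \<sigma> = 1" using \<sigma> by auto

lemma cnj_entries_deriv: "cnj X11 = - X11" "cnj X12 = X21" "cnj X21 = X12"
proof -
  have "deriv (\<lambda>s. - r11 s) t0 = - X11"
    unfolding X11_def by (rule DERIV_imp_deriv) (intro DERIV_minus holomorphic_has_derivative holomorphic_r11)
  then show "cnj X11 = - X11"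
    using cnj_deriv[OF holomorphic_r11, of "\<lambda>s. - r11 s" \<theta>] by (simp add: cnj_r11 X11_def)
  show "cnj X12 = X21" "cnj X21 = X12"
    using cnj_deriv[OF holomorphic_m(2), of m21 \<theta>] cnj_deriv[OF holomorphic_m(3), of m12 \<theta>]
    by (simp_all add: cnj_m X12_def X21_def)
qed

lemma sol_entries:
  "fst (sol \<alpha> s (u1, u2) p) = u1 * m11 s + u2 * m12 s" "snd (sol \<alpha> s (u1, u2) p) = u1 * m21 s + u2 * m22 s"
  by (subst sol_linear, simp add: m11_def m12_def m21_def m22_def)+

lemma sol_entries_deriv:
  "((\<lambda>s. fst (sol \<alpha> s (u1, u2) p) * v2 - snd (sol \<alpha> s (u1, u2) p) * v1) has_field_derivative
    (u1 * X11 + u2 * X12) * v2 - (u1 * X21 - u2 * X11) * v1) (at t0)"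
proof -
  have "((\<lambda>s. D s / 2 + r11 s) has_field_derivative (deriv D t0 / 2 + X11)) (at t0)"
    "((\<lambda>s. D s / 2 - r11 s) has_field_derivative (deriv D t0 / 2 - X11)) (at t0)"
    unfolding X11_def by (intro DERIV_add DERIV_diff DERIV_cdivide holomorphic_has_derivative holomorphic_D holomorphic_r11)+
  then have "(m11 has_field_derivative X11) (at t0)" "(m22 has_field_derivative - X11) (at t0)"
    by (simp_all add: D'_t0 flip: m_eq)
  then show ?thesis
    unfolding sol_entries X12_def X21_def
    by (auto intro!: derivative_eq_intros holomorphic_has_derivative holomorphic_m simp: algebra_simps)
qed

lemma CD_first_term:
  assumes "\<i> * complex_of_real (\<Sum>j<p. (cmod (fst (sol \<alpha> t0 (u1, u2) j)))\<^sup>2) = 0"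
  shows "u1 = 0"
proof -
  have "(\<Sum>j<p. (cmod (fst (sol \<alpha> t0 (u1, u2) j)))\<^sup>2) = 0" using assms by (simp del: of_real_sum)
  then have "\<forall>j\<in>{..<p}. (cmod (fst (sol \<alpha> t0 (u1, u2) j)))\<^sup>2 = 0" by (subst (asm) sum_nonneg_eq_0_iff) auto
  then have "(cmod (fst (sol \<alpha> t0 (u1, u2) 0)))\<^sup>2 = 0" using p_pos by blast
  then show ?thesis by simp
qed

text \<open>The monodromy matrix has a double eigenvalue. If it were not scalar, an eigenvector would contradict
  the derivative of the Christoffel-Darboux formula, whose right-hand side does not vanish.\<close>

lemma entries_t0: "m12 t0 = 0" "m21 t0 = 0" "r11 t0 = 0"
proof -
  define r y z where "r = r11 t0" and "y = m12 t0" and "z = m21 t0"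
  have ryz: "r\<^sup>2 + y * z = 0"
    using r_square[of t0] \<sigma>_square by (simp add: r_def y_def z_def D_t0 power2_eq_square)
  have cz: "cnj r = - r" "cnj y = z" using cnj_r11[of t0] cnj_m(2)[of t0] by (simp_all add: r_def y_def z_def)
  have m_t: "m11 t0 = of_real \<sigma> + r" "m22 t0 = of_real \<sigma> - r" unfolding m_eq D_t0 r_def by simp_all
  \<comment> \<open>(r, z) is the first column of the traceless part, which squares to zero, so the
    traceless part annihilates it. Its conjugate partner in \<open>CD_derivative\<close> is (y,
    -r).\<close>
  have eig: "sol \<alpha> t0 (r, z) p = (of_real \<sigma> * r, of_real \<sigma> * z)"
  proof (rule prod_eqI)
    have "r * (of_real \<sigma> + r) + z * y = of_real \<sigma> * r + (r\<^sup>2 + y * z)" by (simp add: power2_eq_square algebra_simps)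
    then show "fst (sol \<alpha> t0 (r, z) p) = fst (of_real \<sigma> * r, of_real \<sigma> * z)"
      unfolding sol_entries m_t y_def[symmetric] ryz by simp
    show "snd (sol \<alpha> t0 (r, z) p) = snd (of_real \<sigma> * r, of_real \<sigma> * z)"
      unfolding sol_entries m_t z_def[symmetric] by (simp add: algebra_simps)
  qed
  have "((\<lambda>s. (r11 s)\<^sup>2 + m12 s * m21 s) has_field_derivative (2 * r * X11 + (X12 * z + y * X21))) (at t0)"
    unfolding r_def y_def z_def X11_def X12_def X21_def
    by (rule derivative_eq_intros holomorphic_has_derivative holomorphic_m holomorphic_r11 refl | simp)+
  moreover have "((\<lambda>s. (D s / 2)\<^sup>2 - 1) has_field_derivative 0) (at t0)"
    by (rule derivative_eq_intros holomorphic_has_derivative holomorphic_D refl | simp add: D'_t0)+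
  ultimately have dr: "2 * r * X11 + (X12 * z + y * X21) = 0"
    unfolding r_square by (rule DERIV_unique)
  \<comment> \<open>Both terms on the left of \<open>CD_derivative\<close> reduce to the square of
    the traceless part and to its derivative, and both vanish. The sum of squares is then zero, and
    its first term is |y|^2.\<close>
  have "fst (sol \<alpha> t0 (y, - r) p) * z - snd (sol \<alpha> t0 (y, - r) p) * r = (of_real \<sigma> - r) * (r\<^sup>2 + y * z)"
    unfolding sol_entries m_t y_def[symmetric] z_def[symmetric] by (simp add: power2_eq_square algebra_simps)
  moreover have "(y * X11 + - r * X12) * z - (y * X21 - - r * X11) * r = X11 * (r\<^sup>2 + y * z) - r * (2 * r * X11 + (X12 * z + y * X21))"
    by (simp add: power2_eq_square algebra_simps)
  ultimately have "\<i> * complex_of_real (\<Sum>j<p. (cmod (fst (sol \<alpha> t0 (y, - r) j)))\<^sup>2) = 0"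
    using CD_derivative[OF eig _ _ sol_entries_deriv, of "- r" y] cz by (simp add: ryz dr)
  then have "y = 0" by (rule CD_first_term)
  then show "m12 t0 = 0" "m21 t0 = 0" "r11 t0 = 0" using cz ryz by (auto simp: r_def y_def z_def)
qed

text \<open>This says that 1 - (D/2)^2 vanishes at the gap to order exactly 2. The pattern is that
  of \<open>entries_t0\<close>, one derivative higher: if the derivative of the traceless part
  squared to zero, positivity would first force it to vanish and then fail altogether.\<close>

lemma entries_deriv_nondegenerate: "X11\<^sup>2 + X12 * X21 \<noteq> 0"
proof
  assume X0: "X11\<^sup>2 + X12 * X21 = 0"
  have m_t: "m11 t0 = of_real \<sigma>" "m22 t0 = of_real \<sigma>" by (simp_all add: m_eq D_t0 entries_t0)
  have sol_t: "sol \<alpha> t0 (v1, v2) p = (of_real \<sigma> * v1, of_real \<sigma> * v2)" for v1 v2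
    by (rule prod_eqI) (simp_all add: sol_entries m_t entries_t0)
  have 1: "fst (sol \<alpha> t0 (X12, - X11) p) * X21 - snd (sol \<alpha> t0 (X12, - X11) p) * X11 = of_real \<sigma> * (X11\<^sup>2 + X12 * X21)"
    unfolding sol_t by (simp add: power2_eq_square algebra_simps)
  have 2: "(X12 * X11 + - X11 * X12) * X21 - (X12 * X21 - - X11 * X11) * X11 = - (X11\<^sup>2 + X12 * X21) * X11"
    by (simp add: power2_eq_square algebra_simps)
  have "of_real \<sigma> * (\<i> * of_nat p / 2 * (of_real \<sigma> * (X11\<^sup>2 + X12 * X21)) + - (X11\<^sup>2 + X12 * X21) * X11)
    = \<i> * complex_of_real (\<Sum>j<p. (cmod (fst (sol \<alpha> t0 (X12, - X11) j)))\<^sup>2)"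
    unfolding 1[symmetric] 2[symmetric]
    by (rule CD_derivative[OF sol_t _ _ sol_entries_deriv]) (simp_all add: cnj_entries_deriv)
  then have "\<i> * complex_of_real (\<Sum>j<p. (cmod (fst (sol \<alpha> t0 (X12, - X11) j)))\<^sup>2) = 0"
    unfolding X0 by simp
  then have "X12 = 0" by (rule CD_first_term)
  then have "X11 = 0" "X12 = 0" "X21 = 0" using X0 cnj_entries_deriv by auto
  \<comment> \<open>With vanishing derivatives, the initial value (0,1) gives -p/2 on the left and a
    sum of squares on the right.\<close>
  then have "of_real \<sigma> * (\<i> * of_nat p / 2 * (of_real \<sigma> * 0 * 0 - of_real \<sigma> * 1 * 1) + 0)
    = \<i> * complex_of_real (\<Sum>j<p. (cmod (fst (sol \<alpha> t0 (0, 1) j)))\<^sup>2)"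
    using CD_derivative[OF sol_t _ _ sol_entries_deriv, of 1 1 0 0] by (simp add: sol_t)
  moreover have "of_real \<sigma> * (\<i> * of_nat p / 2 * (of_real \<sigma> * 0 * 0 - of_real \<sigma> * 1 * 1) + 0)
    = \<i> * of_real (- (real p / 2)) * (of_real \<sigma> * of_real \<sigma>)" by simp
  ultimately have "\<i> * of_real (- (real p / 2)) = \<i> * complex_of_real (\<Sum>j<p. (cmod (fst (sol \<alpha> t0 (0, 1) j)))\<^sup>2)"
    unfolding \<sigma>_square by simp
  then have "- (real p / 2) = (\<Sum>j<p. (cmod (fst (sol \<alpha> t0 (0, 1) j)))\<^sup>2)"
    by (simp only: mult_cancel_left of_real_eq_iff) simp
  moreover have "0 \<le> (\<Sum>j<p. (cmod (fst (sol \<alpha> t0 (0, 1) j)))\<^sup>2)" by (intro sum_nonneg) simp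
  ultimately show False using p_pos by simp
qed

definition quot :: "(complex \<Rightarrow> complex) \<Rightarrow> complex \<Rightarrow> complex" where
  "quot f s = (if s = t0 then deriv f t0 else f s / (s - t0))"

lemma quot_mult: "f t0 = 0 \<Longrightarrow> (s - t0) * quot f s = f s"
  by (simp add: quot_def)

lemma holomorphic_quot:
  assumes "f holomorphic_on UNIV" "f t0 = 0"
  shows "quot f holomorphic_on UNIV"
proof -
  have "quot f = (\<lambda>z. if z = t0 then deriv f t0 else (f z - f t0) / (z - t0))"
    by (auto simp: fun_eq_iff quot_def assms(2))
  then show ?thesis using pole_lemma[OF assms(1), of t0] by simp
qed

text \<open>By \<open>h_mult\<close> this is sin(\<eta>)^2 / (s - t0)^2, which is how sin \<eta>
  will acquire a simple zero.\<close>

definition "h s = - ((quot r11 s)\<^sup>2 + quot m12 s * quot m21 s)"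

lemma holomorphic_h: "h holomorphic_on UNIV"
  unfolding h_def[abs_def]
  by (intro holomorphic_intros holomorphic_quot holomorphic_r11 holomorphic_m entries_t0)

lemma h_mult: "(s - t0)\<^sup>2 * h s = 1 - (D s / 2)\<^sup>2"
proof -
  have "(s - t0)\<^sup>2 * h s = - (((s - t0) * quot r11 s)\<^sup>2 + ((s - t0) * quot m12 s) * ((s - t0) * quot m21 s))"
    by (simp add: h_def power2_eq_square algebra_simps)
  then show ?thesis by (simp add: quot_mult entries_t0 r_square)
qed

text \<open>On the real line near \<theta> the bound |D| \<le> 2 makes h nonnegative, and
  nondegeneracy excludes the value 0 in the limit. Positivity keeps the square root of h off its
  branch cut.\<close>

lemma h_t0_pos:
  assumes d: "0 < d" "\<And>s. \<bar>\<theta> - s\<bar> < d \<Longrightarrow> \<bar>Re (D (of_real s))\<bar> \<le> 2"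
  obtains \<gamma> where "0 < \<gamma>" "h t0 = complex_of_real \<gamma>"
proof -
  have h0: "h t0 = - (X11\<^sup>2 + X12 * X21)" by (simp add: h_def quot_def X11_def X12_def X21_def)
  have "cnj (h t0) = h t0" by (simp add: h0 cnj_entries_deriv mult.commute)
  then have real: "h t0 = of_real (Re (h t0))" by (simp add: complex_eq_iff)
  have "isCont (\<lambda>s. h (of_real s)) \<theta>"
    by (rule isCont_o2[of \<theta> of_real h]) (auto intro!: continuous_intros holomorphic_isCont holomorphic_h)
  then have "isCont (\<lambda>s. Re (h (of_real s))) \<theta>" by (rule continuous_Re)
  then have lim: "((\<lambda>s. Re (h (of_real s))) \<longlongrightarrow> Re (h t0)) (at \<theta>)" by (simp add: isCont_def)
  have "\<forall>\<^sub>F s in at \<theta>. 0 \<le> Re (h (of_real s))"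
    unfolding eventually_at
  proof (intro exI[of _ d] conjI d(1) ballI impI)
    fix s assume s: "s \<noteq> \<theta> \<and> dist s \<theta> < d"
    define x where "x = Re (D (of_real s))"
    have "\<bar>x\<bar> \<le> 2" unfolding x_def using s by (intro d(2)) (simp add: dist_real_def abs_minus_commute)
    from power_mono[OF this abs_ge_zero, of 2] have x: "x\<^sup>2 / 4 \<le> 1" by simp
    have "of_real ((s - \<theta>)\<^sup>2) * h (of_real s) = of_real (1 - x\<^sup>2 / 4)"
      using h_mult[of "of_real s"] D_real[of s] by (simp add: x_def power_divide)
    from arg_cong[OF this, of Re] have "(s - \<theta>)\<^sup>2 * Re (h (of_real s)) = 1 - x\<^sup>2 / 4"
      by (simp only: times_complex.sel Re_complex_of_real Im_complex_of_real mult_zero_left diff_zero)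
    then have "0 \<le> (s - \<theta>)\<^sup>2 * Re (h (of_real s))" using x by simp
    then show "0 \<le> Re (h (of_real s))" using s by (simp add: zero_le_mult_iff)
  qed
  from tendsto_lowerbound[OF lim this] have "0 \<le> Re (h t0)" by simp
  moreover have "h t0 \<noteq> 0" using entries_deriv_nondegenerate unfolding h0 by (simp only: neg_equal_0_iff_equal not_False_eq_True)
  then have "Re (h t0) \<noteq> 0" using real by auto
  ultimately show thesis by (intro that[of "Re (h t0)"] real) simp
qed

text \<open>Arccos is not analytic at D/2 = \<sigma>, but D/2 touches \<sigma> to second order, so
  sin \<eta> has the analytic square root (s - t0) sqrt h up to sign. Arcsin of it, shifted by
  arccos \<sigma>, which is 0 or pi, continues the phase through the closed gap.\<close>

lemma closed_gap_phase:
  assumes d: "0 < d" "\<And>s. \<bar>\<theta> - s\<bar> < d \<Longrightarrow> \<bar>Re (D (of_real s))\<bar> \<le> 2"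
  shows "\<exists>\<eta> g1 g2 r v. band_phase \<alpha> p \<theta> \<eta> g1 g2 r v \<and> (V_open \<alpha> p \<longlongrightarrow> \<bar>v\<bar>) (at \<theta>)"
proof -
  obtain \<gamma> where \<gamma>: "0 < \<gamma>" "h t0 = complex_of_real \<gamma>" using h_t0_pos[OF d] by blast
  define w where "w s = (s - t0) * csqrt (h s)" for s
  define \<eta> where "\<eta> s = of_real (arccos \<sigma>) + Arcsin (w s)" for s
  have h_cont: "isCont h t0" by (rule holomorphic_isCont[OF holomorphic_h])
  have sq_cont: "isCont (\<lambda>s. csqrt (h s)) t0"
    by (intro isCont_o2[OF h_cont] continuous_at_csqrt) (use \<gamma> in \<open>simp add: complex_nonpos_Reals_iff\<close>)
  have w_cont: "isCont w t0" unfolding w_def[abs_def] by (intro continuous_intros sq_cont)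
  have "\<forall>\<^sub>F s in nhds t0. 0 < Re (h s)"
    using h_cont \<gamma> unfolding isCont_def tendsto_at_iff_tendsto_nhds
    by (intro order_tendstoD(1)[OF tendsto_Re]) auto
  moreover have "\<forall>\<^sub>F s in nhds t0. cmod (w s) < 1"
    using order_tendstoD(2)[OF tendsto_norm[OF w_cont[unfolded isCont_def tendsto_at_iff_tendsto_nhds]], of 1]
    by (simp add: w_def)
  moreover have "\<forall>\<^sub>F s in nhds t0. 0 < \<sigma> * Re (D s)"
    using holomorphic_isCont[OF holomorphic_D, of t0] \<sigma> unfolding isCont_def tendsto_at_iff_tendsto_nhds
    by (intro order_tendstoD(1)[OF tendsto_mult[OF tendsto_const tendsto_Re]]) (auto simp: D_t0)
  ultimately have "\<forall>\<^sub>F s in nhds t0. 0 < Re (h s) \<and> cmod (w s) < 1 \<and> 0 < \<sigma> * Re (D s)" by eventually_elim simp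
  then obtain \<epsilon> where \<epsilon>: "0 < \<epsilon>" "\<And>s. s \<in> ball t0 \<epsilon> \<Longrightarrow> 0 < Re (h s) \<and> cmod (w s) < 1 \<and> 0 < \<sigma> * Re (D s)"
    by (auto simp: eventually_nhds_metric dist_commute)
  have hol_w: "w holomorphic_on ball t0 \<epsilon>"
    unfolding w_def[abs_def]
    by (intro holomorphic_intros holomorphic_on_csqrt' holomorphic_on_subset[OF holomorphic_h])
      (use \<epsilon>(2) in \<open>fastforce simp: complex_nonpos_Reals_iff\<close>)+
  have hol_\<eta>: "\<eta> holomorphic_on ball t0 \<epsilon>"
  proof -
    have "\<bar>Re (w s)\<bar> < 1" if "s \<in> ball t0 \<epsilon>" for s using \<epsilon>(2)[OF that] abs_Re_le_cmod[of "w s"] by linarith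
    then have "Arcsin holomorphic_on w ` ball t0 \<epsilon>" by (intro holomorphic_on_Arcsin) auto
    from holomorphic_on_compose[OF hol_w this]
    show ?thesis unfolding \<eta>_def[abs_def] by (intro holomorphic_intros) (simp add: o_def)
  qed
  have arc: "cos (of_real (arccos \<sigma>)) = complex_of_real \<sigma>" "sin (of_real (arccos \<sigma>)) = (0 :: complex)"
    using \<sigma> by (auto simp: cos_of_real sin_of_real)
  \<comment> \<open>The squares agree by \<open>h_mult\<close>. The sign is settled because both
    sides, after removal of \<sigma>, have positive real part.\<close>
  have cos_\<eta>: "cos (\<eta> s) = D s / 2" if s: "s \<in> ball t0 \<epsilon>" for s
  proof -
    have "(w s)\<^sup>2 = 1 - (D s / 2)\<^sup>2" using h_mult[of s] by (simp add: w_def power_mult_distrib)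
    then have "1 - (w s)\<^sup>2 = (D s / 2)\<^sup>2" by simp
    also have "\<dots> = (of_real \<sigma> * D s / 2)\<^sup>2"
      using \<sigma>_square by (simp add: power_divide power_mult_distrib power2_eq_square)
    finally have "(cos (Arcsin (w s)))\<^sup>2 = (of_real \<sigma> * D s / 2)\<^sup>2" by (simp add: cos_squared_eq)
    moreover have "0 < Re (cos (Arcsin (w s)))"
    proof -
      have "\<bar>Re (Arcsin (w s))\<bar> < pi / 2"
        using \<epsilon>(2)[OF s] abs_Re_le_cmod[of "w s"] by (intro Arcsin_bounds) simp
      then have "0 < cos (Re (Arcsin (w s)))" by (intro cos_gt_zero_pi) auto
      then show ?thesis by (simp add: Re_cos add_pos_pos)
    qed
    moreover have "0 < Re (of_real \<sigma> * D s / 2)" using \<epsilon>(2)[OF s] by simp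
    ultimately have "cos (Arcsin (w s)) = of_real \<sigma> * D s / 2" by (metis csqrt_square)
    then have "cos (\<eta> s) = (of_real \<sigma> * of_real \<sigma>) * D s / 2" by (simp add: \<eta>_def cos_add arc)
    then show ?thesis by (simp add: \<sigma>_square)
  qed
  have sin_\<eta>: "sin (\<eta> s) = of_real \<sigma> * w s" for s by (simp add: \<eta>_def sin_add arc)
  have \<eta>_t0: "\<eta> t0 = of_real (arccos \<sigma>)" by (simp add: \<eta>_def w_def)
  \<comment> \<open>To first order the argument of Arcsin is (s - t0) sqrt \<gamma>, so \<eta>' at
    t0 is sqrt \<gamma> = p v.\<close>
  define v where "v = sqrt \<gamma> / p"
  have \<eta>_deriv: "(\<eta> has_field_derivative of_real (real p * v)) (at t0)"
  proof -
    have "(w has_field_derivative csqrt (h t0)) (at t0)"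
      using sq_cont unfolding CARAT_DERIV by (intro exI[of _ "\<lambda>s. csqrt (h s)"]) (auto simp: w_def mult.commute)
    moreover have "(Arcsin has_field_derivative inverse (cos (Arcsin 0))) (at (w t0))"
      using has_field_derivative_Arcsin[of 0] by (simp add: w_def)
    ultimately have "((\<lambda>s. Arcsin (w s)) has_field_derivative inverse (cos (Arcsin 0)) * csqrt (h t0)) (at t0)"
      by (rule DERIV_chain')
    moreover have "inverse (cos (Arcsin 0)) * csqrt (h t0) = of_real (real p * v)"
      using p_pos \<gamma> by (simp add: v_def)
    ultimately show ?thesis unfolding \<eta>_def[abs_def]
      using DERIV_add[OF DERIV_const[of "of_real (arccos \<sigma>)"]] by fastforce
  qed
  have \<rho>t0: "\<rho>1 t0 = 0" "\<rho>2 t0 = 0" by (simp_all add: \<rho>1_def \<rho>2_def entries_t0)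
  have d\<rho>: "deriv \<rho>1 t0 = X11 + X12" "deriv \<rho>2 t0 = X21 - X11"
    unfolding X11_def X12_def X21_def \<rho>1_def[abs_def] \<rho>2_def[abs_def]
    by (intro DERIV_imp_deriv DERIV_add DERIV_diff holomorphic_has_derivative holomorphic_m holomorphic_r11)+
  \<comment> \<open>The sign argument of the open band, one derivative higher: equality would make a
    squared modulus equal to -\<gamma>.\<close>
  have d\<rho>_ne: "X11 + X12 \<noteq> X21 - X11"
  proof
    assume eq: "X11 + X12 = X21 - X11"
    have "of_real ((cmod (X11 + X12))\<^sup>2) = (X11 + X12) * (X21 - X11)"
      unfolding complex_norm_square by (simp add: cnj_entries_deriv)
    also have "\<dots> = X11 * (X21 - X11 - (X11 + X12)) + (X11\<^sup>2 + X12 * X21)" by (simp add: power2_eq_square algebra_simps)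
    also have "X21 - X11 - (X11 + X12) = 0" using eq by (simp only: diff_self)
    also have "X11 * 0 + (X11\<^sup>2 + X12 * X21) = - h t0" by (simp add: h_def quot_def X11_def X12_def X21_def)
    finally have "(cmod (X11 + X12))\<^sup>2 = - \<gamma>" by (simp only: \<gamma> of_real_minus[symmetric] of_real_eq_iff)
    then show False using \<gamma>(1) zero_le_power2[of "cmod (X11 + X12)"] by simp
  qed
  define g where "g f s = quot f s / (of_real \<sigma> * csqrt (h s))" for f s
  have nz: "of_real \<sigma> * csqrt (h t0) \<noteq> 0" using \<sigma> \<gamma> by auto
  have "band_phase \<alpha> p \<theta> \<eta> (g \<rho>1) (g \<rho>2) (arccos \<sigma>) v"
  proof unfold_locales
    have "cos (\<eta> s) = D s / 2 \<and> \<rho>1 s = sin (\<eta> s) * g \<rho>1 s \<and> \<rho>2 s = sin (\<eta> s) * g \<rho>2 s" if s: "s \<in> ball t0 \<epsilon>" for s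
    proof -
      have "of_real \<sigma> * csqrt (h s) \<noteq> 0" using \<epsilon>(2)[OF s] \<sigma> by auto
      then have "sin (\<eta> s) * g f s = (s - t0) * quot f s" for f by (simp add: sin_\<eta> w_def g_def)
      then show ?thesis using cos_\<eta>[OF s] by (simp add: quot_mult \<rho>t0)
    qed
    then show "\<forall>\<^sub>F s in nhds t0. cos (\<eta> s) = D s / 2 \<and> \<rho>1 s = sin (\<eta> s) * g \<rho>1 s \<and> \<rho>2 s = sin (\<eta> s) * g \<rho>2 s"
      using \<epsilon>(1) by (auto simp: eventually_nhds_metric dist_commute intro!: exI[of _ \<epsilon>])
    show "isCont (g \<rho>1) t0" "isCont (g \<rho>2) t0"
      unfolding g_def[abs_def]
      by (intro isCont_divide isCont_mult continuous_const sq_cont nz holomorphic_isCont holomorphic_quot holomorphic_\<rho> \<rho>t0)+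
    show "g \<rho>1 t0 \<noteq> g \<rho>2 t0" using d\<rho>_ne nz by (simp add: g_def quot_def d\<rho>)
  qed (fact \<eta>_deriv \<eta>_t0)+
  moreover have "(V_open \<alpha> p \<longlongrightarrow> \<bar>v\<bar>) (at \<theta>)"
  proof -
    have "isCont (deriv \<eta>) t0"
      using holomorphic_on_imp_continuous_on[OF holomorphic_deriv[OF hol_\<eta> open_ball]] \<epsilon>(1)
      by (simp add: continuous_on_eq_continuous_at)
    then have "isCont (\<lambda>s. cmod (deriv \<eta> (of_real s)) / p) \<theta>"
      using p_pos by (intro continuous_intros isCont_o2[of \<theta> of_real "deriv \<eta>"]) auto
    moreover have "deriv \<eta> t0 = of_real (real p * v)" by (rule DERIV_imp_deriv[OF \<eta>_deriv])
    ultimately have lim: "((\<lambda>s. cmod (deriv \<eta> (of_real s)) / p) \<longlongrightarrow> \<bar>v\<bar>) (at \<theta>)"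
      using p_pos by (simp add: isCont_def norm_mult)
    have "\<forall>\<^sub>F s in at \<theta>. cmod (deriv \<eta> (of_real s)) / p = V_open \<alpha> p s"
      unfolding eventually_at
    proof (intro exI[of _ "min \<epsilon> d"] conjI ballI impI)
      show "0 < min \<epsilon> d" using \<epsilon>(1) d(1) by simp
      fix s assume s: "s \<noteq> \<theta> \<and> dist s \<theta> < min \<epsilon> d"
      then have b: "complex_of_real s \<in> ball t0 \<epsilon>" by (simp add: dist_of_real dist_commute)
      have "V_open \<alpha> p s = cmod (deriv \<eta> (of_real s)) / p"
      proof (rule V_open_phase)
        show "(\<eta> has_field_derivative deriv \<eta> (of_real s)) (at (of_real s))"
          by (rule holomorphic_derivI[OF hol_\<eta> open_ball b])
        show "\<forall>\<^sub>F z in nhds (of_real s). cos (\<eta> z) = D z / 2"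
          using eventually_nhds_in_open[OF open_ball b] by eventually_elim (rule cos_\<eta>)
        show "sin (\<eta> (of_real s)) \<noteq> 0" using \<epsilon>(2)[OF b] \<sigma> s by (auto simp: sin_\<eta> w_def)
        show "\<bar>Re (D (of_real s))\<bar> \<le> 2" using s by (intro d(2)) (simp add: dist_real_def abs_minus_commute)
      qed
      then show "cmod (deriv \<eta> (of_real s)) / p = V_open \<alpha> p s" ..
    qed
    from Lim_transform_eventually[OF lim this] show ?thesis .
  qed
  ultimately show ?thesis by blast
qed

end

lemma band_interior_point_neighbourhood:
  assumes "band_interior_point \<alpha> p (cis \<theta>)"
  obtains d where "0 < d" "\<And>s. \<bar>\<theta> - s\<bar> < d \<Longrightarrow> cmod (Delta \<alpha> p (cis s)) \<le> 2"
proof -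
  obtain B T where B: "B \<in> bands \<alpha> p" and T: "openin (top_of_set (sphere 0 1)) T" "cis \<theta> \<in> T" "T \<subseteq> B"
    using assms by (auto simp: band_interior_point_def interior_of_def)
  have sub: "B \<subseteq> {z \<in> sphere 0 1. cmod (Delta \<alpha> p z) \<le> 2}"
    using B by (simp add: bands_def in_components_subset)
  obtain U where U: "open U" "T = sphere 0 1 \<inter> U" using T(1) by (auto simp: openin_open)
  have "open (cis -` U)" using U(1) by (rule open_vimage) (intro continuous_intros)
  then obtain d where d: "0 < d" "ball \<theta> d \<subseteq> cis -` U"
    using T(2) U(2) by (metis IntD2 open_contains_ball vimageI)
  show thesis
  proof (rule that[OF d(1)])
    fix s assume "\<bar>\<theta> - s\<bar> < d"
    then have "cis s \<in> U" using d(2) by (auto simp: dist_real_def)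
    then have "cis s \<in> B" using T(3) U(2) by auto
    then show "cmod (Delta \<alpha> p (cis s)) \<le> 2" using sub by auto
  qed
qed

context periodic_point
begin

lemma band_interior_phase:
  assumes "band_interior_point \<alpha> p (cis \<theta>)"
  shows "\<exists>\<eta> g1 g2 r v. band_phase \<alpha> p \<theta> \<eta> g1 g2 r v \<and> \<bar>v\<bar> = V \<alpha> p \<theta>"
proof -
  have cmod_D: "cmod (Delta \<alpha> p (cis s)) = \<bar>Re (D (of_real s))\<bar>" for s
    unfolding Delta_cis by (subst D_real) simp
  obtain d where d: "0 < d" "\<And>s. \<bar>\<theta> - s\<bar> < d \<Longrightarrow> \<bar>Re (D (of_real s))\<bar> \<le> 2"
    using band_interior_point_neighbourhood[OF assms] unfolding cmod_D by blast
  show ?thesis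
  proof (cases "\<bar>Re (D t0)\<bar> = 2")
    case True
    define \<sigma> where "\<sigma> = Re (D t0) / 2"
    have \<sigma>: "\<sigma> = 1 \<or> \<sigma> = - 1" using True by (auto simp: \<sigma>_def abs_if split: if_splits)
    have "((\<lambda>s. (Re (D (of_real s)))\<^sup>2) has_real_derivative (2 * Re (D t0) * Re (deriv D t0))) (at \<theta>)"
      using DERIV_power[OF Re_D_deriv[of \<theta>], of 2] by (simp add: mult_ac)
    \<comment> \<open>Inside a band D^2 \<le> 4 on both sides of \<theta>, so a point with |D| = 2
      is a local maximum of D^2. This makes it a closed gap.\<close>
    then have "2 * Re (D t0) * Re (deriv D t0) = 0"
      by (rule DERIV_local_max[OF _ d(1)]) (use d(2) True in \<open>auto simp: abs_le_square_iff[symmetric]\<close>)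
    then have "Re (deriv D t0) = 0" using True by auto
    then have "deriv D t0 = 0" using deriv_D_real[of \<theta>] by simp
    moreover have "D t0 = 2 * of_real \<sigma>" by (subst D_real) (simp add: \<sigma>_def)
    ultimately interpret closed_gap \<alpha> p \<theta> \<sigma> using \<sigma> by unfold_locales
    show ?thesis using closed_gap_phase[OF d] tendsto_Lim[of "at \<theta>" "V_open \<alpha> p"] True
      by (fastforce simp: V_def cmod_D)
  next
    case False
    then have "\<bar>Re (D t0)\<bar> < 2" using d(2)[of \<theta>] d(1) by simp
    then show ?thesis using open_band_phase by (simp add: V_def cmod_D)
  qed
qed

end

section \<open>Supports\<close>

lemma closed_msupp: "closed (msupp M)"
proof -
  have "- msupp M = \<Union> {U. open U \<and> emeasure M U = 0}"
    by (auto simp: msupp_def not_gr_zero)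
  moreover have "open (\<Union> {U. open U \<and> emeasure M U = 0})" by (rule open_Union) auto
  ultimately show ?thesis by (simp add: closed_def)
qed

text \<open>The complement of the support is a union of possibly uncountably many null open sets;
  Lindelof reduces it to countably many.\<close>

lemma AE_msupp:
  assumes "sets M = sets borel"
  shows "AE z in M. z \<in> msupp M"
proof -
  let ?F = "{U. open U \<and> emeasure M U = 0}"
  obtain F where F: "F \<subseteq> ?F" "countable F" "\<Union> F = \<Union> ?F"
    using Lindelof[of ?F] by auto
  have "(\<Union>U\<in>F. U) \<in> null_sets M"
    using F assms by (intro null_sets_UN' ) (auto simp: null_sets_def)
  moreover have "- msupp M = \<Union> ?F" by (auto simp: msupp_def not_gr_zero)
  ultimately have "- msupp M \<in> null_sets M" using F by simp
  then show ?thesis by (rule AE_I') auto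
qed

lemma msupp_circle:
  assumes "circle_measure M" shows "msupp M \<subseteq> sphere 0 1"
proof
  fix z assume z: "z \<in> msupp M"
  show "z \<in> sphere 0 1"
  proof (rule ccontr)
    assume "z \<notin> sphere 0 1"
    moreover have "open (- sphere (0::complex) 1)" by (simp add: open_Compl)
    ultimately have "0 < emeasure M (- sphere 0 1)" using z by (auto simp: msupp_def)
    then show False using assms by (simp add: circle_measure_def)
  qed
qed

lemma compact_msupp: "circle_measure M \<Longrightarrow> compact (msupp M)"
  using closed_msupp msupp_circle bounded_subset[of "sphere 0 1" "msupp M"] by (auto simp: compact_eq_bounded_closed)

section \<open>The absolutely continuous part of a measure\<close>

lemma largest_null_set_exists:
  fixes M A :: "'a::topological_space measure"
  assumes M: "finite_measure M" "sets M = sets borel" and A: "sets A = sets borel"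
  shows "\<exists>Z \<in> null_sets A. \<forall>B \<in> null_sets A. emeasure M (B - Z) = 0"
proof -
  interpret finite_measure M by fact
  have sets: "Z \<in> sets M" if "Z \<in> null_sets A" for Z using that M A by (auto simp: null_sets_def)
  \<comment> \<open>Exhaustion: the union of null sets nearly attaining the supremum attains it, so
    a further null set with mass outside the union would exceed the supremum.\<close>
  define s where "s = (SUP Z \<in> null_sets A. measure M Z)"
  have bdd: "bdd_above (measure M ` null_sets A)" by (rule bdd_aboveI[of _ "measure M (space M)"]) (auto intro: bounded_measure)
  have ne: "measure M ` null_sets A \<noteq> {}" by auto
  have "\<exists>Z. Z \<in> null_sets A \<and> s - 1 / real (Suc n) < measure M Z" for n
    using less_cSup_iff[OF ne bdd, of "s - 1 / real (Suc n)"] by (auto simp: s_def)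
  then obtain Z where Z: "\<And>n. Z n \<in> null_sets A" "\<And>n. s - 1 / real (Suc n) < measure M (Z n)" by metis
  define U where "U = (\<Union>n. Z n)"
  have U: "U \<in> null_sets A" unfolding U_def using Z(1) by (rule null_sets_UN)
  have "s \<le> measure M U"
  proof (rule LIMSEQ_le_const2)
    show "(\<lambda>n. s - 1 / real (Suc n)) \<longlonglongrightarrow> s"
      using tendsto_diff[OF tendsto_const LIMSEQ_inverse_real_of_nat, of s] by (simp add: inverse_eq_divide)
    have "s - 1 / real (Suc n) \<le> measure M U" for n
      using Z(2)[of n] finite_measure_mono[of "Z n" U] sets[OF U] by (fastforce simp: U_def)
    then show "\<exists>N. \<forall>n\<ge>N. s - 1 / real (Suc n) \<le> measure M U" by blast
  qed
  have "emeasure M (B - U) = 0" if B: "B \<in> null_sets A" for B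
  proof -
    have "U \<union> B \<in> null_sets A" using U B by (rule null_sets.Un)
    then have "measure M (U \<union> B) \<le> s" unfolding s_def using bdd by (intro cSUP_upper) auto
    moreover have "measure M (U \<union> B) = measure M U + measure M (B - U)"
      using finite_measure_Union[of U "B - U"] sets[OF U] sets[OF B] by (simp add: Un_Diff_cancel Int_commute)
    ultimately have "measure M (B - U) \<le> 0" using \<open>s \<le> measure M U\<close> by simp
    then show ?thesis by (simp add: emeasure_eq_measure measure_le_0_iff)
  qed
  then show ?thesis using U by blast
qed

text \<open>\<open>ac_part\<close> is a definite description, so the Lebesgue decomposition has to
  be shown to exist and to be unique. The absolutely continuous part is M restricted to the
  complement of a null set that captures as much of M as possible.\<close>

lemma ac_part_props:
  assumes M: "finite_measure M" "sets M = sets borel"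
  shows "sets (ac_part M) = sets borel" "absolutely_continuous arc_length (ac_part M)"
    "\<And>B. B \<in> sets borel \<Longrightarrow> emeasure (ac_part M) B \<le> emeasure M B"
proof -
  have sA: "sets arc_length = sets borel" by (simp add: arc_length_def)
  define spec where "spec N \<longleftrightarrow> sets N = sets borel \<and> absolutely_continuous arc_length N \<and>
     (\<exists>S. sets S = sets borel \<and> (\<exists>Z \<in> null_sets arc_length. emeasure S (- Z) = 0) \<and>
          (\<forall>A \<in> sets borel. emeasure M A = emeasure N A + emeasure S A))" for N
  obtain Z where Z: "Z \<in> null_sets arc_length" "\<And>B. B \<in> null_sets arc_length \<Longrightarrow> emeasure M (B - Z) = 0"
    using largest_null_set_exists[OF M sA] by blast
  have Zb: "Z \<in> sets M" using Z(1) M(2) sA by (auto simp: null_sets_def)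
  define N S where "N = density M (indicator (- Z))" and "S = density M (indicator Z)"
  have mI: "(indicator (- Z) :: _ \<Rightarrow> ennreal) \<in> borel_measurable M" "(indicator Z :: _ \<Rightarrow> ennreal) \<in> borel_measurable M"
    using Zb M(2) by auto
  have NS: "emeasure N B = emeasure M (B - Z)" "emeasure S B = emeasure M (B \<inter> Z)" if "B \<in> sets borel" for B
  proof -
    have B: "B \<in> sets M" using that M by simp
    have "emeasure N B = (\<integral>\<^sup>+z. indicator (- Z) z * indicator B z \<partial>M)" unfolding N_def by (rule emeasure_density[OF mI(1) B])
    also have "\<dots> = (\<integral>\<^sup>+z. indicator (B - Z) z \<partial>M)" by (intro nn_integral_cong) (auto simp: indicator_def)
    finally show "emeasure N B = emeasure M (B - Z)" using B Zb by simp
    have "emeasure S B = (\<integral>\<^sup>+z. indicator Z z * indicator B z \<partial>M)" unfolding S_def by (rule emeasure_density[OF mI(2) B])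
    also have "\<dots> = (\<integral>\<^sup>+z. indicator (B \<inter> Z) z \<partial>M)" by (intro nn_integral_cong) (auto simp: indicator_def)
    finally show "emeasure S B = emeasure M (B \<inter> Z)" using B Zb by simp
  qed
  have "spec N"
    unfolding spec_def
  proof (intro conjI exI[of _ S] ballI)
    show "sets N = sets borel" "sets S = sets borel" using M by (simp_all add: N_def S_def)
    show "absolutely_continuous arc_length N"
      unfolding absolutely_continuous_def using Z(2) NS(1) sA M by (auto simp: null_sets_def N_def)
    have Zc: "- Z \<in> sets borel" using Zb M by simp
    show "\<exists>Z\<in>null_sets arc_length. emeasure S (- Z) = 0"
      by (rule bexI[OF _ Z(1)]) (simp add: NS(2)[OF Zc])
    fix B assume B: "B \<in> sets (borel :: complex measure)"
    have "emeasure M B = emeasure M ((B - Z) \<union> (B \<inter> Z))" by (rule arg_cong[where f="emeasure M"]) auto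
    also have "\<dots> = emeasure M (B - Z) + emeasure M (B \<inter> Z)"
      using B Zb M by (intro plus_emeasure[symmetric]) auto
    finally show "emeasure M B = emeasure N B + emeasure S B" by (simp add: NS[OF B])
  qed
  have unique: "N1 = N2" if N12: "spec N1" "spec N2" for N1 N2
  proof -
    \<comment> \<open>Every admissible part is M off some null set, which may be enlarged freely.
      For two admissible parts the union of their null sets serves both.\<close>
    have form: "\<exists>Z \<in> null_sets arc_length. \<forall>Z' \<in> null_sets arc_length. Z \<subseteq> Z' \<longrightarrow> (\<forall>B \<in> sets borel. emeasure K B = emeasure M (B - Z'))" if sp: "spec K" for K
    proof -
      from sp obtain S Z where SZ: "sets S = sets borel" "Z \<in> null_sets arc_length" "emeasure S (- Z) = 0"
        "\<And>A. A \<in> sets borel \<Longrightarrow> emeasure M A = emeasure K A + emeasure S A"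
        and K: "sets K = sets borel" "absolutely_continuous arc_length K" by (auto simp: spec_def)
      have "emeasure K B = emeasure M (B - Z')" if Z': "Z' \<in> null_sets arc_length" "Z \<subseteq> Z'" and B: "B \<in> sets borel" for Z' B
      proof -
        have b: "Z \<in> sets borel" "Z' \<in> sets borel" using SZ(2) Z' sA by (auto simp: null_sets_def)
        have "Z' \<in> null_sets K" using K(2) Z' by (auto simp: absolutely_continuous_def)
        then have "emeasure K B = emeasure K (B - Z')" using B K by (simp add: emeasure_Diff_null_set)
        moreover have "emeasure S (B - Z') \<le> emeasure S (- Z)" using Z' b SZ(1) by (intro emeasure_mono) auto
        then have "emeasure S (B - Z') = 0" using SZ(3) by simp
        ultimately show ?thesis using SZ(4)[of "B - Z'"] B b by simp
      qed
      then show ?thesis using SZ(2) by blast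
    qed
    obtain Z1 where Z1: "Z1 \<in> null_sets arc_length" "\<And>Z' B. Z' \<in> null_sets arc_length \<Longrightarrow> Z1 \<subseteq> Z' \<Longrightarrow> B \<in> sets borel \<Longrightarrow> emeasure N1 B = emeasure M (B - Z')"
      using form[OF N12(1)] by blast
    obtain Z2 where Z2: "Z2 \<in> null_sets arc_length" "\<And>Z' B. Z' \<in> null_sets arc_length \<Longrightarrow> Z2 \<subseteq> Z' \<Longrightarrow> B \<in> sets borel \<Longrightarrow> emeasure N2 B = emeasure M (B - Z')"
      using form[OF N12(2)] by blast
    have "Z1 \<union> Z2 \<in> null_sets arc_length" using Z1(1) Z2(1) by (rule null_sets.Un)
    then have "emeasure N1 B = emeasure N2 B" if "B \<in> sets borel" for B
      using Z1(2)[of "Z1 \<union> Z2" B] Z2(2)[of "Z1 \<union> Z2" B] that by simp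
    then show ?thesis using N12 by (intro measure_eqI) (auto simp: spec_def)
  qed
  have "ac_part M = (THE N. spec N)" by (simp add: ac_part_def spec_def)
  then have sp: "spec (ac_part M)" using theI[of spec N] \<open>spec N\<close> unique by metis
  show "sets (ac_part M) = sets borel" "absolutely_continuous arc_length (ac_part M)" using sp by (auto simp: spec_def)
  show "emeasure (ac_part M) B \<le> emeasure M B" if "B \<in> sets borel" for B
    using sp that by (auto simp: spec_def)
qed

lemma finite_null_arc_length:
  assumes "finite F" shows "F \<in> null_sets arc_length"
proof -
  have F: "F \<in> sets borel" using finite_imp_closed[OF assms] by simp
  have m: "cis \<in> borel_measurable borel" by (intro borel_measurable_continuous_onI continuous_intros)
  have sub: "cis -` F \<inter> {0..<2*pi} \<subseteq> Arg2pi ` F"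
  proof
    fix t assume t: "t \<in> cis -` F \<inter> {0..<2*pi}"
    then have "Arg2pi (cis t) = t" by (intro Arg2pi_unique[of 1]) (auto simp: cis_conv_exp)
    then show "t \<in> Arg2pi ` F" using t by (metis IntD1 image_eqI vimageD)
  qed
  have "finite (cis -` F \<inter> {0..<2*pi})" by (rule finite_subset[OF sub]) (use assms in simp)
  then have z: "emeasure lborel (cis -` F \<inter> {0..<2*pi}) = 0" by (simp add: emeasure_lborel_countable countable_finite)
  have "emeasure arc_length F = emeasure (density lborel (indicator {0..<2 * pi})) (cis -` F)"
    unfolding arc_length_def using m F by (subst emeasure_distr) auto
  also have "\<dots> = (\<integral>\<^sup>+t. indicator {0..<2 * pi} t * indicator (cis -` F) t \<partial>lborel)"
    using measurable_sets[OF m F] by (intro emeasure_density) auto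
  also have "\<dots> = (\<integral>\<^sup>+t. indicator (cis -` F \<inter> {0..<2 * pi}) t \<partial>lborel)"
    by (intro nn_integral_cong) (auto simp: indicator_def)
  also have "\<dots> = 0" using z measurable_sets[OF m F] by (subst nn_integral_indicator) auto
  finally show ?thesis using F by (auto simp: null_sets_def arc_length_def)
qed

lemma nn_integral_measure_sum:
  assumes s: "sets S = sets borel" "sets A = sets borel" "sets B = sets borel"
    and e: "\<And>U. U \<in> sets borel \<Longrightarrow> emeasure S U = emeasure A U + emeasure B U"
    and f: "f \<in> borel_measurable borel"
  shows "(\<integral>\<^sup>+z. f z \<partial>S) = (\<integral>\<^sup>+z. f z \<partial>A) + (\<integral>\<^sup>+z. f z \<partial>B)"
  using f
proof (induction rule: borel_measurable_induct)
  case (cong f g)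
  then show ?case by (simp add: space_borel)
next
  case (set U)
  then show ?case using s e by simp
next
  case (mult u c)
  then show ?case using mult by (simp add: nn_integral_cmult distrib_left s[THEN borel_measurable_cong_borel])
next
  case (add u v)
  then show ?case using add by (simp add: nn_integral_add ac_simps s[THEN borel_measurable_cong_borel])
next
  case (seq U)
  have eq: "(\<integral>\<^sup>+z. (SUP i. U i) z \<partial>K) = (SUP i. \<integral>\<^sup>+z. U i z \<partial>K)" if "sets K = sets borel" for K
    using nn_integral_monotone_convergence_SUP[of U K] seq that by (simp add: SUP_apply image_image borel_measurable_cong_borel[OF that])
  have inc: "incseq (\<lambda>i. \<integral>\<^sup>+z. U i z \<partial>K)" for K
    using seq by (intro monoI nn_integral_mono) (auto simp: incseq_def le_fun_def)
  show ?case unfolding eq[OF s(1)] eq[OF s(2)] eq[OF s(3)] using seq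
    by (simp add: ennreal_SUP_add[OF inc inc])
qed

lemma coeff_szego_star_0: "coeff (szego_star n Q) 0 = cnj (coeff Q n)"
proof -
  have "coeff (szego_star n Q) 0 = (\<Sum>k\<le>n. if k = 0 then cnj (coeff Q (n - k)) else 0)"
    unfolding szego_star_def by (simp add: coeff_sum)
  then show ?thesis by simp
qed

lemma poly_szego_star_circle:
  assumes "degree Q \<le> n" "cmod z = 1"
  shows "poly (szego_star n Q) z = z ^ n * cnj (poly Q z)"
proof -
  have "z * cnj z = 1" using assms(2) complex_norm_square[of z] by simp
  moreover from this have "z \<noteq> 0" by auto
  ultimately have "z \<noteq> 0" "1 / cnj z = z" by (simp_all add: divide_eq_eq)
  then show ?thesis using poly_szego_star[OF assms(1), of z] by simp
qed

section \<open>Orthonormal polynomials and the normalized recursion\<close>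

locale verblunsky_measure =
  fixes \<mu> :: "complex measure" and \<alpha> :: "nat \<Rightarrow> complex"
  assumes vc: "verblunsky_coeffs \<mu> \<alpha>"
begin

lemma \<alpha>_less_1: "cmod (\<alpha> n) < 1" using vc by (simp add: verblunsky_coeffs_def)

lemma \<mu>_nontrivial: "nontrivial_measure \<mu>" using vc by (simp add: verblunsky_coeffs_def nontrivial_measure_def)

lemma \<mu>_circle: "circle_measure \<mu>" using vc by (simp add: verblunsky_coeffs_def)

lemma szego_is_monic_op: "is_monic_op \<mu> n (szego_poly \<alpha> n)"
  using monic_op_is_monic_op[OF \<mu>_nontrivial, of n] vc by (simp add: verblunsky_coeffs_def)

lemma sqnorm_cong_circle:
  assumes "\<And>z. cmod z = 1 \<Longrightarrow> cmod (poly P z) = cmod (poly Q z)"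
  shows "sqnorm_M \<mu> P = sqnorm_M \<mu> Q"
  unfolding sqnorm_M_def
proof (rule integral_cong_AE)
  show "(\<lambda>z. (cmod (poly P z))\<^sup>2) \<in> borel_measurable \<mu>" "(\<lambda>z. (cmod (poly Q z))\<^sup>2) \<in> borel_measurable \<mu>"
    by (rule borel_measurable_integrable, intro circle_integrable[OF \<mu>_circle] continuous_intros)+
  show "AE z in \<mu>. (cmod (poly P z))\<^sup>2 = (cmod (poly Q z))\<^sup>2"
    using AE_circle_norm[OF \<mu>_circle] by eventually_elim (simp add: assms)
qed

text \<open>Pythagoras in the recursion: z \<Phi>_n is the orthogonal sum of \<Phi>_{n+1} and a
  multiple of the reversed polynomial, and on the circle z \<Phi>_n, \<Phi>_n and the reversed
  polynomial have equal modulus.\<close>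

lemma sqnorm_szego: "sqnorm_M \<mu> (szego_poly \<alpha> n) = (\<Prod>j<n. 1 - (cmod (\<alpha> j))\<^sup>2)"
proof (induction n)
  case 0
  interpret prob_space \<mu> using vc by (simp add: verblunsky_coeffs_def)
  show ?case by (simp add: sqnorm_M_def prob_space)
next
  case (Suc n)
  let ?P = "szego_poly \<alpha> n" and ?S = "szego_star n (szego_poly \<alpha> n)" and ?P1 = "szego_poly \<alpha> (Suc n)"
  define c where "c = cnj (\<alpha> n)"
  have dS: "degree ?S \<le> n" by (rule degree_szego_star)
  have orth: "inner_M \<mu> ?P1 ?S = 0"
    using szego_is_monic_op[of "Suc n"] dS by (intro inner_monomials_zero[OF \<mu>_circle, of "Suc n"]) (auto simp: is_monic_op_def)
  then have orth': "inner_M \<mu> ?S ?P1 = 0" using inner_M_cnj[of \<mu> ?S ?P1] by simp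
  have split: "pCons 0 ?P = ?P1 + smult c ?S" by (simp add: c_def)
  have "of_real (sqnorm_M \<mu> ?P) = complex_of_real (sqnorm_M \<mu> (pCons 0 ?P))"
    by (subst sqnorm_cong_circle[of "pCons 0 ?P" ?P]) (simp_all add: norm_mult)
  also have "\<dots> = inner_M \<mu> (?P1 + smult c ?S) (?P1 + smult c ?S)"
    unfolding split by (simp only: inner_M_self)
  also have "\<dots> = inner_M \<mu> ?P1 ?P1 + c * cnj c * inner_M \<mu> ?S ?S"
    using orth orth' by (simp only: inner_M_add[OF \<mu>_circle] inner_M_add_right[OF \<mu>_circle] inner_M_smult inner_M_smult_right) simp
  also have "\<dots> = of_real (sqnorm_M \<mu> ?P1 + (cmod (\<alpha> n))\<^sup>2 * sqnorm_M \<mu> ?S)"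
    unfolding inner_M_self by (simp add: c_def mult.commute[of "cnj (\<alpha> n)"] flip: complex_norm_square)
  also have "sqnorm_M \<mu> ?S = sqnorm_M \<mu> ?P"
    by (rule sqnorm_cong_circle) (simp add: poly_szego_star_circle[OF degree_szego_poly] norm_mult norm_power)
  finally have "sqnorm_M \<mu> ?P = sqnorm_M \<mu> ?P1 + (cmod (\<alpha> n))\<^sup>2 * sqnorm_M \<mu> ?P" by (simp only: of_real_eq_iff)
  then have "sqnorm_M \<mu> ?P1 = sqnorm_M \<mu> ?P * (1 - (cmod (\<alpha> n))\<^sup>2)" by (simp add: algebra_simps)
  then show ?case using Suc by simp
qed

lemma orthonormal_poly_eq_phi: "orthonormal_poly \<mu> n = phi \<alpha> n"
proof -
  have "monic_op \<mu> n = szego_poly \<alpha> n" using vc by (simp add: verblunsky_coeffs_def)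
  moreover have "sqrt (\<Prod>j<n. 1 - (cmod (\<alpha> j))\<^sup>2) = (\<Prod>j<n. sqrt (1 - (cmod (\<alpha> j))\<^sup>2))"
    by (induction n) (simp_all add: real_sqrt_mult)
  ultimately show ?thesis
    using sqnorm_szego[of n] by (simp add: orthonormal_poly_def phi_def sqnorm_M_def)
qed

text \<open>Comparing constant coefficients, equality would force |\<alpha>_n| = 1. Consequently
  there are only finitely many resonances.\<close>

lemma phi_minus_star_nonzero: "phi \<alpha> (Suc n) - szego_star (Suc n) (phi \<alpha> (Suc n)) \<noteq> 0"
proof
  assume eq: "phi \<alpha> (Suc n) - szego_star (Suc n) (phi \<alpha> (Suc n)) = 0"
  define R where "R = (\<Prod>j<Suc n. sqrt (1 - (cmod (\<alpha> j))\<^sup>2))"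
  have "sqrt (1 - (cmod (\<alpha> j))\<^sup>2) > 0" for j
    using \<alpha>_less_1[of j] by (simp add: abs_square_less_1)
  then have R: "R > 0" unfolding R_def by (intro prod_pos) auto
  have lead: "coeff (szego_poly \<alpha> k) k = 1" for k using szego_is_monic_op[of k] by (auto simp: is_monic_op_def)
  have "coeff (phi \<alpha> (Suc n)) 0 = complex_of_real (1/R) * (- cnj (\<alpha> n))"
    by (simp add: phi_def R_def coeff_szego_star_0 lead)
  moreover have "coeff (szego_star (Suc n) (phi \<alpha> (Suc n))) 0 = complex_of_real (1/R)"
    unfolding coeff_szego_star_0 phi_def coeff_smult lead by (simp add: R_def)
  ultimately have "complex_of_real (1/R) * (- cnj (\<alpha> n)) = complex_of_real (1/R)"
    using eq by (metis (no_types) coeff_0 coeff_diff eq_iff_diff_eq_0)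
  then have "complex_of_real (1/R) * (- cnj (\<alpha> n)) = complex_of_real (1/R) * 1" by simp
  then have "- cnj (\<alpha> n) = 1" using R by (subst (asm) mult_cancel_left) auto
  then have "cmod (\<alpha> n) = 1" by (metis complex_mod_cnj norm_minus_cancel norm_one)
  then show False using \<alpha>_less_1[of n] by simp
qed

end

section \<open>Growth of the polynomials on and off the bands\<close>

lemma cheb_real_bounds:
  assumes "\<bar>x\<bar> \<le> 1"
  shows "cmod (fst (cheb (of_real x) q)) \<le> 1" "cmod (snd (cheb (of_real x) q)) \<le> real q"
proof -
  define r where "r = arccos x"
  have x: "of_real x = cos (complex_of_real r)" using assms by (simp add: r_def cos_of_real cos_arccos_abs)
  have 1: "cmod (fst (cheb (of_real x) q)) \<le> 1" for q
  proof -
    have "fst (cheb (of_real x) q) = of_real (cos (real q * r))"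
      unfolding x cheb_cos by (simp flip: cos_of_real)
    then show ?thesis by simp
  qed
  then show "cmod (fst (cheb (of_real x) q)) \<le> 1" .
  show "cmod (snd (cheb (of_real x) q)) \<le> real q"
  proof (induction q)
    case (Suc q)
    have "cmod (snd (cheb (of_real x) (Suc q))) \<le> \<bar>x\<bar> * cmod (snd (cheb (of_real x) q)) + cmod (fst (cheb (of_real x) q))"
      unfolding cheb.simps snd_conv by (rule order_trans[OF norm_triangle_ineq]) (simp add: norm_mult)
    also have "\<dots> \<le> 1 * real q + 1" using assms Suc 1 by (intro add_mono mult_mono) auto
    finally show ?case by simp
  qed simp
qed

text \<open>In the three-term recursion the factor |2x| is at least 2, so by the triangle inequality
  each increment of the modulus is at least the previous one, and the first is 1.\<close>

lemma cheb_growth: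
  assumes "\<bar>x\<bar> > 1"
  shows "real q \<le> cmod (snd (cheb (of_real x) q))"
proof -
  define S where "S q = snd (cheb (of_real x) q)" for q
  have rec: "S (Suc (Suc q)) = 2 * of_real x * S (Suc q) - S q" for q
    by (simp add: S_def algebra_simps power2_eq_square)
  have step: "cmod (S q) + 1 \<le> cmod (S (Suc q))" for q
  proof (induction q)
    case (Suc q)
    have "cmod (2 * of_real x * S (Suc q)) \<le> cmod (S (Suc (Suc q))) + cmod (S q)"
      unfolding rec using norm_triangle_ineq[of "2 * of_real x * S (Suc q) - S q" "S q"] by simp
    moreover have "cmod (2 * of_real x * S (Suc q)) = 2 * \<bar>x\<bar> * cmod (S (Suc q))" by (simp add: norm_mult)
    moreover have "2 * cmod (S (Suc q)) \<le> 2 * \<bar>x\<bar> * cmod (S (Suc q))" using assms by (intro mult_right_mono) auto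
    ultimately show ?case using Suc by linarith
  qed (simp add: S_def)
  have "real q \<le> cmod (S q)" for q
  proof (induction q)
    case (Suc q)
    then show ?case using step[of q] by simp
  qed simp
  then show ?thesis by (simp add: S_def)
qed

lemma circle_angle:
  assumes "cmod z = 1" obtains s where "0 \<le> s" "s \<le> 2 * pi" "z = cis s"
proof
  show "z = cis (Arg2pi z)" using assms Arg2pi_eq[of z] by (simp add: cis_conv_exp)
  show "0 \<le> Arg2pi z" by (rule Arg2pi_ge_0)
  show "Arg2pi z \<le> 2 * pi" using Arg2pi_lt_2pi[of z] by simp
qed

locale periodic_measure = verblunsky_measure + periodic_verblunsky
begin

lemma CD_kernel_ker:
  "q \<ge> 1 \<Longrightarrow> CD_kernel (q * p - 1) (exp (\<i> * s)) (exp (\<i> * t)) \<mu> = ker (q * p) s (cnj t)"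
proof -
  assume q: "q \<ge> 1"
  then have "q * p \<ge> 1" using p_pos by (simp add: Suc_le_eq)
  then have "{..q * p - 1} = {..<q * p}" by (cases "q * p") (auto simp: lessThan_Suc_atMost)
  then show ?thesis unfolding CD_kernel_def orthonormal_poly_eq_phi ker_phi[symmetric] by simp
qed

lemma norm_phi_circle: "cmod (poly (phi \<alpha> j) (cis s)) = cmod (X (of_real s) j)"
proof -
  have "cmod (exp (\<i> * of_real s / 2)) = 1" by (simp add: norm_exp_eq_Re)
  then show ?thesis
    using phi_eq_sol(1)[where \<alpha>=\<alpha> and n=j and s="of_real s", OF \<alpha>_lt] by (simp add: cis_conv_exp norm_mult norm_power)
qed

definition "E = {z \<in> sphere 0 1. cmod (Delta \<alpha> p z) \<le> 2}"

text \<open>On the bands T is bounded by 1 and U_{q-1} by q, and one period of solutions is bounded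
  uniformly over a compact range of angles. Each polynomial thus grows at most linearly; squaring
  and summing gives the cube.\<close>

lemma CD_kernel_polynomial_bound:
  "\<exists>B\<ge>0. \<forall>z\<in>E. \<forall>n. Re (CD_kernel n z z \<mu>) \<le> B * (real n + 1) ^ 3"
proof -
  have "\<exists>K. \<forall>s\<in>{0..2*pi}. \<forall>r\<in>{..<p}. cmod (X (of_real s) r) \<le> K \<and> cmod (Rx r (of_real s)) \<le> K"
  proof -
    have bd: "\<exists>K. \<forall>s\<in>{0..2*pi}. cmod (f (of_real s)) \<le> K" if "f holomorphic_on UNIV" for f
    proof -
      have "continuous_on {0..2*pi} (\<lambda>s. f (of_real s))"
        by (rule continuous_on_compose2[OF holomorphic_on_imp_continuous_on[OF that]]) (auto intro!: continuous_intros)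
      then have "compact ((\<lambda>s. f (of_real s)) ` {0..2*pi})" by (rule compact_continuous_image) simp
      then have "bounded ((\<lambda>s. f (of_real s)) ` {0..2*pi})" by (rule compact_imp_bounded)
      then show ?thesis unfolding bounded_iff by blast
    qed
    have "\<forall>r. \<exists>K. \<forall>s\<in>{0..2*pi}. cmod (X (of_real s) r) \<le> K" "\<forall>r. \<exists>K. \<forall>s\<in>{0..2*pi}. cmod (Rx r (of_real s)) \<le> K"
      by (intro allI bd sol_holomorphic holomorphic_R)+
    then obtain K1 K2 where K: "\<And>r s. s \<in> {0..2*pi} \<Longrightarrow> cmod (X (of_real s) r) \<le> K1 r" "\<And>r s. s \<in> {0..2*pi} \<Longrightarrow> cmod (Rx r (of_real s)) \<le> K2 r"
      unfolding choice_iff by blast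
    have "\<bar>K1 r\<bar> + \<bar>K2 r\<bar> \<le> (\<Sum>r<p. \<bar>K1 r\<bar> + \<bar>K2 r\<bar>)" if "r < p" for r
      using that by (intro member_le_sum) auto
    moreover have "cmod (X (of_real s) r) \<le> \<bar>K1 r\<bar> + \<bar>K2 r\<bar>" "cmod (Rx r (of_real s)) \<le> \<bar>K1 r\<bar> + \<bar>K2 r\<bar>" if "s \<in> {0..2*pi}" for s r
      using K(1)[OF that, of r] K(2)[OF that, of r] by linarith+
    ultimately show ?thesis
      by (intro exI[of _ "\<Sum>r<p. \<bar>K1 r\<bar> + \<bar>K2 r\<bar>"]) (meson lessThan_iff order_trans)
  qed
  then obtain K where K: "\<And>s r. s \<in> {0..2*pi} \<Longrightarrow> r < p \<Longrightarrow> cmod (X (of_real s) r) \<le> K \<and> cmod (Rx r (of_real s)) \<le> K" by blast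
  have Re_le: "Re (CD_kernel n z z \<mu>) \<le> (K\<^sup>2) * (real n + 1) ^ 3" if z: "z \<in> E" for z n
  proof -
    obtain s where s: "0 \<le> s" "s \<le> 2 * pi" "z = cis s" using z by (auto simp: E_def elim: circle_angle)
    have "cmod (D (of_real s)) \<le> 2" using z s by (simp add: E_def Delta_cis)
    define x where "x = Re (D (of_real s)) / 2"
    have x: "D (of_real s) / 2 = of_real x" using D_real[of s] by (simp add: x_def)
    then have "D (of_real s) = of_real (2 * x)" by (simp add: field_simps)
    then have x2: "\<bar>x\<bar> \<le> 1" using \<open>cmod (D (of_real s)) \<le> 2\<close> by (simp add: abs_mult)
    have K0: "0 \<le> K" using K[of s 0] s p_pos norm_ge_zero order_trans by fastforce
    have "(cmod (poly (phi \<alpha> j) z))\<^sup>2 \<le> K\<^sup>2 * (real n + 1)\<^sup>2" if "j \<le> n" for j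
    proof -
      have j: "j = (j div p) * p + j mod p" by simp
      have r: "j mod p < p" using p_pos by simp
      have "X (of_real s) j = fst (cheb (of_real x) (j div p)) * X (of_real s) (j mod p) + snd (cheb (of_real x) (j div p)) * Rx (j mod p) (of_real s)"
        using XY_block(1)[of "of_real s" "j div p" "j mod p"] x by simp
      then have "cmod (X (of_real s) j) \<le> cmod (fst (cheb (of_real x) (j div p))) * cmod (X (of_real s) (j mod p)) + cmod (snd (cheb (of_real x) (j div p))) * cmod (Rx (j mod p) (of_real s))"
        by (simp add: norm_triangle_le norm_mult)
      also have "\<dots> \<le> 1 * K + real (j div p) * K"
        using cheb_real_bounds[OF x2] K[of s "j mod p"] r s by (intro add_mono mult_mono) auto
      also have "\<dots> \<le> K * (real n + 1)"
      proof -
        have "j div p \<le> n" using that div_le_dividend order_trans by blast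
        then have "real (j div p) * K \<le> real n * K" using K0 by (intro mult_right_mono) auto
        then show ?thesis by (simp add: algebra_simps)
      qed
      finally have "cmod (poly (phi \<alpha> j) z) \<le> K * (real n + 1)" by (simp add: s norm_phi_circle)
      then have "(cmod (poly (phi \<alpha> j) z))\<^sup>2 \<le> (K * (real n + 1))\<^sup>2" by (intro power_mono) auto
      then show ?thesis by (simp add: power_mult_distrib)
    qed
    then have "(\<Sum>j\<le>n. (cmod (poly (phi \<alpha> j) z))\<^sup>2) \<le> (\<Sum>j\<le>n. K\<^sup>2 * (real n + 1)\<^sup>2)" by (intro sum_mono) auto
    also have "\<dots> = K\<^sup>2 * (real n + 1) ^ 3" by (simp add: power2_eq_square power3_eq_cube algebra_simps)
    finally show ?thesis by (simp add: CD_kernel_diag orthonormal_poly_eq_phi)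
  qed
  show ?thesis by (rule exI[of _ "K\<^sup>2"]) (use Re_le in auto)
qed

text \<open>The difference X - Y isolates the U part, with coefficient \<kappa>, which is nonzero
  off resonances. At a real angle X and Y have equal modulus, so X is at least half of this
  difference.\<close>

lemma phi_unbounded_off_bands:
  assumes z: "cmod z = 1" "2 < cmod (Delta \<alpha> p z)" "\<not> resonance \<alpha> p z"
  shows "\<exists>c>0. \<forall>q. c * real q \<le> cmod (poly (phi \<alpha> (q * p)) z)"
proof -
  obtain s where s: "z = cis s" using z(1) by (auto elim: circle_angle)
  define t where "t = complex_of_real s"
  have zt: "z = exp (\<i> * t)" by (simp add: s t_def cis_conv_exp)
  have \<kappa>: "\<kappa> t \<noteq> 0" using z(3) unfolding zt resonance_iff .
  define x where "x = Re (D t) / 2"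
  have x: "D t / 2 = of_real x" using D_real[of s] by (simp add: x_def t_def)
  have "2 < cmod (D t)" using z(2) by (simp add: s t_def Delta_cis)
  also have "D t = of_real (2 * x)" using x by (simp add: field_simps)
  finally have x1: "\<bar>x\<bar> > 1" by (simp add: abs_mult)
  have "cmod (\<kappa> t) / 2 * real q \<le> cmod (poly (phi \<alpha> (q * p)) z)" for q
  proof -
    have "X t (q * p) - Y t (q * p) = snd (cheb (of_real x) q) * \<kappa> t"
      unfolding sol_period x by (simp add: \<kappa>_def algebra_simps)
    then have "cmod (snd (cheb (of_real x) q)) * cmod (\<kappa> t) \<le> cmod (X t (q * p)) + cmod (Y t (q * p))"
      by (metis norm_mult norm_triangle_ineq4)
    moreover have "cmod (Y t (q * p)) = cmod (X t (q * p))"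
      using cnj_XY(1)[of t "q * p"] by (metis complex_cnj_complex_of_real complex_mod_cnj t_def)
    moreover have "real q * cmod (\<kappa> t) \<le> cmod (snd (cheb (of_real x) q)) * cmod (\<kappa> t)"
      by (intro mult_right_mono cheb_growth x1) auto
    ultimately have "real q * cmod (\<kappa> t) \<le> 2 * cmod (X t (q * p))" by simp
    then show ?thesis using norm_phi_circle[of "q * p" s] by (simp add: s t_def mult.commute)
  qed
  then show ?thesis using \<kappa> by (intro exI[of _ "cmod (\<kappa> t) / 2"]) auto
qed

lemma Delta_measurable: "Delta \<alpha> p \<in> borel_measurable borel"
  unfolding Delta_def[abs_def] by (intro borel_measurable_divide borel_measurable_continuous_onI continuous_intros)

lemma closed_E: "closed E"
proof -
  have "continuous_on (sphere 0 1) (\<lambda>z. cmod (Delta \<alpha> p z))"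
    unfolding Delta_def by (intro continuous_intros) auto
  then have "closed (sphere 0 1 \<inter> (\<lambda>z. cmod (Delta \<alpha> p z)) -` {..2})"
    by (intro continuous_closed_preimage) auto
  moreover have "sphere 0 1 \<inter> (\<lambda>z. cmod (Delta \<alpha> p z)) -` {..2} = E" by (auto simp: E_def)
  ultimately show ?thesis by simp
qed

text \<open>Fatou's lemma: the squared orthonormal polynomials have integral 1, yet along multiples
  of p they tend to infinity everywhere on this set.\<close>

lemma \<mu>_null_off_bands: "emeasure \<mu> {z. cmod z = 1 \<and> 2 < cmod (Delta \<alpha> p z) \<and> \<not> resonance \<alpha> p z} = 0"
proof -
  let ?G = "{z. cmod z = 1 \<and> 2 < cmod (Delta \<alpha> p z) \<and> \<not> resonance \<alpha> p z}"
  have sb: "sets \<mu> = sets borel" using \<mu>_circle by (simp add: circle_measure_def)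
  have "?G = {z \<in> space borel. cmod z = 1 \<and> 2 < cmod (Delta \<alpha> p z) \<and> \<not> (poly (phi \<alpha> p) z - poly (szego_star p (phi \<alpha> p)) z = 0)}"
    by (simp add: resonance_def)
  also have "\<dots> \<in> sets borel"
  proof -
    have [measurable]: "Delta \<alpha> p \<in> borel_measurable borel" by (rule Delta_measurable)
    have [measurable]: "poly P \<in> borel_measurable borel" for P :: "complex poly"
      by (intro borel_measurable_continuous_onI continuous_intros)
    show ?thesis by measurable
  qed
  finally have G: "?G \<in> sets \<mu>" using sb by simp
  define u where "u q z = ennreal ((cmod (poly (phi \<alpha> (q * p)) z))\<^sup>2)" for q z
  have um: "u q \<in> borel_measurable \<mu>" for q
    unfolding u_def circle_measurable[OF \<mu>_circle] by (intro measurable_compose[OF _ measurable_ennreal] borel_measurable_continuous_onI continuous_intros)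
  have int: "(\<integral>\<^sup>+z. u q z \<partial>\<mu>) = 1" for q
  proof -
    have "(\<integral>\<^sup>+z. u q z \<partial>\<mu>) = ennreal (sqnorm_M \<mu> (phi \<alpha> (q * p)))"
      unfolding u_def sqnorm_M_def by (intro nn_integral_eq_integral circle_integrable[OF \<mu>_circle] continuous_intros) auto
    also have "complex_of_real (sqnorm_M \<mu> (phi \<alpha> (q * p))) = 1"
      using inner_orthonormal_poly[OF \<mu>_nontrivial, of "q * p" "q * p"]
      by (simp add: inner_M_self[symmetric] orthonormal_poly_eq_phi)
    then have "sqnorm_M \<mu> (phi \<alpha> (q * p)) = 1" by (simp only: of_real_eq_1_iff)
    finally show ?thesis by simp
  qed
  have top: "liminf (\<lambda>q. u q z) = \<infinity>" if zG: "z \<in> ?G" for z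
  proof -
    obtain c where c: "c > 0" "\<And>q. c * real q \<le> cmod (poly (phi \<alpha> (q * p)) z)"
      using phi_unbounded_off_bands[of z] zG by blast
    have lim: "filterlim (\<lambda>q. (c * real q)\<^sup>2) at_top sequentially" using c(1) by real_asymp
    have le: "(c * real q)\<^sup>2 \<le> (cmod (poly (phi \<alpha> (q * p)) z))\<^sup>2" for q
      using c by (intro power_mono) auto
    have "filterlim (\<lambda>q. (cmod (poly (phi \<alpha> (q * p)) z))\<^sup>2) at_top sequentially"
      by (rule filterlim_at_top_mono[OF lim always_eventually[OF allI[OF le]]])
    then have "(\<lambda>q. u q z) \<longlonglongrightarrow> \<infinity>"
      unfolding u_def infinity_ennreal_def by (rule ennreal_tendsto_top_eq_at_top[THEN iffD2])
    then show ?thesis by (intro lim_imp_Liminf) auto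
  qed
  have "\<infinity> * emeasure \<mu> ?G = (\<integral>\<^sup>+z. \<infinity> * indicator ?G z \<partial>\<mu>)"
    using G by (simp add: nn_integral_cmult_indicator)
  also have "\<dots> \<le> (\<integral>\<^sup>+z. liminf (\<lambda>q. u q z) \<partial>\<mu>)"
    by (intro nn_integral_mono) (use top in \<open>auto simp: indicator_def\<close>)
  also have "\<dots> \<le> liminf (\<lambda>q. \<integral>\<^sup>+z. u q z \<partial>\<mu>)" by (rule nn_integral_liminf[OF um])
  also have "\<dots> = 1" unfolding int by (simp add: Liminf_const)
  finally have "\<infinity> * emeasure \<mu> ?G \<le> 1" .
  then show "emeasure \<mu> ?G = 0" by (cases "emeasure \<mu> ?G = 0") (auto simp: ennreal_top_mult top_unique)
qed

text \<open>Off the bands \<mu> can charge only resonances. These are finitely many, hence null for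
  arc length and for the absolutely continuous part.\<close>

lemma msupp_ac_part: "msupp (ac_part \<mu>) \<subseteq> E"
proof
  fix z assume z: "z \<in> msupp (ac_part \<mu>)"
  have fin: "finite_measure \<mu>" "sets \<mu> = sets borel" using \<mu>_circle by (auto simp: circle_measure_def)
  note ac = ac_part_props[OF fin]
  let ?N = "ac_part \<mu>"
  let ?G = "{z. cmod z = 1 \<and> 2 < cmod (Delta \<alpha> p z) \<and> \<not> resonance \<alpha> p z}"
  let ?F = "{z. resonance \<alpha> p z}"
  obtain n where n: "p = Suc n" using p_pos by (cases p) auto
  have "?F = {z. poly (phi \<alpha> p - szego_star p (phi \<alpha> p)) z = 0}" by (simp add: resonance_def)
  then have F: "finite ?F" using poly_roots_finite[OF phi_minus_star_nonzero[of n]] n by simp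
  then have "?F \<in> null_sets ?N" using finite_null_arc_length ac(2) by (auto simp: absolutely_continuous_def)
  moreover have "- sphere 0 1 \<in> null_sets ?N"
    using ac(3)[of "- sphere 0 1"] \<mu>_circle ac(1) by (auto simp: circle_measure_def null_sets_def)
  moreover have "- E - ?F - (- sphere 0 1) \<in> null_sets ?N"
  proof -
    have m: "- E - ?F - (- sphere 0 1) \<in> sets borel"
      using closed_E F by (intro sets.Diff) (auto intro: finite_imp_closed borel_closed)
    have "- E - ?F - (- sphere 0 1) = ?G" by (auto simp: E_def)
    then have "emeasure ?N (- E - ?F - (- sphere 0 1)) \<le> 0" using ac(3)[OF m] \<mu>_null_off_bands by simp
    then show ?thesis using m ac(1) by (auto simp: null_sets_def)
  qed
  ultimately have "?F \<union> - sphere 0 1 \<union> (- E - ?F - (- sphere 0 1)) \<in> null_sets ?N" by (intro null_sets.Un)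
  then have "- E \<in> null_sets ?N"
    by (rule null_sets_subset) (use closed_E ac(1) in auto)
  then show "z \<in> E" using z closed_E by (auto simp: msupp_def null_sets_def)
qed

end

section \<open>Perturbed measures\<close>

locale perturbed_measure = periodic_measure +
  fixes \<mu>0 \<mu>star :: "complex measure" and w :: "complex \<Rightarrow> real" and \<theta> :: real
  assumes w_cont: "continuous_on (msupp \<mu>) w" and w_pos: "\<And>z. z \<in> msupp \<mu> \<Longrightarrow> 0 < w z"
    and \<mu>0_circle: "circle_measure \<mu>0" and \<mu>0_supp: "msupp \<mu>0 \<subseteq> msupp (ac_part \<mu>)"
    and \<mu>star_sets: "sets \<mu>star = sets borel"
    and \<mu>star: "\<And>A. A \<in> sets borel \<Longrightarrow> emeasure \<mu>star A = (\<integral>\<^sup>+z\<in>A. ennreal (w z) \<partial>\<mu>) + emeasure \<mu>0 A"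
    and \<mu>0_away: "msupp \<mu>0 \<noteq> {} \<Longrightarrow> 0 < infdist (cis \<theta>) (msupp \<mu>0)"
begin

text \<open>The weight is continuous only on the support; setting it to 0 elsewhere makes it Borel
  on the whole plane without changing any integral against \<mu>.\<close>

definition "v z = w z * indicat_real (msupp \<mu>) z"

lemma v_borel: "v \<in> borel_measurable borel"
proof -
  have "(\<lambda>z. indicator (msupp \<mu>) z *\<^sub>R w z) \<in> borel_measurable borel"
    by (rule borel_measurable_continuous_on_indicator[OF _ w_cont]) (simp add: closed_msupp)
  then show ?thesis by (simp add: v_def[abs_def] mult.commute)
qed

lemma sets_\<mu>: "sets \<mu> = sets borel" and fin_\<mu>: "finite_measure \<mu>"
  using \<mu>_circle by (simp_all add: circle_measure_def)

lemma supp_bounds: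
  obtains m Mx where "0 < m" "\<And>z. z \<in> msupp \<mu> \<Longrightarrow> m \<le> w z \<and> w z \<le> Mx" "0 \<le> Mx"
proof -
  have c: "compact (msupp \<mu>)" by (rule compact_msupp[OF \<mu>_circle])
  have ne: "msupp \<mu> \<noteq> {}" using \<mu>_nontrivial by (auto simp: nontrivial_measure_def)
  obtain a b where ab: "a \<in> msupp \<mu>" "\<And>z. z \<in> msupp \<mu> \<Longrightarrow> w a \<le> w z" "b \<in> msupp \<mu>" "\<And>z. z \<in> msupp \<mu> \<Longrightarrow> w z \<le> w b"
    using continuous_attains_inf[OF c ne w_cont] continuous_attains_sup[OF c ne w_cont] by blast
  show thesis using that[of "w a" "w b"] ab w_pos less_imp_le by blast
qed

lemma AE_supp: "AE z in \<mu>. z \<in> msupp \<mu>"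
  by (rule AE_msupp[OF sets_\<mu>])

lemma \<mu>star_density: 
  assumes "A \<in> sets borel"
  shows "emeasure \<mu>star A = emeasure (density \<mu> (\<lambda>z. ennreal (v z))) A + emeasure \<mu>0 A"
proof -
  have "(\<integral>\<^sup>+z\<in>A. ennreal (w z) \<partial>\<mu>) = (\<integral>\<^sup>+z. ennreal (v z) * indicator A z \<partial>\<mu>)"
    by (rule nn_integral_cong_AE) (use AE_supp in eventually_elim, simp add: v_def)
  also have "\<dots> = emeasure (density \<mu> (\<lambda>z. ennreal (v z))) A"
    using assms sets_\<mu> v_borel by (subst emeasure_density) (auto simp: circle_measurable[OF \<mu>_circle])
  finally show ?thesis using \<mu>star[OF assms] by simp
qed

lemma nn_integral_\<mu>star:
  assumes f: "f \<in> borel_measurable borel"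
  shows "(\<integral>\<^sup>+z. f z \<partial>\<mu>star) = (\<integral>\<^sup>+z. ennreal (v z) * f z \<partial>\<mu>) + (\<integral>\<^sup>+z. f z \<partial>\<mu>0)"
proof -
  have "(\<integral>\<^sup>+z. f z \<partial>\<mu>star) = (\<integral>\<^sup>+z. f z \<partial>density \<mu> (\<lambda>z. ennreal (v z))) + (\<integral>\<^sup>+z. f z \<partial>\<mu>0)"
    by (rule nn_integral_measure_sum[OF \<mu>star_sets _ _ \<mu>star_density f])
      (use sets_\<mu> \<mu>0_circle in \<open>auto simp: circle_measure_def\<close>)
  also have "(\<integral>\<^sup>+z. f z \<partial>density \<mu> (\<lambda>z. ennreal (v z))) = (\<integral>\<^sup>+z. ennreal (v z) * f z \<partial>\<mu>)"
    using f v_borel by (intro nn_integral_density) (auto simp: circle_measurable[OF \<mu>_circle])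
  finally show ?thesis .
qed

lemma \<mu>star_circle: "circle_measure \<mu>star"
proof -
  obtain m Mx where m: "0 < m" "\<And>z. z \<in> msupp \<mu> \<Longrightarrow> m \<le> w z \<and> w z \<le> Mx" "0 \<le> Mx" using supp_bounds by blast
  have bound: "emeasure \<mu>star A \<le> ennreal Mx * emeasure \<mu> A + emeasure \<mu>0 A" if A: "A \<in> sets borel" for A
  proof -
    have "(\<integral>\<^sup>+z\<in>A. ennreal (w z) \<partial>\<mu>) \<le> (\<integral>\<^sup>+z\<in>A. ennreal Mx \<partial>\<mu>)"
      by (rule nn_integral_mono_AE) (use AE_supp in eventually_elim, auto intro!: mult_right_mono ennreal_leI dest: m(2))
    also have "\<dots> = ennreal Mx * emeasure \<mu> A" using A sets_\<mu> by (simp add: nn_integral_cmult_indicator)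
    finally show ?thesis using \<mu>star[OF A] by (simp add: add_right_mono)
  qed
  have f0: "finite_measure \<mu>0" using \<mu>0_circle by (simp add: circle_measure_def)
  have "emeasure \<mu>star UNIV < \<infinity>"
  proof -
    have "emeasure \<mu> UNIV < \<infinity>" "emeasure \<mu>0 UNIV < \<infinity>"
      using finite_measure.emeasure_finite[OF fin_\<mu>] finite_measure.emeasure_finite[OF f0] by (simp_all add: less_top)
    then have "ennreal Mx * emeasure \<mu> UNIV + emeasure \<mu>0 UNIV < \<infinity>" by (simp add: ennreal_mult_less_top)
    then show ?thesis using bound[of UNIV] by (simp add: order_le_less_trans)
  qed
  then have "finite_measure \<mu>star"
    using sets_eq_imp_space_eq[OF \<mu>star_sets] by (intro finite_measureI) simp
  moreover have "emeasure \<mu>star (- sphere 0 1) = 0"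
    using bound[of "- sphere 0 1"] \<mu>_circle \<mu>0_circle by (simp add: circle_measure_def)
  ultimately show ?thesis using \<mu>star_sets by (simp add: circle_measure_def)
qed

lemma msupp_subset_\<mu>star: "msupp \<mu> \<subseteq> msupp \<mu>star"
proof
  obtain m Mx where m: "0 < m" "\<And>z. z \<in> msupp \<mu> \<Longrightarrow> m \<le> w z \<and> w z \<le> Mx" "0 \<le> Mx" using supp_bounds by blast
  fix z assume z: "z \<in> msupp \<mu>"
  show "z \<in> msupp \<mu>star" unfolding msupp_def
  proof (intro CollectI allI impI)
    fix U assume U: "open U \<and> z \<in> U"
    then have Ub: "U \<in> sets borel" and pos: "0 < emeasure \<mu> U" using z by (auto simp: msupp_def)
    have "ennreal m * emeasure \<mu> U = (\<integral>\<^sup>+z\<in>U. ennreal m \<partial>\<mu>)" using Ub sets_\<mu> by (simp add: nn_integral_cmult_indicator)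
    also have "\<dots> \<le> (\<integral>\<^sup>+z\<in>U. ennreal (w z) \<partial>\<mu>)"
      by (rule nn_integral_mono_AE) (use AE_supp in eventually_elim, auto intro!: mult_right_mono ennreal_leI dest: m(2))
    also have "\<dots> \<le> emeasure \<mu>star U" using \<mu>star[OF Ub] by simp
    finally have "ennreal m * emeasure \<mu> U \<le> emeasure \<mu>star U" .
    moreover have "0 < ennreal m * emeasure \<mu> U" using m(1) pos by (simp add: ennreal_zero_less_mult_iff)
    ultimately show "0 < emeasure \<mu>star U" by (rule order_less_le_trans[rotated])
  qed
qed

lemma \<mu>star_nontrivial: "nontrivial_measure \<mu>star"
  using \<mu>star_circle msupp_subset_\<mu>star \<mu>_nontrivial finite_subset by (auto simp: nontrivial_measure_def)

lemma sqnorm_\<mu>star: "sqnorm_M \<mu>star P = (LINT z|\<mu>. v z * (cmod (poly P z))\<^sup>2) + sqnorm_M \<mu>0 P"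
proof -
  obtain m Mx where m: "0 < m" "\<And>z. z \<in> msupp \<mu> \<Longrightarrow> m \<le> w z \<and> w z \<le> Mx" "0 \<le> Mx" using supp_bounds by blast
  have v0: "0 \<le> v z" for z using w_pos by (auto simp: v_def indicator_def less_imp_le)
  have vM: "v z \<le> Mx" for z using m by (auto simp: v_def indicator_def)
  define f where "f z = (cmod (poly P z))\<^sup>2" for z
  have fb: "(\<lambda>z. ennreal (f z)) \<in> borel_measurable borel"
    unfolding f_def by (intro measurable_compose[OF _ measurable_ennreal] borel_measurable_continuous_onI continuous_intros)
  have int: "integrable K f" if "circle_measure K" for K
    unfolding f_def by (intro circle_integrable[OF that] continuous_intros)
  have iv: "integrable \<mu> (\<lambda>z. v z * f z)"
  proof (rule Bochner_Integration.integrable_bound[OF integrable_mult_right[OF int[OF \<mu>_circle], of Mx]])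
    show "(\<lambda>z. v z * f z) \<in> borel_measurable \<mu>"
      using v_borel borel_measurable_integrable[OF int[OF \<mu>_circle]] by (simp add: circle_measurable[OF \<mu>_circle])
    show "AE z in \<mu>. norm (v z * f z) \<le> norm (Mx * f z)"
      using v0 vM m(3) by (intro always_eventually allI) (auto simp: f_def abs_mult intro!: mult_right_mono)
  qed
  have nn: "(\<integral>\<^sup>+z. ennreal (f z) \<partial>K) = ennreal (LINT z|K. f z)" if "circle_measure K" for K
    by (intro nn_integral_eq_integral int[OF that]) (simp add: f_def)
  have "ennreal (LINT z|\<mu>star. f z) = (\<integral>\<^sup>+z. ennreal (v z) * ennreal (f z) \<partial>\<mu>) + (\<integral>\<^sup>+z. ennreal (f z) \<partial>\<mu>0)"
    using nn[OF \<mu>star_circle] nn_integral_\<mu>star[OF fb] by simp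
  also have "(\<integral>\<^sup>+z. ennreal (v z) * ennreal (f z) \<partial>\<mu>) = (\<integral>\<^sup>+z. ennreal (v z * f z) \<partial>\<mu>)"
    using v0 by (intro nn_integral_cong) (simp add: ennreal_mult f_def)
  also have "\<dots> = ennreal (LINT z|\<mu>. v z * f z)"
    using v0 by (intro nn_integral_eq_integral iv) (simp add: f_def)
  also have "(\<integral>\<^sup>+z. ennreal (f z) \<partial>\<mu>0) = ennreal (LINT z|\<mu>0. f z)" by (rule nn[OF \<mu>0_circle])
  also have "ennreal (LINT z|\<mu>. v z * f z) + ennreal (LINT z|\<mu>0. f z) = ennreal ((LINT z|\<mu>. v z * f z) + (LINT z|\<mu>0. f z))"
    using v0 by (intro ennreal_plus[symmetric] integral_nonneg_AE always_eventually allI) (auto simp: f_def)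
  finally have "ennreal (LINT z|\<mu>star. f z) = ennreal ((LINT z|\<mu>. v z * f z) + (LINT z|\<mu>0. f z))" .
  moreover have "0 \<le> (LINT z|\<mu>star. f z)" "0 \<le> (LINT z|\<mu>. v z * f z) + (LINT z|\<mu>0. f z)"
    using v0 by (auto intro!: add_nonneg_nonneg integral_nonneg_AE always_eventually simp: f_def)
  ultimately have "(LINT z|\<mu>star. f z) = (LINT z|\<mu>. v z * f z) + (LINT z|\<mu>0. f z)" by (simp add: ennreal_inj)
  then show ?thesis by (simp add: sqnorm_M_def f_def)
qed

lemma \<mu>0_far:
  "\<exists>\<delta>0 B. 0 < \<delta>0 \<and> \<delta>0 \<le> 2 \<and> 0 \<le> B \<and>
    (AE z in \<mu>0. \<delta>0 \<le> cmod (z - cis \<theta>) \<and> (\<forall>n. Re (CD_kernel n z z \<mu>) \<le> B * (real n + 1) ^ 3))"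
proof -
  obtain B where B: "B \<ge> 0" "\<And>z n. z \<in> E \<Longrightarrow> Re (CD_kernel n z z \<mu>) \<le> B * (real n + 1) ^ 3"
    using CD_kernel_polynomial_bound by blast
  \<comment> \<open>If the support is empty the added measure is null and any value in (0, 2]
    serves. The cap at 2, the diameter of the circle, keeps 1 - \<delta>0^2/4 nonnegative.\<close>
  define \<delta>0 where "\<delta>0 = (if msupp \<mu>0 = {} then 1 else min 2 (infdist (cis \<theta>) (msupp \<mu>0)))"
  have \<delta>0: "0 < \<delta>0" "\<delta>0 \<le> 2" using \<mu>0_away by (auto simp: \<delta>0_def)
  have "AE z in \<mu>0. z \<in> msupp \<mu>0" using \<mu>0_circle by (intro AE_msupp) (simp add: circle_measure_def)
  then have "AE z in \<mu>0. \<delta>0 \<le> cmod (z - cis \<theta>) \<and> (\<forall>n. Re (CD_kernel n z z \<mu>) \<le> B * (real n + 1) ^ 3)"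
  proof eventually_elim
    case (elim z)
    have "\<delta>0 \<le> infdist (cis \<theta>) (msupp \<mu>0)" using elim by (auto simp: \<delta>0_def)
    also have "\<dots> \<le> dist (cis \<theta>) z" using elim by (rule infdist_le)
    also have "\<dots> = cmod (z - cis \<theta>)" by (simp add: dist_norm norm_minus_commute)
    finally have "\<delta>0 \<le> cmod (z - cis \<theta>)" .
    moreover have "z \<in> E" using elim \<mu>0_supp msupp_ac_part by blast
    ultimately show ?case using B by blast
  qed
  then show ?thesis using \<delta>0 B(1) by blast
qed

text \<open>If \<^term>\<open>cis \<theta>\<close> lies off the support of \<^term>\<open>\<mu>\<close>, any positive local value of the density will do.\<close>

lemma weight_modulus:
  assumes m: "0 < m" "\<And>z. z \<in> msupp \<mu> \<Longrightarrow> m \<le> w z \<and> w z \<le> Mx"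
  shows "\<exists>c \<omega>. m \<le> c \<and> (\<omega> \<longlongrightarrow> 0) (at_right 0) \<and>
    (\<forall>\<delta>>0. AE z in \<mu>. cmod (z - cis \<theta>) \<le> \<delta> \<longrightarrow> \<bar>v z - c\<bar> \<le> \<omega> \<delta>)"
proof -
  define c where "c = (if cis \<theta> \<in> msupp \<mu> then w (cis \<theta>) else m)"
  have c: "m \<le> c" using m by (auto simp: c_def)
  \<comment> \<open>The inserted 0 keeps the set nonempty when no point of the support is within
    distance \<delta>, so that its supremum is meaningful.\<close>
  define T where "T \<delta> = insert 0 ((\<lambda>z. \<bar>w z - c\<bar>) ` {z \<in> msupp \<mu>. cmod (z - cis \<theta>) \<le> \<delta>})" for \<delta> :: real
  define \<omega> where "\<omega> \<delta> = Sup (T \<delta>)" for \<delta>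
  have bdd: "bdd_above (T \<delta>)" for \<delta>
  proof (rule bdd_aboveI[of _ "\<bar>Mx\<bar> + \<bar>c\<bar>"])
    fix x assume "x \<in> T \<delta>"
    then show "x \<le> \<bar>Mx\<bar> + \<bar>c\<bar>" using m by (force simp: T_def)
  qed
  have \<omega>0: "0 \<le> \<omega> \<delta>" for \<delta> unfolding \<omega>_def by (rule cSup_upper[OF _ bdd]) (simp add: T_def)
  have near: "AE z in \<mu>. cmod (z - cis \<theta>) \<le> \<delta> \<longrightarrow> \<bar>v z - c\<bar> \<le> \<omega> \<delta>" for \<delta>
    using AE_supp
  proof eventually_elim
    case (elim z)
    show ?case unfolding \<omega>_def
      by (intro impI cSup_upper bdd) (use elim in \<open>auto simp: T_def v_def\<close>)
  qed
  have "(\<omega> \<longlongrightarrow> 0) (at_right 0)"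
  proof (rule tendstoI)
    fix e :: real assume e: "e > 0"
    have "\<exists>d>0. \<forall>z\<in>msupp \<mu>. cmod (z - cis \<theta>) < d \<longrightarrow> \<bar>w z - c\<bar> < e/2"
    proof (cases "cis \<theta> \<in> msupp \<mu>")
      case True
      then show ?thesis using w_cont e unfolding continuous_on_iff c_def dist_norm
        by (metis half_gt_zero real_norm_def)
    next
      case False
      then obtain d where "d > 0" "ball (cis \<theta>) d \<inter> msupp \<mu> = {}"
        using closed_msupp[of \<mu>] by (metis ComplI Compl_eq_Diff_UNIV disjoint_eq_subset_Compl open_Compl openE)
      then show ?thesis
        by (intro exI[of _ d] conjI ballI impI) (auto simp: disjoint_iff dist_norm norm_minus_commute)
    qed
    then obtain d where d: "d > 0" "\<And>z. z\<in>msupp \<mu> \<Longrightarrow> cmod (z - cis \<theta>) < d \<Longrightarrow> \<bar>w z - c\<bar> < e/2" by blast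
    have "\<forall>\<^sub>F \<delta> in at_right 0. \<delta> < d" using d(1) by (simp add: eventually_at_right_less eventually_at_right_field) blast
    then show "\<forall>\<^sub>F \<delta> in at_right 0. dist (\<omega> \<delta>) 0 < e"
    proof eventually_elim
      case (elim \<delta>)
      have "\<omega> \<delta> \<le> e/2" unfolding \<omega>_def
        by (rule cSup_least) (use d elim e in \<open>force simp: T_def\<close>)+
      then show ?case using \<omega>0[of \<delta>] e by simp
    qed
  qed
  then show ?thesis using c near by blast
qed

text \<open>The common route from the holomorphic kernel of the periodic measure to the uniform
  statement for the perturbed one. The conjugate on b enters here, through
  \<open>CD_kernel_ker\<close>, and both the normalization N^\<beta> and the local density cancel in
  the quotient.\<close>

lemma kernel_transfer:
  fixes L :: "complex \<Rightarrow> complex \<Rightarrow> complex" and \<gamma> \<beta> :: nat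
  assumes \<gamma>: "1 \<le> \<gamma>"
    and H: "\<And>Q a b a' b'. filterlim Q at_top sequentially \<Longrightarrow> a \<longlonglongrightarrow> a' \<Longrightarrow> b \<longlonglongrightarrow> b' \<Longrightarrow>
      (\<lambda>n. ker (Q n * p) (of_real \<theta> + a n / of_nat (Q n * p) ^ \<gamma>) (of_real \<theta> + b n / of_nat (Q n * p) ^ \<gamma>) / of_nat (Q n * p) ^ \<beta>)
        \<longlonglongrightarrow> L a' b'"
    and L0: "L 0 0 \<noteq> 0" and L: "continuous_on UNIV (\<lambda>(a, b). L a b)"
    and C: "compact C"
  shows "uniform_limit C (\<lambda>n (a, b). CD_kernel n (pt \<theta> \<gamma> n a) (pt \<theta> \<gamma> n b) \<mu>star / CD_kernel n (cis \<theta>) (cis \<theta>) \<mu>star)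
    (\<lambda>(a, b). L a (cnj b) / L 0 0) sequentially"
proof -
  obtain m Mx where m: "0 < m" "\<And>z. z \<in> msupp \<mu> \<Longrightarrow> m \<le> w z \<and> w z \<le> Mx" "0 \<le> Mx" using supp_bounds by blast
  obtain c \<omega> where c: "m \<le> c" "(\<omega> \<longlongrightarrow> 0) (at_right 0)"
    "\<And>\<delta>. \<delta> > 0 \<Longrightarrow> AE z in \<mu>. cmod (z - cis \<theta>) \<le> \<delta> \<longrightarrow> \<bar>v z - c\<bar> \<le> \<omega> \<delta>"
    using weight_modulus[OF m(1,2)] by blast
  obtain \<delta>0 B where far: "0 < \<delta>0" "\<delta>0 \<le> 2" "0 \<le> B"
    "AE z in \<mu>0. \<delta>0 \<le> cmod (z - cis \<theta>) \<and> (\<forall>n. Re (CD_kernel n z z \<mu>) \<le> B * (real n + 1) ^ 3)"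
    using \<mu>0_far by blast
  have loc: "localization \<mu> \<mu>star \<mu>0 v \<omega> \<theta> c m Mx \<delta>0 B p \<gamma> \<beta> (\<lambda>a b. L a (cnj b))"
  proof unfold_locales
    show "AE z in \<mu>. m \<le> v z \<and> v z \<le> Mx" using AE_supp by eventually_elim (use m in \<open>auto simp: v_def\<close>)
    fix Q :: "nat \<Rightarrow> nat" and a b :: "nat \<Rightarrow> complex" and a' b'
    assume Q: "filterlim Q at_top sequentially" and a: "a \<longlonglongrightarrow> a'" and b: "b \<longlonglongrightarrow> b'"
    have l: "(\<lambda>n. ker (Q n * p) (of_real \<theta> + a n / of_nat (Q n * p) ^ \<gamma>) (of_real \<theta> + cnj (b n) / of_nat (Q n * p) ^ \<gamma>) / of_nat (Q n * p) ^ \<beta>)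
      \<longlonglongrightarrow> L a' (cnj b')"
      by (rule H[OF Q a]) (rule tendsto_cnj[OF b])
    have "\<forall>\<^sub>F n in sequentially. Q n \<ge> 1" using Q by (simp add: filterlim_at_top)
    then have "\<forall>\<^sub>F n in sequentially. ker (Q n * p) (of_real \<theta> + a n / of_nat (Q n * p) ^ \<gamma>) (of_real \<theta> + cnj (b n) / of_nat (Q n * p) ^ \<gamma>) / of_nat (Q n * p) ^ \<beta>
      = CD_kernel (Q n * p - 1) (pt \<theta> \<gamma> (Q n * p) (a n)) (pt \<theta> \<gamma> (Q n * p) (b n)) \<mu> / of_nat (Q n * p) ^ \<beta>"
      by eventually_elim (simp add: pt_def CD_kernel_ker del: of_nat_mult One_nat_def)
    from Lim_transform_eventually[OF l this]
    show "(\<lambda>n. CD_kernel (Q n * p - 1) (pt \<theta> \<gamma> (Q n * p) (a n)) (pt \<theta> \<gamma> (Q n * p) (b n)) \<mu> / of_nat (Q n * p) ^ \<beta>) \<longlonglongrightarrow> L a' (cnj b')" .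
  qed (use \<mu>_nontrivial \<mu>star_nontrivial \<mu>0_circle v_borel m c far sqnorm_\<mu>star p_pos \<gamma> in auto)
  have c0: "0 < c" using m c by simp
  show ?thesis
  proof (rule uniform_limit_continuous_convergence[OF C])
    have "continuous_on UNIV (\<lambda>x. (\<lambda>(a, b). L a b) (fst x, cnj (snd x)) / L 0 0)"
      by (intro continuous_on_divide continuous_on_const continuous_on_compose2[OF L] continuous_intros) (auto simp: L0)
    then show "continuous_on C (\<lambda>(a, b). L a (cnj b) / L 0 0)"
      by (auto simp: case_prod_beta intro: continuous_on_subset)
    fix N :: "nat \<Rightarrow> nat" and x :: "nat \<Rightarrow> complex \<times> complex" and y
    assume N: "filterlim N at_top sequentially" and x: "x \<longlonglongrightarrow> y"
    have fs: "(\<lambda>n. fst (x n)) \<longlonglongrightarrow> fst y" "(\<lambda>n. snd (x n)) \<longlonglongrightarrow> snd y" using x by (auto intro: tendsto_intros)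
    define \<kappa>' where "\<kappa>' n = complex_of_nat (N n) ^ \<beta>" for n
    have 1: "(\<lambda>n. CD_kernel (N n) (pt \<theta> \<gamma> (N n) (fst (x n))) (pt \<theta> \<gamma> (N n) (snd (x n))) \<mu>star / \<kappa>' n) \<longlonglongrightarrow> L (fst y) (cnj (snd y)) / of_real c"
      unfolding \<kappa>'_def by (rule localization.CD_kernel_Ms_tendsto[OF loc N fs])
    have 2: "(\<lambda>n. CD_kernel (N n) (cis \<theta>) (cis \<theta>) \<mu>star / \<kappa>' n) \<longlonglongrightarrow> L 0 0 / of_real c"
      using localization.CD_kernel_Ms_tendsto[OF loc N tendsto_const[of 0] tendsto_const[of 0]]
      by (simp add: \<kappa>'_def pt_def cis_conv_exp)
    have l: "(\<lambda>n. CD_kernel (N n) (pt \<theta> \<gamma> (N n) (fst (x n))) (pt \<theta> \<gamma> (N n) (snd (x n))) \<mu>star / \<kappa>' n / (CD_kernel (N n) (cis \<theta>) (cis \<theta>) \<mu>star / \<kappa>' n))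
      \<longlonglongrightarrow> L (fst y) (cnj (snd y)) / of_real c / (L 0 0 / of_real c)"
      using L0 c0 by (intro tendsto_divide 1 2) auto
    have "\<forall>\<^sub>F n in sequentially. N n \<ge> 1" using N by (simp add: filterlim_at_top)
    then have "\<forall>\<^sub>F n in sequentially. CD_kernel (N n) (pt \<theta> \<gamma> (N n) (fst (x n))) (pt \<theta> \<gamma> (N n) (snd (x n))) \<mu>star / \<kappa>' n / (CD_kernel (N n) (cis \<theta>) (cis \<theta>) \<mu>star / \<kappa>' n)
      = (case x n of (a, b) \<Rightarrow> CD_kernel (N n) (pt \<theta> \<gamma> (N n) a) (pt \<theta> \<gamma> (N n) b) \<mu>star / CD_kernel (N n) (cis \<theta>) (cis \<theta>) \<mu>star)"
    proof eventually_elim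
      case (elim n)
      then have "\<kappa>' n \<noteq> 0" by (simp add: \<kappa>'_def)
      then show ?case by (simp add: case_prod_beta)
    qed
    from Lim_transform_eventually[OF l this]
    show "(\<lambda>n. case x n of (a, b) \<Rightarrow> CD_kernel (N n) (pt \<theta> \<gamma> (N n) a) (pt \<theta> \<gamma> (N n) b) \<mu>star / CD_kernel (N n) (cis \<theta>) (cis \<theta>) \<mu>star)
      \<longlonglongrightarrow> (case y of (a, b) \<Rightarrow> L a (cnj b) / L 0 0)"
      using c0 by (simp add: case_prod_beta)
  qed
qed

end

section \<open>Limits in the interior and at the edges of bands\<close>

context perturbed_measure
begin

lemma band_limit:
  assumes int: "band_interior_point \<alpha> p (cis \<theta>)" and C: "compact C"
  shows "uniform_limit C
    (\<lambda>n (a, b). CD_kernel n (exp (\<i> * (of_real \<theta> + a / of_nat n))) (exp (\<i> * (of_real \<theta> + b / of_nat n))) \<mu>star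
      / CD_kernel n (cis \<theta>) (cis \<theta>) \<mu>star)
    (\<lambda>(a, b). exp (\<i> * ((a - cnj b) / 2)) * csinc (of_real (V \<alpha> p \<theta>) * (a - cnj b))) sequentially"
proof -
  interpret periodic_point \<alpha> p \<theta> ..
  obtain \<eta> g1 g2 r v where phase: "band_phase \<alpha> p \<theta> \<eta> g1 g2 r v" and v: "\<bar>v\<bar> = V \<alpha> p \<theta>"
    using band_interior_phase[OF int] by blast
  interpret band_phase \<alpha> p \<theta> \<eta> g1 g2 r v by (rule phase)
  define L where "L a c = amplitude * (exp (\<i> * (a - c) / 2) * csinc (of_real v * (a - c)))" for a c
  have "uniform_limit C (\<lambda>n (a, b). CD_kernel n (pt \<theta> 1 n a) (pt \<theta> 1 n b) \<mu>star / CD_kernel n (cis \<theta>) (cis \<theta>) \<mu>star)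
    (\<lambda>(a, b). L a (cnj b) / L 0 0) sequentially"
  proof (rule kernel_transfer[where \<beta>=1, OF _ _ _ _ C])
    show "L 0 0 \<noteq> 0" using amplitude_nonzero by (simp add: L_def csinc_def)
    show "continuous_on UNIV (\<lambda>(a, b). L a b)"
      unfolding L_def csinc_sincq case_prod_beta by (intro continuous_intros) auto
    fix Q :: "nat \<Rightarrow> nat" and a b :: "nat \<Rightarrow> complex" and a' b'
    assume "filterlim Q at_top sequentially" "a \<longlonglongrightarrow> a'" "b \<longlonglongrightarrow> b'"
    from ker_band_tendsto[OF this]
    show "(\<lambda>n. ker (Q n * p) (of_real \<theta> + a n / of_nat (Q n * p) ^ 1) (of_real \<theta> + b n / of_nat (Q n * p) ^ 1)
        / of_nat (Q n * p) ^ 1) \<longlonglongrightarrow> L a' b'"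
      by (simp only: spt_def L_def power_one_right)
  qed simp
  \<comment> \<open>The phase may decrease, so v is determined only up to sign; the sinc is even and
    does not see it.\<close>
  moreover have "csinc (of_real v * z) = csinc (of_real (V \<alpha> p \<theta>) * z)" for z
    by (simp add: csinc_sincq power_mult_distrib flip: v of_real_power)
  then have "L a (cnj b) / L 0 0 = exp (\<i> * ((a - cnj b) / 2)) * csinc (of_real (V \<alpha> p \<theta>) * (a - cnj b))" for a b
    using amplitude_nonzero by (simp add: L_def csinc_def[of 0])
  ultimately show ?thesis by (simp add: pt_def)
qed

lemma edge_limit:
  fixes c0 :: real
  assumes c0: "c0 > 0" and K: "continuous_on UNIV (\<lambda>(a, b). K a b)" "K 0 0 \<noteq> 0"
    and H: "\<And>Q a c a' c'. filterlim Q at_top sequentially \<Longrightarrow> a \<longlonglongrightarrow> a' \<Longrightarrow> c \<longlonglongrightarrow> c' \<Longrightarrow>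
      (\<lambda>n. ker (Q n * p) (of_real \<theta> + a n / (of_nat (Q n * p))\<^sup>2) (of_real \<theta> + c n / (of_nat (Q n * p))\<^sup>2)
        / of_nat (Q n * p) ^ \<beta>) \<longlonglongrightarrow>
        of_real c0 * K (- deriv D (of_real \<theta>) * a' / (of_nat p)\<^sup>2) (- deriv D (of_real \<theta>) * c' / (of_nat p)\<^sup>2)"
    and C: "compact C"
  shows "uniform_limit C
    (\<lambda>n (a, b). CD_kernel n (exp (\<i> * (of_real \<theta> - a / (of_nat n)\<^sup>2))) (exp (\<i> * (of_real \<theta> - b / (of_nat n)\<^sup>2))) \<mu>star
      / CD_kernel n (cis \<theta>) (cis \<theta>) \<mu>star)
    (\<lambda>(a, b). K (of_real (W \<alpha> p \<theta>) * a / (of_nat p)\<^sup>2) (of_real (W \<alpha> p \<theta>) * cnj b / (of_nat p)\<^sup>2) / K 0 0) sequentially"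
proof -
  define L where "L a c = of_real c0 * K (- deriv D (of_real \<theta>) * a / (of_nat p)\<^sup>2) (- deriv D (of_real \<theta>) * c / (of_nat p)\<^sup>2)" for a c
  \<comment> \<open>The edge points are displaced by -a/n^2, whereas \<open>pt\<close> adds its
    argument. Reflecting the compact set accounts for this and turns -D' into the W of the
    limit.\<close>
  define neg where "neg = (\<lambda>(a, b). (- a, - b) :: complex \<times> complex)"
  have "compact (neg ` C)"
    unfolding neg_def case_prod_beta by (intro compact_continuous_image continuous_intros C)
  then have "uniform_limit (neg ` C) (\<lambda>n (a, b). CD_kernel n (pt \<theta> 2 n a) (pt \<theta> 2 n b) \<mu>star / CD_kernel n (cis \<theta>) (cis \<theta>) \<mu>star)
    (\<lambda>(a, b). L a (cnj b) / L 0 0) sequentially"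
  proof (rule kernel_transfer[rotated -1])
    show "L 0 0 \<noteq> 0" using c0 K by (simp add: L_def)
    have "continuous_on UNIV (\<lambda>x. (\<lambda>(a, b). K a b) (- deriv D (of_real \<theta>) * fst x / (of_nat p)\<^sup>2, - deriv D (of_real \<theta>) * snd x / (of_nat p)\<^sup>2))"
      by (rule continuous_on_compose2[OF K(1)]) (use p_pos in \<open>auto intro!: continuous_intros\<close>)
    then show "continuous_on UNIV (\<lambda>(a, b). L a b)"
      unfolding L_def by (simp add: case_prod_beta continuous_on_mult_left)
  qed (use H in \<open>simp_all add: L_def\<close>)
  then have "uniform_limit C (\<lambda>n x. (\<lambda>(a, b). CD_kernel n (pt \<theta> 2 n a) (pt \<theta> 2 n b) \<mu>star / CD_kernel n (cis \<theta>) (cis \<theta>) \<mu>star) (neg x))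
    (\<lambda>x. (\<lambda>(a, b). L a (cnj b) / L 0 0) (neg x)) sequentially"
    by (rule uniform_limit_compose') auto
  moreover have "deriv D (of_real \<theta>) = of_real (W \<alpha> p \<theta>)" using deriv_D_real[of \<theta>] by (simp add: W_eq)
  ultimately show ?thesis using c0 by (simp add: neg_def case_prod_unfold pt_def L_def)
qed

lemma edge_limit_nonresonant:
  assumes \<Delta>: "Delta \<alpha> p (cis \<theta>) = 2" and r: "\<not> resonance \<alpha> p (cis \<theta>)" and C: "compact C"
  shows "uniform_limit C
    (\<lambda>n (a, b). CD_kernel n (exp (\<i> * (of_real \<theta> - a / (of_nat n)\<^sup>2))) (exp (\<i> * (of_real \<theta> - b / (of_nat n)\<^sup>2))) \<mu>star
      / CD_kernel n (cis \<theta>) (cis \<theta>) \<mu>star)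
    (\<lambda>(a, b). Jstar (1 / 2) (of_real (W \<alpha> p \<theta>) * a / (of_nat p)\<^sup>2) (of_real (W \<alpha> p \<theta>) * cnj b / (of_nat p)\<^sup>2)
      / Jstar (1 / 2) 0 0) sequentially"
proof -
  interpret periodic_edge \<alpha> p \<theta> by unfold_locales (use \<Delta> Delta_cis in simp)
  have "\<kappa> (of_real \<theta>) \<noteq> 0" using r resonance_iff[of "of_real \<theta>"] by (simp add: cis_conv_exp)
  then obtain c0 :: real where c0: "c0 > 0"
    "\<And>Q a c a' c'. filterlim Q at_top sequentially \<Longrightarrow> a \<longlonglongrightarrow> a' \<Longrightarrow> c \<longlonglongrightarrow> c' \<Longrightarrow>
      (\<lambda>n. ker (Q n * p) (spt 2 (Q n) (a n)) (spt 2 (Q n) (c n)) / of_nat (Q n * p) ^ 3) \<longlonglongrightarrow>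
        of_real c0 * sin_kernel (- deriv D (of_real \<theta>) * a' / (of_nat p)\<^sup>2) (- deriv D (of_real \<theta>) * c' / (of_nat p)\<^sup>2)"
    using ker_edge_nonresonant by blast
  have nz: "sin_kernel 0 0 \<noteq> 0" by (simp add: sin_kernel_0)
  have Jstar_ratio: "Jstar (1 / 2) x y / Jstar (1 / 2) 0 0 = sin_kernel x y / sin_kernel 0 0" for x y
    by (simp add: Jstar_half sin_kernel_0)
  show ?thesis unfolding Jstar_ratio
    by (rule edge_limit[OF c0(1) continuous_on_sin_kernel nz c0(2)[unfolded spt_def] C])
qed

lemma edge_limit_resonant:
  assumes \<Delta>: "Delta \<alpha> p (cis \<theta>) = 2" and r: "resonance \<alpha> p (cis \<theta>)" and C: "compact C"
  shows "uniform_limit C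
    (\<lambda>n (a, b). CD_kernel n (exp (\<i> * (of_real \<theta> - a / (of_nat n)\<^sup>2))) (exp (\<i> * (of_real \<theta> - b / (of_nat n)\<^sup>2))) \<mu>star
      / CD_kernel n (cis \<theta>) (cis \<theta>) \<mu>star)
    (\<lambda>(a, b). Jstar (- (1 / 2)) (of_real (W \<alpha> p \<theta>) * a / (of_nat p)\<^sup>2) (of_real (W \<alpha> p \<theta>) * cnj b / (of_nat p)\<^sup>2)
      / Jstar (- (1 / 2)) 0 0) sequentially"
proof -
  interpret periodic_edge \<alpha> p \<theta> by unfold_locales (use \<Delta> Delta_cis in simp)
  have "\<kappa> (of_real \<theta>) = 0" using r resonance_iff[of "of_real \<theta>"] by (simp add: cis_conv_exp)
  then obtain c0 :: real where c0: "c0 > 0"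
    "\<And>Q a c a' c'. filterlim Q at_top sequentially \<Longrightarrow> a \<longlonglongrightarrow> a' \<Longrightarrow> c \<longlonglongrightarrow> c' \<Longrightarrow>
      (\<lambda>n. ker (Q n * p) (spt 2 (Q n) (a n)) (spt 2 (Q n) (c n)) / of_nat (Q n * p) ^ 1) \<longlonglongrightarrow>
        of_real c0 * cos_kernel (- deriv D (of_real \<theta>) * a' / (of_nat p)\<^sup>2) (- deriv D (of_real \<theta>) * c' / (of_nat p)\<^sup>2)"
    using ker_edge_resonant by blast
  have nz: "cos_kernel 0 0 \<noteq> 0" by (simp add: cos_kernel_0)
  have Jstar_ratio: "Jstar (- (1 / 2)) x y / Jstar (- (1 / 2)) 0 0 = cos_kernel x y / cos_kernel 0 0" for x y
    by (simp add: Jstar_minus_half cos_kernel_0)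
  show ?thesis unfolding Jstar_ratio
    by (rule edge_limit[OF c0(1) continuous_on_cos_kernel nz c0(2)[unfolded spt_def] C])
qed

end

theorem theorem3p1:
  fixes p :: nat and \<alpha> :: "nat \<Rightarrow> complex"
    and \<mu> \<mu>0 \<mu>star :: "complex measure"
    and w :: "complex \<Rightarrow> real" and \<theta> :: real
  assumes "even p" and "0 < p"
    and "verblunsky_coeffs \<mu> \<alpha>"
    and "\<forall>n. \<alpha> (n + p) = \<alpha> n"
    and "continuous_on (msupp \<mu>) w" and "\<forall>z \<in> msupp \<mu>. 0 < w z"
    and "circle_measure \<mu>0" and "msupp \<mu>0 \<subseteq> msupp (ac_part \<mu>)"
    and "sets \<mu>star = sets borel"
    and "\<forall>A \<in> sets borel.
           emeasure \<mu>star A = (\<integral>\<^sup>+z\<in>A. ennreal (w z) \<partial>\<mu>) + emeasure \<mu>0 A"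
    and "msupp \<mu>0 \<noteq> {} \<longrightarrow> 0 < infdist (cis \<theta>) (msupp \<mu>0)"
      (* infdist to the empty set is 0 in the library, hence the guard *)
  shows
    "(band_interior_point \<alpha> p (cis \<theta>) \<longrightarrow>
       (\<forall>C :: (complex \<times> complex) set. compact C \<longrightarrow>
         uniform_limit C
           (\<lambda>n (a, b).
              CD_kernel n (exp (\<i> * (of_real \<theta> + a / of_nat n)))
                          (exp (\<i> * (of_real \<theta> + b / of_nat n))) \<mu>star
              / CD_kernel n (cis \<theta>) (cis \<theta>) \<mu>star)
           (\<lambda>(a, b). exp (\<i> * ((a - cnj b) / 2)) * csinc (of_real (V \<alpha> p \<theta>) * (a - cnj b)))
           sequentially))
     \<and>
     (band_endpoint \<alpha> p (cis \<theta>) \<and> Delta \<alpha> p (cis \<theta>) = 2 \<and> \<not> resonance \<alpha> p (cis \<theta>) \<longrightarrow>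
       (\<forall>C :: (complex \<times> complex) set. compact C \<longrightarrow>
         uniform_limit C
           (\<lambda>n (a, b).
              CD_kernel n (exp (\<i> * (of_real \<theta> - a / (of_nat n)\<^sup>2)))
                          (exp (\<i> * (of_real \<theta> - b / (of_nat n)\<^sup>2))) \<mu>star
              / CD_kernel n (cis \<theta>) (cis \<theta>) \<mu>star)
           (\<lambda>(a, b). Jstar (1 / 2) (of_real (W \<alpha> p \<theta>) * a / (of_nat p)\<^sup>2)
                                 (of_real (W \<alpha> p \<theta>) * cnj b / (of_nat p)\<^sup>2)
                    / Jstar (1 / 2) 0 0)
           sequentially))
     \<and>
     (band_endpoint \<alpha> p (cis \<theta>) \<and> Delta \<alpha> p (cis \<theta>) = 2 \<and> resonance \<alpha> p (cis \<theta>) \<longrightarrow>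
       (\<forall>C :: (complex \<times> complex) set. compact C \<longrightarrow>
         uniform_limit C
           (\<lambda>n (a, b).
              CD_kernel n (exp (\<i> * (of_real \<theta> - a / (of_nat n)\<^sup>2)))
                          (exp (\<i> * (of_real \<theta> - b / (of_nat n)\<^sup>2))) \<mu>star
              / CD_kernel n (cis \<theta>) (cis \<theta>) \<mu>star)
           (\<lambda>(a, b). Jstar (- (1 / 2)) (of_real (W \<alpha> p \<theta>) * a / (of_nat p)\<^sup>2)
                                     (of_real (W \<alpha> p \<theta>) * cnj b / (of_nat p)\<^sup>2)
                    / Jstar (- (1 / 2)) 0 0)
           sequentially))"
proof -
  interpret perturbed_measure \<mu> \<alpha> p \<mu>0 \<mu>star w \<theta>
    using assms by unfold_locales (auto simp: verblunsky_coeffs_def)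
  show ?thesis
    using band_limit edge_limit_nonresonant edge_limit_resonant by blast
qed

end
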